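(* Let $Q$ be a differential operator mapping schlicht functions on a domain $D\subset\mathbb C$ to holomorphic functions on $D$, such that for some $m\in\mathbb Z$ $$Q[f\circ g]=(Q[f]\circ g)\,(g')^{m}\qquad\text{for all } g\in \mathrm{PSL}(2,\mathbb C),$$ and such that $Q[f]$ is a polynomial in $f'',\ldots,f^{(N)}$ and $(f')^{-1}$ with complex coefficients. Let $$M_1(Q[f])=\sum_{k,l}a_{k,l}\,\frac{f^{(k)}}{(f')^l}$$ be the part of the polynomial $Q[f]$ consisting of the monomials of degree one in $f'',\ldots,f^{(N)}$. Let $\tilde\beta^Q:\mathrm{Belt}(\mathbb D^c)\to B_m(\mathbb D)$, $\tilde\beta^Q(\mu)=Q[w^\mu|_{\mathbb D}]$. Then the derivative $D_0\tilde\beta^Q$ of $\tilde\beta^Q$ at the origin of $L^\infty(\mathbb D^c)$ is the bounded linear operator $$D_0\tilde\beta^Q:L^\infty(\mathbb D^c)\to B_m(\mathbb D),\qquad \nu\mapsto\left(z\mapsto\sum_{k,l}a_{k,l}\,\frac{(-1)^k k!}{\pi}\int_{\mathbb D^c}\frac{\nu(\eta)}{(z-\eta)^{k+1}}\,d^2\eta\right).$$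
   Context: $\mathbb D$ is the unit disc and $\mathbb D^c$ the interior of its complement in the Riemann sphere $\hat{\mathbb C}$. A schlicht function is an injective holomorphic function. $Q$ is given by one fixed polynomial formula, so it can be applied to schlicht functions on any domain; for $f$ schlicht on $D$ and $g$ Möbius, $f\circ g$ is a function on $g^{-1}(D)$. $B_m(\mathbb D)$ is the complex Banach space of holomorphic $f$ on $\mathbb D$ with $\|f\|_{B_m(\mathbb D)}=\sup_{z\in\mathbb D}|f(z)|(1-|z|^2)^{m}<\infty$. $\mathrm{Belt}(\mathbb D^c)$ is the open unit ball of $L^\infty(\mathbb D^c)$. For $\mu\in\mathrm{Belt}(\mathbb D^c)$, extended by $0$ to $\mathbb D$, $w^\mu$ is the quasiconformal homeomorphism of $\hat{\mathbb C}$ solving $\bar\partial w=\mu\,\partial w$ and normalized by $w^\mu(0)=0$, $(w^\mu)'(0)=1$, $(w^\mu)''(0)=0$; it is injective and holomorphic on $\mathbb D$. $d^2\eta$ is Lebesgue measure.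
   Formalization: That Q[w^μ|_D] lies in B_m(D) is taken as a premise (it fails for Q[f]=S_f/f', m=1), and β is considered only on those μ in Belt(D^c) for which w^μ has no pole in D; that these contain a neighbourhood of 0 is part of the conclusion. *)

theory Defs
  imports
    "HOL-Complex_Analysis.Complex_Analysis"
    "HOL-Probability.Essential_Supremum"
    "HOL-Library.Poly_Mapping"
begin

section \<open>Differential polynomials\<close>

text \<open>
  A polynomial is a finitely supported family of coefficients indexed by finitely supported
  exponent vectors. The indeterminate of index \<open>k \<ge> 2\<close> stands for the \<open>k\<close>-th derivative of \<open>f\<close>,
  the indeterminate of index \<open>1\<close> for \<open>1 / f'\<close>.
\<close>

type_synonym diff_poly = "(nat \<Rightarrow>\<^sub>0 nat) \<Rightarrow>\<^sub>0 complex"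

definition diff_poly_upto :: "nat \<Rightarrow> diff_poly \<Rightarrow> bool" where
  "diff_poly_upto N P \<longleftrightarrow>
     (\<forall>e \<in> Poly_Mapping.keys P. Poly_Mapping.keys e \<subseteq> insert 1 {2..N})"

definition jet :: "(complex \<Rightarrow> complex) \<Rightarrow> complex \<Rightarrow> nat \<Rightarrow> complex" where
  "jet f z k = (if k = 1 then inverse (deriv f z) else (deriv ^^ k) f z)"

definition diff_op :: "diff_poly \<Rightarrow> (complex \<Rightarrow> complex) \<Rightarrow> complex \<Rightarrow> complex" where
  "diff_op P f z =
     (\<Sum>e \<in> Poly_Mapping.keys P. Poly_Mapping.lookup P e *
        (\<Prod>k \<in> Poly_Mapping.keys e. jet f z k ^ Poly_Mapping.lookup e k))"

text \<open>The coefficient of the monomial \<open>f\<^sup>(\<^sup>k\<^sup>) / (f')\<^sup>l\<close>, for \<open>k \<ge> 2\<close>.\<close>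

definition lin_coeff :: "diff_poly \<Rightarrow> nat \<Rightarrow> nat \<Rightarrow> complex" where
  "lin_coeff P k l = Poly_Mapping.lookup P (Poly_Mapping.single k 1 + Poly_Mapping.single 1 l)"

definition lin_support :: "diff_poly \<Rightarrow> (nat \<times> nat) set" where
  "lin_support P = {(k, l). 2 \<le> k \<and> lin_coeff P k l \<noteq> 0}"

lemma finite_lin_support: "finite (lin_support P)"
proof -
  let ?h = "\<lambda>(k, l). Poly_Mapping.single k 1 + Poly_Mapping.single 1 l :: nat \<Rightarrow>\<^sub>0 nat"
  have "inj_on ?h (lin_support P)"
  proof (rule inj_onI)
    fix x y
    assume xy: "x \<in> lin_support P" "y \<in> lin_support P" "?h x = ?h y"
    obtain k l k' l' where x: "x = (k, l)" and y: "y = (k', l')"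
      by (metis surj_pair)
    with xy have kl: "(k, l) \<in> lin_support P" "(k', l') \<in> lin_support P"
      and eq: "?h (k, l) = ?h (k', l')"
      by simp_all
    have look: "Poly_Mapping.lookup (?h (k, l)) i = Poly_Mapping.lookup (?h (k', l')) i" for i
      using eq by simp
    from kl have k: "2 \<le> k" "2 \<le> k'" by (auto simp: lin_support_def)
    show "x = y"
      using look[of 1] look[of k] k unfolding x y
      by (auto simp: lookup_add lookup_single when_def split: if_splits)
  qed
  moreover have "?h ` lin_support P \<subseteq> Poly_Mapping.keys P"
    by (auto simp: lin_support_def lin_coeff_def in_keys_iff)
  ultimately show ?thesis
    by (meson finite_keys finite_imageD finite_subset)
qed

text \<open>
  Schlicht functions on a domain \<open>D\<close> of the plane. In the covariance law the point \<open>z\<close> ranges over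
  the finite points of \<open>g\<^sup>-\<^sup>1(D)\<close>; the pole of \<open>g\<close> is not among them and has to be excluded
  explicitly because \<^const>\<open>moebius\<close> takes the value \<open>0\<close> there.
\<close>

definition schlicht_on :: "(complex \<Rightarrow> complex) \<Rightarrow> complex set \<Rightarrow> bool" where
  "schlicht_on f D \<longleftrightarrow> f holomorphic_on D \<and> inj_on f D"

definition moebius_covariant :: "int \<Rightarrow> diff_poly \<Rightarrow> bool" where
  "moebius_covariant m P \<longleftrightarrow>
     (\<forall>D f a b c d. open D \<longrightarrow> connected D \<longrightarrow> schlicht_on f D \<longrightarrow> a * d - b * c = 1 \<longrightarrow>
        (\<forall>z. c * z + d \<noteq> 0 \<longrightarrow> moebius a b c d z \<in> D \<longrightarrow>
           diff_op P (f \<circ> moebius a b c d) z =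
           diff_op P f (moebius a b c d z) * deriv (moebius a b c d) z powi m))"


section \<open>The function spaces\<close>

definition B_space :: "int \<Rightarrow> (complex \<Rightarrow> complex) set" where
  "B_space m = {f. f holomorphic_on ball 0 1 \<and>
                   bdd_above ((\<lambda>z. norm (f z) * (1 - (norm z)\<^sup>2) powi m) ` ball 0 1)}"

definition B_norm :: "int \<Rightarrow> (complex \<Rightarrow> complex) \<Rightarrow> real" where
  "B_norm m f = (SUP z \<in> ball 0 1. norm (f z) * (1 - (norm z)\<^sup>2) powi m)"

text \<open>
  The finite part of the exterior disc (the point at infinity is a null set), and
  \<open>L\<^sup>\<infinity>\<close> on it. Elements of \<open>L\<^sup>\<infinity>\<close> are represented by functions, whose values off \<open>Dc\<close> are
  irrelevant; so \<open>Linf_norm\<close> is only a seminorm.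
\<close>

definition Dc :: "complex set" where
  "Dc = {z. 1 < norm z}"

definition Linf :: "(complex \<Rightarrow> complex) set" where
  "Linf = {\<nu> \<in> borel_measurable (lebesgue_on Dc).
             esssup (lebesgue_on Dc) (\<lambda>z. ereal (norm (\<nu> z))) < \<infinity>}"

definition Linf_norm :: "(complex \<Rightarrow> complex) \<Rightarrow> real" where
  "Linf_norm \<nu> = real_of_ereal (esssup (lebesgue_on Dc) (\<lambda>z. ereal (norm (\<nu> z))))"

definition Belt :: "(complex \<Rightarrow> complex) set" where
  "Belt = {\<mu> \<in> Linf. Linf_norm \<mu> < 1}"

definition bounded_linear_Linf_B ::
    "int \<Rightarrow> ((complex \<Rightarrow> complex) \<Rightarrow> complex \<Rightarrow> complex) \<Rightarrow> bool" where
  "bounded_linear_Linf_B m L \<longleftrightarrow>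
     (\<forall>\<nu> \<in> Linf. L \<nu> \<in> B_space m) \<and>
     (\<forall>\<nu> \<in> Linf. \<forall>\<nu>' \<in> Linf. \<forall>z \<in> ball 0 1. L (\<lambda>\<eta>. \<nu> \<eta> + \<nu>' \<eta>) z = L \<nu> z + L \<nu>' z) \<and>
     (\<forall>c. \<forall>\<nu> \<in> Linf. \<forall>z \<in> ball 0 1. L (\<lambda>\<eta>. c * \<nu> \<eta>) z = c * L \<nu> z) \<and>
     (\<exists>C. \<forall>\<nu> \<in> Linf. B_norm m (L \<nu>) \<le> C * Linf_norm \<nu>)"

text \<open>
  \<open>L\<close> is the Frechet derivative at the origin of a map \<open>F\<close> from a subset \<open>U\<close> of \<open>L\<^sup>\<infinity>\<close>, containing
  a neighbourhood of the origin, to \<open>B_space m\<close>.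
\<close>

definition frechet_derivative_at_0 ::
    "int \<Rightarrow> (complex \<Rightarrow> complex) set \<Rightarrow> ((complex \<Rightarrow> complex) \<Rightarrow> complex \<Rightarrow> complex) \<Rightarrow>
     ((complex \<Rightarrow> complex) \<Rightarrow> complex \<Rightarrow> complex) \<Rightarrow> bool" where
  "frechet_derivative_at_0 m U F L \<longleftrightarrow>
     bounded_linear_Linf_B m L \<and>
     (\<exists>r > 0. \<forall>\<nu> \<in> Linf. Linf_norm \<nu> < r \<longrightarrow> \<nu> \<in> U) \<and>
     (\<forall>\<nu> \<in> U. F \<nu> \<in> B_space m) \<and>
     (\<forall>\<epsilon> > 0. \<exists>\<delta> > 0. \<forall>\<nu> \<in> U. Linf_norm \<nu> < \<delta> \<longrightarrow>
        B_norm m (\<lambda>z. F \<nu> z - F (\<lambda>_. 0) z - L \<nu> z) \<le> \<epsilon> * Linf_norm \<nu>)"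


section \<open>Normalized solutions of the Beltrami equation\<close>

text \<open>
  The Riemann sphere is the one-point compactification of the plane, with \<^const>\<open>None\<close> as the
  point at infinity. \<open>planar w\<close> is the coordinate expression of a map \<open>w\<close> of the sphere, and is
  meaningful on \<open>finite_points w\<close> only.
\<close>

definition sphere_top :: "complex option topology" where
  "sphere_top = Alexandroff_compactification euclidean"

definition planar :: "(complex option \<Rightarrow> complex option) \<Rightarrow> complex \<Rightarrow> complex" where
  "planar w z = the (w (Some z))"

definition finite_points :: "(complex option \<Rightarrow> complex option) \<Rightarrow> complex set" where
  "finite_points w = {z. w (Some z) \<noteq> None}"

text \<open>Compactly supported \<open>C\<^sup>1\<close> test functions define the same weak derivatives as smooth ones.\<close>

definition test_function_on :: "complex set \<Rightarrow> (complex \<Rightarrow> complex) \<Rightarrow> bool" where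
  "test_function_on U \<phi> \<longleftrightarrow>
     (\<forall>z. \<phi> differentiable (at z)) \<and>
     (\<forall>h. continuous_on UNIV (\<lambda>z. frechet_derivative \<phi> (at z) h)) \<and>
     (\<exists>K. compact K \<and> K \<subseteq> U \<and> (\<forall>z. z \<notin> K \<longrightarrow> \<phi> z = 0))"

text \<open>The classical operators \<open>\<partial> = (\<partial>\<^sub>x - i \<partial>\<^sub>y) / 2\<close> and \<open>(\<partial>\<^sub>x + i \<partial>\<^sub>y) / 2\<close>.\<close>

definition d_z :: "(complex \<Rightarrow> complex) \<Rightarrow> complex \<Rightarrow> complex" where
  "d_z \<phi> z = (frechet_derivative \<phi> (at z) 1 - \<i> * frechet_derivative \<phi> (at z) \<i>) / 2"

definition d_zbar :: "(complex \<Rightarrow> complex) \<Rightarrow> complex \<Rightarrow> complex" where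
  "d_zbar \<phi> z = (frechet_derivative \<phi> (at z) 1 + \<i> * frechet_derivative \<phi> (at z) \<i>) / 2"

definition locally_L2 :: "complex set \<Rightarrow> (complex \<Rightarrow> complex) \<Rightarrow> bool" where
  "locally_L2 U p \<longleftrightarrow>
     p \<in> borel_measurable (lebesgue_on U) \<and>
     (\<forall>K. compact K \<longrightarrow> K \<subseteq> U \<longrightarrow> integrable (lebesgue_on K) (\<lambda>z. (norm (p z))\<^sup>2))"

text \<open>\<open>p\<close> and \<open>q\<close> are the weak derivatives \<open>\<partial>f\<close> and \<open>\<partial>f\<close>-bar of \<open>f\<close> on the open set \<open>U\<close>.\<close>

definition weak_derivatives ::
    "complex set \<Rightarrow> (complex \<Rightarrow> complex) \<Rightarrow> (complex \<Rightarrow> complex) \<Rightarrow> (complex \<Rightarrow> complex) \<Rightarrow> bool"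
  where
  "weak_derivatives U f p q \<longleftrightarrow>
     (\<forall>\<phi>. test_function_on U \<phi> \<longrightarrow>
        (LINT z|lebesgue_on U. f z * d_z \<phi> z) = - (LINT z|lebesgue_on U. p z * \<phi> z) \<and>
        (LINT z|lebesgue_on U. f z * d_zbar \<phi> z) = - (LINT z|lebesgue_on U. q z * \<phi> z))"

text \<open>
  Quasiconformality in the analytic sense: a homeomorphism of the sphere with locally square
  integrable weak derivatives that satisfies the Beltrami equation, whose coefficient (extended by
  zero) has supremum norm less than \<open>1\<close>. It suffices to impose this away from the point at infinity
  and its preimage, since isolated points are removable for quasiconformal homeomorphisms.
\<close>

definition qc_solution ::
    "(complex \<Rightarrow> complex) \<Rightarrow> (complex option \<Rightarrow> complex option) \<Rightarrow> bool" where
  "qc_solution \<mu> w \<longleftrightarrow>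
     homeomorphic_map sphere_top sphere_top w \<and>
     (\<exists>p q. locally_L2 (finite_points w) p \<and> locally_L2 (finite_points w) q \<and>
            weak_derivatives (finite_points w) (planar w) p q \<and>
            (AE z in lebesgue_on (finite_points w). q z = (if z \<in> Dc then \<mu> z else 0) * p z))"

definition normalized_qc_solution ::
    "(complex \<Rightarrow> complex) \<Rightarrow> (complex option \<Rightarrow> complex option) \<Rightarrow> bool" where
  "normalized_qc_solution \<mu> w \<longleftrightarrow>
     qc_solution \<mu> w \<and>
     w (Some 0) = Some 0 \<and> deriv (planar w) 0 = 1 \<and> (deriv ^^ 2) (planar w) 0 = 0"

text \<open>
  A normalized solution is injective and holomorphic on the disc as a map to the sphere, but for
  coefficients far from the origin it may have a pole there. The following are the coefficients
  whose solution restricts to a schlicht function on the disc.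
\<close>

definition schlicht_Belt ::
    "((complex \<Rightarrow> complex) \<Rightarrow> complex option \<Rightarrow> complex option) \<Rightarrow> (complex \<Rightarrow> complex) set" where
  "schlicht_Belt w = {\<mu> \<in> Belt. ball 0 1 \<subseteq> finite_points (w \<mu>)}"

end

theory Submission imports Defs begin

text \<open>Let \<open>f\<close> be the solution for a coefficient of norm \<open>k\<close>, and \<open>z\<close> a point of the disc at distance
\<open>r\<close> from the circle. The regular part of \<open>r f'(z) / (f - f z)\<close> at \<open>z\<close> is bounded on the plane, and since
its two Wirtinger derivatives have equal \<open>L\<^sup>2\<close> norm, it has energy \<open>O(k\<^sup>2)\<close>; logarithmic cutoffs remove its
singularities. Hence its Taylor coefficients at \<open>z\<close> are Cauchy integrals of the coefficient up to
\<open>O(k\<^sup>2)\<close>. The first of them is the Schwarzian derivative, and its Riccati equation excludes a pole in the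
disc and bounds \<open>f'\<close>. A Moebius map sending \<open>0\<close> to \<open>z\<close> removes the second derivative, so covariance expresses
\<open>r\<^sup>m Q[f](z)\<close> by powers of \<open>\<rho> = r f'(z)\<close> and jets that are linear in the coefficient up to \<open>O(k\<^sup>2)\<close>.
No negative power of \<open>\<rho>\<close> occurs: a coefficient with a suitable pattern repeated on sparse scales at a
boundary point would otherwise make \<open>Q[f]\<close> unbounded. So the remainder is \<open>O(k\<^sup>2)\<close> uniformly in \<open>z\<close>.\<close>

text \<open>The kernel of the derivative enters through one identity: with r the distance from z0 to
  the circle, \<open>reg_q z0 z = \<mu> z * (reg_p z0 z - r / (z - z0)^2)\<close>. Dropping
  \<open>reg_p\<close> leaves a Taylor coefficient linear in \<mu>. The dropped term is a product of
  two factors of size k, hence quadratic. On the support of \<mu> the kernel has L2 norm at most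
  sqrt pi / r, so after scaling by powers of r no constant depends on the point. The obstacle is the
  circle: only |f' - 1| (1 - |z|) = O(k) is at hand there, so Q[f] is not expanded around the
  identity directly. In the normal form \<rho> - r = O(k) suffices, since \<rho> multiplies jets
  that are themselves O(k). The threshold 1/48 means 12 k <= 1/4. In that range the Riccati
  comparison bounds the pre-Schwarzian by 1 / (2 (1 - |z|)), which makes |f'|^2 (1 - |z|)
  nonincreasing along radii. Hence \<rho> tends to 0 at the circle, and this is what turns a
  negative power of \<rho> into a contradiction.\<close>

abbreviation (input) "cx \<equiv> complex_of_real"
abbreviation (input) "bmeas \<equiv> borel_measurable borel"
abbreviation (input) "integrbl \<equiv> integrable lborel"
abbreviation (input) "lookup \<equiv> Poly_Mapping.lookup"
abbreviation (input) "keys \<equiv> Poly_Mapping.keys"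
abbreviation (input) "single \<equiv> Poly_Mapping.single"

section \<open>Square integrable functions on the plane\<close>

definition sq_int :: "(complex => complex) => bool" where
 "sq_int f \<longleftrightarrow> f \<in> bmeas \<and> integrbl (%z. (cmod (f z))\<^sup>2)"

definition l2 :: "(complex => complex) => real" where
 "l2 f = sqrt (LBINT z. (cmod (f z))\<^sup>2)"

lemma sq_int_measurable [measurable_dest]: "sq_int f ==> f \<in> bmeas"
 by (simp add: sq_int_def)

lemma sq_int_integrable: "sq_int f ==> integrbl (%z. (cmod (f z))\<^sup>2)"
 by (simp add: sq_int_def)

lemma l2_nonneg [simp]: "0 <= l2 f"
 by (simp add: l2_def)

lemma l2_power2: "(l2 f)\<^sup>2 = (LBINT z. (cmod (f z))\<^sup>2)"
 by (simp add: l2_def)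

lemma l2_mono:
 assumes f: "f \<in> bmeas" and g: "sq_int g"
  and le: "AE z in lborel. cmod (f z) <= cmod (g z)"
 shows "sq_int f" "l2 f <= l2 g"
proof -
 have [measurable]: "f \<in> borel_measurable lborel" using f by simp
 have ae: "AE z in lborel. (cmod (f z))\<^sup>2 <= (cmod (g z))\<^sup>2"
  using le by eventually_elim (simp add: power_mono)
 have i: "integrbl (%z. (cmod (f z))\<^sup>2)"
  by (rule Bochner_Integration.integrable_bound[OF sq_int_integrable[OF g]]) (use ae in auto)
 then show "sq_int f" using f by (simp add: sq_int_def)
 show "l2 f <= l2 g" unfolding l2_def
  by (intro real_sqrt_le_mono integral_mono_AE i sq_int_integrable[OF g] ae)
qed

lemma sq_int_cmult: "sq_int f ==> sq_int (%z. c * f z)"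
 and l2_cmult: "l2 (%z. c * f z) = cmod c * l2 f"
 by (auto simp: sq_int_def l2_def norm_mult power_mult_distrib real_sqrt_mult)

lemma sq_int_minus: "sq_int f ==> sq_int (%z. - f z)"
 and l2_minus: "l2 (%z. - f z) = l2 f"
 by (auto simp: sq_int_def l2_def)

lemma sq_int_zero [simp]: "sq_int (%z. 0)" and l2_zero [simp]: "l2 (%z. 0) = 0"
 by (auto simp: sq_int_def l2_def)

lemma sq_int_add:
 assumes f: "sq_int f" and g: "sq_int g"
 shows "sq_int (%z. f z + g z)"
proof -
 have [measurable]: "f \<in> borel_measurable lborel" "g \<in> borel_measurable lborel"
  using f g by (auto simp: sq_int_def)
 have le: "(cmod (f z + g z))\<^sup>2 <= 2 * (cmod (f z))\<^sup>2 + 2 * (cmod (g z))\<^sup>2" for z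
 proof -
  have "(cmod (f z + g z))\<^sup>2 <= (cmod (f z) + cmod (g z))\<^sup>2"
   by (intro power_mono norm_triangle_ineq) auto
  also have "\<dots> <= 2 * (cmod (f z))\<^sup>2 + 2 * (cmod (g z))\<^sup>2"
   using sum_squares_bound[of "cmod (f z)" "cmod (g z)"] by (simp add: power2_sum)
  finally show ?thesis .
 qed
 have "integrbl (%z. (cmod (f z + g z))\<^sup>2)"
  by (rule Bochner_Integration.integrable_bound[where f = "%z. 2 * (cmod (f z))\<^sup>2 + 2 * (cmod (g z))\<^sup>2"])
    (use f g le in \<open>auto simp: sq_int_def\<close>)
 then show ?thesis using f g by (simp add: sq_int_def)
qed

lemma sq_int_diff: "sq_int f ==> sq_int g ==> sq_int (%z. f z - g z)"
 using sq_int_add[OF _ sq_int_minus, of f g] by simp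

lemma l2_Cauchy_Schwarz:
 assumes f: "sq_int f" and g: "sq_int g"
 shows "integrbl (%z. f z * g z)"
  and "integrbl (%z. cmod (f z) * cmod (g z))"
  and "(LBINT z. cmod (f z) * cmod (g z)) <= l2 f * l2 g"
  and "cmod (LBINT z. f z * g z) <= l2 f * l2 g"
proof -
 have [measurable]: "f \<in> borel_measurable lborel" "g \<in> borel_measurable lborel"
  using f g by (auto simp: sq_int_def)
 note i = sq_int_integrable[OF f] sq_int_integrable[OF g]
 show 1: "integrbl (%z. cmod (f z) * cmod (g z))"
 proof (rule Bochner_Integration.integrable_bound[where f = "%z. (cmod (f z))\<^sup>2 + (cmod (g z))\<^sup>2"])
  show "AE z in lborel. norm (cmod (f z) * cmod (g z)) <= norm ((cmod (f z))\<^sup>2 + (cmod (g z))\<^sup>2)"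
  proof (rule AE_I2)
   fix z
   have "0 <= cmod (f z) * cmod (g z)" by simp
   then have "cmod (f z) * cmod (g z) <= (cmod (f z))\<^sup>2 + (cmod (g z))\<^sup>2"
    using sum_squares_bound[of "cmod (f z)" "cmod (g z)"] unfolding mult.assoc by linarith
   then show "norm (cmod (f z) * cmod (g z)) <= norm ((cmod (f z))\<^sup>2 + (cmod (g z))\<^sup>2)"
    by simp
  qed
 qed (use i in auto)
 show 2: "integrbl (%z. f z * g z)"
  by (rule Bochner_Integration.integrable_bound[OF 1]) (auto simp: norm_mult)
 define A where "A = (LBINT z. (cmod (f z))\<^sup>2)"
 define B where "B = (LBINT z. (cmod (g z))\<^sup>2)"
 define C where "C = (LBINT z. cmod (f z) * cmod (g z))"
 have A0: "A \<ge> 0" and B0: "B \<ge> 0" and C0: "C \<ge> 0"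
  by (auto simp: A_def B_def C_def)
 \<comment> \<open>The integral of (|f| - t |g|)^2 is a nonnegative quadratic in t; its discriminant
   gives C^2 <= A B.\<close>
 have q: "A - 2 * t * C + t\<^sup>2 * B \<ge> 0" for t
 proof -
  have "0 <= (LBINT z. (cmod (f z) - t * cmod (g z))\<^sup>2)" by simp
  also have "(%z. (cmod (f z) - t * cmod (g z))\<^sup>2) =
   (%z. (cmod (f z))\<^sup>2 - 2 * t * (cmod (f z) * cmod (g z)) + t\<^sup>2 * (cmod (g z))\<^sup>2)"
   by (auto simp: power2_eq_square algebra_simps)
  also have "(LBINT z. \<dots> z) = A - 2 * t * C + t\<^sup>2 * B"
   using i 1 by (simp add: A_def B_def C_def)
  finally show ?thesis .
 qed
 have "C\<^sup>2 <= A * B"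
 proof (cases "B = 0")
  case True
  have "C = 0"
  proof (rule ccontr)
   assume "C ~= 0"
   with C0 have "C > 0" by simp
   have "A * C \<ge> 0" using A0 C0 by simp
   \<comment> \<open>For B = 0 the quadratic is linear in t, and this t makes it equal to -A -
     2.\<close>
   with q[of "(A + 1) / C"] True \<open>C > 0\<close> show False by (simp add: field_simps)
  qed
  with True show ?thesis by simp
 next
  case False
  with B0 have "B > 0" by simp
  with q[of "C / B"] show ?thesis by (simp add: field_simps power2_eq_square)
 qed
 then have "C <= sqrt (A * B)" using C0 by (simp add: real_le_rsqrt)
 then show 3: "(LBINT z. cmod (f z) * cmod (g z)) <= l2 f * l2 g"
  by (simp add: l2_def A_def B_def C_def real_sqrt_mult)
 have "cmod (LBINT z. f z * g z) <= (LBINT z. cmod (f z * g z))"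
  by (rule integral_norm_bound)
 with 3 show "cmod (LBINT z. f z * g z) <= l2 f * l2 g"
  by (simp add: norm_mult)
qed

lemma l2_triangle:
 assumes f: "sq_int f" and g: "sq_int g"
 shows "l2 (%z. f z + g z) <= l2 f + l2 g"
proof -
 note i = sq_int_integrable[OF f] sq_int_integrable[OF g] l2_Cauchy_Schwarz(2)[OF f g]
 have "(l2 (%z. f z + g z))\<^sup>2 <= (LBINT z. (cmod (f z))\<^sup>2 + 2 * (cmod (f z) * cmod (g z)) + (cmod (g z))\<^sup>2)"
  unfolding l2_power2
 proof (rule integral_mono)
  fix z
  have "(cmod (f z + g z))\<^sup>2 <= (cmod (f z) + cmod (g z))\<^sup>2"
   by (intro power_mono norm_triangle_ineq) auto
  then show "(cmod (f z + g z))\<^sup>2 <= (cmod (f z))\<^sup>2 + 2 * (cmod (f z) * cmod (g z)) + (cmod (g z))\<^sup>2"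
   by (simp add: power2_sum)
 qed (use i sq_int_integrable[OF sq_int_add[OF f g]] in auto)
 also have "\<dots> = (l2 f)\<^sup>2 + 2 * (LBINT z. cmod (f z) * cmod (g z)) + (l2 g)\<^sup>2"
  using i by (simp add: l2_power2)
 also have "\<dots> <= (l2 f + l2 g)\<^sup>2"
  using l2_Cauchy_Schwarz(3)[OF f g] by (simp add: power2_sum)
 finally show ?thesis by (rule power2_le_imp_le) simp
qed

lemma l2_triangle_diff:
 assumes f: "sq_int f" and g: "sq_int g"
 shows "l2 (%z. f z - g z) <= l2 f + l2 g"
 using l2_triangle[OF f sq_int_minus[OF g]] by (simp add: l2_minus)

lemma l2_reverse_triangle:
 assumes f: "sq_int f" and g: "sq_int g"
 shows "\<bar>l2 f - l2 g\<bar> <= l2 (%z. f z - g z)"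
proof -
 have "l2 f <= l2 (%z. f z - g z) + l2 g"
  using l2_triangle[OF sq_int_diff[OF f g] g] by simp
 moreover have "l2 g <= l2 (%z. - (f z - g z)) + l2 f"
  using l2_triangle[OF sq_int_minus[OF sq_int_diff[OF f g]] f] by simp
 moreover have "l2 (%z. - (f z - g z)) = l2 (%z. f z - g z)" by (rule l2_minus)
 ultimately show ?thesis by linarith
qed

lemma l2_mult_bounded:
 assumes f: "sq_int f" and g: "g \<in> bmeas" and C: "!!z. cmod (g z) <= C"
 shows "sq_int (%z. g z * f z)" "l2 (%z. g z * f z) <= C * l2 f"
proof -
 have C0: "0 <= C" using C[of 0] norm_ge_zero order_trans by blast
 have m: "(%z. g z * f z) \<in> bmeas"
  using f g by (auto simp: sq_int_def)
 have le: "AE z in lborel. cmod (g z * f z) <= cmod (cx C * f z)"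
  using C C0 by (auto simp: norm_mult mult_right_mono)
 show "sq_int (%z. g z * f z)" by (rule l2_mono(1)[OF m sq_int_cmult[OF f] le])
 have "l2 (%z. g z * f z) <= l2 (%z. cx C * f z)"
  by (rule l2_mono(2)[OF m sq_int_cmult[OF f] le])
 also have "\<dots> = C * l2 f" by (simp only: l2_cmult) (simp add: C0)
 finally show "l2 (%z. g z * f z) <= C * l2 f" .
qed

lemma integrable_indicator_cball: "integrbl (%z::complex. indicator (cball c R) z * (C::real))"
 by (intro integrable_mult_left integrable_real_indicator) (use emeasure_lborel_cball_finite[of c R] in simp_all)

lemma sq_int_bounded_support:
 assumes f: "f \<in> bmeas" and C: "!!z. cmod (f z) <= C"
  and R: "!!z. R < norm z ==> f z = 0"
 shows "sq_int f"
proof -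
 have "integrbl (%z::complex. indicator (cball 0 R) z * C\<^sup>2)"
  by (rule integrable_indicator_cball)
 then have "integrbl (%z. (cmod (f z))\<^sup>2)"
 proof (rule Bochner_Integration.integrable_bound)
  show "AE z in lborel. norm ((cmod (f z))\<^sup>2) <= norm (indicator (cball 0 R) z * C\<^sup>2)"
   using C R by (auto simp: indicator_def power_mono not_le)
 qed (use f in simp)
 with f show ?thesis by (simp add: sq_int_def)
qed

text \<open>Pairing with a fixed square integrable function is continuous in L2; this carries weak
  derivative identities to limits.\<close>

lemma l2_integral_tendsto:
 assumes f: "!!n. sq_int (f n)" and f0: "sq_int f0" and g: "sq_int g"
  and lim: "(%n. l2 (%z. f n z - f0 z)) \<longlonglongrightarrow> 0"
 shows "(%n. (LBINT z. f n z * g z)) \<longlonglongrightarrow> (LBINT z. f0 z * g z)"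
proof (rule Lim_null[THEN iffD2, OF Lim_null_comparison])
 show "\<forall>\<^sub>F n in sequentially. norm ((LBINT z. f n z * g z) - (LBINT z. f0 z * g z)) <=
   l2 (%z. f n z - f0 z) * l2 g"
 proof (rule always_eventually, rule allI)
  fix n
  have "(LBINT z. f n z * g z) - (LBINT z. f0 z * g z) = (LBINT z. (f n z - f0 z) * g z)"
   using l2_Cauchy_Schwarz(1)[OF f[of n] g] l2_Cauchy_Schwarz(1)[OF f0 g]
   by (simp add: left_diff_distrib)
  then show "norm ((LBINT z. f n z * g z) - (LBINT z. f0 z * g z)) <= l2 (%z. f n z - f0 z) * l2 g"
   using l2_Cauchy_Schwarz(4)[OF sq_int_diff[OF f[of n] f0] g] by simp
 qed
 show "(%n. l2 (%z. f n z - f0 z) * l2 g) \<longlonglongrightarrow> 0"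
  using tendsto_mult_right[OF lim, of "l2 g"] by simp
qed

lemma lborel_translation:
 fixes f :: "complex => complex"
 assumes "integrbl f"
 shows "integrbl (%z. f (c + z))" "(LBINT z. f (c + z)) = integral\<^sup>L lborel f"
proof -
 have [measurable]: "f \<in> bmeas"
  using borel_measurable_integrable[OF assms] by simp
 have d: "distr lborel borel ((+) c) = lborel" by (rule lborel_distr_plus)
 show "integrbl (%z. f (c + z))"
  using assms integrable_distr_eq[of "(+) c" lborel borel f] by (simp add: d)
 show "(LBINT z. f (c + z)) = integral\<^sup>L lborel f"
  using integral_distr[of "(+) c" lborel borel f] by (simp add: d)
qed

lemma lborel_distr_reflect: "distr lborel borel (%z. c - z) = (lborel :: complex measure)"
 using lborel_affine[of "-1" "c"] by (simp add: density_1)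

lemma lborel_reflect:
 fixes f :: "complex => complex"
 assumes "integrbl f"
 shows "integrbl (%z. f (c - z))" "(LBINT z. f (c - z)) = integral\<^sup>L lborel f"
proof -
 have [measurable]: "f \<in> bmeas"
  using borel_measurable_integrable[OF assms] by simp
 note d = lborel_distr_reflect[of c]
 show "integrbl (%z. f (c - z))"
  using assms integrable_distr_eq[of "%z. c - z" lborel borel f] by (simp add: d)
 show "(LBINT z. f (c - z)) = integral\<^sup>L lborel f"
  using integral_distr[of "%z. c - z" lborel borel f] by (simp add: d)
qed

section \<open>Wirtinger calculus for continuously differentiable functions\<close>

text \<open>The Wirtinger derivatives are arguments and not operators applied to \<phi>. Product
  rules thus carry explicit formulas, and equality of mixed derivatives is expressed by using one
  name twice.\<close>

definition C1 :: "(complex => complex) => (complex => complex) => (complex => complex) => bool" where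
 "C1 \<phi> A B \<longleftrightarrow> (\<forall>z. (\<phi> has_derivative (%h. A z * h + B z * cnj h)) (at z)) \<and>
   continuous_on UNIV A \<and> continuous_on UNIV B"

lemma C1_has_derivative: "C1 \<phi> A B ==> (\<phi> has_derivative (%h. A z * h + B z * cnj h)) (at z)"
 by (simp add: C1_def)

lemma C1_continuous: "C1 \<phi> A B ==> continuous_on UNIV \<phi>"
 unfolding C1_def
 by (meson continuous_at_imp_continuous_on has_derivative_continuous)

lemma C1_continuous_derivs:
 "C1 \<phi> A B ==> continuous_on UNIV A" "C1 \<phi> A B ==> continuous_on UNIV B"
 by (auto simp: C1_def)

lemma wirtinger_unique:
 assumes "!!h. A * h + B * cnj h = A' * h + B' * cnj h"
 shows "A = A'" "B = B'"
proof -
 from assms[of 1] have 1: "A + B = A' + B'" by simp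
 from assms[of \<i>] have "\<i> * (A - B) = \<i> * (A' - B')" by (simp add: algebra_simps)
 then have 2: "A - B = A' - B'" by simp
 have "A = ((A + B) + (A - B)) / 2" by (simp add: field_simps)
 also have "\<dots> = ((A' + B') + (A' - B')) / 2" by (simp only: 1 2)
 also have "\<dots> = A'" by (simp add: field_simps)
 finally show "A = A'" .
 with 1 show "B = B'" by simp
qed

lemma C1_I:
 assumes "!!z. (\<phi> has_derivative (%h. A z * h + B z * cnj h)) (at z)"
  "continuous_on UNIV A" "continuous_on UNIV B"
 shows "C1 \<phi> A B"
 using assms by (simp add: C1_def)

lemma C1_add:
 assumes "C1 \<phi> A B" "C1 \<psi> A' B'"
 shows "C1 (%z. \<phi> z + \<psi> z) (%z. A z + A' z) (%z. B z + B' z)"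
proof (rule C1_I)
 show "((%z. \<phi> z + \<psi> z) has_derivative (%h. (A z + A' z) * h + (B z + B' z) * cnj h)) (at z)" for z
  by (rule has_derivative_eq_rhs[OF has_derivative_add[OF assms[THEN C1_has_derivative]]])
    (simp add: fun_eq_iff algebra_simps)
qed (intro continuous_on_add C1_continuous_derivs[OF assms(1)] C1_continuous_derivs[OF assms(2)])+

lemma C1_cmult:
 assumes "C1 \<phi> A B"
 shows "C1 (%z. c * \<phi> z) (%z. c * A z) (%z. c * B z)"
proof (rule C1_I)
 show "((%z. c * \<phi> z) has_derivative (%h. c * A z * h + c * B z * cnj h)) (at z)" for z
  by (rule has_derivative_eq_rhs[OF has_derivative_mult_right[OF assms[THEN C1_has_derivative]]])
    (simp add: fun_eq_iff algebra_simps)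
qed (intro continuous_on_mult continuous_on_const C1_continuous_derivs[OF assms(1)])+

lemma C1_minus: "C1 \<phi> A B ==> C1 (%z. - \<phi> z) (%z. - A z) (%z. - B z)"
 using C1_cmult[of \<phi> A B "-1"] by simp

lemma C1_diff: "C1 \<phi> A B ==> C1 \<psi> A' B' ==> C1 (%z. \<phi> z - \<psi> z) (%z. A z - A' z) (%z. B z - B' z)"
 using C1_add[of \<phi> A B, OF _ C1_minus, of \<psi> A' B'] by simp

lemma C1_const: "C1 (%z. c) (%z. 0) (%z. 0)"
 unfolding C1_def by auto

lemma C1_ident: "C1 (%z. z) (%z. 1) (%z. 0)"
 unfolding C1_def by (auto intro!: derivative_eq_intros)

lemma C1_cnj:
 assumes "C1 \<phi> A B"
 shows "C1 (%z. cnj (\<phi> z)) (%z. cnj (B z)) (%z. cnj (A z))"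
proof (rule C1_I)
 show "((%z. cnj (\<phi> z)) has_derivative (%h. cnj (B z) * h + cnj (A z) * cnj h)) (at z)" for z
  by (rule has_derivative_eq_rhs[OF bounded_linear.has_derivative[OF bounded_linear_cnj C1_has_derivative[OF assms]]])
    (simp add: fun_eq_iff)
qed (intro continuous_on_cnj C1_continuous_derivs[OF assms(1)])+

lemma wirtinger_mult:
 assumes "(\<phi> has_derivative (%h. a * h + b * cnj h)) (at z)"
  "(\<psi> has_derivative (%h. a' * h + b' * cnj h)) (at z)"
 shows "((%z. \<phi> z * \<psi> z) has_derivative
  (%h. (a * \<psi> z + \<phi> z * a') * h + (b * \<psi> z + \<phi> z * b') * cnj h)) (at z)"
 by (rule has_derivative_eq_rhs[OF has_derivative_mult[OF assms]])
   (simp add: fun_eq_iff algebra_simps)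

lemma C1_mult:
 assumes "C1 \<phi> A B" "C1 \<psi> A' B'"
 shows "C1 (%z. \<phi> z * \<psi> z) (%z. A z * \<psi> z + \<phi> z * A' z) (%z. B z * \<psi> z + \<phi> z * B' z)"
 by (rule C1_I)
   (intro wirtinger_mult C1_has_derivative[OF assms(1)] C1_has_derivative[OF assms(2)]
    continuous_on_add continuous_on_mult
    C1_continuous[OF assms(1)] C1_continuous[OF assms(2)]
    C1_continuous_derivs[OF assms(1)] C1_continuous_derivs[OF assms(2)])+

lemma C1_affine:
 assumes "C1 \<phi> A B"
 shows "C1 (%z. \<phi> (c * z + d)) (%z. c * A (c * z + d)) (%z. cnj c * B (c * z + d))"
proof (rule C1_I)
 fix z
 have "((%z. \<phi> (c * z + d)) has_derivative (%h. A (c * z + d) * (c * h) + B (c * z + d) * cnj (c * h))) (at z)"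
  by (rule has_derivative_compose[OF _ C1_has_derivative[OF assms], of "%z. c * z + d"])
    (auto intro!: derivative_eq_intros)
 moreover have "(%h. A (c * z + d) * (c * h) + B (c * z + d) * cnj (c * h)) =
  (%h. c * A (c * z + d) * h + cnj c * B (c * z + d) * cnj h)"
  by (simp add: fun_eq_iff)
 ultimately show "((%z. \<phi> (c * z + d)) has_derivative (%h. c * A (c * z + d) * h + cnj c * B (c * z + d) * cnj h)) (at z)"
  by simp
next
 have "continuous_on UNIV (%z. c * z + d)" by (intro continuous_intros)
 note c = continuous_on_compose2[OF C1_continuous_derivs(1)[OF assms] this subset_UNIV]
  continuous_on_compose2[OF C1_continuous_derivs(2)[OF assms] this subset_UNIV]
 show "continuous_on UNIV (%z. c * A (c * z + d))" "continuous_on UNIV (%z. cnj c * B (c * z + d))"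
  by (intro continuous_on_mult continuous_on_const c)+
qed

lemma C1_derivs_zero:
 assumes "C1 \<phi> A B" "open U" "!!z. z \<in> U ==> \<phi> z = c" "z \<in> U"
 shows "A z = 0" "B z = 0"
proof -
 have "(\<phi> has_derivative (%h. 0)) (at z)"
  by (rule has_derivative_transform_within_open[OF has_derivative_const[of c] assms(2,4)])
    (use assms(3) in auto)
 from has_derivative_unique[OF C1_has_derivative[OF assms(1)] this]
 have "!!h. A z * h + B z * cnj h = 0 * h + 0 * cnj h" by (simp add: fun_eq_iff)
 from wirtinger_unique[OF this] show "A z = 0" "B z = 0" by auto
qed

text \<open>The product is the zero function on the open complement of \<open>S\<close>, so
  \<open>H\<close> may be singular or arbitrary off \<open>W\<close>. In this way kernels with a
  pole and reciprocals become functions on the whole plane.\<close>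

lemma C1_mult_local:
 assumes \<kappa>: "C1 \<kappa> A B" and S: "closed S" "!!z. z \<notin> S ==> \<kappa> z = 0" and OW: "open W" "S \<subseteq> W"
  and H: "!!z. z \<in> W ==> (H has_derivative (%h. A' z * h + B' z * cnj h)) (at z)"
  and c: "continuous_on W A'" "continuous_on W B'"
 shows "C1 (%z. \<kappa> z * H z) (%z. A z * H z + \<kappa> z * A' z) (%z. B z * H z + \<kappa> z * B' z)"
proof -
 have z: "A z = 0" "B z = 0" if "z \<notin> S" for z
  using C1_derivs_zero[OF \<kappa>, of "- S" 0 z] S that by auto
 have cH: "continuous_on W H"
  by (meson H continuous_at_imp_continuous_on has_derivative_continuous)
 have cov: "UNIV = W \<union> - S" using OW by auto
 have cont: "continuous_on UNIV (%z. D z * H z + \<kappa> z * D' z)"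
  if D: "continuous_on UNIV D" "continuous_on W D'" "!!z. z \<notin> S ==> D z = 0" for D D'
 proof -
  have "continuous_on (W \<union> - S) (%z. D z * H z + \<kappa> z * D' z)"
  proof (rule continuous_on_open_Un)
   show "continuous_on W (%z. D z * H z + \<kappa> z * D' z)"
    using cH D(1,2) C1_continuous[OF \<kappa>]
    by (auto intro!: continuous_intros intro: continuous_on_subset)
   show "continuous_on (- S) (%z. D z * H z + \<kappa> z * D' z)"
    by (rule continuous_on_eq[OF continuous_on_const[of _ 0]]) (use D(3) S in auto)
  qed (use OW S in auto)
  then show ?thesis using cov by simp
 qed
 show ?thesis unfolding C1_def
 proof (intro conjI allI cont C1_continuous_derivs[OF \<kappa>] c z)
  fix z
  show "((%z. \<kappa> z * H z) has_derivative (%h. (A z * H z + \<kappa> z * A' z) * h + (B z * H z + \<kappa> z * B' z) * cnj h)) (at z)"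
  proof (cases "z \<in> W")
   case True
   show ?thesis
    by (rule wirtinger_mult[OF C1_has_derivative[OF \<kappa>] H[OF True]])
  next
   case False
   then have "z \<in> - S" using OW by auto
   then have "((%z. \<kappa> z * H z) has_derivative (%h. 0)) (at z)"
    by (intro has_derivative_transform_within_open[OF has_derivative_const[of 0], where s = "- S"])
      (use S in auto)
   moreover have "A z = 0" "B z = 0" "\<kappa> z = 0" using z S \<open>z \<in> - S\<close> by auto
   ultimately show ?thesis by simp
  qed
 qed
qed

lemma holomorphic_has_wirtinger:
 assumes "H holomorphic_on W" "open W" "z \<in> W"
 shows "(H has_derivative (%h. deriv H z * h + 0 * cnj h)) (at z)"
 using holomorphic_derivI[OF assms(1,2,3)] by (simp add: has_field_derivative_def)

lemma C1_mult_holomorphic: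
 assumes \<kappa>: "C1 \<kappa> A B" and S: "closed S" "!!z. z \<notin> S ==> \<kappa> z = 0" and OW: "open W" "S \<subseteq> W"
  and H: "H holomorphic_on W"
 shows "C1 (%z. \<kappa> z * H z) (%z. A z * H z + \<kappa> z * deriv H z) (%z. B z * H z)"
 using C1_mult_local[OF \<kappa> S OW, of H "deriv H" "%_. 0"] holomorphic_has_wirtinger[OF H OW(1)]
  holomorphic_deriv[OF H OW(1)]
 by (auto intro: holomorphic_on_imp_continuous_on)

lemma C1_frechet:
 assumes "C1 \<phi> A B"
 shows "frechet_derivative \<phi> (at z) h = A z * h + B z * cnj h"
  "d_z \<phi> z = A z" "d_zbar \<phi> z = B z"
proof -
 show 1: "frechet_derivative \<phi> (at z) h = A z * h + B z * cnj h" for h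
  using frechet_derivative_at[OF C1_has_derivative[OF assms, of z]] by metis
 show "d_z \<phi> z = A z" "d_zbar \<phi> z = B z"
  unfolding d_z_def d_zbar_def 1 by (auto simp: algebra_simps)
qed

lemma C1_test_function:
 assumes "C1 \<phi> A B" "compact K" "K \<subseteq> U" "!!z. z \<notin> K ==> \<phi> z = 0"
 shows "test_function_on U \<phi>"
 unfolding test_function_on_def
proof (intro conjI allI)
 show "\<phi> differentiable at z" for z
  using C1_has_derivative[OF assms(1)] differentiable_def by blast
 show "continuous_on UNIV (%z. frechet_derivative \<phi> (at z) h)" for h
  using C1_continuous_derivs[OF assms(1)]
  by (auto simp: C1_frechet[OF assms(1)] intro!: continuous_intros)
qed (use assms in auto)

lemma bounded_if_compact_support:
 fixes f :: "complex => complex"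
 assumes "continuous_on UNIV f" "!!z. R < norm z ==> f z = 0"
 obtains C where "C > 0" "!!z. cmod (f z) <= C"
proof -
 have "compact (f ` cball 0 R)"
  by (intro compact_continuous_image continuous_on_subset[OF assms(1)]) auto
 then obtain C where C: "C > 0" "!!z. z \<in> cball 0 R ==> cmod (f z) <= C"
  using compact_imp_bounded[of "f ` cball 0 R"] by (auto simp: bounded_pos)
 have "cmod (f z) <= C" for z
  using C assms(2)[of z] by (cases "R < norm z") auto
 with C show ?thesis using that by blast
qed

lemma integrable_compact_support:
 fixes f :: "complex => complex"
 assumes c: "continuous_on UNIV f" and R: "!!z. R < norm z ==> f z = 0"
 shows "integrbl f"
proof -
 obtain C where C: "C > 0" "!!z. cmod (f z) <= C"
  using bounded_if_compact_support[OF assms] by blast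
 have [measurable]: "f \<in> bmeas" using c by (rule borel_measurable_continuous_onI)
 have "integrbl (%z::complex. indicator (cball 0 R) z * C)"
  by (rule integrable_indicator_cball)
 then show ?thesis
  by (rule Bochner_Integration.integrable_bound) (use C R in \<open>auto simp: indicator_def not_le\<close>)
qed

lemma C1_Lipschitz:
 assumes \<phi>: "C1 \<phi> A B" and C: "!!z. cmod (A z) <= C" "!!z. cmod (B z) <= C"
 shows "cmod (\<phi> x - \<phi> y) <= 2 * C * cmod (x - y)"
proof (rule differentiable_bound[of UNIV \<phi> "%z h. A z * h + B z * cnj h"])
 show "onorm (%h. A z * h + B z * cnj h) <= 2 * C" for z
 proof (rule onorm_le)
  fix h
  have "norm (A z * h + B z * cnj h) <= cmod (A z) * norm h + cmod (B z) * norm h"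
   by (metis complex_mod_cnj norm_mult norm_triangle_ineq)
  also have "\<dots> <= C * norm h + C * norm h"
   by (intro add_mono mult_right_mono C) auto
  finally show "norm (A z * h + B z * cnj h) <= 2 * C * norm h" by simp
 qed
qed (use C1_has_derivative[OF \<phi>] in auto)

text \<open>Difference quotients integrate to zero by translation invariance and converge
  dominatedly to directional derivatives; the directions 1 and \<i> separate \<open>A\<close> from
  \<open>B\<close>. This is the integration by parts used throughout.\<close>

lemma C1_integral_zero:
 assumes \<phi>: "C1 \<phi> A B" and R: "!!z. R < norm z ==> \<phi> z = 0"
 shows "integral\<^sup>L lborel A = 0" "integral\<^sup>L lborel B = 0"
proof -
 have AR: "A z = 0" "B z = 0" if "R < norm z" for z
 proof -
  have "open {z::complex. R < norm z}" by (intro open_Collect_less continuous_intros)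
  then show "A z = 0" "B z = 0"
   using C1_derivs_zero[OF \<phi>, of "{z. R < norm z}" 0 z] R that by auto
 qed
 note cA = C1_continuous_derivs[OF \<phi>]
 obtain c1 where "c1 > 0" "!!z. cmod (A z) <= c1"
  using bounded_if_compact_support[OF cA(1) AR(1)] by blast
 moreover obtain c2 where "c2 > 0" "!!z. cmod (B z) <= c2"
  using bounded_if_compact_support[OF cA(2) AR(2)] by blast
 ultimately obtain C where C: "C > 0" "!!z. cmod (A z) <= C" "!!z. cmod (B z) <= C"
  by (metis max.coboundedI1 max.coboundedI2 max.strict_coboundedI1)
 note Lip = C1_Lipschitz[OF \<phi> C(2,3)]
 have [measurable]: "\<phi> \<in> bmeas" "A \<in> bmeas" "B \<in> bmeas"
  using C1_continuous[OF \<phi>] cA by (auto intro: borel_measurable_continuous_onI)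
 have i\<phi>: "integrbl \<phi>" by (rule integrable_compact_support[OF C1_continuous[OF \<phi>] R])
 have iA: "integrbl A" "integrbl B"
  using integrable_compact_support cA AR by blast+
 have dir: "(LBINT z. A z * h + B z * cnj h) = 0" if h: "cmod h = 1" for h
 proof -
  define g where "g n z = of_nat (Suc n) * (\<phi> (z + h / of_nat (Suc n)) - \<phi> z)" for n z
  have [measurable]: "g n \<in> bmeas" for n
   unfolding g_def by measurable
  have lim: "(%n. (LBINT z. g n z)) \<longlonglongrightarrow> (LBINT z. A z * h + B z * cnj h)"
  \<comment> \<open>The increment has length at most 1, which keeps the quotient supported in the
    ball of radius \<open>R + 1\<close>; the Lipschitz bound of \<phi> gives the height
    \<open>2 * C\<close>.\<close>
  proof (rule integral_dominated_convergence[where w = "%z. indicator (cball 0 (R + 1)) z * (2 * C)"])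
   show "integrbl (%z::complex. indicator (cball 0 (R + 1)) z * (2 * C))"
    by (rule integrable_indicator_cball)
   show "AE z in lborel. cmod (g n z) <= indicator (cball 0 (R + 1)) z * (2 * C)" for n
   proof (rule AE_I2)
    fix z
    have "cmod (g n z) = real (Suc n) * cmod (\<phi> (z + h / of_nat (Suc n)) - \<phi> z)"
     unfolding g_def norm_mult norm_of_nat by simp
    also have "\<dots> <= real (Suc n) * (2 * C * cmod (h / of_nat (Suc n)))"
     using Lip[of "z + h / of_nat (Suc n)" z] by (intro mult_left_mono) auto
    also have "\<dots> = 2 * C" using h by (simp add: norm_divide del: of_nat_Suc)
    finally have 1: "cmod (g n z) <= 2 * C" .
    have "g n z = 0" if "R + 1 < norm z"
    proof -
     have "norm (h / of_nat (Suc n)) <= 1" using h by (simp add: norm_divide del: of_nat_Suc)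
     then have "R < norm (z + h / of_nat (Suc n))"
      using that norm_diff_ineq[of z "h / of_nat (Suc n)"] by linarith
     then show ?thesis using that R[of z] R[of "z + h / of_nat (Suc n)"] by (simp add: g_def)
    qed
    with 1 show "cmod (g n z) <= indicator (cball 0 (R + 1)) z * (2 * C)"
     by (auto simp: indicator_def not_le)
   qed
   show "AE z in lborel. (%n. g n z) \<longlonglongrightarrow> A z * h + B z * cnj h"
   proof (rule AE_I2)
    fix z
    have "((%y. norm (\<phi> y - \<phi> z - (A z * (y - z) + B z * cnj (y - z))) / norm (y - z)) \<longlongrightarrow> 0) (at z)"
     using C1_has_derivative[OF \<phi>, of z] by (simp add: has_derivative_iff_norm)
    moreover have "filterlim (%n. z + h / of_nat (Suc n)) (at z) sequentially"
     unfolding filterlim_at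
    proof (intro conjI always_eventually allI)
     have "(%n. z + h * (1 / of_nat (Suc n))) \<longlonglongrightarrow> z + h * 0"
      by (intro tendsto_intros LIMSEQ_Suc[OF lim_1_over_n])
     then show "(%n. z + h / of_nat (Suc n)) \<longlonglongrightarrow> z" by simp
     have "h ~= 0" using h by auto
     then show "z + h / of_nat (Suc n) ~= z" for n by (simp del: of_nat_Suc)
    qed simp
    ultimately have l: "(%n. norm (\<phi> (z + h / of_nat (Suc n)) - \<phi> z - (A z * (h / of_nat (Suc n)) + B z * cnj (h / of_nat (Suc n))))
       / norm (h / of_nat (Suc n))) \<longlonglongrightarrow> 0"
     by (auto dest: filterlim_compose)
    have "norm (\<phi> (z + h / of_nat (Suc n)) - \<phi> z - (A z * (h / of_nat (Suc n)) + B z * cnj (h / of_nat (Suc n))))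
       / norm (h / of_nat (Suc n)) = norm (g n z - (A z * h + B z * cnj h))" for n
    proof -
     define N where "N = complex_of_nat (Suc n)"
     have N: "N ~= 0" "cnj N = N" "norm (h / N) = 1 / norm N"
      using h by (simp_all add: N_def norm_divide del: of_nat_Suc)
     have "g n z - (A z * h + B z * cnj h) = N * (\<phi> (z + h / N) - \<phi> z - (A z * (h / N) + B z * cnj (h / N)))"
      using N unfolding g_def N_def[symmetric] by (simp add: field_simps)
     then show ?thesis unfolding N_def[symmetric] N(3) by (simp add: norm_mult)
    qed
    with l have "(%n. norm (g n z - (A z * h + B z * cnj h))) \<longlonglongrightarrow> 0"
     by (simp only:)
    then show "(%n. g n z) \<longlonglongrightarrow> A z * h + B z * cnj h"
     by (rule LIM_zero_cancel[OF tendsto_norm_zero_cancel])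
   qed
  qed auto
  have g0: "(LBINT z. g n z) = 0" for n
  proof -
   define c where "c = h / of_nat (Suc n)"
   have eq: "(%z. \<phi> (c + z)) = (%z. \<phi> (z + c))" by (simp only: add.commute)
   note t = lborel_translation[OF i\<phi>, of c, unfolded eq]
   have "(LBINT z. \<phi> (z + c) - \<phi> z) = 0"
    using t i\<phi> by (subst Bochner_Integration.integral_diff) simp_all
   then show ?thesis unfolding g_def c_def[symmetric] by (subst integral_mult_right_zero) simp
  qed
  show ?thesis using lim unfolding g0 by (simp only: LIMSEQ_const_iff)
 qed
 from dir[of 1] dir[of \<i>] iA
 have 1: "integral\<^sup>L lborel A + integral\<^sup>L lborel B = 0"
  and "integral\<^sup>L lborel A * \<i> - integral\<^sup>L lborel B * \<i> = 0"
  by simp_all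
 then have "\<i> * (integral\<^sup>L lborel A - integral\<^sup>L lborel B) = 0" by (simp add: algebra_simps)
 then have "integral\<^sup>L lborel A = integral\<^sup>L lborel B" by simp
 with 1 show "integral\<^sup>L lborel A = 0" "integral\<^sup>L lborel B = 0" by simp_all
qed

text \<open>Radial functions are written in the squared distance, which is smooth at the centre and
  has Wirtinger derivatives cnj (z - a) and z - a.\<close>

lemma C1_radial:
 assumes k: "!!s. (k has_real_derivative k' s) (at s)" and c: "continuous_on UNIV k'"
 shows "C1 (%z. cx (k ((cmod (z - a))\<^sup>2)))
  (%z. of_real (k' ((cmod (z - a))\<^sup>2)) * cnj (z - a)) (%z. of_real (k' ((cmod (z - a))\<^sup>2)) * (z - a))"
proof (rule C1_I)
 fix z
 have n: "((%z. (cmod (z - a))\<^sup>2) has_derivative (%h. 2 * ((z - a) \<bullet> h))) (at z)"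
  unfolding power2_norm_eq_inner
  by (rule has_derivative_eq_rhs[OF has_derivative_inner])
    (auto intro!: derivative_eq_intros simp: inner_commute)
 have "((%z. k ((cmod (z - a))\<^sup>2)) has_derivative (%h. k' ((cmod (z - a))\<^sup>2) * (2 * ((z - a) \<bullet> h)))) (at z)"
  by (rule has_derivative_compose[OF n]) (use k in \<open>simp add: has_field_derivative_def\<close>)
 then have "((%z. cx (k ((cmod (z - a))\<^sup>2))) has_derivative
   (%h. cx (k' ((cmod (z - a))\<^sup>2) * (2 * ((z - a) \<bullet> h))))) (at z)"
  by (rule bounded_linear.has_derivative[OF bounded_linear_of_real])
 moreover have "cx (k' ((cmod (z - a))\<^sup>2) * (2 * ((z - a) \<bullet> h))) =
   of_real (k' ((cmod (z - a))\<^sup>2)) * cnj (z - a) * h + of_real (k' ((cmod (z - a))\<^sup>2)) * (z - a) * cnj h" for h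
 proof -
  have "cx (2 * ((z - a) \<bullet> h)) = cnj (z - a) * h + (z - a) * cnj h"
   by (simp add: complex_eq_iff inner_complex_def algebra_simps)
  then show ?thesis unfolding of_real_mult[of "k' _"] by (simp only: distrib_left mult.assoc)
 qed
 ultimately show "((%z. cx (k ((cmod (z - a))\<^sup>2))) has_derivative
   (%h. of_real (k' ((cmod (z - a))\<^sup>2)) * cnj (z - a) * h + of_real (k' ((cmod (z - a))\<^sup>2)) * (z - a) * cnj h)) (at z)"
  by (simp only:)
next
 have "continuous_on UNIV (%z. k' ((cmod (z - a))\<^sup>2))"
  by (rule continuous_on_compose2[OF c]) (auto intro!: continuous_intros)
 then show "continuous_on UNIV (%z. of_real (k' ((cmod (z - a))\<^sup>2)) * cnj (z - a))"
  "continuous_on UNIV (%z. of_real (k' ((cmod (z - a))\<^sup>2)) * (z - a))"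
  by (auto intro!: continuous_intros)
qed

lemma pos_part_power_deriv:
 "((%s::real. (max 0 s) ^ (k + 2)) has_real_derivative of_nat (k + 2) * (max 0 s) ^ (k + 1)) (at s)"
proof -
 consider "s > 0" | "s < 0" | "s = 0" by linarith
 then show ?thesis
 proof cases
  case 1
  have "((%s::real. s ^ (k + 2)) has_real_derivative of_nat (k + 2) * s ^ (k + 1)) (at s)"
   using DERIV_pow[of "k + 2" s] by simp
  then have "((%s::real. (max 0 s) ^ (k + 2)) has_real_derivative of_nat (k + 2) * s ^ (k + 1)) (at s)"
   by (rule has_field_derivative_transform_within_open[where S = "{0<..}"]) (use 1 in auto)
  with 1 show ?thesis by (simp add: max_def)
 next
  case 2
  have "((%s::real. 0) has_real_derivative 0) (at s)" by simp
  then have "((%s::real. (max 0 s) ^ (k + 2)) has_real_derivative 0) (at s)"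
   by (rule has_field_derivative_transform_within_open[where S = "{..<0}"]) (use 2 in \<open>auto simp: max_def\<close>)
  with 2 show ?thesis by (simp add: max_def)
 next
  case 3
  have "((%y::real. (max 0 y) ^ (k + 2) / y) \<longlongrightarrow> 0) (at 0)"
  proof (rule Lim_null_comparison)
   show "\<forall>\<^sub>F y in at (0::real). norm ((max 0 y) ^ (k + 2) / y) <= \<bar>y\<bar> ^ (k + 1)"
   proof (rule always_eventually, rule allI)
    fix y :: real
    show "norm ((max 0 y) ^ (k + 2) / y) <= \<bar>y\<bar> ^ (k + 1)"
    proof (cases "y > 0")
     case True
     then show ?thesis by (simp add: max_absorb2 field_simps)
    next
     case False
     then have "max 0 y = 0" by simp
     then have "norm ((max 0 y) ^ (k + 2) / y) = 0" by (simp only: power_0_left) simp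
     then show ?thesis by (simp only: zero_le_power abs_ge_zero)
    qed
   qed
   show "((%y::real. \<bar>y\<bar> ^ (k + 1)) \<longlongrightarrow> 0) (at 0)"
    by (rule tendsto_eq_intros refl)+ auto
  qed
  then show ?thesis using 3 by (simp add: has_field_derivative_iff)
 qed
qed

section \<open>Mollification\<close>

definition conv :: "(complex => complex) => (complex => complex) => complex => complex" where
 "conv f g z = (LBINT t. f t * g (z - t))"

lemma integrable_mult_bounded:
 fixes f g :: "complex => complex"
 assumes f: "integrbl f" and g: "g \<in> bmeas" and C: "!!z. cmod (g z) <= C"
 shows "integrbl (%z. f z * g z)"
proof -
 have [measurable]: "f \<in> bmeas" using borel_measurable_integrable[OF f] by simp
 have C0: "0 <= C" using C[of 0] norm_ge_zero order_trans by blast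
 have "integrbl (%z. C * cmod (f z))" using f by simp
 then show ?thesis
  by (rule Bochner_Integration.integrable_bound)
    (use g C C0 in \<open>auto simp: norm_mult mult.commute[of C] abs_mult intro!: mult_left_mono\<close>)
qed

lemma conv_bound_diff:
 assumes f: "integrbl f" and A: "continuous_on UNIV A" "!!z. cmod (A z) <= C"
  and B: "continuous_on UNIV B" "!!z. cmod (B z) <= C'"
  and K: "!!t. cmod (A (z - t) - B (w - t)) <= K"
 shows "cmod (conv f A z - conv f B w) <= K * (LBINT t. cmod (f t))"
proof -
 have m: "(%t. g (z - t)) \<in> bmeas" if "continuous_on UNIV g" for g :: "complex => complex" and z
  by (rule borel_measurable_continuous_onI, rule continuous_on_compose2[OF that]) (auto intro!: continuous_intros)
 have i: "integrbl (%t. f t * A (z - t))" "integrbl (%t. f t * B (w - t))"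
  by (rule integrable_mult_bounded[OF f m[OF A(1)] A(2)], rule integrable_mult_bounded[OF f m[OF B(1)] B(2)])
 have "conv f A z - conv f B w = (LBINT t. f t * (A (z - t) - B (w - t)))"
  unfolding conv_def using i by (simp add: right_diff_distrib)
 also have "cmod \<dots> <= (LBINT t. cmod (f t * (A (z - t) - B (w - t))))"
  by (rule integral_norm_bound)
 also have "\<dots> <= (LBINT t. K * cmod (f t))"
 proof (rule integral_mono)
  show "integrbl (%t. cmod (f t * (A (z - t) - B (w - t))))"
   using Bochner_Integration.integrable_diff[OF i] by (intro integrable_norm) (simp add: right_diff_distrib)
  show "cmod (f t * (A (z - t) - B (w - t))) <= K * cmod (f t)" for t
   using mult_left_mono[OF K, of "cmod (f t)" t] by (simp add: norm_mult mult.commute)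
 qed (use f in simp)
 finally show ?thesis by simp
qed

lemma Lipschitz_continuous_on:
 fixes f :: "complex => complex"
 assumes "!!x y. cmod (f x - f y) <= L * cmod (x - y)"
 shows "continuous_on UNIV f"
proof (rule continuous_at_imp_continuous_on, rule ballI)
 fix x
 have "((%y. f y - f x) \<longlongrightarrow> 0) (at x)"
 proof (rule Lim_null_comparison)
  show "\<forall>\<^sub>F y in at x. norm (f y - f x) <= L * cmod (y - x)"
   using assms by simp
  show "((%y. L * cmod (y - x)) \<longlongrightarrow> 0) (at x)"
   by (rule tendsto_eq_intros refl)+ auto
 qed
 then show "isCont f x" by (simp add: isCont_def LIM_zero_iff)
qed

text \<open>The quadratic remainder is uniform in the base point, so that in \<open>conv_C1\<close>
  it can be integrated against f to differentiate under the integral sign.\<close>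

lemma C1_Taylor:
 assumes \<phi>: "C1 \<phi> A B" and L: "!!x y. cmod (A x - A y) <= L * cmod (x - y)" "!!x y. cmod (B x - B y) <= L * cmod (x - y)"
 shows "cmod (\<phi> y - \<phi> x - (A x * (y - x) + B x * cnj (y - x))) <= 2 * L * (cmod (y - x))\<^sup>2"
proof -
 define g where "g y = \<phi> y - (A x * y + B x * cnj y)" for y
 have g: "(g has_derivative (%h. (A y - A x) * h + (B y - B x) * cnj h)) (at y)" for y
 proof -
  have "((%y. A x * y + B x * cnj y) has_derivative (%h. A x * h + B x * cnj h)) (at y)"
   by (intro has_derivative_add has_derivative_mult_right has_derivative_ident
     bounded_linear.has_derivative[OF bounded_linear_cnj])
  from has_derivative_diff[OF C1_has_derivative[OF \<phi>, of y] this]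
  show ?thesis unfolding g_def by (rule has_derivative_eq_rhs) (simp add: fun_eq_iff algebra_simps)
 qed
 have L0: "0 <= L" using order_trans[OF norm_ge_zero L(1)[of 1 0]] by simp
 have "cmod (g y - g x) <= 2 * (L * cmod (y - x)) * cmod (y - x)"
 proof (rule differentiable_bound[of "cball x (cmod (y - x))" g "%y h. (A y - A x) * h + (B y - B x) * cnj h"])
  fix w assume w: "w \<in> cball x (cmod (y - x))"
  show "(g has_derivative (%h. (A w - A x) * h + (B w - B x) * cnj h)) (at w within cball x (cmod (y - x)))"
   by (rule has_derivative_at_withinI[OF g])
  have le: "L * cmod (w - x) <= L * cmod (y - x)"
   using w L0 by (intro mult_left_mono) (auto simp: dist_norm norm_minus_commute)
  show "onorm (%h. (A w - A x) * h + (B w - B x) * cnj h) <= 2 * (L * cmod (y - x))"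
  proof (rule onorm_le)
   fix h
   have "norm ((A w - A x) * h + (B w - B x) * cnj h) <= cmod (A w - A x) * norm h + cmod (B w - B x) * norm h"
    by (metis complex_mod_cnj norm_mult norm_triangle_ineq)
   also have "\<dots> <= (L * cmod (y - x)) * norm h + (L * cmod (y - x)) * norm h"
    by (intro add_mono mult_right_mono order_trans[OF L(1) le] order_trans[OF L(2) le]) auto
   also have "\<dots> = 2 * (L * cmod (y - x)) * norm h" by (simp only: mult_2 distrib_right)
   finally show "norm ((A w - A x) * h + (B w - B x) * cnj h) <= 2 * (L * cmod (y - x)) * norm h" .
  qed
 qed (auto simp: dist_norm norm_minus_commute)
 moreover have "g y - g x = \<phi> y - \<phi> x - (A x * (y - x) + B x * cnj (y - x))"
  unfolding g_def by (simp add: algebra_simps)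
 ultimately show ?thesis by (simp add: power2_eq_square mult.assoc)
qed

lemma conv_C1:
 assumes f: "integrbl f" and \<phi>: "C1 \<phi> A B" "!!z. cmod (\<phi> z) <= C"
  and L: "!!x y. cmod (A x - A y) <= L * cmod (x - y)" "!!x y. cmod (B x - B y) <= L * cmod (x - y)"
  and C: "!!z. cmod (A z) <= C" "!!z. cmod (B z) <= C"
 shows "C1 (conv f \<phi>) (conv f A) (conv f B)"
proof (rule C1_I)
 note cA = C1_continuous_derivs[OF \<phi>(1)]
 define M where "M = (LBINT t. cmod (f t))"
 have M0: "M \<ge> 0" by (simp add: M_def)
 have Lip: "cmod (conv f D x - conv f D y) <= (L * M) * cmod (x - y)"
  if D: "continuous_on UNIV D" "!!z. cmod (D z) <= C" "!!x y. cmod (D x - D y) <= L * cmod (x - y)" for D x y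
  using conv_bound_diff[OF f D(1,2) D(1,2), where z = x and w = y and K = "L * cmod (x - y)"] D(3)[of "x - t" "y - t" for t]
  by (simp add: M_def mult.commute mult.left_commute)
 show "continuous_on UNIV (conv f A)" "continuous_on UNIV (conv f B)"
  by (rule Lipschitz_continuous_on, rule Lip, (rule cA C L)+)+
 fix x
 have m: "(%t. g (z - t)) \<in> bmeas" if "continuous_on UNIV g" for g :: "complex => complex" and z
  by (rule borel_measurable_continuous_onI, rule continuous_on_compose2[OF that]) (auto intro!: continuous_intros)
 have i: "integrbl (%t. f t * \<phi> (y - t))" "integrbl (%t. f t * A (y - t))" "integrbl (%t. f t * B (y - t))" for y
  by (rule integrable_mult_bounded[OF f m], (rule C1_continuous[OF \<phi>(1)] cA), (rule C \<phi>))+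
 show "(conv f \<phi> has_derivative (%h. conv f A x * h + conv f B x * cnj h)) (at x)"
 proof (rule has_derivativeI_sandwich[of 1])
  have "((%h. conv f A x * h + conv f B x * cnj h) has_derivative (%h. conv f A x * h + conv f B x * cnj h)) (at 0)"
   by (intro has_derivative_add has_derivative_mult_right has_derivative_ident
     bounded_linear.has_derivative[OF bounded_linear_cnj])
  then show "bounded_linear (%h. conv f A x * h + conv f B x * cnj h)"
   by (rule has_derivative_bounded_linear)
  fix y assume y: "y ~= x"
  have eq: "conv f \<phi> y - conv f \<phi> x - (conv f A x * (y - x) + conv f B x * cnj (y - x)) =
   (LBINT t. f t * (\<phi> (y - t) - \<phi> (x - t) - (A (x - t) * (y - x) + B (x - t) * cnj (y - x))))"
   (is "_ = (LBINT t. f t * ?T t)")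
  proof -
   have "(%t. f t * ?T t) = (%t. f t * \<phi> (y - t) - f t * \<phi> (x - t) - (f t * A (x - t) * (y - x) + f t * B (x - t) * cnj (y - x)))"
    by (simp add: fun_eq_iff algebra_simps)
   then show ?thesis unfolding conv_def using i by simp
  qed
  have "cmod (conv f \<phi> y - conv f \<phi> x - (conv f A x * (y - x) + conv f B x * cnj (y - x)))
    <= (LBINT t. cmod (f t * ?T t))" unfolding eq by (rule integral_norm_bound)
  also have "\<dots> <= (LBINT t. cmod (f t) * (2 * L * (cmod (y - x))\<^sup>2))"
  proof (rule integral_mono_AE')
   show "integrbl (%t. cmod (f t) * (2 * L * (cmod (y - x))\<^sup>2))" using f by simp
   show "AE t in lborel. cmod (f t * ?T t) <= cmod (f t) * (2 * L * (cmod (y - x))\<^sup>2)"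
   proof (rule AE_I2)
    fix t
    have "cmod (?T t) <= 2 * L * (cmod (y - x))\<^sup>2"
     using C1_Taylor[OF \<phi>(1) L, of "y - t" "x - t"] by simp
    then show "cmod (f t * ?T t) <= cmod (f t) * (2 * L * (cmod (y - x))\<^sup>2)"
     unfolding norm_mult by (intro mult_left_mono) auto
   qed
   have "0 <= L" using order_trans[OF norm_ge_zero L(1)[of 1 0]] by simp
   then show "AE t in lborel. 0 <= cmod (f t) * (2 * L * (cmod (y - x))\<^sup>2)" by simp
  qed
  also have "\<dots> = M * (2 * L * (cmod (y - x))\<^sup>2)" by (simp add: M_def)
  finally show "norm (conv f \<phi> y - conv f \<phi> x - (conv f A x * (y - x) + conv f B x * cnj (y - x))) / norm (y - x)
    <= M * (2 * L * cmod (y - x))"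
   using y by (simp add: field_simps power2_eq_square)
 next
  show "((%y. M * (2 * L * cmod (y - x))) \<longlongrightarrow> 0) (at x)"
   by (rule tendsto_eq_intros refl)+ auto
 qed auto
qed

definition mollifier :: "real => (complex => real) => bool" where
 "mollifier e \<rho> \<longleftrightarrow> 0 < e \<and> continuous_on UNIV \<rho> \<and> (\<forall>z. 0 <= \<rho> z) \<and> (\<forall>z. e < norm z --> \<rho> z = 0) \<and>
  integrbl \<rho> \<and> integral\<^sup>L lborel \<rho> = 1"

text \<open>The bump is the normalized fourth power of the positive part of e^2 - |z|^2. Two
  differentiations leave the second power, which is still continuously differentiable, as
  \<open>weak_C1_mollify\<close> needs. The repeated name \<open>AB\<close> records that the mixed
  derivatives agree.\<close>

lemma C2_mollifier_exists:
 assumes e: "0 < e"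
 obtains \<rho> A B AA AB BB where "mollifier e \<rho>" "C1 (%z. cx (\<rho> z)) A B"
  "C1 A AA AB" "C1 B AB BB" "(\<exists>D E. C1 AA D E) \<and> (\<exists>D E. C1 AB D E) \<and> (\<exists>D E. C1 BB D E)"
proof -
 define \<rho>0 where "\<rho>0 z = (max 0 (e\<^sup>2 - (cmod z)\<^sup>2)) ^ 4" for z :: complex
 have P: "C1 (%z. cx ((max 0 (e\<^sup>2 - (cmod z)\<^sup>2)) ^ (n + 2)))
   (%z. of_real (- of_nat (n + 2) * (max 0 (e\<^sup>2 - (cmod z)\<^sup>2)) ^ (n + 1)) * cnj z)
   (%z. of_real (- of_nat (n + 2) * (max 0 (e\<^sup>2 - (cmod z)\<^sup>2)) ^ (n + 1)) * z)" for n
 proof -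
  have "((%s. (max 0 (e\<^sup>2 - s)) ^ (n + 2)) has_real_derivative - of_nat (n + 2) * (max 0 (e\<^sup>2 - s)) ^ (n + 1)) (at s)" for s
  proof -
   have "((%s. e\<^sup>2 - s) has_real_derivative - 1) (at s)"
    by (auto intro!: derivative_eq_intros)
   show ?thesis
    by (rule DERIV_cong[OF DERIV_chain2[OF pos_part_power_deriv[of n "e\<^sup>2 - s"] \<open>((%s. e\<^sup>2 - s) has_real_derivative - 1) (at s)\<close>]])
      (simp only: mult_minus1_right mult_minus_left)
  qed
  from C1_radial[OF this, of 0] show ?thesis by (simp add: continuous_intros)
 qed
 have P': "k = n + 2 ==> j = n + 1 ==> C1 (%z. cx ((max 0 (e\<^sup>2 - (cmod z)\<^sup>2)) ^ k))
   (%z. of_real (- of_nat k * (max 0 (e\<^sup>2 - (cmod z)\<^sup>2)) ^ j) * cnj z)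
   (%z. of_real (- of_nat k * (max 0 (e\<^sup>2 - (cmod z)\<^sup>2)) ^ j) * z)" for n k j
  using P[of n] by (simp only:)
 define c where "c = integral\<^sup>L lborel \<rho>0"
 have cont: "continuous_on UNIV \<rho>0" unfolding \<rho>0_def by (intro continuous_intros)
 have supp: "\<rho>0 z = 0" if "e < norm z" for z
 proof -
  have "e\<^sup>2 <= (cmod z)\<^sup>2" using that e by (intro power_mono) auto
  then show ?thesis by (simp add: \<rho>0_def max_def)
 qed
 have nonneg: "0 <= \<rho>0 z" for z by (simp add: \<rho>0_def)
 have int: "integrbl \<rho>0"
 proof -
  have "integrbl (%z. cx (\<rho>0 z))"
   by (rule integrable_compact_support[where R = e]) (use cont supp in \<open>auto intro: continuous_intros\<close>)
  then show ?thesis by (simp only: complex_of_real_integrable_eq)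
 qed
 have c: "c > 0"
 proof -
  \<comment> \<open>On the ball of radius e/2 the base e^2 - |z|^2 is at least e^2/2, so the
    normalizing integral is positive.\<close>
  have "0 < measure lborel (ball (0::complex) (e/2)) * (e\<^sup>2 / 2) ^ 4"
   using e content_ball_pos[of "e/2" "0::complex"] by simp
  also have "\<dots> = (LBINT z. indicator (ball (0::complex) (e/2)) z * (e\<^sup>2 / 2) ^ 4)"
   by simp
  also have "\<dots> <= c" unfolding c_def
  proof (rule integral_mono_AE')
   show "AE z in lborel. indicator (ball (0::complex) (e/2)) z * (e\<^sup>2 / 2) ^ 4 <= \<rho>0 z"
   proof (rule AE_I2)
    fix z :: complex
    have "(e\<^sup>2 / 2) ^ 4 <= \<rho>0 z" if "norm z < e / 2"
    proof -
     have "(cmod z)\<^sup>2 <= (e / 2)\<^sup>2" using that e by (intro power_mono) auto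
     then have "e\<^sup>2 / 2 <= e\<^sup>2 - (cmod z)\<^sup>2" proof -
      assume "(cmod z)\<^sup>2 <= (e / 2)\<^sup>2"
      moreover have "(e / 2)\<^sup>2 = e\<^sup>2 / 4" by (simp add: power_divide)
      moreover have "0 <= (cmod z)\<^sup>2" by simp
      ultimately show "e\<^sup>2 / 2 <= e\<^sup>2 - (cmod z)\<^sup>2" by linarith
     qed
     then have "e\<^sup>2 / 2 <= max 0 (e\<^sup>2 - (cmod z)\<^sup>2)" by linarith
     then show ?thesis unfolding \<rho>0_def by (intro power_mono) auto
    qed
    then show "indicator (ball (0::complex) (e/2)) z * (e\<^sup>2 / 2) ^ 4 <= \<rho>0 z"
     using nonneg by (auto simp: indicator_def)
   qed
  qed (use int nonneg in auto)
  finally show ?thesis .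
 qed
 define \<rho> where "\<rho> z = inverse c * \<rho>0 z" for z
 have "mollifier e \<rho>" unfolding mollifier_def \<rho>_def
  using e cont nonneg supp int c by (auto intro!: continuous_intros simp: c_def[symmetric])
 moreover
 have P2: "C1 (%z. cx ((max 0 (e\<^sup>2 - (cmod z)\<^sup>2)) ^ 4))
   (%z. of_real (- 4 * (max 0 (e\<^sup>2 - (cmod z)\<^sup>2)) ^ 3) * cnj z)
   (%z. of_real (- 4 * (max 0 (e\<^sup>2 - (cmod z)\<^sup>2)) ^ 3) * z)"
  by (rule P'[of 4 2 3, unfolded of_nat_numeral]) simp_all
 have P1: "C1 (%z. cx ((max 0 (e\<^sup>2 - (cmod z)\<^sup>2)) ^ 3))
   (%z. of_real (- 3 * (max 0 (e\<^sup>2 - (cmod z)\<^sup>2)) ^ 2) * cnj z)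
   (%z. of_real (- 3 * (max 0 (e\<^sup>2 - (cmod z)\<^sup>2)) ^ 2) * z)"
  by (rule P'[of 3 1 2, unfolded of_nat_numeral]) simp_all
 define p3 where "p3 z = cx ((max 0 (e\<^sup>2 - (cmod z)\<^sup>2)) ^ 3)" for z
 define p2 where "p2 z = cx ((max 0 (e\<^sup>2 - (cmod z)\<^sup>2)) ^ 2)" for z
 have Q2: "C1 (%z. cx (\<rho> z)) (%z. cx (inverse c) * (- 4 * p3 z * cnj z)) (%z. cx (inverse c) * (- 4 * p3 z * z))"
  using C1_cmult[OF P2, of "cx (inverse c)"] by (simp add: \<rho>_def \<rho>0_def p3_def)
 have Q1: "C1 p3 (%z. - 3 * p2 z * cnj z) (%z. - 3 * p2 z * z)"
  using P1 by (simp add: p3_def[abs_def] p2_def)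
 have R1: "C1 (%z. cx (inverse c) * (- 4 * p3 z * cnj z))
   (%z. cx (inverse c) * (- 4 * (- 3 * p2 z * cnj z * cnj z + p3 z * 0)))
   (%z. cx (inverse c) * (- 4 * (- 3 * p2 z * z * cnj z + p3 z * 1)))"
  using C1_cmult[OF C1_cmult[OF C1_mult[OF Q1 C1_cnj[OF C1_ident]], of "- 4"], of "cx (inverse c)"]
  by (simp add: mult.assoc)
 have R2: "C1 (%z. cx (inverse c) * (- 4 * p3 z * z))
   (%z. cx (inverse c) * (- 4 * (- 3 * p2 z * z * cnj z + p3 z * 1)))
   (%z. cx (inverse c) * (- 4 * (- 3 * p2 z * z * z + p3 z * 0)))"
  using C1_cmult[OF C1_cmult[OF C1_mult[OF Q1 C1_ident], of "- 4"], of "cx (inverse c)"]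
  by (simp add: mult_ac)
 have Q0: "\<exists>D E. C1 p2 D E"
  using P[of 0] unfolding p2_def[abs_def] numeral_2_eq_2 add_0 by blast
 have T: "\<exists>D E. C1 (%z. cx (inverse c) * (- 4 * (- 3 * p2 z * u z * v z + p3 z * w))) D E"
  if "C1 u u1 u2" "C1 v v1 v2" for u v u1 u2 v1 v2 w
 proof -
  obtain D E where D: "C1 p2 D E" using Q0 by blast
  note C1_cmult[OF C1_cmult[OF C1_add[OF C1_mult[OF C1_mult[OF C1_cmult[OF D, of "- 3"] that(1)] that(2)]
   C1_mult[OF Q1 C1_const[of w]]], of "- 4"], of "cx (inverse c)"]
  then show ?thesis by blast
 qed
 note T' = T[OF C1_cnj[OF C1_ident] C1_cnj[OF C1_ident], of 0] T[OF C1_ident C1_cnj[OF C1_ident], of 1] T[OF C1_ident C1_ident, of 0]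
 show ?thesis by (rule that[OF \<open>mollifier e \<rho>\<close> Q2 R1 R2]) (use T' in blast)
qed

text \<open>The square root of a mollifier is a unit vector of L2, the form in which Cauchy-Schwarz
  can use it.\<close>

lemma l2_mult_sqrt_mollifier_aux:
 assumes "mollifier e \<rho>"
 shows "sq_int (%t. cx (sqrt (\<rho> (z - t))))" "(l2 (%t. cx (sqrt (\<rho> (z - t)))))\<^sup>2 = 1"
  "integrbl (%t. \<rho> (z - t))" "(LBINT t. \<rho> (z - t)) = 1"
  "(\<integral>\<^sup>+t. ennreal (\<rho> (t - z)) \<partial>lborel) = 1"
proof -
 from assms have \<rho>: "continuous_on UNIV \<rho>" "!!z. 0 <= \<rho> z" "integrbl \<rho>" "integral\<^sup>L lborel \<rho> = 1"
  by (auto simp: mollifier_def)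
 have [measurable]: "\<rho> \<in> bmeas" using \<rho>(1) by (rule borel_measurable_continuous_onI)
 have "integrbl (%t. cx (\<rho> t))" using \<rho>(3) by (simp only: complex_of_real_integrable_eq)
 note r = lborel_reflect[OF this, of z]
 show i: "integrbl (%t. \<rho> (z - t))" using r(1) by (simp only: complex_of_real_integrable_eq)
 have "cx (LBINT t. \<rho> (z - t)) = cx (integral\<^sup>L lborel \<rho>)"
  using r(2) by (simp only: integral_complex_of_real)
 then show 1: "(LBINT t. \<rho> (z - t)) = 1" using \<rho>(4) by simp
 show "sq_int (%t. cx (sqrt (\<rho> (z - t))))"
  using i \<rho>(2) by (simp add: sq_int_def)
 show "(l2 (%t. cx (sqrt (\<rho> (z - t)))))\<^sup>2 = 1"
  using 1 \<rho>(2) by (simp add: l2_power2)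
 have "(\<integral>\<^sup>+t. ennreal (\<rho> (t - z)) \<partial>lborel) = (\<integral>\<^sup>+t. ennreal (\<rho> (t - z)) \<partial>(distr lborel borel ((+) z)))"
  by (simp add: lborel_distr_plus)
 also have "\<dots> = (\<integral>\<^sup>+t. ennreal (\<rho> t) \<partial>lborel)" by (subst nn_integral_distr) auto
 also have "\<dots> = 1" using \<rho> by (subst nn_integral_eq_integral) auto
 finally show "(\<integral>\<^sup>+t. ennreal (\<rho> (t - z)) \<partial>lborel) = 1" .
qed

text \<open>Young's inequality for a probability density: splitting \<rho> into two square roots,
  Cauchy-Schwarz bounds the square of the convolution by the convolution of |f|^2 with \<rho>, and
  Tonelli integrates the density out.\<close>

lemma conv_mollifier_l2:
 assumes f: "sq_int f" and m: "mollifier e \<rho>"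
 shows "sq_int (conv f (%z. cx (\<rho> z)))" "l2 (conv f (%z. cx (\<rho> z))) <= l2 f"
  "integrbl (%t. f t * cx (\<rho> (z - t)))"
proof -
 from m have \<rho>: "continuous_on UNIV \<rho>" "!!z. 0 <= \<rho> z" by (auto simp: mollifier_def)
 note aux = l2_mult_sqrt_mollifier_aux[OF m]
 have [measurable]: "\<rho> \<in> bmeas" using \<rho>(1) by (rule borel_measurable_continuous_onI)
 have [measurable]: "f \<in> bmeas" using f by (simp add: sq_int_def)
 define F where "F = conv f (%z. cx (\<rho> z))"
 have Fm[measurable]: "F \<in> bmeas"
  unfolding F_def conv_def[abs_def] by measurable
 have s\<rho>: "cx (\<rho> (z - t)) = cx (sqrt (\<rho> (z - t))) * cx (sqrt (\<rho> (z - t)))" for z t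
  using \<rho>(2)[of "z - t"] by (simp only: of_real_mult[symmetric] real_sqrt_mult_self abs_of_nonneg)
 obtain C where C: "!!z. \<rho> z <= C" "C > 0"
 proof -
  obtain C where "C > 0" "!!z. cmod (cx (\<rho> z)) <= C"
   by (rule bounded_if_compact_support[where R = e and f = "%z. cx (\<rho> z)"])
    (use m in \<open>auto simp: mollifier_def intro: continuous_intros\<close>)
  with that \<rho>(2) show ?thesis by auto
 qed
 have fs: "sq_int (%t. cx (sqrt (\<rho> (z - t))) * f t)" for z
  by (rule l2_mult_bounded(1)[OF f, where C = "sqrt C"]) (use C \<rho> in auto)
 have pt: "ennreal ((cmod (F z))\<^sup>2) <= (\<integral>\<^sup>+t. ennreal ((cmod (f t))\<^sup>2) * ennreal (\<rho> (z - t)) \<partial>lborel)" for z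
 proof -
  have "cmod (F z) = cmod (LBINT t. cx (sqrt (\<rho> (z - t))) * f t * cx (sqrt (\<rho> (z - t))))"
   unfolding F_def conv_def by (simp only: s\<rho> mult_ac)
  also have "\<dots> <= l2 (%t. cx (sqrt (\<rho> (z - t))) * f t) * l2 (%t. cx (sqrt (\<rho> (z - t))))"
   by (rule l2_Cauchy_Schwarz(4)[OF fs aux(1)])
  finally have "(cmod (F z))\<^sup>2 <= (l2 (%t. cx (sqrt (\<rho> (z - t))) * f t))\<^sup>2 * (l2 (%t. cx (sqrt (\<rho> (z - t)))))\<^sup>2"
   unfolding power_mult_distrib[symmetric] by (rule power_mono) simp
  also have "\<dots> = (LBINT t. (cmod (f t))\<^sup>2 * \<rho> (z - t))"
   unfolding aux(2) l2_power2 using \<rho>(2) by (simp add: norm_mult power_mult_distrib mult.commute)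
  finally have "ennreal ((cmod (F z))\<^sup>2) <= ennreal (LBINT t. (cmod (f t))\<^sup>2 * \<rho> (z - t))"
   by (rule ennreal_leI)
  also have "\<dots> = (\<integral>\<^sup>+t. ennreal ((cmod (f t))\<^sup>2 * \<rho> (z - t)) \<partial>lborel)"
   using sq_int_integrable[OF fs[of z]] \<rho>(2)
   by (subst nn_integral_eq_integral) (auto simp: norm_mult power_mult_distrib mult.commute)
  also have "\<dots> = (\<integral>\<^sup>+t. ennreal ((cmod (f t))\<^sup>2) * ennreal (\<rho> (z - t)) \<partial>lborel)"
   using \<rho>(2) by (simp add: ennreal_mult)
  finally show ?thesis .
 qed
 have "(\<integral>\<^sup>+z. ennreal ((cmod (F z))\<^sup>2) \<partial>lborel) <= (\<integral>\<^sup>+z. \<integral>\<^sup>+t. ennreal ((cmod (f t))\<^sup>2) * ennreal (\<rho> (z - t)) \<partial>lborel \<partial>lborel)"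
  by (intro nn_integral_mono pt)
 also have "\<dots> = (\<integral>\<^sup>+t. \<integral>\<^sup>+z. ennreal ((cmod (f t))\<^sup>2) * ennreal (\<rho> (z - t)) \<partial>lborel \<partial>lborel)"
  by (rule lborel_pair.Fubini') measurable
 also have "\<dots> = (\<integral>\<^sup>+t. ennreal ((cmod (f t))\<^sup>2) \<partial>lborel)"
  by (subst nn_integral_cmult) (auto simp: aux(5))
 also have "\<dots> = ennreal ((l2 f)\<^sup>2)"
  unfolding l2_power2 using sq_int_integrable[OF f] by (subst nn_integral_eq_integral) auto
 finally have le: "(\<integral>\<^sup>+z. ennreal ((cmod (F z))\<^sup>2) \<partial>lborel) <= ennreal ((l2 f)\<^sup>2)" .
 have Fi: "integrbl (%z. (cmod (F z))\<^sup>2)"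
  by (rule integrableI_bounded) (use le in \<open>auto simp: less_top[symmetric] top_unique intro: le_less_trans\<close>)
 then show "sq_int (conv f (%z. cx (\<rho> z)))" using Fm by (simp add: sq_int_def F_def)
 have "ennreal ((l2 F)\<^sup>2) <= ennreal ((l2 f)\<^sup>2)"
  unfolding l2_power2[of F] using le Fi by (subst (asm) nn_integral_eq_integral) auto
 then show "l2 (conv f (%z. cx (\<rho> z))) <= l2 f"
  unfolding F_def[symmetric] by (intro power2_le_imp_le[of "l2 F" "l2 f"]) simp_all
 have "integrbl (%t. cx (sqrt (\<rho> (z - t))) * f t * cx (sqrt (\<rho> (z - t))))"
  by (rule l2_Cauchy_Schwarz(1)[OF fs aux(1)])
 then show "integrbl (%t. f t * cx (\<rho> (z - t)))"
  by (simp only: s\<rho> mult_ac)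
qed

lemma l2_dominated_tendsto:
 assumes [measurable]: "!!n. f n \<in> bmeas" "f0 \<in> bmeas"
  and g: "sq_int g" and dom: "!!n. AE z in lborel. cmod (f n z - f0 z) <= cmod (g z)"
  and lim: "AE z in lborel. (%n. f n z) \<longlonglongrightarrow> f0 z"
 shows "(%n. l2 (%z. f n z - f0 z)) \<longlonglongrightarrow> 0"
proof -
 have "(%n. (LBINT z. (cmod (f n z - f0 z))\<^sup>2)) \<longlonglongrightarrow> (\<integral>z. 0 \<partial>(lborel :: complex measure))"
 proof (rule integral_dominated_convergence[where w = "%z. (cmod (g z))\<^sup>2"])
  show "AE z in lborel. (%n. (cmod (f n z - f0 z))\<^sup>2) \<longlonglongrightarrow> 0"
   using lim
  proof eventually_elim
   case (elim z)
   then have "(%n. (cmod (f n z - f0 z))\<^sup>2) \<longlonglongrightarrow> (cmod (f0 z - f0 z))\<^sup>2" by (intro tendsto_intros)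
   then show ?case by simp
  qed
  show "AE z in lborel. norm ((cmod (f n z - f0 z))\<^sup>2) <= (cmod (g z))\<^sup>2" for n
   using dom[of n] by eventually_elim (simp add: power_mono)
 qed (use sq_int_integrable[OF g] in auto)
 then have "(%n. sqrt (LBINT z. (cmod (f n z - f0 z))\<^sup>2)) \<longlonglongrightarrow> sqrt (\<integral>z. 0 \<partial>(lborel :: complex measure))"
  by (rule tendsto_real_sqrt)
 then show ?thesis by (simp add: l2_def)
qed

text \<open>Truncating the values at n makes f bounded. A bounded measurable function is an a.e.
  limit of continuous ones; the retraction \<open>cl\<close> onto the disc of radius n and the
  cutoff \<open>cu\<close> keep these bounded and compactly supported, so that dominated convergence
  applies.\<close>

lemma l2_dense_continuous:
 assumes f: "sq_int f" and R: "!!z. R < norm z ==> f z = 0" and e: "0 < e"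
 obtains g where "continuous_on UNIV g" "!!z. R + 1 < norm z ==> g z = 0" "l2 (%z. g z - f z) < e"
proof -
 have [measurable]: "f \<in> bmeas" using f by (simp add: sq_int_def)
 define fM where "fM n z = (if cmod (f z) <= real n then f z else 0)" for n z
 have [measurable]: "fM n \<in> bmeas" for n unfolding fM_def by measurable
 have "(%n. l2 (%z. fM n z - f z)) \<longlonglongrightarrow> 0"
 proof (rule l2_dominated_tendsto[OF _ _ f])
  show "AE z in lborel. (%n. fM n z) \<longlonglongrightarrow> f z"
  proof (rule AE_I2)
   fix z
   obtain N where N: "cmod (f z) <= real N" using real_arch_simple by blast
   have "\<forall>\<^sub>F n in sequentially. fM n z = f z"
    by (rule eventually_sequentiallyI[of N]) (use N in \<open>auto simp: fM_def\<close>)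
   then show "(%n. fM n z) \<longlonglongrightarrow> f z" by (rule tendsto_eventually)
  qed
 qed (auto simp: fM_def)
 then obtain n where n: "l2 (%z. fM n z - f z) < e / 2"
  using e by (metis (no_types, lifting) LIMSEQ_D abs_less_iff diff_zero half_gt_zero order_refl real_norm_def)
 have fMn: "sq_int (fM n)" by (rule sq_int_bounded_support[of _ "real n" R]) (auto simp: fM_def R)
 have "fM n \<in> borel_measurable lebesgue" by (rule measurable_completion) simp
 then have "fM n measurable_on UNIV"
  using measurable_on_iff_borel_measurable[of UNIV "fM n"] by (simp add: lebesgue_on_UNIV_eq)
 then obtain N g where N: "negligible N" and g: "!!k. continuous_on UNIV (g k)"
  and lim: "!!x. x \<notin> N ==> (%k. g k x) \<longlonglongrightarrow> fM n x"
  unfolding measurable_on_def by auto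
 define cl where "cl = closest_point (cball (0::complex) (real n))"
 have clc: "continuous_on UNIV cl" unfolding cl_def
  by (rule continuous_on_closest_point) auto
 have cl1: "cmod (cl w) <= real n" for w
  using closest_point_in_set[of "cball (0::complex) (real n)" w] by (auto simp: cl_def)
 have cl2: "cl w = w" if "cmod w <= real n" for w
  unfolding cl_def by (rule closest_point_self) (use that in auto)
 define cu where "cu z = max 0 (min 1 (R + 1 - cmod z))" for z :: complex
 have cuc: "continuous_on UNIV cu" unfolding cu_def by (intro continuous_intros)
 have cu01: "0 <= cu z" "cu z <= 1" for z by (auto simp: cu_def)
 define G where "G k z = of_real (cu z) * cl (g k z)" for k z
 have Gc: "continuous_on UNIV (G k)" for k
  unfolding G_def by (intro continuous_intros cuc continuous_on_compose2[OF clc g]) auto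
 have [measurable]: "G k \<in> bmeas" for k
  by (rule borel_measurable_continuous_onI[OF Gc])
 have Gb: "cmod (G k z) <= real n" for k z
  using mult_mono[OF cu01(2)[of z] cl1[of "g k z"]] cu01[of z] by (simp add: G_def norm_mult)
 have GR: "G k z = 0" if "R + 1 < norm z" for k z
  using that by (simp add: G_def cu_def)
 have GN: "(%k. G k z) \<longlonglongrightarrow> fM n z" if "z \<notin> N" for z
 proof -
  have "(%k. cl (g k z)) \<longlonglongrightarrow> cl (fM n z)"
   by (rule continuous_on_tendsto_compose[OF clc lim[OF that]]) auto
  moreover have "cl (fM n z) = fM n z" by (rule cl2) (auto simp: fM_def)
  ultimately have l: "(%k. G k z) \<longlonglongrightarrow> of_real (cu z) * fM n z"
   unfolding G_def by (intro tendsto_intros) simp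
  have "of_real (cu z) * fM n z = fM n z"
   using R[of z] by (cases "R < norm z") (auto simp: cu_def fM_def)
  with l show ?thesis by simp
 qed
 have "(%k. l2 (%z. G k z - fM n z)) \<longlonglongrightarrow> 0"
 proof (rule l2_dominated_tendsto[where g = "%z. of_real (indicator (cball 0 (R + 1)) z * (2 * real n))"])
  show "sq_int (%z. cx (indicator (cball 0 (R + 1)) z * (2 * real n)))"
   by (rule sq_int_bounded_support[of _ "2 * real n" "R + 1"]) (auto simp: indicator_def)
  show "AE z in lborel. cmod (G k z - fM n z) <= cmod (cx (indicator (cball 0 (R + 1)) z * (2 * real n)))" for k
  proof (rule AE_I2)
   fix z
   have "cmod (fM n z) <= real n" by (auto simp: fM_def)
   then have 1: "cmod (G k z - fM n z) <= 2 * real n"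
    using norm_triangle_ineq4[of "G k z" "fM n z"] Gb[of k z] by linarith
   have "G k z - fM n z = 0" if "R + 1 < norm z"
    using GR[OF that] R[of z] that by (simp add: fM_def)
   with 1 show "cmod (G k z - fM n z) <= cmod (cx (indicator (cball 0 (R + 1)) z * (2 * real n)))"
    by (auto simp: indicator_def)
  qed
  have "AE z in lebesgue. z \<notin> N"
   using N by (simp add: negligible_iff_null_sets AE_not_in)
  then have "AE z in lborel. z \<notin> N" by (simp only: AE_completion_iff)
  then show "AE z in lborel. (%k. G k z) \<longlonglongrightarrow> fM n z"
   by eventually_elim (rule GN)
 qed auto
 then obtain k where k: "l2 (%z. G k z - fM n z) < e / 2"
  using e by (metis (no_types, lifting) LIMSEQ_D abs_less_iff diff_zero half_gt_zero order_refl real_norm_def)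
 have Gs: "sq_int (G k)" by (rule sq_int_bounded_support[OF _ Gb GR]) auto
 have "l2 (%z. G k z - f z) <= l2 (%z. G k z - fM n z) + l2 (%z. fM n z - f z)"
  using l2_triangle[OF sq_int_diff[OF Gs fMn] sq_int_diff[OF fMn f]] by simp
 with n k have "l2 (%z. G k z - f z) < e" by simp
 with Gc GR show ?thesis using that by blast
qed


lemma conv_mollifier_uniform:
 assumes g: "continuous_on UNIV g" and R: "!!z. R < norm z ==> g z = 0" and e: "0 < e"
 obtains d where "0 < d" "d <= 1"
  "!!r \<rho> z. mollifier r \<rho> ==> r <= d ==> cmod (conv g (%z. cx (\<rho> z)) z - g z) <= e"
proof -
 have "uniformly_continuous_on (cball 0 (R + 2)) g"
  by (rule compact_uniformly_continuous) (auto intro: continuous_on_subset[OF g])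
 then obtain d0 where d0: "0 < d0"
  "!!x y. x \<in> cball 0 (R + 2) ==> y \<in> cball 0 (R + 2) ==> dist y x < d0 ==> dist (g y) (g x) < e"
  using e unfolding uniformly_continuous_on_def by meson
 define d where "d = min 1 (d0 / 2)"
 have unif: "cmod (g y - g x) <= e" if "cmod (y - x) <= d" for x y
 proof (cases "R < norm x \<and> R < norm y")
  case True
  then show ?thesis using R e by simp
 next
  case False
  have "norm x <= norm y + norm (y - x)" "norm y <= norm x + norm (y - x)"
   using norm_triangle_ineq4[of y "y - x"] norm_triangle_ineq[of x "y - x"] by simp_all
  with False that have "x \<in> cball 0 (R + 2)" "y \<in> cball 0 (R + 2)" by (auto simp: d_def)
  moreover have "dist y x < d0" using that d0(1) by (auto simp: d_def dist_norm)
  ultimately show ?thesis using d0(2) by (metis dist_norm less_imp_le)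
 qed
 have "cmod (conv g (%z. cx (\<rho> z)) z - g z) <= e" if m: "mollifier r \<rho>" and r: "r <= d" for r \<rho> z
 proof -
  from m have \<rho>: "continuous_on UNIV \<rho>" "!!z. 0 <= \<rho> z" "!!z. r < norm z ==> \<rho> z = 0" by (auto simp: mollifier_def)
  have gs: "sq_int g"
  proof -
   obtain C where "!!z. cmod (g z) <= C" using bounded_if_compact_support[OF g R] by blast
   then show ?thesis by (intro sq_int_bounded_support[OF _ _ R] borel_measurable_continuous_onI g)
  qed
  note aux = l2_mult_sqrt_mollifier_aux[OF m, of z]
  have i1: "integrbl (%t. g t * cx (\<rho> (z - t)))" by (rule conv_mollifier_l2(3)[OF gs m])
  have i2: "integrbl (%t. g z * cx (\<rho> (z - t)))"
   using aux(3) by (intro integrable_mult_right) (simp only: complex_of_real_integrable_eq)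
  have "(LBINT t. g z * cx (\<rho> (z - t))) = g z"
   using aux(4) by (subst integral_mult_right_zero) (simp only: integral_complex_of_real of_real_1 mult_1_right)
  then have eq: "conv g (%z. cx (\<rho> z)) z - g z = (LBINT t. g t * cx (\<rho> (z - t)) - g z * cx (\<rho> (z - t)))"
   unfolding conv_def using i1 i2 by (subst Bochner_Integration.integral_diff) simp_all
  have "cmod (conv g (%z. cx (\<rho> z)) z - g z) <= (LBINT t. cmod (g t * cx (\<rho> (z - t)) - g z * cx (\<rho> (z - t))))"
   unfolding eq by (rule integral_norm_bound)
  also have "\<dots> <= (LBINT t. e * \<rho> (z - t))"
  proof (rule integral_mono)
   fix t
   have "cmod (g t * cx (\<rho> (z - t)) - g z * cx (\<rho> (z - t))) = cmod (g t - g z) * \<rho> (z - t)"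
    using \<rho>(2)[of "z - t"] by (simp only: left_diff_distrib[symmetric] norm_mult norm_of_real abs_of_nonneg)
   also have "\<dots> <= e * \<rho> (z - t)"
   proof (cases "r < norm (z - t)")
    case False
    then have "cmod (t - z) <= d" using r by (simp add: norm_minus_commute)
    then show ?thesis by (intro mult_right_mono unif \<rho>)
   qed (simp add: \<rho>(3))
   finally show "cmod (g t * cx (\<rho> (z - t)) - g z * cx (\<rho> (z - t))) <= e * \<rho> (z - t)" .
  qed (use i1 i2 aux(3) in auto)
  also have "\<dots> = e" using aux(4) by simp
  finally show ?thesis .
 qed
 moreover have "0 < d" "d <= 1" using d0 by (auto simp: d_def)
 ultimately show ?thesis using that by blast
qed

lemma conv_support:
 assumes g: "!!z. R < norm z ==> g z = 0" and \<rho>: "mollifier r \<rho>" "r <= 1" and z: "R + 1 < norm z"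
 shows "conv g (%z. cx (\<rho> z)) z = 0"
proof -
 have "g t * cx (\<rho> (z - t)) = 0" for t
 proof (cases "R < norm t")
  case False
  then have "r < norm (z - t)" using norm_triangle_ineq[of t "z - t"] z \<rho>(2) by simp
  then show ?thesis using \<rho>(1) by (simp add: mollifier_def)
 qed (simp add: g)
 then have "(%t. g t * cx (\<rho> (z - t))) = (%t. 0)" by (rule ext)
 then show ?thesis by (simp only: conv_def) simp
qed

text \<open>Approximation by a continuous g, and mollification as a contraction of L2. Of the three
  errors, each at most e/3, the one of g itself is uniform and lives on a ball, hence is controlled
  by the norm of an indicator.\<close>

lemma conv_mollifier_l2_tendsto:
 assumes f: "sq_int f" and R: "!!z. R < norm z ==> f z = 0" and e: "0 < e"
 obtains d where "0 < d"
  "!!r \<rho>. mollifier r \<rho> ==> r <= d ==> l2 (%z. conv f (%z. cx (\<rho> z)) z - f z) <= e"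
proof -
 have e3: "0 < e / 3" using e by simp
 obtain g where g: "continuous_on UNIV g" "!!z. R + 1 < norm z ==> g z = 0" "l2 (%z. g z - f z) < e / 3"
  using l2_dense_continuous[OF f R e3] by blast
 define I where "I z = cx (indicator (cball 0 (R + 2)) z)" for z :: complex
 have Is: "sq_int I" unfolding I_def by (rule sq_int_bounded_support[of _ 1 "R + 2"]) (auto simp: indicator_def)
 define \<eta> where "\<eta> = e / (3 * (l2 I + 1))"
 have l0: "0 < l2 I + 1" using l2_nonneg[of I] by linarith
 have \<eta>: "\<eta> > 0" using e l0 by (simp add: \<eta>_def)
 have \<eta>I: "\<eta> * l2 I <= e / 3"
 proof -
  have "\<eta> * l2 I = e / 3 * (l2 I / (l2 I + 1))" by (simp add: \<eta>_def)
  also have "\<dots> <= e / 3 * 1" using e l0 by (intro mult_left_mono) (simp_all add: divide_le_eq_1)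
  finally show ?thesis by simp
 qed
 obtain d where d: "0 < d" "d <= 1"
  "!!r \<rho> z. mollifier r \<rho> ==> r <= d ==> cmod (conv g (%z. cx (\<rho> z)) z - g z) <= \<eta>"
  using conv_mollifier_uniform[OF g(1,2) \<eta>] by blast
 have gs: "sq_int g"
 proof -
  obtain C where "!!z. cmod (g z) <= C" using bounded_if_compact_support[OF g(1,2)] by blast
  then show ?thesis by (intro sq_int_bounded_support[OF _ _ g(2)] borel_measurable_continuous_onI g)
 qed
 have "l2 (%z. conv f (%z. cx (\<rho> z)) z - f z) <= e" if m: "mollifier r \<rho>" and r: "r <= d" for r \<rho>
 proof -
  define c where "c h = conv h (%z. cx (\<rho> z))" for h
  have cs: "sq_int (c h)" if "sq_int h" for h unfolding c_def by (rule conv_mollifier_l2(1)[OF that m])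
  have gf: "sq_int (%z. g z - f z)" by (rule sq_int_diff[OF gs f])
  have cd: "c (%z. g z - f z) z = c g z - c f z" for z
   unfolding c_def conv_def using conv_mollifier_l2(3)[OF gs m, of z] conv_mollifier_l2(3)[OF f m, of z]
   by (simp add: left_diff_distrib)
  have 1: "l2 (%z. c g z - c f z) <= e / 3"
   using conv_mollifier_l2(2)[OF gf m] g(3) unfolding c_def[symmetric] cd[abs_def] by linarith
  have 2: "l2 (%z. c g z - g z) <= e / 3"
  proof -
   have "l2 (%z. c g z - g z) <= l2 (%z. of_real \<eta> * I z)"
   proof (rule l2_mono(2)[OF _ sq_int_cmult[OF Is]])
    show "(%z. c g z - g z) \<in> bmeas" using sq_int_diff[OF cs[OF gs] gs] by (simp add: sq_int_def)
    show "AE z in lborel. cmod (c g z - g z) <= cmod (cx \<eta> * I z)"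
    proof (rule AE_I2)
     fix z
     have "c g z - g z = 0" if "R + 2 < norm z"
      using conv_support[of "R + 1" g r \<rho> z] g(2) m r d(2) that by (simp add: c_def)
     then show "cmod (c g z - g z) <= cmod (cx \<eta> * I z)"
      using d(3)[OF m r, of z] \<eta> by (auto simp: I_def c_def norm_mult indicator_def)
    qed
   qed
   also have "\<dots> = \<eta> * l2 I" using \<eta> by (simp only: l2_cmult norm_of_real abs_of_pos)
   finally show ?thesis using \<eta>I by linarith
  qed
  have "(%z. c f z - f z) = (%z. (c g z - g z) + (g z - f z) - (c g z - c f z))" by (simp add: fun_eq_iff)
  then have "l2 (%z. c f z - f z) <= l2 (%z. (c g z - g z) + (g z - f z)) + l2 (%z. c g z - c f z)"
   using l2_triangle_diff[OF sq_int_add[OF sq_int_diff[OF cs[OF gs] gs] gf] sq_int_diff[OF cs[OF gs] cs[OF f]]] by simp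
  also have "\<dots> <= (l2 (%z. c g z - g z) + l2 (%z. g z - f z)) + l2 (%z. c g z - c f z)"
   using l2_triangle[OF sq_int_diff[OF cs[OF gs] gs] gf] by simp
  finally show ?thesis using 1 2 g(3) by (simp add: c_def)
 qed
 with d(1) show ?thesis using that by blast
qed

section \<open>Weak derivatives on the plane\<close>

text \<open>As the function and both derivatives vanish beyond \<open>R\<close>, the test functions
  need no compact support. The derivatives are square integrable, which is all that the energy
  argument uses.\<close>

definition weak_C1 :: "real => (complex => complex) => (complex => complex) => (complex => complex) => bool" where
 "weak_C1 R \<psi> P Q \<longleftrightarrow> continuous_on UNIV \<psi> \<and> sq_int P \<and> sq_int Q \<and>
   (\<forall>z. R < norm z --> \<psi> z = 0 \<and> P z = 0 \<and> Q z = 0) \<and>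
   (\<forall>\<theta> A B. C1 \<theta> A B --> (LBINT z. \<psi> z * A z) = - (LBINT z. P z * \<theta> z) \<and>
    (LBINT z. \<psi> z * B z) = - (LBINT z. Q z * \<theta> z))"

lemma C1_support:
 assumes "C1 \<phi> A B" "!!z. R < norm z ==> \<phi> z = 0" "R < norm z"
 shows "A z = 0" "B z = 0"
proof -
 have "open {z::complex. R < norm z}" by (intro open_Collect_less continuous_intros)
 then show "A z = 0" "B z = 0"
  using C1_derivs_zero[OF assms(1), of "{z. R < norm z}" 0 z] assms(2,3) by auto
qed

lemma continuous_support_sq_int:
 assumes "continuous_on UNIV g" "!!z. R < norm z ==> g z = 0"
 shows "sq_int g"
proof -
 obtain C where "!!z. cmod (g z) <= C" using bounded_if_compact_support[OF assms] by blast
 then show ?thesis by (intro sq_int_bounded_support[OF _ _ assms(2)] borel_measurable_continuous_onI assms)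
qed

lemma C1_weak:
 assumes \<phi>: "C1 \<phi> A B" and R: "!!z. R < norm z ==> \<phi> z = 0"
 shows "weak_C1 R \<phi> A B"
 unfolding weak_C1_def
proof (intro conjI allI impI)
 note s = C1_support[OF \<phi> R] and c = C1_continuous_derivs[OF \<phi>]
 show "continuous_on UNIV \<phi>" by (rule C1_continuous[OF \<phi>])
 show "sq_int A" "sq_int B" using continuous_support_sq_int c s by blast+
 show "\<phi> z = 0" "A z = 0" "B z = 0" if "R < norm z" for z using R s that by auto
 fix \<theta> A' B' assume \<theta>: "C1 \<theta> A' B'"
 have z: "\<phi> z * \<theta> z = 0" if "R < norm z" for z using R[OF that] by simp
 note i = C1_integral_zero[OF C1_mult[OF \<phi> \<theta>] z]
 have i2: "integrbl (%z. D z * E z)"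
  if "continuous_on UNIV D" "continuous_on UNIV E" "!!z. R < norm z ==> D z = 0" for D E :: "complex => complex"
  by (rule integrable_compact_support[where R = R]) (use that in \<open>auto intro: continuous_intros\<close>)
 note i3 = i2[OF c(1) C1_continuous[OF \<theta>] s(1)] i2[OF c(2) C1_continuous[OF \<theta>] s(2)]
  i2[OF C1_continuous[OF \<phi>] C1_continuous_derivs(1)[OF \<theta>] R] i2[OF C1_continuous[OF \<phi>] C1_continuous_derivs(2)[OF \<theta>] R]
 have "(LBINT z. A z * \<theta> z) + (LBINT z. \<phi> z * A' z) = 0"
  using i(1) by (subst (asm) Bochner_Integration.integral_add[OF i3(1,3)])
 then show "(LBINT z. \<phi> z * A' z) = - (LBINT z. A z * \<theta> z)"
  by (simp add: add_eq_0_iff)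
 have "(LBINT z. B z * \<theta> z) + (LBINT z. \<phi> z * B' z) = 0"
  using i(2) by (subst (asm) Bochner_Integration.integral_add[OF i3(2,4)])
 then show "(LBINT z. \<phi> z * B' z) = - (LBINT z. B z * \<theta> z)"
  by (simp add: add_eq_0_iff)
qed

text \<open>One integration by parts turns both the integral of |p|^2 and that of |q|^2 into minus
  the integral of \<phi> times the conjugate of the common mixed derivative
  \<open>pq\<close>.\<close>

lemma C2_isometry:
 assumes \<phi>: "C1 \<phi> p q" "C1 p pp pq" "C1 q pq qq" and R: "!!z. R < norm z ==> \<phi> z = 0"
 shows "l2 p = l2 q"
proof -
 note s = C1_support[OF \<phi>(1) R]
 have zp: "\<phi> z * cnj (p z) = 0" and zq: "\<phi> z * cnj (q z) = 0" if "R < norm z" for z using R[OF that] by simp_all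
 note i = C1_integral_zero(1)[OF C1_mult[OF \<phi>(1) C1_cnj[OF \<phi>(2)]] zp]
  C1_integral_zero(2)[OF C1_mult[OF \<phi>(1) C1_cnj[OF \<phi>(3)]] zq]
 have i2: "integrbl (%z. D z * E z)"
  if "continuous_on UNIV D" "continuous_on UNIV E" "!!z. R < norm z ==> D z = 0" for D E :: "complex => complex"
  by (rule integrable_compact_support[where R = R]) (use that in \<open>auto intro: continuous_intros\<close>)
 note c = C1_continuous_derivs[OF \<phi>(1)] C1_continuous_derivs[OF \<phi>(2)] C1_continuous[OF \<phi>(1)]
 have j1: "integrbl (%z. p z * cnj (p z))"
  by (rule i2[OF c(1) continuous_on_cnj[OF c(1)]]) (rule s(1))
 have j2: "integrbl (%z. q z * cnj (q z))"
  by (rule i2[OF c(2) continuous_on_cnj[OF c(2)]]) (rule s(2))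
 have j3: "integrbl (%z. \<phi> z * cnj (pq z))"
  by (rule i2[OF c(5) continuous_on_cnj[OF c(4)]]) (rule R)
 note j = j1 j2 j3
 have "(LBINT z. p z * cnj (p z)) + (LBINT z. \<phi> z * cnj (pq z)) = 0"
  using i(1) by (subst (asm) Bochner_Integration.integral_add[OF j(1,3)])
 moreover have "(LBINT z. q z * cnj (q z)) + (LBINT z. \<phi> z * cnj (pq z)) = 0"
  using i(2) by (subst (asm) Bochner_Integration.integral_add[OF j(2,3)])
 ultimately have "(LBINT z. p z * cnj (p z)) = (LBINT z. q z * cnj (q z))"
  by (metis add_right_cancel)
 then have "cx (LBINT z. (cmod (p z))\<^sup>2) = cx (LBINT z. (cmod (q z))\<^sup>2)"
  by (simp only: complex_norm_square[symmetric] integral_complex_of_real)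
 then show ?thesis by (simp only: l2_def of_real_eq_iff)
qed

text \<open>Testing against t -> \<rho> (z - t) moves the derivative from the mollifier to \<psi>,
  so mollification commutes with weak derivatives. The result is twice differentiable, and
  \<open>C2_isometry\<close> applies to it.\<close>

lemma weak_C1_mollify:
 assumes w: "weak_C1 R \<psi> P Q" and m: "mollifier r \<rho>" and \<rho>: "C1 (%z. cx (\<rho> z)) A B"
  and A: "C1 A AA AB" and B: "C1 B AB BB" and r: "r <= 1"
  and third: "(\<exists>D E. C1 AA D E) \<and> (\<exists>D E. C1 AB D E) \<and> (\<exists>D E. C1 BB D E)"
 defines "c \<equiv> %h. conv h (%z. cx (\<rho> z))"
 shows "C1 (c \<psi>) (c P) (c Q)" "l2 (c P) = l2 (c Q)"
proof -
 from w have \<psi>: "continuous_on UNIV \<psi>" "!!z. R < norm z ==> \<psi> z = 0" and P: "sq_int P" and Q: "sq_int Q"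
  and \<psi>A: "!!\<theta> A B. C1 \<theta> A B ==> (LBINT z. \<psi> z * A z) = - (LBINT z. P z * \<theta> z)"
  and \<psi>B: "!!\<theta> A B. C1 \<theta> A B ==> (LBINT z. \<psi> z * B z) = - (LBINT z. Q z * \<theta> z)"
  by (auto simp: weak_C1_def)
 have \<rho>R: "cx (\<rho> z) = 0" if "r < norm z" for z using m that by (simp add: mollifier_def)
 note sA = C1_support(1)[OF \<rho> \<rho>R] and sB = C1_support(2)[OF \<rho> \<rho>R]
 note sAA = C1_support[OF A sA] and sBB = C1_support[OF B sB]
 have bd: "\<exists>C>0. \<forall>z. cmod (g z) <= C" if "continuous_on UNIV g" "!!z. r < norm z ==> g z = 0" for g :: "complex => complex"
  using bounded_if_compact_support[OF that] by metis
 have Lip: "\<exists>C>0. (\<forall>z. cmod (g z) <= C) \<and> (\<forall>x y. cmod (g x - g y) <= C * cmod (x - y))"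
  if g: "C1 g D E" "!!z. r < norm z ==> g z = 0" for g D E
 proof -
  have DE: "D z = 0" "E z = 0" if "r < norm z" for z
   using C1_support[OF g(1), of r z] g(2) that by auto
  obtain C1 where C1: "C1 > 0" "\<forall>z. cmod (g z) <= C1"
   using bd[OF C1_continuous[OF g(1)] g(2)] by blast
  obtain C2 where C2: "C2 > 0" "\<forall>z. cmod (D z) <= C2"
   using bd[OF C1_continuous_derivs(1)[OF g(1)] DE(1)] by blast
  obtain C3 where C3: "C3 > 0" "\<forall>z. cmod (E z) <= C3"
   using bd[OF C1_continuous_derivs(2)[OF g(1)] DE(2)] by blast
  note C = C1 C2 C3
  define M where "M = C1 + 2 * (C2 + C3)"
  have "cmod (D z) <= C2 + C3" "cmod (E z) <= C2 + C3" for z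
   using C(4)[rule_format, of z] C(6)[rule_format, of z] C(3,5) by linarith+
  note L = C1_Lipschitz[OF g(1) this]
  have "cmod (g x - g y) <= M * cmod (x - y)" for x y
   by (rule order_trans[OF L]) (use C in \<open>auto simp: M_def intro!: mult_right_mono\<close>)
  moreover have "cmod (g z) <= M" for z using C(2)[rule_format, of z] C(3,5) by (simp add: M_def)
  moreover have "M > 0" using C by (simp add: M_def)
  ultimately show ?thesis by blast
 qed
 have \<psi>i: "integrbl \<psi>" by (rule integrable_compact_support[OF \<psi>])
 have cC1: "C1 (conv \<psi> g) (conv \<psi> D) (conv \<psi> E)"
  if g: "C1 g D E" "!!z. r < norm z ==> g z = 0" and D: "C1 D D1 D2" and E: "C1 E E1 E2" for g D E D1 D2 E1 E2
 proof -
  have DE: "D z = 0" "E z = 0" if "r < norm z" for z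
   using C1_support[OF g(1), of r z] g(2) that by auto
  obtain K1 where K1: "K1 > 0" "\<forall>z. cmod (g z) <= K1" using Lip[OF g] by blast
  obtain K2 where K2: "K2 > 0" "\<forall>z. cmod (D z) <= K2" "\<forall>x y. cmod (D x - D y) <= K2 * cmod (x - y)"
   using Lip[OF D DE(1)] by blast
  obtain K3 where K3: "K3 > 0" "\<forall>z. cmod (E z) <= K3" "\<forall>x y. cmod (E x - E y) <= K3 * cmod (x - y)"
   using Lip[OF E DE(2)] by blast
  note K = K1 K2 K3
  define M where "M = K1 + K2 + K3"
  have M: "K1 <= M" "K2 <= M" "K3 <= M" using K by (auto simp: M_def)
  show ?thesis
  proof (rule conv_C1[OF \<psi>i g(1)])
   show "cmod (g z) <= M" "cmod (D z) <= M" "cmod (E z) <= M" for z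
    using K(2,4,7)[rule_format, of z] M by linarith+
   show "cmod (D x - D y) <= M * cmod (x - y)" "cmod (E x - E y) <= M * cmod (x - y)" for x y
    using order_trans[OF K(5)[rule_format] mult_right_mono[OF M(2)]] order_trans[OF K(8)[rule_format] mult_right_mono[OF M(3)]]
    by simp_all
  qed
 qed
 have flip: "C1 (%t. cx (\<rho> (z - t))) (%t. - A (z - t)) (%t. - B (z - t))" for z
  using C1_affine[OF \<rho>, of "-1" z] by simp
 have PA: "conv \<psi> A = c P"
 proof
  fix z
  have "- (LBINT t. \<psi> t * A (z - t)) = - (LBINT t. P t * cx (\<rho> (z - t)))"
   using \<psi>A[OF flip[of z]] by simp
  then show "conv \<psi> A z = c P z" by (simp add: conv_def c_def)
 qed
 have QB: "conv \<psi> B = c Q"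
 proof
  fix z
  have "- (LBINT t. \<psi> t * B (z - t)) = - (LBINT t. Q t * cx (\<rho> (z - t)))"
   using \<psi>B[OF flip[of z]] by simp
  then show "conv \<psi> B z = c Q z" by (simp add: conv_def c_def)
 qed
 show 1: "C1 (c \<psi>) (c P) (c Q)" using cC1[OF \<rho> \<rho>R A B] unfolding PA QB c_def .
 obtain D1 E1 D2 E2 D3 E3 where D: "C1 AA D1 E1" "C1 AB D2 E2" "C1 BB D3 E3" using third by blast
 have 2: "C1 (conv \<psi> A) (conv \<psi> AA) (conv \<psi> AB)" by (rule cC1[OF A sA D(1,2)])
 have 3: "C1 (conv \<psi> B) (conv \<psi> AB) (conv \<psi> BB)" by (rule cC1[OF B sB D(2,3)])
 show "l2 (c P) = l2 (c Q)"
 proof (rule C2_isometry[OF 1 2[unfolded PA] 3[unfolded QB]])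
  show "c \<psi> z = 0" if "R + 1 < norm z" for z
   unfolding c_def by (rule conv_support[OF \<psi>(2) m r that])
 qed
qed

lemma weak_C1_D:
 assumes "weak_C1 R \<psi> P Q"
 shows "continuous_on UNIV \<psi>" "sq_int P" "sq_int Q"
  "!!z. R < norm z ==> \<psi> z = 0" "!!z. R < norm z ==> P z = 0" "!!z. R < norm z ==> Q z = 0"
  "!!\<theta> A B. C1 \<theta> A B ==> (LBINT z. \<psi> z * A z) = - (LBINT z. P z * \<theta> z)"
  "!!\<theta> A B. C1 \<theta> A B ==> (LBINT z. \<psi> z * B z) = - (LBINT z. Q z * \<theta> z)"
 using assms unfolding weak_C1_def by blast+

lemma weak_C1_mono: "weak_C1 R \<psi> P Q ==> R <= R' ==> weak_C1 R' \<psi> P Q"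
 unfolding weak_C1_def by (meson le_less_trans)

text \<open>The last property is locality: \<open>q\<close> vanishes at points around which
  \<open>Q\<close> vanishes. It is what makes the approximations of the solution holomorphic inside
  the disc.\<close>

lemma weak_C1_approx:
 assumes w: "weak_C1 R \<psi> P Q" and e: "0 < e"
 obtains \<phi> p q where "C1 \<phi> p q" "!!z. R + 1 < norm z ==> \<phi> z = 0" "!!z. cmod (\<phi> z - \<psi> z) <= e"
  "l2 p = l2 q" "l2 (%z. p z - P z) <= e" "l2 (%z. q z - Q z) <= e"
  "!!z. (!!t. dist z t <= e ==> Q t = 0) ==> q z = 0"
proof -
 note D = weak_C1_D[OF w]
 obtain d1 where d1: "0 < d1" "!!r \<rho>. mollifier r \<rho> ==> r <= d1 ==> l2 (%z. conv P (%z. cx (\<rho> z)) z - P z) <= e"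
  using conv_mollifier_l2_tendsto[OF D(2,5) e] by blast
 obtain d2 where d2: "0 < d2" "!!r \<rho>. mollifier r \<rho> ==> r <= d2 ==> l2 (%z. conv Q (%z. cx (\<rho> z)) z - Q z) <= e"
  using conv_mollifier_l2_tendsto[OF D(3,6) e] by blast
 obtain d3 where d3: "0 < d3" "d3 <= 1" "!!r \<rho> z. mollifier r \<rho> ==> r <= d3 ==> cmod (conv \<psi> (%z. cx (\<rho> z)) z - \<psi> z) <= e"
  using conv_mollifier_uniform[OF D(1,4) e] by blast
 define r where "r = min (min d1 d2) (min d3 e)"
 have r: "0 < r" "r <= d1" "r <= d2" "r <= d3" "r <= 1" "r <= e" using d1 d2 d3 e by (auto simp: r_def)
 obtain \<rho> A B AA AB BB where \<rho>: "mollifier r \<rho>" "C1 (%z. cx (\<rho> z)) A B"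
  "C1 A AA AB" "C1 B AB BB" "(\<exists>D E. C1 AA D E) \<and> (\<exists>D E. C1 AB D E) \<and> (\<exists>D E. C1 BB D E)"
  using C2_mollifier_exists[OF r(1)] by blast
 note m = weak_C1_mollify[OF w \<rho>(1-4) r(5) \<rho>(5)]
 show ?thesis
 proof (rule that[OF m(1) _ _ m(2)])
  fix z
  show "conv \<psi> (%z. cx (\<rho> z)) z = 0" if "R + 1 < norm z"
   using conv_support[OF D(4) \<rho>(1) r(5) that] by simp
  show "cmod (conv \<psi> (%z. cx (\<rho> z)) z - \<psi> z) <= e" by (rule d3(3)[OF \<rho>(1) r(4)])
  show "conv Q (%z. cx (\<rho> z)) z = 0" if z: "!!t. dist z t <= e ==> Q t = 0"
  proof -
   have "Q t * cx (\<rho> (z - t)) = 0" for t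
   proof (cases "dist z t <= e")
    case False
    then have "r < norm (z - t)" using r(6) by (simp add: dist_norm)
    then show ?thesis using \<rho>(1) by (simp add: mollifier_def)
   qed (simp add: z)
   then have "(%t. Q t * cx (\<rho> (z - t))) = (%t. 0)" by (rule ext)
   then show ?thesis by (simp only: conv_def) simp
  qed
 qed (rule d1(2)[OF \<rho>(1) r(2)] d2(2)[OF \<rho>(1) r(3)])+
qed

lemma weak_C1_isometry:
 assumes w: "weak_C1 R \<psi> P Q"
 shows "l2 P = l2 Q"
proof -
 note D = weak_C1_D[OF w]
 have "\<bar>l2 P - l2 Q\<bar> <= 0"
 proof (rule field_le_epsilon)
  fix e :: real assume "0 < e"
  then have "0 < e / 2" by simp
  have "\<exists>\<phi> p q. C1 \<phi> p q \<and> (\<forall>z. R + 1 < norm z --> \<phi> z = 0) \<and> l2 p = l2 q \<and>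
    l2 (%z. p z - P z) <= e / 2 \<and> l2 (%z. q z - Q z) <= e / 2"
   by (rule weak_C1_approx[OF w \<open>0 < e / 2\<close>]) blast
  then obtain \<phi> p q where *: "C1 \<phi> p q" "!!z. R + 1 < norm z ==> \<phi> z = 0"
   "l2 p = l2 q" "l2 (%z. p z - P z) <= e / 2" "l2 (%z. q z - Q z) <= e / 2"
   by blast
  have "weak_C1 (R + 1) \<phi> p q" by (rule C1_weak[OF *(1)]) (rule *(2))
  note s = weak_C1_D(2,3)[OF this]
  have "\<bar>l2 p - l2 P\<bar> <= e / 2" "\<bar>l2 q - l2 Q\<bar> <= e / 2"
   using l2_reverse_triangle[OF s(1) D(2)] l2_reverse_triangle[OF s(2) D(3)] *(4,5) by linarith+
  then show "\<bar>l2 P - l2 Q\<bar> <= 0 + e" using *(3) by linarith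
 qed
 then show ?thesis by simp
qed

lemma sq_int_on_ball:
 assumes "continuous_on UNIV g"
 shows "sq_int (%z. indicator (cball 0 R) z * g z)"
proof -
 have [measurable]: "g \<in> bmeas" using assms by (rule borel_measurable_continuous_onI)
 have "compact (g ` cball 0 R)"
  by (intro compact_continuous_image continuous_on_subset[OF assms]) auto
 then obtain C where C: "C > 0" "!!z. z \<in> cball 0 R ==> cmod (g z) <= C"
  using compact_imp_bounded[of "g ` cball 0 R"] by (auto simp: bounded_pos)
 show ?thesis
  by (rule sq_int_bounded_support[of _ C R]) (use C in \<open>auto simp: indicator_def\<close>)
qed

lemma weak_integral_limit:
 assumes f: "!!n. sq_int (f n)" "sq_int f0" and supp: "!!n z. R < norm z ==> f n z = 0" "!!z. R < norm z ==> f0 z = 0"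
  and g: "continuous_on UNIV g" and lim: "(%n. l2 (%z. f n z - f0 z)) \<longlonglongrightarrow> 0"
 shows "(%n. (LBINT z. f n z * g z)) \<longlonglongrightarrow> (LBINT z. f0 z * g z)"
proof -
 have eq: "(%z. h z * (indicator (cball 0 R) z * g z)) = (%z. h z * g z)" if "!!z. R < norm z ==> h z = 0" for h :: "complex => complex"
 proof
  fix z show "h z * (indicator (cball 0 R) z * g z) = h z * g z"
   using that[of z] by (cases "R < norm z") (auto simp: indicator_def)
 qed
 have eq1: "(%z. f n z * (indicator (cball 0 R) z * g z)) = (%z. f n z * g z)" for n
  by (rule eq) (rule supp(1))
 have eq2: "(%z. f0 z * (indicator (cball 0 R) z * g z)) = (%z. f0 z * g z)"
  by (rule eq) (rule supp(2))
 show ?thesis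
  using l2_integral_tendsto[OF f sq_int_on_ball[OF g, of R] lim] unfolding eq1 eq2 .
qed

text \<open>The quotient rule is classical for C1 approximations of \<psi>. It survives the limit
  because the reciprocals are bounded on \<open>S\<close> and converge uniformly there. Through it
  the weak Beltrami equation passes from f to 1 / (f - f z0).\<close>

lemma weak_C1_reciprocal:
 assumes w: "weak_C1 R \<psi> P Q" and k: "C1 \<kappa> A B" and S: "closed S" "!!z. z \<notin> S ==> \<kappa> z = 0"
  and R': "!!z. R' < norm z ==> \<kappa> z = 0" and \<delta>: "0 < \<delta>" "!!z. z \<in> S ==> \<delta> <= cmod (\<psi> z)"
 shows "weak_C1 R' (%z. \<kappa> z / \<psi> z) (%z. A z / \<psi> z - \<kappa> z * P z / (\<psi> z)\<^sup>2) (%z. B z / \<psi> z - \<kappa> z * Q z / (\<psi> z)\<^sup>2)"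
proof -
 have wk: "weak_C1 R' \<kappa> A B" by (rule C1_weak[OF k]) (rule R')
 note D = weak_C1_D[OF w] and K = weak_C1_D[OF wk]
 have S0: "A z = 0" "B z = 0" if "z \<notin> S" for z
  using C1_derivs_zero[OF k, of "- S" 0 z] S that by auto
 have [measurable]: "\<psi> \<in> bmeas" "\<kappa> \<in> bmeas" "A \<in> bmeas" "B \<in> bmeas"
  "P \<in> bmeas" "Q \<in> bmeas" "S \<in> sets borel"
  using D(1-3) K(1-3) S(1) by (auto intro: borel_measurable_continuous_onI simp: sq_int_def)
 obtain Ck where Ck: "Ck > 0" "!!z. cmod (\<kappa> z) <= Ck"
  using bounded_if_compact_support[OF C1_continuous[OF k] R'] by blast
 \<comment> \<open>An error of at most \<delta>/2 keeps the approximations at least \<delta>/2 in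
   modulus on \<open>S\<close>.\<close>
 define e where "e n = \<delta> / 2 / real (Suc n)" for n
 have e: "0 < e n" "e n <= \<delta> / 2" for n
  using \<delta> by (auto simp: e_def field_simps)
 have e0: "e \<longlonglongrightarrow> 0"
 proof -
  have "(%n. \<delta> / 2 * (1 / real (Suc n))) \<longlonglongrightarrow> \<delta> / 2 * 0"
   by (intro tendsto_intros LIMSEQ_Suc[OF lim_1_over_n])
  then show ?thesis by (simp add: e_def[abs_def])
 qed
 define G where "G n \<phi> p q \<longleftrightarrow> C1 \<phi> p q \<and> (\<forall>z. R + 1 < norm z --> \<phi> z = 0) \<and> (\<forall>z. cmod (\<phi> z - \<psi> z) <= e n) \<and>
   l2 (%z. p z - P z) <= e n \<and> l2 (%z. q z - Q z) <= e n" for n \<phi> p q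
 have "\<forall>n. \<exists>\<phi> p q. G n \<phi> p q"
 proof
  fix n
  show "\<exists>\<phi> p q. G n \<phi> p q" unfolding G_def
   by (rule weak_C1_approx[OF w e(1)[of n]]) blast
 qed
 from choice[OF this] obtain \<phi> where "\<forall>n. \<exists>p q. G n (\<phi> n) p q" ..
 from choice[OF this] obtain p where "\<forall>n. \<exists>q. G n (\<phi> n) (p n) q" ..
 from choice[OF this] obtain q where G: "\<forall>n. G n (\<phi> n) (p n) (q n)" ..
 have \<phi>: "!!n. C1 (\<phi> n) (p n) (q n)" "!!n z. R + 1 < norm z ==> \<phi> n z = 0"
  "!!n z. cmod (\<phi> n z - \<psi> z) <= e n" "!!n. l2 (%z. p n z - P z) <= e n" "!!n. l2 (%z. q n z - Q z) <= e n"
  using G unfolding G_def by blast+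
 have w\<phi>: "weak_C1 (R + 1) (\<phi> n) (p n) (q n)" for n by (rule C1_weak[OF \<phi>(1)]) (rule \<phi>(2))
 note \<phi>s = weak_C1_D(2,3)[OF w\<phi>]
 have \<phi>c: "continuous_on UNIV (\<phi> n)" for n by (rule C1_continuous[OF \<phi>(1)])
 have [measurable]: "\<phi> n \<in> bmeas" "p n \<in> bmeas" "q n \<in> bmeas" for n
  using \<phi>c[of n] \<phi>s[of n] by (auto intro: borel_measurable_continuous_onI simp: sq_int_def)
 have low: "\<delta> / 2 <= cmod (\<phi> n z)" if "z \<in> S" for n z
 proof -
  have "cmod (\<psi> z) <= cmod (\<phi> n z) + cmod (\<phi> n z - \<psi> z)"
   using norm_triangle_ineq4[of "\<phi> n z" "\<phi> n z - \<psi> z"] by simp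
  then show ?thesis using \<phi>(3)[where n = n and z = z] e(2)[of n] \<delta>(2)[OF that] by linarith
 qed
 define h where "h n z = (if z \<in> S then 1 / \<phi> n z - 1 / \<psi> z else 0)" for n z
 have [measurable]: "h n \<in> bmeas" for n unfolding h_def by measurable
 have hb: "cmod (h n z) <= 2 / \<delta>\<^sup>2 * e n" for n z
 proof (cases "z \<in> S")
  case True
  have nz: "\<phi> n z ~= 0" "\<psi> z ~= 0" using low[OF True, of n] \<delta>(2)[OF True] \<delta>(1) by auto
  have "1 / \<phi> n z - 1 / \<psi> z = - ((\<phi> n z - \<psi> z) / (\<phi> n z * \<psi> z))" using nz by (simp add: field_simps)
  then have "cmod (1 / \<phi> n z - 1 / \<psi> z) = cmod (\<phi> n z - \<psi> z) / (cmod (\<phi> n z) * cmod (\<psi> z))"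
   by (simp only: norm_minus_cancel norm_divide norm_mult)
  also have "\<dots> <= e n / (\<delta> / 2 * \<delta>)"
   using \<phi>(3)[where n = n and z = z] e(1)[of n] \<delta>(1)
   by (intro frac_le mult_mono low[OF True] \<delta>(2)[OF True]) auto
  also have "\<dots> = 2 / \<delta>\<^sup>2 * e n" by (simp add: power2_eq_square)
  finally show ?thesis using True by (simp add: h_def)
 next
  case False
  then show ?thesis using e(1)[of n] by (simp add: h_def)
 qed
 \<comment> \<open>Three instances are used: \<open>D\<close>, \<open>T\<close> equal to
   \<open>A\<close>, \<open>P\<close>, then to \<open>B\<close>, \<open>Q\<close>, and finally to
   \<kappa>, 0, the last for the quotient itself.\<close>
 have main: "continuous_on UNIV D ==> sq_int D ==> sq_int T ==> (!!n. sq_int (t n)) ==> (!!z. z \<notin> S ==> D z = 0) ==>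
   (!!n. l2 (%z. t n z - T z) <= e n) ==>
   sq_int (%z. D z / \<psi> z - \<kappa> z * T z / (\<psi> z)\<^sup>2) \<and>
   (\<forall>n. sq_int (%z. D z / \<phi> n z - \<kappa> z * t n z / (\<phi> n z)\<^sup>2)) \<and>
   (%n. l2 (%z. (D z / \<phi> n z - \<kappa> z * t n z / (\<phi> n z)\<^sup>2) - (D z / \<psi> z - \<kappa> z * T z / (\<psi> z)\<^sup>2))) \<longlonglongrightarrow> 0" for D T t
 proof (intro conjI allI)
  assume Dc: "continuous_on UNIV D" and Ds: "sq_int D" and T: "sq_int T" and t: "!!n. sq_int (t n)" and DS: "!!z. z \<notin> S ==> D z = 0"
   and tT: "!!n. l2 (%z. t n z - T z) <= e n"
  have [measurable]: "D \<in> bmeas" "T \<in> bmeas" "t n \<in> bmeas" for n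
   using Ds T t[of n] by (auto simp: sq_int_def)
  have sq: "sq_int (%z. D z / f z - \<kappa> z * u z / (f z)\<^sup>2)"
   if f: "f \<in> bmeas" "!!z. z \<in> S ==> \<delta> / 2 <= cmod (f z)" and u: "sq_int u" for f u
  proof -
   note [measurable] = f(1)
   define i where "i z = (if z \<in> S then 1 / f z else 0)" for z
   define j where "j z = (if z \<in> S then \<kappa> z / (f z)\<^sup>2 else 0)" for z
   have i: "cmod (i z) <= 2 / \<delta>" for z
   proof (cases "z \<in> S")
    case True
    then have "1 / cmod (f z) <= 1 / (\<delta> / 2)" using f(2)[of z] \<delta>(1) by (intro frac_le) auto
    with True show ?thesis by (simp add: i_def norm_divide)
   qed (use \<delta> in \<open>simp add: i_def\<close>)
   have j: "cmod (j z) <= Ck * (2 / \<delta>)\<^sup>2" for z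
   proof -
    have "j z = \<kappa> z * (i z)\<^sup>2" by (simp add: j_def i_def power_divide)
    then have "cmod (j z) = cmod (\<kappa> z) * (cmod (i z))\<^sup>2" by (simp add: norm_mult norm_power)
    also have "\<dots> <= Ck * (2 / \<delta>)\<^sup>2" using Ck by (intro mult_mono power_mono i) auto
    finally show ?thesis .
   qed
   have im: "i \<in> bmeas" unfolding i_def by measurable
   have jm: "j \<in> bmeas" unfolding j_def by measurable
   have "sq_int (%z. i z * D z - j z * u z)"
    by (intro sq_int_diff l2_mult_bounded(1)[OF Ds im i] l2_mult_bounded(1)[OF u jm j])
   moreover have "(%z. i z * D z - j z * u z) = (%z. D z / f z - \<kappa> z * u z / (f z)\<^sup>2)"
   proof
    fix z show "i z * D z - j z * u z = D z / f z - \<kappa> z * u z / (f z)\<^sup>2"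
     using DS[of z] S(2)[of z] by (cases "z \<in> S") (simp_all add: i_def j_def)
   qed
   ultimately show ?thesis by simp
  qed
  have \<psi>l: "\<delta> / 2 <= cmod (\<psi> z)" if "z \<in> S" for z using \<delta>(2)[OF that] \<delta>(1) by simp
  show s1: "sq_int (%z. D z / \<psi> z - \<kappa> z * T z / (\<psi> z)\<^sup>2)" by (rule sq[OF _ \<psi>l T]) auto
  show s2: "sq_int (%z. D z / \<phi> n z - \<kappa> z * t n z / (\<phi> n z)\<^sup>2)" for n by (rule sq[OF _ low t]) auto
  define b where "b n z = (if z \<in> S then \<kappa> z / (\<phi> n z)\<^sup>2 else 0)" for n z
  \<comment> \<open>On \<open>S\<close> this is \<kappa> times the difference of 1/\<phi>^2 and
    1/\<psi>^2, factored as difference times sum so that the uniformly small \<open>h n\<close>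
    appears.\<close>
  define c where "c n z = h n z * (if z \<in> S then (1 / \<phi> n z + 1 / \<psi> z) * \<kappa> z else 0)" for n z
  have bm: "b n \<in> bmeas" for n unfolding b_def by measurable
  have cm: "c n \<in> bmeas" for n unfolding c_def by measurable
  have bb: "cmod (b n z) <= Ck * (4 / \<delta>\<^sup>2)" for n z
  proof (cases "z \<in> S")
   case True
   have "(\<delta> / 2)\<^sup>2 <= (cmod (\<phi> n z))\<^sup>2" using low[OF True, of n] \<delta>(1) by (intro power_mono) auto
   then have "cmod (\<kappa> z) / (cmod (\<phi> n z))\<^sup>2 <= Ck / (\<delta> / 2)\<^sup>2" using Ck \<delta>(1) by (intro frac_le) auto
   with True show ?thesis by (simp add: b_def norm_divide norm_power power_divide)
  qed (use Ck \<delta> in \<open>simp add: b_def\<close>)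
  have cb: "cmod (c n z) <= 2 / \<delta>\<^sup>2 * e n * (3 / \<delta> * Ck)" for n z
  proof (cases "z \<in> S")
   case True
   have 1: "1 / cmod (\<phi> n z) <= 1 / (\<delta> / 2)" using low[OF True, of n] \<delta>(1) by (intro frac_le) auto
   have 2: "1 / cmod (\<psi> z) <= 1 / \<delta>" using \<delta>(2)[OF True] \<delta>(1) by (intro frac_le) auto
   have "cmod (1 / \<phi> n z + 1 / \<psi> z) <= 1 / cmod (\<phi> n z) + 1 / cmod (\<psi> z)"
    using norm_triangle_ineq[of "1 / \<phi> n z" "1 / \<psi> z"] by (simp add: norm_divide)
   also have "\<dots> <= 3 / \<delta>" using 1 2 by simp
   finally have "cmod ((1 / \<phi> n z + 1 / \<psi> z) * \<kappa> z) <= 3 / \<delta> * Ck"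
    unfolding norm_mult using Ck \<delta>(1) by (intro mult_mono) auto
   then have "cmod (h n z * ((1 / \<phi> n z + 1 / \<psi> z) * \<kappa> z)) <= 2 / \<delta>\<^sup>2 * e n * (3 / \<delta> * Ck)"
    unfolding norm_mult[of "h n z"] using e(1)[of n] \<delta>(1) by (intro mult_mono hb) auto
   with True show ?thesis by (simp add: c_def)
  next
   case False
   then show ?thesis using e(1)[of n] \<delta>(1) Ck by (simp add: c_def)
  qed
  have eq: "(D z / \<phi> n z - \<kappa> z * t n z / (\<phi> n z)\<^sup>2) - (D z / \<psi> z - \<kappa> z * T z / (\<psi> z)\<^sup>2)
    = h n z * D z - (b n z * (t n z - T z) + c n z * T z)" for n z
  proof (cases "z \<in> S")
   case True
   have nz: "\<phi> n z ~= 0" "\<psi> z ~= 0" using low[OF True, of n] \<delta>(2)[OF True] \<delta>(1) by auto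
   have "(1 / \<phi> n z - 1 / \<psi> z) * ((1 / \<phi> n z + 1 / \<psi> z) * \<kappa> z) = \<kappa> z / (\<phi> n z)\<^sup>2 - \<kappa> z / (\<psi> z)\<^sup>2"
    using nz by (simp add: field_simps power2_eq_square)
   then have c': "c n z = \<kappa> z / (\<phi> n z)\<^sup>2 - \<kappa> z / (\<psi> z)\<^sup>2" using True by (simp add: c_def h_def)
   have h': "h n z = 1 / \<phi> n z - 1 / \<psi> z" and b': "b n z = \<kappa> z / (\<phi> n z)\<^sup>2" using True by (simp_all add: h_def b_def)
   show ?thesis unfolding c' h' b' by (simp add: algebra_simps diff_divide_distrib)
  qed (simp add: DS S(2) h_def b_def c_def)
  have bound: "l2 (%z. h n z * D z - (b n z * (t n z - T z) + c n z * T z)) <=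
    e n * (2 / \<delta>\<^sup>2 * l2 D + Ck * (4 / \<delta>\<^sup>2) + 2 / \<delta>\<^sup>2 * (3 / \<delta> * Ck) * l2 T)" for n
  proof -
   note tTs = sq_int_diff[OF t[of n] T]
   note m1 = l2_mult_bounded[OF Ds _ hb, of n] and m2 = l2_mult_bounded[OF tTs bm bb] and m3 = l2_mult_bounded[OF T cm cb, of n]
   have m1': "sq_int (%z. h n z * D z)" "l2 (%z. h n z * D z) <= 2 / \<delta>\<^sup>2 * e n * l2 D" using m1 by auto
   have "l2 (%z. h n z * D z - (b n z * (t n z - T z) + c n z * T z)) <= l2 (%z. h n z * D z) + l2 (%z. b n z * (t n z - T z) + c n z * T z)"
    by (rule l2_triangle_diff[OF m1'(1) sq_int_add[OF m2(1) m3(1)]])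
   also have "l2 (%z. b n z * (t n z - T z) + c n z * T z) <= l2 (%z. b n z * (t n z - T z)) + l2 (%z. c n z * T z)"
    by (rule l2_triangle[OF m2(1) m3(1)])
   also have "l2 (%z. b n z * (t n z - T z)) <= Ck * (4 / \<delta>\<^sup>2) * e n"
    by (rule order_trans[OF m2(2) mult_left_mono[OF tT]]) (use Ck in simp)
   finally show ?thesis using m1'(2) m3(2) by (simp add: algebra_simps)
  qed
  have "(%n. e n * (2 / \<delta>\<^sup>2 * l2 D + Ck * (4 / \<delta>\<^sup>2) + 2 / \<delta>\<^sup>2 * (3 / \<delta> * Ck) * l2 T)) \<longlonglongrightarrow> 0"
   by (rule tendsto_mult_left_zero[OF e0])
  then show "(%n. l2 (%z. (D z / \<phi> n z - \<kappa> z * t n z / (\<phi> n z)\<^sup>2) - (D z / \<psi> z - \<kappa> z * T z / (\<psi> z)\<^sup>2))) \<longlonglongrightarrow> 0"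
   unfolding eq
   by (rule Lim_null_comparison[rotated])
     (intro always_eventually allI, simp only: real_norm_def abs_of_nonneg[OF l2_nonneg], rule bound)
 qed
 have cA: "continuous_on UNIV A" "continuous_on UNIV B" using C1_continuous_derivs[OF k] by auto
 note MA = main[OF cA(1) K(2) D(2) \<phi>s(1) S0(1) \<phi>(4)] and MB = main[OF cA(2) K(3) D(3) \<phi>s(2) S0(2) \<phi>(5)]
 have ks: "sq_int \<kappa>" by (rule continuous_support_sq_int[OF K(1)]) (rule R')
 have M0: "sq_int (%z. \<kappa> z / \<psi> z) \<and> (\<forall>n. sq_int (%z. \<kappa> z / \<phi> n z)) \<and>
   (%n. l2 (%z. \<kappa> z / \<phi> n z - \<kappa> z / \<psi> z)) \<longlonglongrightarrow> 0"
  using main[OF K(1) ks sq_int_zero sq_int_zero S(2)] e(1) by (simp add: less_imp_le)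
 have CN: "C1 (%z. \<kappa> z / \<phi> n z) (%z. A z / \<phi> n z - \<kappa> z * p n z / (\<phi> n z)\<^sup>2) (%z. B z / \<phi> n z - \<kappa> z * q n z / (\<phi> n z)\<^sup>2)" for n
 proof -
  define W where "W = {z. \<phi> n z ~= 0}"
  have W: "open W" unfolding W_def by (rule open_Collect_neq[OF \<phi>c continuous_on_const])
  have SW: "S \<subseteq> W" using low[of _ n] \<delta>(1) by (force simp: W_def)
  have H: "((%z. 1 / \<phi> n z) has_derivative (%h. (- p n z / (\<phi> n z)\<^sup>2) * h + (- q n z / (\<phi> n z)\<^sup>2) * cnj h)) (at z)" if "z \<in> W" for z
  proof -
   have "((%z. inverse (\<phi> n z)) has_derivative (%h. - (inverse (\<phi> n z) * (p n z * h + q n z * cnj h) * inverse (\<phi> n z)))) (at z)"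
    by (rule Deriv.has_derivative_inverse[OF _ C1_has_derivative[OF \<phi>(1)]]) (use that in \<open>simp add: W_def\<close>)
   moreover have "(%h. - (inverse (\<phi> n z) * (p n z * h + q n z * cnj h) * inverse (\<phi> n z))) =
     (%h. (- p n z / (\<phi> n z)\<^sup>2) * h + (- q n z / (\<phi> n z)\<^sup>2) * cnj h)"
    by (simp add: fun_eq_iff field_simps power2_eq_square inverse_eq_divide add_divide_distrib)
   ultimately show ?thesis by (simp only: inverse_eq_divide)
  qed
  have c: "continuous_on W (%z. - p n z / (\<phi> n z)\<^sup>2)" "continuous_on W (%z. - q n z / (\<phi> n z)\<^sup>2)"
   using C1_continuous_derivs[OF \<phi>(1)[of n]] \<phi>c[of n]
   by (auto intro!: continuous_intros intro: continuous_on_subset simp: W_def)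
  from C1_mult_local[OF k S W SW H c] show ?thesis by simp
 qed
 have Rn: "\<kappa> z / \<phi> n z = 0" if "R' < norm z" for n z using R'[OF that] by simp
 have wN: "weak_C1 R' (%z. \<kappa> z / \<phi> n z) (%z. A z / \<phi> n z - \<kappa> z * p n z / (\<phi> n z)\<^sup>2) (%z. B z / \<phi> n z - \<kappa> z * q n z / (\<phi> n z)\<^sup>2)" for n
  by (rule C1_weak[OF CN]) (rule Rn)
 note WN = weak_C1_D[OF wN]
 show ?thesis unfolding weak_C1_def
 proof (intro conjI allI impI)
  show "continuous_on UNIV (%z. \<kappa> z / \<psi> z)"
  proof -
   define W where "W = {z. \<psi> z ~= 0}"
   have W: "open W" unfolding W_def by (rule open_Collect_neq[OF D(1) continuous_on_const])
   have SW: "S \<subseteq> W" using \<delta> by (force simp: W_def)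
   have "continuous_on (W \<union> - S) (%z. \<kappa> z / \<psi> z)"
   proof (rule continuous_on_open_Un)
    show "continuous_on W (%z. \<kappa> z / \<psi> z)"
     using D(1) K(1) by (auto intro!: continuous_intros intro: continuous_on_subset simp: W_def)
    show "continuous_on (- S) (%z. \<kappa> z / \<psi> z)"
     by (rule continuous_on_eq[OF continuous_on_const[of _ 0]]) (use S in auto)
   qed (use W S in auto)
   moreover have "W \<union> - S = UNIV" using SW by auto
   ultimately show ?thesis by simp
  qed
  show "\<kappa> z / \<psi> z = 0" "A z / \<psi> z - \<kappa> z * P z / (\<psi> z)\<^sup>2 = 0" "B z / \<psi> z - \<kappa> z * Q z / (\<psi> z)\<^sup>2 = 0" if "R' < norm z" for z
   using K(4-6)[OF that] by simp_all
  fix \<theta> A' B' assume \<theta>: "C1 \<theta> A' B'"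
  note c\<theta> = C1_continuous[OF \<theta>] C1_continuous_derivs[OF \<theta>]
  have L1: "(%n. (LBINT z. \<kappa> z / \<phi> n z * g z)) \<longlonglongrightarrow> (LBINT z. \<kappa> z / \<psi> z * g z)" if "continuous_on UNIV g" for g
   by (rule weak_integral_limit[where R = R', OF _ _ _ _ that]) (use M0 R' in auto)
  have L2: "(%n. (LBINT z. (A z / \<phi> n z - \<kappa> z * p n z / (\<phi> n z)\<^sup>2) * \<theta> z)) \<longlonglongrightarrow> (LBINT z. (A z / \<psi> z - \<kappa> z * P z / (\<psi> z)\<^sup>2) * \<theta> z)"
   by (rule weak_integral_limit[where R = R', OF _ _ _ _ c\<theta>(1)]) (use MA K(4-6) in auto)
  have L3: "(%n. (LBINT z. (B z / \<phi> n z - \<kappa> z * q n z / (\<phi> n z)\<^sup>2) * \<theta> z)) \<longlonglongrightarrow> (LBINT z. (B z / \<psi> z - \<kappa> z * Q z / (\<psi> z)\<^sup>2) * \<theta> z)"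
   by (rule weak_integral_limit[where R = R', OF _ _ _ _ c\<theta>(1)]) (use MB K(4-6) in auto)
  show "(LBINT z. \<kappa> z / \<psi> z * A' z) = - (LBINT z. (A z / \<psi> z - \<kappa> z * P z / (\<psi> z)\<^sup>2) * \<theta> z)"
   using LIMSEQ_unique[OF L1[OF c\<theta>(2), unfolded WN(7)[OF \<theta>]] tendsto_minus[OF L2]] .
  show "(LBINT z. \<kappa> z / \<psi> z * B' z) = - (LBINT z. (B z / \<psi> z - \<kappa> z * Q z / (\<psi> z)\<^sup>2) * \<theta> z)"
   using LIMSEQ_unique[OF L1[OF c\<theta>(3), unfolded WN(8)[OF \<theta>]] tendsto_minus[OF L3]] .
 qed (use MA MB in auto)
qed

lemma weak_C1_add:
 assumes "weak_C1 R \<psi> P Q" "weak_C1 R \<psi>' P' Q'"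
 shows "weak_C1 R (%z. \<psi> z + \<psi>' z) (%z. P z + P' z) (%z. Q z + Q' z)"
proof -
 note D = weak_C1_D[OF assms(1)] and D' = weak_C1_D[OF assms(2)]
 show ?thesis unfolding weak_C1_def
 proof (intro conjI allI impI)
  fix \<theta> A B assume \<theta>: "C1 \<theta> A B"
  have i: "integrbl (%z. h z * g z)" if "sq_int h" "!!z. R < norm z ==> h z = 0" "continuous_on UNIV g" for h g
  proof -
   have "(%z. h z * (indicator (cball 0 R) z * g z)) = (%z. h z * g z)"
   proof
    fix z show "h z * (indicator (cball 0 R) z * g z) = h z * g z"
     using that(2)[of z] by (cases "R < norm z") (auto simp: indicator_def)
   qed
   with l2_Cauchy_Schwarz(1)[OF that(1) sq_int_on_ball[OF that(3), of R]] show ?thesis by simp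
  qed
  note c = C1_continuous[OF \<theta>] C1_continuous_derivs[OF \<theta>]
  have s: "sq_int \<psi>" "sq_int \<psi>'"
   by (rule continuous_support_sq_int[OF D(1)], erule D(4)) (rule continuous_support_sq_int[OF D'(1)], erule D'(4))
  have j: "integrbl (%z. \<psi> z * A z)" "integrbl (%z. \<psi> z * B z)"
   "integrbl (%z. \<psi>' z * A z)" "integrbl (%z. \<psi>' z * B z)"
   "integrbl (%z. P z * \<theta> z)" "integrbl (%z. Q z * \<theta> z)"
   "integrbl (%z. P' z * \<theta> z)" "integrbl (%z. Q' z * \<theta> z)"
   using s D D' c by (auto intro!: i)
  show "(LBINT z. (\<psi> z + \<psi>' z) * A z) = - (LBINT z. (P z + P' z) * \<theta> z)"
   using D(7)[OF \<theta>] D'(7)[OF \<theta>] j by (simp add: distrib_right)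
  show "(LBINT z. (\<psi> z + \<psi>' z) * B z) = - (LBINT z. (Q z + Q' z) * \<theta> z)"
   using D(8)[OF \<theta>] D'(8)[OF \<theta>] j by (simp add: distrib_right)
 qed (use D D' in \<open>auto intro: continuous_on_add sq_int_add\<close>)
qed

lemma weak_C1_cmult:
 assumes "weak_C1 R \<psi> P Q"
 shows "weak_C1 R (%z. c * \<psi> z) (%z. c * P z) (%z. c * Q z)"
proof -
 note D = weak_C1_D[OF assms]
 show ?thesis unfolding weak_C1_def
 proof (intro conjI allI impI)
  fix \<theta> A B assume \<theta>: "C1 \<theta> A B"
  show "(LBINT z. (c * \<psi> z) * A z) = - (LBINT z. (c * P z) * \<theta> z)"
   using D(7)[OF \<theta>] by (simp add: mult.assoc)
  show "(LBINT z. (c * \<psi> z) * B z) = - (LBINT z. (c * Q z) * \<theta> z)"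
   using D(8)[OF \<theta>] by (simp add: mult.assoc)
 qed (use D in \<open>auto intro!: continuous_intros sq_int_cmult\<close>)
qed

section \<open>Radial integrals and cutoff functions\<close>

text \<open>The disc of radius sqrt s has area pi s, so the squared distance pushes area forward to
  pi times length. This takes the place of polar coordinates.\<close>

lemma distr_cmod_power2:
 "distr lborel borel (%z. (cmod (z - a))\<^sup>2) = density lborel (%s. ennreal pi * indicator {0..} s)"
proof (rule measure_eqI_generator_eq[where E = "range (%s::real. {..s})" and \<Omega> = UNIV and A = "%i. {..real i}"])
 show "Int_stable (range (%s::real. {..s}))"
  by (auto simp: Int_stable_def)
 have b: "sets (borel :: real measure) = sigma_sets UNIV (range (%s::real. {..s}))"
  by (subst borel_eq_atMost) simp
 show "sets (distr lborel borel (%z. (cmod (z - a))\<^sup>2)) = sigma_sets UNIV (range (%s::real. {..s}))"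
  "sets (density lborel (%s. ennreal pi * indicator {0..} s)) = sigma_sets UNIV (range (%s::real. {..s}))"
  using b by simp_all
 have L: "emeasure (distr lborel borel (%z. (cmod (z - a))\<^sup>2)) {..s} = ennreal (pi * max 0 s)" for s :: real
 proof -
  have "(%z. (cmod (z - a))\<^sup>2) -` {..s} = (if 0 <= s then cball a (sqrt s) else {})"
  proof (cases "0 <= s")
   case True
   have "(cmod (z - a))\<^sup>2 <= s \<longleftrightarrow> cmod (z - a) <= sqrt s" for z
    using True by (metis norm_ge_zero real_sqrt_abs real_sqrt_le_iff abs_of_nonneg)
   then show ?thesis using True by (auto simp: dist_norm norm_minus_commute)
  next
   case False
   then have "\<not> (cmod (z - a))\<^sup>2 <= s" for z using zero_le_power2[of "cmod (z - a)"] by linarith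
   then show ?thesis using False by auto
  qed
  moreover have "emeasure lborel (cball a (sqrt s)) = ennreal (pi * s)" if "0 <= s"
   using that by (subst emeasure_cball) (simp_all add: unit_ball_vol_2)
  ultimately show ?thesis by (subst emeasure_distr) (auto simp: max_def)
 qed
 have R: "emeasure (density lborel (%s. ennreal pi * indicator {0..} s)) {..s} = ennreal (pi * max 0 s)" for s :: real
 proof -
  have "emeasure (density lborel (%s. ennreal pi * indicator {0..} s)) {..s} = (\<integral>\<^sup>+x. ennreal pi * indicator {0..s} x \<partial>lborel)"
   by (subst emeasure_density) (auto intro!: nn_integral_cong simp: indicator_def)
  also have "\<dots> = ennreal pi * emeasure lborel {0..s}" by (subst nn_integral_cmult_indicator) auto
  also have "\<dots> = ennreal (pi * max 0 s)" by (auto simp: ennreal_mult max_def)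
  finally show ?thesis .
 qed
 show "emeasure (distr lborel borel (%z. (cmod (z - a))\<^sup>2)) X = emeasure (density lborel (%s. ennreal pi * indicator {0..} s)) X"
  if "X \<in> range (%s::real. {..s})" for X using that L R by auto
 show "(\<Union>i. {..real i}) = UNIV" using real_arch_simple by auto
 show "emeasure (distr lborel borel (%z. (cmod (z - a))\<^sup>2)) {..real i} ~= \<infinity>" for i by (simp add: L)
qed auto

lemma nn_integral_radial:
 assumes [measurable]: "g \<in> bmeas"
 shows "(\<integral>\<^sup>+z. g ((cmod (z - a))\<^sup>2) \<partial>lborel) = ennreal pi * (\<integral>\<^sup>+s. g s * indicator {0..} s \<partial>lborel)"
proof -
 have "(\<integral>\<^sup>+z. g ((cmod (z - a))\<^sup>2) \<partial>lborel) = (\<integral>\<^sup>+s. g s \<partial>distr lborel borel (%z. (cmod (z - a))\<^sup>2))"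
  by (subst nn_integral_distr) auto
 also have "\<dots> = (\<integral>\<^sup>+s. ennreal pi * (g s * indicator {0..} s) \<partial>lborel)"
  unfolding distr_cmod_power2 by (subst nn_integral_density) (auto intro!: nn_integral_cong simp: mult_ac)
 also have "\<dots> = ennreal pi * (\<integral>\<^sup>+s. g s * indicator {0..} s \<partial>lborel)"
  by (rule nn_integral_cmult) measurable
 finally show ?thesis .
qed

lemma l2_of_nn_integral:
 assumes f: "f \<in> bmeas" and C: "0 <= C" "(\<integral>\<^sup>+z. ennreal ((cmod (f z))\<^sup>2) \<partial>lborel) <= ennreal C"
 shows "sq_int f" "l2 f <= sqrt C"
proof -
 have i: "integrbl (%z. (cmod (f z))\<^sup>2)"
  by (rule integrableI_bounded) (use f C in \<open>auto intro: le_less_trans\<close>)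
 then show "sq_int f" using f by (simp add: sq_int_def)
 have "ennreal (LBINT z. (cmod (f z))\<^sup>2) <= ennreal C"
  using C(2) i by (subst (asm) nn_integral_eq_integral) auto
 then have "(LBINT z. (cmod (f z))\<^sup>2) <= C" using C(1) by (simp add: ennreal_le_iff)
 then show "l2 f <= sqrt C" by (simp add: l2_def)
qed

text \<open>In s = |z - a|^2 the squared norm is pi times the integral of 1/s^2 from r^2 on, that is
  pi/r^2. This is the origin of the factor sqrt pi in all energy bounds.\<close>

lemma l2_inverse_square:
 fixes a :: complex
 assumes r: "0 < r"
 defines "f \<equiv> %z. indicator {z. r <= cmod (z - a)} z / (z - a)\<^sup>2"
 shows "sq_int f" "l2 f <= sqrt pi / r"
proof -
 have [measurable]: "f \<in> bmeas" unfolding f_def by measurable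
 have r2: "0 < r\<^sup>2" using r by simp
 have eq: "ennreal ((cmod (f z))\<^sup>2) = ennreal (indicator {r\<^sup>2..} ((cmod (z - a))\<^sup>2) / ((cmod (z - a))\<^sup>2)\<^sup>2)" for z
 proof -
  have "r <= cmod (z - a) \<longleftrightarrow> r\<^sup>2 <= (cmod (z - a))\<^sup>2" using r by (simp add: power_mono_iff)
  then show ?thesis by (auto simp: f_def indicator_def norm_divide norm_power power_divide)
 qed
 have "(\<integral>\<^sup>+z. ennreal ((cmod (f z))\<^sup>2) \<partial>lborel) = ennreal pi * (\<integral>\<^sup>+s. ennreal (indicator {r\<^sup>2..} s / s\<^sup>2) * indicator {0..} s \<partial>lborel)"
  unfolding eq by (rule nn_integral_radial) measurable
 also have "(\<integral>\<^sup>+s. ennreal (indicator {r\<^sup>2..} s / s\<^sup>2) * indicator {0..} s \<partial>lborel) = (\<integral>\<^sup>+s. ennreal (1 / s\<^sup>2) * indicator {r\<^sup>2..} s \<partial>lborel)"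
 proof (rule nn_integral_cong)
  fix s
  have "0 <= s" if "r\<^sup>2 <= s" using that zero_le_power2[of r] by linarith
  then show "ennreal (indicator {r\<^sup>2..} s / s\<^sup>2) * indicator {0..} s = ennreal (1 / s\<^sup>2) * indicator {r\<^sup>2..} s"
   by (auto simp: indicator_def)
 qed
 also have "\<dots> = ennreal (0 - (- 1 / r\<^sup>2))"
 proof (rule nn_integral_FTC_atLeast)
  fix x assume "r\<^sup>2 <= x"
  then have "0 < x" using r2 by linarith
  then show "DERIV (%x. - 1 / x) x :> 1 / x\<^sup>2"
   by (auto intro!: derivative_eq_intros simp: power2_eq_square)
 next
  show "((%x::real. - 1 / x) \<longlongrightarrow> 0) at_top"
   by (rule tendsto_divide_0[OF tendsto_const filterlim_at_top_imp_at_infinity[OF filterlim_ident]])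
 qed auto
 also have "ennreal pi * ennreal (0 - (- 1 / r\<^sup>2)) = ennreal (pi / r\<^sup>2)"
  using r by (simp add: ennreal_mult[symmetric])
 finally have le: "(\<integral>\<^sup>+z. ennreal ((cmod (f z))\<^sup>2) \<partial>lborel) <= ennreal (pi / r\<^sup>2)" by simp
 have "0 <= pi / r\<^sup>2" by simp
 from l2_of_nn_integral[OF _ this le] show "sq_int f" "l2 f <= sqrt pi / r"
  using r by (simp_all add: real_sqrt_divide)
qed

text \<open>A quadratic spline: 2 x^2 up to 1/2, then 1 - 2 (1 - x)^2 up to 1, and constant outside
  [0, 1]. Its largest slope 2 is the numerator in the hypothesis \<open>2 / L\<close> of
  \<open>log_cutoff\<close>.\<close>

definition step :: "real => real" where
 "step x = 2 * (max 0 x)\<^sup>2 - 4 * (max 0 (x - 1/2))\<^sup>2 + 2 * (max 0 (x - 1))\<^sup>2"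

definition step' :: "real => real" where
 "step' x = 4 * max 0 x - 8 * max 0 (x - 1/2) + 4 * max 0 (x - 1)"

lemma step_deriv: "(step has_real_derivative step' x) (at x)"
proof -
 have p: "((%s::real. (max 0 (s - c))\<^sup>2) has_real_derivative 2 * max 0 (x - c)) (at x)" for c
 proof -
  have "((%s. s - c) has_real_derivative 1) (at x)" by (auto intro!: derivative_eq_intros)
  from DERIV_chain2[OF pos_part_power_deriv[of 0 "x - c"] this] show ?thesis by (simp add: power2_eq_square)
 qed
 have "((%x. 2 * (max 0 (x - 0))\<^sup>2 - 4 * (max 0 (x - 1/2))\<^sup>2 + 2 * (max 0 (x - 1))\<^sup>2) has_real_derivative
  2 * (2 * max 0 (x - 0)) - 4 * (2 * max 0 (x - 1/2)) + 2 * (2 * max 0 (x - 1))) (at x)"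
  by (intro DERIV_add DERIV_diff DERIV_cmult p)
 then show ?thesis by (simp add: step_def[abs_def] step'_def)
qed

lemma step'_cont: "continuous_on UNIV step'"
 unfolding step'_def[abs_def] by (intro continuous_intros)

lemma step_values:
 "x <= 0 ==> step x = 0" "1 <= x ==> step x = 1" "0 <= step x" "step x <= 1"
 "x <= 0 ==> step' x = 0" "1 <= x ==> step' x = 0" "0 <= step' x" "step' x <= 2"
proof -
 show 0: "step x = 0" if "x <= 0" for x using that by (simp add: step_def max_def)
 show 1: "step x = 1" if "1 <= x" for x using that by (simp add: step_def max_def power2_eq_square algebra_simps)
 show "step' x = 0" if "x <= 0" using that by (simp add: step'_def max_def)
 show "step' x = 0" if "1 <= x" using that by (simp add: step'_def max_def)
 show n: "0 <= step' x" for x by (simp add: step'_def max_def)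
 show "step' x <= 2" by (simp add: step'_def max_def)
 have mono: "step x <= step y" if "x <= y" for x y
  by (rule DERIV_nonneg_imp_nondecreasing[OF that]) (use step_deriv n in blast)
 show "0 <= step x" using mono[of "min 0 x" x] 0[of "min 0 x"] by simp
 show "step x <= 1" using mono[of x "max 1 x"] 1[of "max 1 x"] by simp
qed

lemma ln_le_if_le_exp: "0 < s ==> s <= exp x ==> ln s <= (x::real)"
 using ln_le_cancel_iff[of s "exp x"] by simp

text \<open>Functions of \<open>ln |z - a|\<close> have small Dirichlet energy because the energy of \<open>ln |z - a|\<close> over an
 annulus grows only with the logarithm of the ratio of its radii.\<close>

lemma log_cutoff:
 fixes h h' :: "real => real" and a :: complex and c0 :: real
 assumes h: "!!x. (h has_real_derivative h' x) (at x)" "continuous_on UNIV h'"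
  and L: "0 < L" and h'0: "!!x. x <= \<alpha> \<or> \<alpha> + L <= x ==> h' x = 0" and h'b: "!!x. \<bar>h' x\<bar> <= 2 / L"
  and c0: "!!x. x <= \<alpha> ==> h x = c0"
 defines "k \<equiv> %s. if s <= 0 then c0 else h (ln s)" and "k' \<equiv> %s. if s <= 0 then 0 else h' (ln s) / s"
 defines "A \<equiv> %z. cx (k' ((cmod (z - a))\<^sup>2)) * cnj (z - a)" and "B \<equiv> %z. cx (k' ((cmod (z - a))\<^sup>2)) * (z - a)"
 shows "C1 (%z. cx (k ((cmod (z - a))\<^sup>2))) A B"
  and "sq_int A" "sq_int B" "l2 A <= sqrt (4 * pi / L)" "l2 B <= sqrt (4 * pi / L)"
proof -
 define s0 where "s0 = exp \<alpha>"
 have s0: "0 < s0" by (simp add: s0_def)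
 have low: "k s = c0" "k' s = 0" if "s < s0" for s
 proof -
  have "s <= 0 \<or> ln s <= \<alpha>" using that ln_le_if_le_exp[of s \<alpha>] unfolding s0_def by linarith
  then show "k s = c0" "k' s = 0" using c0 h'0 by (auto simp: k_def k'_def)
 qed
 have kd: "(k has_real_derivative k' s) (at s)" for s
 proof (cases "s < s0")
  case True
  have "((%s. c0) has_real_derivative 0) (at s)" by simp
  then have "(k has_real_derivative 0) (at s)"
   by (rule has_field_derivative_transform_within_open[where S = "{..<s0}"]) (use True low in auto)
  with True low show ?thesis by simp
 next
  case False
  then have s: "0 < s" using s0 by linarith
  have "((%s. h (ln s)) has_real_derivative h' (ln s) * (1 / s)) (at s)"
   by (rule DERIV_chain2[OF h(1)]) (use s in \<open>auto intro!: derivative_eq_intros\<close>)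
  then have "(k has_real_derivative h' (ln s) * (1 / s)) (at s)"
   by (rule has_field_derivative_transform_within_open[where S = "{0<..}"]) (use s in \<open>auto simp: k_def\<close>)
  with s show ?thesis by (simp add: k'_def)
 qed
 have kc: "continuous_on UNIV k'"
 proof -
  have "continuous_on ({..<s0} \<union> {0<..}) k'"
  proof (rule continuous_on_open_Un)
   show "continuous_on {..<s0} k'"
    by (rule continuous_on_eq[OF continuous_on_const[of _ 0]]) (use low in auto)
   have "continuous_on {0<..} (%s. h' (ln s) / s)"
    by (intro continuous_intros continuous_on_compose2[OF h(2)]) auto
   then show "continuous_on {0<..} k'"
    by (rule continuous_on_eq) (auto simp: k'_def)
  qed auto
  moreover have "{..<s0} \<union> {0<..} = UNIV" using s0 by auto
  ultimately show ?thesis by simp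
 qed
 show C: "C1 (%z. cx (k ((cmod (z - a))\<^sup>2))) A B"
  unfolding A_def B_def by (rule C1_radial[OF kd kc])
 have m: "A \<in> bmeas" "B \<in> bmeas"
  using C1_continuous_derivs[OF C] by (auto intro: borel_measurable_continuous_onI)
 \<comment> \<open>The slope bound gives (k' s)^2 s <= 4 / (L^2 s), supported on an interval where
   ln s grows by L; the integral is therefore at most 4/L.\<close>
 have nn: "(\<integral>\<^sup>+z. ennreal ((k' ((cmod (z - a))\<^sup>2))\<^sup>2 * (cmod (z - a))\<^sup>2) \<partial>lborel) <= ennreal (4 * pi / L)"
 proof -
  have [measurable]: "k' \<in> bmeas" using kc by (rule borel_measurable_continuous_onI)
  have "(\<integral>\<^sup>+z. ennreal ((k' ((cmod (z - a))\<^sup>2))\<^sup>2 * (cmod (z - a))\<^sup>2) \<partial>lborel) = ennreal pi * (\<integral>\<^sup>+s. ennreal ((k' s)\<^sup>2 * s) * indicator {0..} s \<partial>lborel)"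
   by (rule nn_integral_radial) measurable
  also have "(\<integral>\<^sup>+s. ennreal ((k' s)\<^sup>2 * s) * indicator {0..} s \<partial>lborel) <= (\<integral>\<^sup>+s. ennreal (4 / L\<^sup>2 * (1 / s)) * indicator {exp \<alpha>..exp (\<alpha> + L)} s \<partial>lborel)"
  proof (rule nn_integral_mono)
   fix s
   show "ennreal ((k' s)\<^sup>2 * s) * indicator {0..} s <= ennreal (4 / L\<^sup>2 * (1 / s)) * indicator {exp \<alpha>..exp (\<alpha> + L)} s"
   proof (cases "s \<in> {exp \<alpha>..exp (\<alpha> + L)}")
    case True
    then have s: "0 < s" using less_le_trans[OF exp_gt_zero, of \<alpha> s] by simp
    have "(h' (ln s))\<^sup>2 <= (2 / L)\<^sup>2" using power_mono[OF h'b[of "ln s"] abs_ge_zero, of 2] by simp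
    then have "(k' s)\<^sup>2 * s <= 4 / L\<^sup>2 * (1 / s)"
     using s by (simp add: k'_def power_divide field_simps power2_eq_square)
    then show ?thesis using True by (auto simp: indicator_def intro: ennreal_leI)
   next
    case False
    have "k' s = 0"
    proof (cases "s < s0")
     case True then show ?thesis by (rule low(2))
    next
     case F: False
     then have "0 < s" using s0 by linarith
     moreover have "exp (\<alpha> + L) <= s" using F False by (simp add: s0_def)
     ultimately have s: "0 < s" "exp (\<alpha> + L) <= s" by auto
     then have "\<alpha> + L <= ln s" using ln_ge_iff by blast
     then show ?thesis using h'0 by (simp add: k'_def)
    qed
    then show ?thesis by simp
   qed
  qed
  also have "\<dots> = ennreal (4 / L\<^sup>2 * ln (exp (\<alpha> + L)) - 4 / L\<^sup>2 * ln (exp \<alpha>))"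
  proof (rule nn_integral_FTC_Icc)
   fix x assume x: "x \<in> {exp \<alpha>..exp (\<alpha> + L)}"
   then have "0 < x" using less_le_trans[OF exp_gt_zero, of \<alpha> x] by simp
   then show "((%x. 4 / L\<^sup>2 * ln x) has_real_derivative 4 / L\<^sup>2 * (1 / x)) (at x)"
    by (intro DERIV_cmult) (auto intro!: derivative_eq_intros)
   show "0 <= 4 / L\<^sup>2 * (1 / x)" using \<open>0 < x\<close> by simp
  qed (use L in auto)
  also have "4 / L\<^sup>2 * ln (exp (\<alpha> + L)) - 4 / L\<^sup>2 * ln (exp \<alpha>) = 4 / L"
   using L by (simp add: field_simps power2_eq_square)
  also have "ennreal pi * ennreal (4 / L) = ennreal (4 * pi / L)"
   using L by (simp add: ennreal_mult[symmetric] mult.commute)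
  finally show ?thesis by (simp add: mult_left_mono)
 qed
 have nA: "(\<integral>\<^sup>+z. ennreal ((cmod (A z))\<^sup>2) \<partial>lborel) <= ennreal (4 * pi / L)"
  and nB: "(\<integral>\<^sup>+z. ennreal ((cmod (B z))\<^sup>2) \<partial>lborel) <= ennreal (4 * pi / L)"
  using nn by (simp_all add: A_def B_def norm_mult power_mult_distrib flip: complex_cnj_diff)
 have "0 <= 4 * pi / L" using L by simp
 from l2_of_nn_integral[OF m(1) this nA] l2_of_nn_integral[OF m(2) this nB]
 show "sq_int A" "sq_int B" "l2 A <= sqrt (4 * pi / L)" "l2 B <= sqrt (4 * pi / L)" by auto
qed

lemma inner_cutoff:
 assumes L: "0 < L"
 obtains \<kappa> A B where "C1 \<kappa> A B" "sq_int A" "sq_int B" "l2 A <= sqrt (4 * pi / L)" "l2 B <= sqrt (4 * pi / L)"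
  "!!z. cmod (\<kappa> z) <= 1" "!!z. (cmod (z - a))\<^sup>2 < exp (- 2 * L) ==> \<kappa> z = 0" "!!z. exp (- L) <= (cmod (z - a))\<^sup>2 ==> \<kappa> z = 1"
proof -
 \<comment> \<open>As a function of ln |z - a|^2 the step rises on the interval from -2 L to
   -L.\<close>
 define h where "h x = step (x / L + 2)" for x
 define h' where "h' x = step' (x / L + 2) / L" for x
 have hd: "(h has_real_derivative h' x) (at x)" for x
 proof -
  have "((%x. x / L + 2) has_real_derivative 1 / L) (at x)" using L by (auto intro!: derivative_eq_intros)
  from DERIV_chain2[OF step_deriv this] show ?thesis by (simp add: h_def[abs_def] h'_def)
 qed
 have hc: "continuous_on UNIV h'"
  unfolding h'_def[abs_def] using L by (intro continuous_intros continuous_on_compose2[OF step'_cont]) auto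
 have z: "x / L + 2 <= 0" if "x <= - 2 * L" for x
  using that L by (simp add: field_simps)
 have z2: "1 <= x / L + 2" if "- 2 * L + L <= x" for x
  using that L by (simp add: field_simps)
 have h'0: "h' x = 0" if "x <= - 2 * L \<or> - 2 * L + L <= x" for x
  using that step_values(5)[OF z] step_values(6)[OF z2] by (auto simp: h'_def)
 have h'b: "\<bar>h' x\<bar> <= 2 / L" for x
  using step_values(7,8)[of "x / L + 2"] L by (simp add: h'_def divide_right_mono)
 have h0: "h x = 0" if "x <= - 2 * L" for x using step_values(1)[OF z[OF that]] by (simp add: h_def)
 note lc = log_cutoff[OF hd hc L h'0 h'b h0, where a = a]
 show ?thesis
 proof (rule that[OF lc])
  fix z
  show "cmod (cx (if (cmod (z - a))\<^sup>2 <= 0 then 0 else h (ln ((cmod (z - a))\<^sup>2)))) <= 1"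
   using step_values(3,4) by (auto simp: h_def)
  show "cx (if (cmod (z - a))\<^sup>2 <= 0 then 0 else h (ln ((cmod (z - a))\<^sup>2))) = 0" if "(cmod (z - a))\<^sup>2 < exp (- 2 * L)"
  proof (cases "(cmod (z - a))\<^sup>2 <= 0")
   case False
   then have "ln ((cmod (z - a))\<^sup>2) <= - 2 * L"
    using that ln_le_if_le_exp[of "(cmod (z - a))\<^sup>2" "- 2 * L"] by simp
   then show ?thesis using h0 by simp
  qed simp
  show "cx (if (cmod (z - a))\<^sup>2 <= 0 then 0 else h (ln ((cmod (z - a))\<^sup>2))) = 1" if "exp (- L) <= (cmod (z - a))\<^sup>2"
  proof -
   have p: "0 < (cmod (z - a))\<^sup>2" using less_le_trans[OF exp_gt_zero that] .
   then have "- L <= ln ((cmod (z - a))\<^sup>2)" using that ln_ge_iff by blast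
   then have "h (ln ((cmod (z - a))\<^sup>2)) = 1" using step_values(2)[OF z2] by (simp add: h_def)
   with p show ?thesis by simp
  qed
 qed
qed

lemma outer_cutoff:
 assumes L: "0 < L"
 obtains \<kappa> A B where "C1 \<kappa> A B" "sq_int A" "sq_int B" "l2 A <= sqrt (4 * pi / L)" "l2 B <= sqrt (4 * pi / L)"
  "!!z. cmod (\<kappa> z) <= 1" "!!z. exp (2 * L) < (cmod z)\<^sup>2 ==> \<kappa> z = 0" "!!z. (cmod z)\<^sup>2 <= exp L ==> \<kappa> z = 1"
proof -
 \<comment> \<open>As a function of ln |z|^2 the step falls on the interval from L to 2 L.\<close>
 define h where "h x = step (2 - x / L)" for x
 define h' where "h' x = - step' (2 - x / L) / L" for x
 have hd: "(h has_real_derivative h' x) (at x)" for x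
 proof -
  have "((%x. 2 - x / L) has_real_derivative - (1 / L)) (at x)" using L by (auto intro!: derivative_eq_intros)
  from DERIV_chain2[OF step_deriv this] show ?thesis by (simp add: h_def[abs_def] h'_def)
 qed
 have hc: "continuous_on UNIV h'"
  unfolding h'_def[abs_def] using L by (intro continuous_intros continuous_on_compose2[OF step'_cont]) auto
 have z: "1 <= 2 - x / L" if "x <= L" for x
  using that L by (simp add: field_simps)
 have z2: "2 - x / L <= 0" if "L + L <= x" for x
  using that L by (simp add: field_simps)
 have h'0: "h' x = 0" if "x <= L \<or> L + L <= x" for x
  using that step_values(6)[OF z] step_values(5)[OF z2] by (auto simp: h'_def)
 have h'b: "\<bar>h' x\<bar> <= 2 / L" for x
  using step_values(7,8)[of "2 - x / L"] L by (simp add: h'_def divide_right_mono)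
 have h0: "h x = 1" if "x <= L" for x using step_values(2)[OF z[OF that]] by (simp add: h_def)
 note lc = log_cutoff[OF hd hc L h'0 h'b h0, where a = 0]
 show ?thesis
 proof (rule that[OF lc])
  fix z :: complex
  show "cmod (cx (if (cmod (z - 0))\<^sup>2 <= 0 then 1 else h (ln ((cmod (z - 0))\<^sup>2)))) <= 1"
   using step_values(3,4) by (auto simp: h_def)
  show "cx (if (cmod (z - 0))\<^sup>2 <= 0 then 1 else h (ln ((cmod (z - 0))\<^sup>2))) = 0" if "exp (2 * L) < (cmod z)\<^sup>2"
  proof -
   have p: "0 < (cmod z)\<^sup>2" using less_trans[OF exp_gt_zero that] .
   then have "L + L <= ln ((cmod z)\<^sup>2)" using that by (subst ln_ge_iff) auto
   then have "h (ln ((cmod z)\<^sup>2)) = 0" using step_values(1)[OF z2] by (simp add: h_def)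
   with p show ?thesis by simp
  qed
  show "cx (if (cmod (z - 0))\<^sup>2 <= 0 then 1 else h (ln ((cmod (z - 0))\<^sup>2))) = 1" if "(cmod z)\<^sup>2 <= exp L"
  proof (cases "(cmod z)\<^sup>2 <= 0")
   case False
   then have "ln ((cmod z)\<^sup>2) <= L" using that ln_le_if_le_exp[of "(cmod z)\<^sup>2" L] by simp
   then show ?thesis using h0 by simp
  qed simp
 qed
qed

text \<open>A product of three logarithmic cutoffs, at \<open>a\<close>, at \<open>b\<close> and at
  infinity. Each is bounded by 1, so by the product rule the norms of the derivatives add up to the
  factor 3.\<close>

lemma cutoff_exists:
 assumes L: "0 < L"
 obtains \<kappa> A B where "C1 \<kappa> A B" "sq_int A" "sq_int B" "l2 A <= 3 * sqrt (4 * pi / L)" "l2 B <= 3 * sqrt (4 * pi / L)"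
  "!!z. cmod (\<kappa> z) <= 1"
  "!!z. (cmod (z - a))\<^sup>2 < exp (- 2 * L) \<or> (cmod (z - b))\<^sup>2 < exp (- 2 * L) \<or> exp (2 * L) < (cmod z)\<^sup>2 ==> \<kappa> z = 0"
  "!!z. exp (- L) <= (cmod (z - a))\<^sup>2 ==> exp (- L) <= (cmod (z - b))\<^sup>2 ==> (cmod z)\<^sup>2 <= exp L ==> \<kappa> z = 1"
proof -
 obtain k1 A1 B1 where 1: "C1 k1 A1 B1" "sq_int A1" "sq_int B1" "l2 A1 <= sqrt (4 * pi / L)" "l2 B1 <= sqrt (4 * pi / L)"
  "!!z. cmod (k1 z) <= 1" "!!z. (cmod (z - a))\<^sup>2 < exp (- 2 * L) ==> k1 z = 0" "!!z. exp (- L) <= (cmod (z - a))\<^sup>2 ==> k1 z = 1"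
  by (rule inner_cutoff[OF L, of a]) blast
 obtain k2 A2 B2 where 2: "C1 k2 A2 B2" "sq_int A2" "sq_int B2" "l2 A2 <= sqrt (4 * pi / L)" "l2 B2 <= sqrt (4 * pi / L)"
  "!!z. cmod (k2 z) <= 1" "!!z. (cmod (z - b))\<^sup>2 < exp (- 2 * L) ==> k2 z = 0" "!!z. exp (- L) <= (cmod (z - b))\<^sup>2 ==> k2 z = 1"
  by (rule inner_cutoff[OF L, of b]) blast
 obtain k3 A3 B3 where 3: "C1 k3 A3 B3" "sq_int A3" "sq_int B3" "l2 A3 <= sqrt (4 * pi / L)" "l2 B3 <= sqrt (4 * pi / L)"
  "!!z. cmod (k3 z) <= 1" "!!z. exp (2 * L) < (cmod z)\<^sup>2 ==> k3 z = 0" "!!z. (cmod z)\<^sup>2 <= exp L ==> k3 z = 1"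
  by (rule outer_cutoff[OF L]) blast
 have prod: "sq_int (%z. D z * g z + f z * E z) \<and> l2 (%z. D z * g z + f z * E z) <= l2 D + l2 E"
  if "sq_int D" "sq_int E" "continuous_on UNIV f" "continuous_on UNIV g" "!!z. cmod (f z) <= 1" "!!z. cmod (g z) <= 1" for D E f g
 proof -
  have m: "f \<in> bmeas" "g \<in> bmeas"
   using that by (auto intro: borel_measurable_continuous_onI)
  note gD = l2_mult_bounded[OF that(1) m(2) that(6)] and fE = l2_mult_bounded[OF that(2) m(1) that(5)]
  have eq: "(%z. D z * g z + f z * E z) = (%z. g z * D z + f z * E z)" by (simp add: mult.commute)
  show ?thesis unfolding eq using sq_int_add[OF gD(1) fE(1)] l2_triangle[OF gD(1) fE(1)] gD(2) fE(2) by simp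
 qed
 note c1 = C1_continuous[OF 1(1)] and c2 = C1_continuous[OF 2(1)] and c3 = C1_continuous[OF 3(1)]
 note C12 = C1_mult[OF 1(1) 2(1)]
 have b12: "cmod (k1 z * k2 z) <= 1" for z
  unfolding norm_mult by (intro mult_le_one 1 2) auto
 note pA = prod[OF 1(2) 2(2) c1 c2 1(6) 2(6)] and pB = prod[OF 1(3) 2(3) c1 c2 1(6) 2(6)]
 note qA = prod[OF conjunct1[OF pA] 3(2) C1_continuous[OF C12] c3 b12 3(6)] and qB = prod[OF conjunct1[OF pB] 3(3) C1_continuous[OF C12] c3 b12 3(6)]
 show ?thesis
 proof (rule that[OF C1_mult[OF C12 3(1)] conjunct1[OF qA] conjunct1[OF qB]])
  show "cmod (k1 z * k2 z * k3 z) <= 1" for z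
   unfolding norm_mult[of _ "k3 z"] by (intro mult_le_one b12 3) auto
  show "l2 (%z. (A1 z * k2 z + k1 z * A2 z) * k3 z + k1 z * k2 z * A3 z) <= 3 * sqrt (4 * pi / L)"
   using conjunct2[OF pA] conjunct2[OF qA] 1(4) 2(4) 3(4) by linarith
  show "l2 (%z. (B1 z * k2 z + k1 z * B2 z) * k3 z + k1 z * k2 z * B3 z) <= 3 * sqrt (4 * pi / L)"
   using conjunct2[OF pB] conjunct2[OF qB] 1(5) 2(5) 3(5) by linarith
  fix z
  show "k1 z * k2 z * k3 z = 0" if "(cmod (z - a))\<^sup>2 < exp (- 2 * L) \<or> (cmod (z - b))\<^sup>2 < exp (- 2 * L) \<or> exp (2 * L) < (cmod z)\<^sup>2"
   using that 1(7)[of z] 2(7)[of z] 3(7)[of z] by (elim disjE) simp_all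
  show "k1 z * k2 z * k3 z = 1" if "exp (- L) <= (cmod (z - a))\<^sup>2" "exp (- L) <= (cmod (z - b))\<^sup>2" "(cmod z)\<^sup>2 <= exp L"
   using 1(8)[OF that(1)] 2(8)[OF that(2)] 3(8)[OF that(3)] by simp
 qed
qed

section \<open>Annular averages that extract Taylor coefficients\<close>

lemma radial_step:
 assumes "0 < s" "s < t"
 defines "k \<equiv> %x. step ((x - s\<^sup>2) / (t\<^sup>2 - s\<^sup>2))" and "k' \<equiv> %x. step' ((x - s\<^sup>2) / (t\<^sup>2 - s\<^sup>2)) / (t\<^sup>2 - s\<^sup>2)"
 shows "!!x. (k has_real_derivative k' x) (at x)" "continuous_on UNIV k'" "!!x. 0 <= k' x"
  "!!x. x <= s\<^sup>2 ==> k x = 0" "!!x. t\<^sup>2 <= x ==> k x = 1" "!!x. x <= s\<^sup>2 ==> k' x = 0" "!!x. t\<^sup>2 <= x ==> k' x = 0" "!!x. 0 <= k x \<and> k x <= 1"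
proof -
 have d: "0 < t\<^sup>2 - s\<^sup>2" using assms(1,2) by (simp add: power_strict_mono)
 show "(k has_real_derivative k' x) (at x)" for x
 proof -
  have "((%x. (x - s\<^sup>2) / (t\<^sup>2 - s\<^sup>2)) has_real_derivative 1 / (t\<^sup>2 - s\<^sup>2)) (at x)" using d by (auto intro!: derivative_eq_intros)
  from DERIV_chain2[OF step_deriv this] show ?thesis by (simp add: k_def k'_def)
 qed
 show "continuous_on UNIV k'"
  unfolding k'_def using d by (intro continuous_intros continuous_on_compose2[OF step'_cont]) auto
 show "0 <= k' x" for x using d step_values(7) by (simp add: k'_def)
 have z: "(x - s\<^sup>2) / (t\<^sup>2 - s\<^sup>2) <= 0" if "x <= s\<^sup>2" for x using that d by (simp add: field_simps)
 have o: "1 <= (x - s\<^sup>2) / (t\<^sup>2 - s\<^sup>2)" if "t\<^sup>2 <= x" for x using that d by (simp add: field_simps)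
 show "k x = 0" "k' x = 0" if "x <= s\<^sup>2" for x using step_values(1,5)[OF z[OF that]] by (simp_all add: k_def k'_def)
 show "k x = 1" "k' x = 0" if "t\<^sup>2 <= x" for x using step_values(2,6)[OF o[OF that]] by (simp_all add: k_def k'_def)
 show "0 <= k x \<and> k x <= 1" for x using step_values(3,4) by (simp add: k_def)
qed


text \<open>By \<open>nn_integral_radial\<close> the integral is pi times the total increase of
  \<open>k\<close>. Divided by pi, the annular weight defines a mean value.\<close>

lemma radial_step_integral:
 fixes c :: complex
 assumes st: "0 < s" "s < t"
  and k: "!!x. (k has_real_derivative k' x) (at x)" "continuous_on UNIV k'" "!!x. 0 <= k' x"
   "!!x. x <= s\<^sup>2 ==> k x = 0" "!!x. t\<^sup>2 <= x ==> k x = 1" "!!x. x <= s\<^sup>2 ==> k' x = 0" "!!x. t\<^sup>2 <= x ==> k' x = 0"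
 shows "integrbl (%z. k' ((cmod (z - c))\<^sup>2))" "(LBINT z. k' ((cmod (z - c))\<^sup>2)) = pi"
proof -
 have [measurable]: "k' \<in> bmeas" using k(2) by (rule borel_measurable_continuous_onI)
 have s2t2: "s\<^sup>2 <= t\<^sup>2" using st by (intro power_mono) auto
 have "(\<integral>\<^sup>+z. ennreal (k' ((cmod (z - c))\<^sup>2)) \<partial>lborel) = ennreal pi * (\<integral>\<^sup>+x. ennreal (k' x) * indicator {0..} x \<partial>lborel)"
  by (rule nn_integral_radial) measurable
 also have "(\<integral>\<^sup>+x. ennreal (k' x) * indicator {0..} x \<partial>lborel) = (\<integral>\<^sup>+x. ennreal (k' x) * indicator {s\<^sup>2..t\<^sup>2} x \<partial>lborel)"
 proof (rule nn_integral_cong)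
  fix x
  show "ennreal (k' x) * indicator {0..} x = ennreal (k' x) * indicator {s\<^sup>2..t\<^sup>2} x"
  proof (cases "x \<in> {s\<^sup>2..t\<^sup>2}")
   case True
   then have "0 <= x" using order_trans[OF zero_le_power2[of s], of x] by simp
   then show ?thesis using True by (simp add: indicator_def)
  next
   case False
   then have "k' x = 0" using k(6)[of x] k(7)[of x] by auto
   then show ?thesis by simp
  qed
 qed
 also have "\<dots> = ennreal (k (t\<^sup>2) - k (s\<^sup>2))"
 proof (rule nn_integral_FTC_Icc[OF _ _ _ s2t2])
  show "(k has_real_derivative k' x) (at x)" for x by (rule k(1))
 qed (use k(3) in auto)
 also have "k (t\<^sup>2) - k (s\<^sup>2) = 1" using k(4)[of "s\<^sup>2"] k(5)[of "t\<^sup>2"] by simp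
 finally have nn: "(\<integral>\<^sup>+z. ennreal (k' ((cmod (z - c))\<^sup>2)) \<partial>lborel) = ennreal pi" by simp
 show i: "integrbl (%z. k' ((cmod (z - c))\<^sup>2))"
  by (rule integrableI_nonneg) (use nn k(3) in auto)
 have "ennreal (LBINT z. k' ((cmod (z - c))\<^sup>2)) = ennreal pi"
  using nn nn_integral_eq_integral[OF i] k(3) by auto
 then show "(LBINT z. k' ((cmod (z - c))\<^sup>2)) = pi"
  using k(3) by (subst (asm) ennreal_inj) auto
qed

text \<open>The weight vanishes off the annulus between s and t, so a singularity of
  \<open>H\<close> at the centre and its values beyond \<rho> do no harm.\<close>

lemma continuous_on_radial_glue:
 fixes c :: complex
 assumes k': "continuous_on UNIV k'" "!!x. x <= s\<^sup>2 ==> k' x = 0" "!!x. t\<^sup>2 <= x ==> k' x = (0::real)"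
  and st: "0 < s" "0 < t" "t < \<rho>" and H: "continuous_on (ball c \<rho> - {c}) H"
 shows "continuous_on UNIV (%z. cx (k' ((cmod (z - c))\<^sup>2)) * H z)"
  and "!!z. norm c + t < norm z ==> cx (k' ((cmod (z - c))\<^sup>2)) * H z = 0"
proof -
 define U where "U = - cball c t"
 have z: "cx (k' ((cmod (z - c))\<^sup>2)) * H z = 0" if "z \<in> U \<or> z \<in> ball c s" for z
 proof -
  have "t\<^sup>2 <= (cmod (z - c))\<^sup>2 \<or> (cmod (z - c))\<^sup>2 <= s\<^sup>2"
   using that st by (auto simp: U_def dist_norm norm_minus_commute not_le power_mono)
  then show ?thesis using k' by auto
 qed
 have "continuous_on ((ball c \<rho> - {c}) \<union> (U \<union> ball c s)) (%z. cx (k' ((cmod (z - c))\<^sup>2)) * H z)"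
 proof (rule continuous_on_open_Un)
  have "continuous_on (ball c \<rho> - {c}) (%z. k' ((cmod (z - c))\<^sup>2))"
   by (rule continuous_on_compose2[OF k'(1)]) (auto intro!: continuous_intros)
  then show "continuous_on (ball c \<rho> - {c}) (%z. cx (k' ((cmod (z - c))\<^sup>2)) * H z)"
   by (intro continuous_intros H)
  show "continuous_on (U \<union> ball c s) (%z. cx (k' ((cmod (z - c))\<^sup>2)) * H z)"
   by (rule continuous_on_eq[OF continuous_on_const[of _ 0]]) (use z in auto)
 qed (auto simp: U_def open_Compl)
 moreover have "(ball c \<rho> - {c}) \<union> (U \<union> ball c s) = UNIV"
  using st by (auto simp: U_def not_le)
 ultimately show "continuous_on UNIV (%z. cx (k' ((cmod (z - c))\<^sup>2)) * H z)" by simp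
 show "cx (k' ((cmod (z - c))\<^sup>2)) * H z = 0" if "norm c + t < norm z" for z
 proof (rule z)
  have "norm z <= norm c + norm (z - c)" using norm_triangle_ineq[of c "z - c"] by simp
  with that show "z \<in> U \<or> z \<in> ball c s" by (auto simp: U_def dist_norm norm_minus_commute)
 qed
qed

text \<open>The integral against \<open>(z - c)\<^bsup>-q\<^esup>\<close> does not depend on the radii of the cutoff, by integration by
 parts, and tends to zero as they grow.\<close>

lemma radial_step_negative_power:
 fixes c :: complex
 assumes st: "0 < s" "s < t"
  and k: "!!x. (k has_real_derivative k' x) (at x)" "continuous_on UNIV k'" "!!x. 0 <= k' x"
   "!!x. x <= s\<^sup>2 ==> k x = 0" "!!x. t\<^sup>2 <= x ==> k x = 1" "!!x. x <= s\<^sup>2 ==> k' x = 0" "!!x. t\<^sup>2 <= x ==> k' x = 0"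
  and q: "1 <= q"
 shows "(LBINT z. cx (k' ((cmod (z - c))\<^sup>2)) * (1 / (z - c) ^ q)) = 0" (is "?I = 0")
proof -
 have bound: "cmod ?I <= pi / S ^ q" if S: "t < S" for S
 proof -
  define j where "j x = step ((x - S\<^sup>2) / ((S + 1)\<^sup>2 - S\<^sup>2))" for x
  define j' where "j' x = step' ((x - S\<^sup>2) / ((S + 1)\<^sup>2 - S\<^sup>2)) / ((S + 1)\<^sup>2 - S\<^sup>2)" for x
  have S0: "0 < S" "S < S + 1" using st S by auto
  note rs = radial_step[OF S0, folded j_def[abs_def] j'_def[abs_def]]
  have j: "!!x. (j has_real_derivative j' x) (at x)" "continuous_on UNIV j'" "!!x. 0 <= j' x"
   "!!x. x <= S\<^sup>2 ==> j x = 0" "!!x. (S+1)\<^sup>2 <= x ==> j x = 1" "!!x. x <= S\<^sup>2 ==> j' x = 0" "!!x. (S+1)\<^sup>2 <= x ==> j' x = 0"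
   using rs by (auto simp: j_def[abs_def] j'_def[abs_def])
  have kj: "((%x. k x - j x) has_real_derivative k' x - j' x) (at x)" "continuous_on UNIV (%x. k' x - j' x)" for x
   by (intro DERIV_diff k j, intro continuous_intros k j)
  define A where "A z = cx (k' ((cmod (z - c))\<^sup>2) - j' ((cmod (z - c))\<^sup>2)) * cnj (z - c)" for z
  define B where "B z = cx (k' ((cmod (z - c))\<^sup>2) - j' ((cmod (z - c))\<^sup>2)) * (z - c)" for z
  have C: "C1 (%z. cx (k ((cmod (z - c))\<^sup>2) - j ((cmod (z - c))\<^sup>2))) A B"
   unfolding A_def B_def by (rule C1_radial[OF kj])
  have m: "C1 (%z. cx (k ((cmod (z - c))\<^sup>2) - j ((cmod (z - c))\<^sup>2)) * (1 / (z - c) ^ Suc q))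
   (%z. A z * (1 / (z - c) ^ Suc q) + cx (k ((cmod (z - c))\<^sup>2) - j ((cmod (z - c))\<^sup>2)) * deriv (%z. 1 / (z - c) ^ Suc q) z)
   (%z. B z * (1 / (z - c) ^ Suc q))"
  proof (rule C1_mult_holomorphic[OF C, of "- ball c s" "- {c}"])
   fix z assume "z \<notin> - ball c s"
   then have "cmod (z - c) < s" by (simp add: dist_norm norm_minus_commute)
   then have "(cmod (z - c))\<^sup>2 <= s\<^sup>2" "(cmod (z - c))\<^sup>2 <= S\<^sup>2" using S st by (auto intro: power_mono)
   then show "cx (k ((cmod (z - c))\<^sup>2) - j ((cmod (z - c))\<^sup>2)) = 0" using k(4) j(4) by simp
  qed (use st in \<open>auto intro!: holomorphic_intros\<close>)
  have z0: "cx (k ((cmod (z - c))\<^sup>2) - j ((cmod (z - c))\<^sup>2)) * (1 / (z - c) ^ Suc q) = 0"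
   if "norm c + (S + 1) < norm z" for z
  proof -
   have "norm z <= norm c + norm (z - c)" using norm_triangle_ineq[of c "z - c"] by simp
   with that have "S + 1 <= cmod (z - c)" by linarith
   then have "(S + 1)\<^sup>2 <= (cmod (z - c))\<^sup>2" using S0 by (intro power_mono) auto
   moreover have "t\<^sup>2 <= (S + 1)\<^sup>2" using S st by (intro power_mono) auto
   ultimately show ?thesis using k(5) j(5) by simp
  qed
  have BB: "B z * (1 / (z - c) ^ Suc q) = cx (k' ((cmod (z - c))\<^sup>2)) * (1 / (z - c) ^ q) - cx (j' ((cmod (z - c))\<^sup>2)) * (1 / (z - c) ^ q)" for z
  proof (cases "z = c")
   case True
   then show ?thesis using k(6)[of 0] j(6)[of 0] q by (simp add: B_def)
  next
   case False
   then show ?thesis by (simp add: B_def field_simps)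
  qed
  have hq: "continuous_on (ball c \<rho> - {c}) (%z. 1 / (z - c) ^ q)" for \<rho>
   by (intro continuous_intros) auto
  have t0: "0 < t" using st by simp
  have i1: "integrbl (%z. cx (k' ((cmod (z - c))\<^sup>2)) * (1 / (z - c) ^ q))"
   by (rule integrable_compact_support[OF continuous_on_radial_glue[OF k(2,6,7) st(1) t0 less_add_one hq]])
  have i2: "integrbl (%z. cx (j' ((cmod (z - c))\<^sup>2)) * (1 / (z - c) ^ q))"
  proof -
   have S1: "0 < S + 1" using S0 by simp
   show ?thesis
    by (rule integrable_compact_support[OF continuous_on_radial_glue[OF j(2,6,7) S0(1) S1 less_add_one hq]])
  qed
  have "(LBINT z. B z * (1 / (z - c) ^ Suc q)) = 0"
   by (rule C1_integral_zero(2)[OF m]) (rule z0)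
  then have eq: "?I = (LBINT z. cx (j' ((cmod (z - c))\<^sup>2)) * (1 / (z - c) ^ q))"
   unfolding BB using i1 i2 by (simp add: Bochner_Integration.integral_diff)
  have "cmod ?I <= (LBINT z. cmod (cx (j' ((cmod (z - c))\<^sup>2)) * (1 / (z - c) ^ q)))"
   unfolding eq by (rule integral_norm_bound)
  also have "\<dots> <= (LBINT z. j' ((cmod (z - c))\<^sup>2) * (1 / S ^ q))"
  proof (rule integral_mono)
   fix z
   show "cmod (cx (j' ((cmod (z - c))\<^sup>2)) * (1 / (z - c) ^ q)) <= j' ((cmod (z - c))\<^sup>2) * (1 / S ^ q)"
   proof (cases "S <= cmod (z - c)")
    case True
    have "1 / cmod (z - c) ^ q <= 1 / S ^ q" using True S0 by (intro frac_le power_mono) auto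
    then show ?thesis using j(3) by (simp add: norm_mult norm_divide norm_power mult_left_mono del: times_divide_eq_right)
   next
    case False
    then have "j' ((cmod (z - c))\<^sup>2) = 0" by (intro j(6) power_mono) auto
    then show ?thesis by simp
   qed
  qed (use i2 radial_step_integral(1)[OF S0 j] in auto)
  also have "\<dots> = pi / S ^ q" using radial_step_integral(2)[OF S0 j, of c] by simp
  finally show ?thesis .
 qed
 have lim: "(%n::nat. pi / real n ^ q) \<longlonglongrightarrow> 0"
 proof -
  have "(%n::nat. pi * (1 / real n) ^ q) \<longlonglongrightarrow> pi * 0 ^ q"
   by (intro tendsto_intros lim_1_over_n)
  then show ?thesis using q by (simp add: power_divide power_0_left)
 qed
 have "cmod ?I <= 0"
 proof (rule tendsto_lowerbound[OF lim])
  obtain N :: nat where N: "t < real N" using reals_Archimedean2 by blast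
  show "\<forall>\<^sub>F n in sequentially. cmod ?I <= pi / real n ^ q"
  proof (rule eventually_sequentiallyI[of N])
   fix n assume "N <= n"
   then have "t < real n" using N by linarith
   then show "cmod ?I <= pi / real n ^ q" by (rule bound)
  qed
 qed simp
 then show ?thesis by simp
qed

text \<open>A Cauchy formula with the circle thickened to an annulus. The induction splits H z = H c
  + (z - c) R z: the singular constant part integrates to zero by
  \<open>radial_step_negative_power\<close>, and R has the shifted expansion.\<close>

lemma radial_step_coefficient:
 fixes c :: complex and H :: "complex => complex"
 assumes st: "0 < s" "s < t" "t < \<rho>"
  and k: "!!x. (k has_real_derivative k' x) (at x)" "continuous_on UNIV k'" "!!x. 0 <= k' x"
   "!!x. x <= s\<^sup>2 ==> k x = 0" "!!x. t\<^sup>2 <= x ==> k x = 1" "!!x. x <= s\<^sup>2 ==> k' x = 0" "!!x. t\<^sup>2 <= x ==> k' x = 0"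
  and H: "H holomorphic_on ball c \<rho>" "(%w. H (c + w)) has_fps_expansion F"
 shows "(LBINT z. cx (k' ((cmod (z - c))\<^sup>2)) * (H z * (1 / (z - c) ^ n))) = pi * fps_nth F n"
 using H
proof (induction n arbitrary: H F)
 case (0 H F)
 have st': "0 < t" "0 < \<rho>" using st by auto
 have int: "integrbl (%z. cx (k' ((cmod (z - c))\<^sup>2)) * G z)"
  if "continuous_on (ball c \<rho> - {c}) G" for G
  by (rule integrable_compact_support[OF continuous_on_radial_glue[OF k(2,6,7) st(1) st'(1) st(3) that]])
 define R where "R z = (if z = c then deriv H c else (H z - H c) / (z - c))" for z
 have R: "R holomorphic_on ball c \<rho>" unfolding R_def by (rule pole_lemma_open[OF 0(1)]) simp
 have C: "C1 (%z. cx (1 - k ((cmod (z - c))\<^sup>2))) (%z. cx (- k' ((cmod (z - c))\<^sup>2)) * cnj (z - c)) (%z. cx (- k' ((cmod (z - c))\<^sup>2)) * (z - c))"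
 proof (rule C1_radial)
  show "((%x. 1 - k x) has_real_derivative - k' x) (at x)" for x
   using DERIV_diff[OF DERIV_const k(1)] by simp
  show "continuous_on UNIV (%x. - k' x)" by (intro continuous_intros k)
 qed
 have off: "1 - k ((cmod (z - c))\<^sup>2) = 0" if "z \<notin> cball c t" for z
 proof -
  have "t\<^sup>2 <= (cmod (z - c))\<^sup>2" using that st' by (auto simp: dist_norm norm_minus_commute intro!: power_mono)
  then show ?thesis using k(5) by simp
 qed
 have m: "C1 (%z. cx (1 - k ((cmod (z - c))\<^sup>2)) * R z)
   (%z. cx (- k' ((cmod (z - c))\<^sup>2)) * cnj (z - c) * R z + cx (1 - k ((cmod (z - c))\<^sup>2)) * deriv R z)
   (%z. cx (- k' ((cmod (z - c))\<^sup>2)) * (z - c) * R z)"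
  by (rule C1_mult_holomorphic[OF C, of "cball c t" "ball c \<rho>"]) (use off st R in auto)
 \<comment> \<open>The integrand is the zbar-derivative of (1 - k) R, which has compact
   support.\<close>
 have "(LBINT z. cx (- k' ((cmod (z - c))\<^sup>2)) * (z - c) * R z) = 0"
 proof (rule C1_integral_zero(2)[OF m])
  fix z :: complex assume z: "norm c + t < norm z"
  have "norm z <= norm c + norm (z - c)" using norm_triangle_ineq[of c "z - c"] by simp
  then have "z \<notin> cball c t" using z by (auto simp: dist_norm norm_minus_commute)
  then show "cx (1 - k ((cmod (z - c))\<^sup>2)) * R z = 0" using off by simp
 qed
 then have R0: "(LBINT z. cx (k' ((cmod (z - c))\<^sup>2)) * ((z - c) * R z)) = 0"
  by (simp add: mult.assoc)
 have eq: "cx (k' ((cmod (z - c))\<^sup>2)) * (H z * (1 / (z - c) ^ 0)) =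
  cx (k' ((cmod (z - c))\<^sup>2)) * H c + cx (k' ((cmod (z - c))\<^sup>2)) * ((z - c) * R z)" for z :: complex
 proof -
  have "H z = H c + (z - c) * R z" by (simp add: R_def)
  then show ?thesis by (simp add: distrib_left)
 qed
 have "continuous_on (ball c \<rho> - {c}) (%z. (z - c) * R z)"
  by (intro continuous_intros continuous_on_subset[OF holomorphic_on_imp_continuous_on[OF R]]) auto
 note i2 = int[OF this]
 have i1: "integrbl (%z. cx (k' ((cmod (z - c))\<^sup>2)) * H c)" by (rule int) (intro continuous_intros)
 have st1: "0 < s" "s < t" using st by auto
 have "(LBINT z. cx (k' ((cmod (z - c))\<^sup>2)) * H c) = cx pi * H c"
  using radial_step_integral[OF st1 k] by (subst integral_mult_left_zero) (simp only: integral_complex_of_real)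
 then have "(LBINT z. cx (k' ((cmod (z - c))\<^sup>2)) * (H z * (1 / (z - c) ^ 0))) = pi * H c"
  unfolding eq using i1 i2 R0 by (subst Bochner_Integration.integral_add) simp_all
 moreover have "fps_nth F 0 = H c" using fps_nth_fps_expansion[OF 0(2), of 0] by simp
 ultimately show ?case by simp
next
 case (Suc n H F)
 have st': "0 < t" "0 < \<rho>" "s < t" using st by auto
 have int: "integrbl (%z. cx (k' ((cmod (z - c))\<^sup>2)) * G z)"
  if "continuous_on (ball c \<rho> - {c}) G" for G
  by (rule integrable_compact_support[OF continuous_on_radial_glue[OF k(2,6,7) st(1) st'(1) st(3) that]])
 define R where "R z = (if z = c then deriv H c else (H z - H c) / (z - c))" for z
 have R: "R holomorphic_on ball c \<rho>" unfolding R_def by (rule pole_lemma_open[OF Suc(2)]) simp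
 have "(%w. R (c + w)) holomorphic_on ball 0 \<rho>"
  by (rule holomorphic_on_compose_gen[OF _ R, of "%w. c + w", unfolded o_def]) (auto intro!: holomorphic_intros simp: dist_norm)
 then have FR: "(%w. R (c + w)) has_fps_expansion fps_expansion (%w. R (c + w)) 0"
  by (rule has_fps_expansion_fps_expansion[rotated 2]) (use st' in auto)
 define FR' where "FR' = fps_expansion (%w. R (c + w)) 0"
 have "(%w. H c + w * R (c + w)) has_fps_expansion (fps_const (H c) + fps_X * FR')"
  by (intro fps_expansion_intros FR[folded FR'_def])
 moreover have "(%w. H c + w * R (c + w)) = (%w. H (c + w))"
  by (auto simp: R_def fun_eq_iff)
 ultimately have "(%w. H (c + w)) has_fps_expansion (fps_const (H c) + fps_X * FR')" by simp
 from fps_nth_fps_expansion[OF this, of "Suc n"] fps_nth_fps_expansion[OF Suc(3), of "Suc n"]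
 have Fn: "fps_nth F (Suc n) = fps_nth FR' n" by simp
 have eq: "cx (k' ((cmod (z - c))\<^sup>2)) * (H z * (1 / (z - c) ^ Suc n)) =
  H c * (cx (k' ((cmod (z - c))\<^sup>2)) * (1 / (z - c) ^ Suc n)) + cx (k' ((cmod (z - c))\<^sup>2)) * (R z * (1 / (z - c) ^ n))" for z
 proof (cases "z = c")
  case True
  then show ?thesis using k(6)[of 0] by simp
 next
  case False
  then have "H z = H c + (z - c) * R z" by (simp add: R_def)
  then have "H z * (1 / (z - c) ^ Suc n) = H c * (1 / (z - c) ^ Suc n) + R z * (1 / (z - c) ^ n)"
  proof -
   define d where "d = z - c"
   have d: "d ~= 0" using False by (simp add: d_def)
   have "(H c + d * R z) * (1 / d ^ Suc n) = H c * (1 / d ^ Suc n) + R z * (1 / d ^ n)"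
    using d by (simp add: field_simps)
   then show ?thesis using \<open>H z = H c + (z - c) * R z\<close> by (simp only: d_def)
  qed
  then show ?thesis by (simp only: distrib_left mult.left_commute)
 qed
 have i1: "integrbl (%z. H c * (cx (k' ((cmod (z - c))\<^sup>2)) * (1 / (z - c) ^ Suc n)))"
  by (intro integrable_mult_right int continuous_intros) auto
 have i2: "integrbl (%z. cx (k' ((cmod (z - c))\<^sup>2)) * (R z * (1 / (z - c) ^ n)))"
  by (intro int continuous_intros continuous_on_subset[OF holomorphic_on_imp_continuous_on[OF R]]) auto
 have st1: "0 < s" "s < t" using st by auto
 have z: "(LBINT z. H c * (cx (k' ((cmod (z - c))\<^sup>2)) * (1 / (z - c) ^ Suc n))) = 0"
  using radial_step_negative_power[OF st1 k, of "Suc n" c] by (subst integral_mult_right_zero) simp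
 show ?case unfolding eq Fn
  by (subst Bochner_Integration.integral_add[OF i1 i2]) (simp only: z Suc.IH[OF R FR[folded FR'_def]] add_0_left)
qed

section \<open>Injective solutions of the Beltrami equation on a punctured plane\<close>

lemma eq_neg_of_sums: "x + y = - z ==> w = z + x ==> y = - (w :: complex)"
 by algebra

lemma radial_bump:
 fixes c :: complex
 assumes st: "0 < s" "s < t"
 obtains \<kappa> A B where "C1 \<kappa> A B" "!!z. z \<notin> cball c t ==> \<kappa> z = 0" "!!z. z \<in> ball c s ==> \<kappa> z = 1"
  "!!z. z \<in> ball c s ==> A z = 0" "!!z. z \<in> ball c s ==> B z = 0"
proof -
 define k where "k x = step ((x - s\<^sup>2) / (t\<^sup>2 - s\<^sup>2))" for x
 define k' where "k' x = step' ((x - s\<^sup>2) / (t\<^sup>2 - s\<^sup>2)) / (t\<^sup>2 - s\<^sup>2)" for x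
 have k: "!!x. (k has_real_derivative k' x) (at x)" "continuous_on UNIV k'"
  "!!x. x <= s\<^sup>2 ==> k x = 0" "!!x. t\<^sup>2 <= x ==> k x = 1"
  using radial_step[OF st] by (auto simp: k_def[abs_def] k'_def[abs_def])
 have C: "C1 (%z. cx (1 - k ((cmod (z - c))\<^sup>2))) (%z. cx (- k' ((cmod (z - c))\<^sup>2)) * cnj (z - c)) (%z. cx (- k' ((cmod (z - c))\<^sup>2)) * (z - c))"
 proof (rule C1_radial)
  show "((%x. 1 - k x) has_real_derivative - k' x) (at x)" for x
   using DERIV_diff[OF DERIV_const k(1)] by simp
  show "continuous_on UNIV (%x. - k' x)" by (intro continuous_intros k)
 qed
 have 1: "cx (1 - k ((cmod (z - c))\<^sup>2)) = 1" if "z \<in> ball c s" for z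
 proof -
  have "(cmod (z - c))\<^sup>2 <= s\<^sup>2" using that by (auto simp: dist_norm norm_minus_commute intro!: power_mono)
  then show ?thesis using k(3) by simp
 qed
 show ?thesis
 proof (rule that[OF C])
  show "cx (1 - k ((cmod (z - c))\<^sup>2)) = 0" if "z \<notin> cball c t" for z
  proof -
   have "t\<^sup>2 <= (cmod (z - c))\<^sup>2" using that st by (auto simp: dist_norm norm_minus_commute intro!: power_mono)
   then show ?thesis using k(4) by simp
  qed
 qed (use 1 C1_derivs_zero[OF C open_ball 1] in auto)
qed

text \<open>A large bump around \<open>K\<close> times the complement of a small bump at
  \<open>a\<close>. The derivatives vanish on \<open>K\<close> too, so that cutting off leaves weak
  derivatives unchanged there.\<close>

lemma compact_bump:
 fixes a :: complex
 assumes K: "compact K" "a \<notin> K"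
 obtains \<kappa> A B K' where "C1 \<kappa> A B" "compact K'" "a \<notin> K'" "!!z. z \<notin> K' ==> \<kappa> z = 0"
  "!!z. z \<in> K ==> \<kappa> z = 1" "!!z. z \<in> K ==> A z = 0" "!!z. z \<in> K ==> B z = 0"
proof -
 have "open (- K)" using K compact_imp_closed by auto
 then obtain d where d: "0 < d" "ball a d \<subseteq> - K" using K(2) open_contains_ball by blast
 obtain R where R: "0 < R" "K \<subseteq> ball 0 R"
  using bounded_subset_ballD[OF compact_imp_bounded[OF K(1)]] by blast
 obtain \<kappa>1 A1 B1 where 1: "C1 \<kappa>1 A1 B1" "!!z. z \<notin> cball 0 (R + 1) ==> \<kappa>1 z = 0" "!!z. z \<in> ball 0 R ==> \<kappa>1 z = 1"
  "!!z. z \<in> ball 0 R ==> A1 z = 0" "!!z. z \<in> ball 0 R ==> B1 z = 0"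
  by (rule radial_bump[of R "R + 1" 0]) (use R in auto)
 have d3: "0 < d / 3" "d / 3 < d / 2" using d by auto
 obtain \<kappa>2 A2 B2 where 2: "C1 \<kappa>2 A2 B2" "!!z. z \<notin> cball a (d / 2) ==> \<kappa>2 z = 0" "!!z. z \<in> ball a (d / 3) ==> \<kappa>2 z = 1"
  by (rule radial_bump[OF d3]) blast
 have K2: "K \<subseteq> - cball a (d / 2)" using d by (force simp: dist_norm)
 have o: "open (- cball a (d / 2))" by auto
 note z2 = C1_derivs_zero[OF 2(1) o, of 0]
 show ?thesis
 proof (rule that[OF C1_mult[OF 1(1) C1_diff[OF C1_const[of 1] 2(1)]], of "cball 0 (R + 1) - ball a (d / 3)"])
  show "compact (cball 0 (R + 1) - ball a (d / 3))" by (intro compact_diff) auto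
  show "a \<notin> cball 0 (R + 1) - ball a (d / 3)" using d by auto
  show "\<kappa>1 z * (1 - \<kappa>2 z) = 0" if "z \<notin> cball 0 (R + 1) - ball a (d / 3)" for z
   using that 1(2) 2(3) by auto
  fix z assume z: "z \<in> K"
  have zb: "z \<in> ball 0 R" "z \<in> - cball a (d / 2)" using z R K2 by auto
  then have k2: "\<kappa>2 z = 0" using 2(2) by auto
  have "A2 z = 0" "B2 z = 0" using z2 zb(2) 2(2) by auto
  then show "\<kappa>1 z * (1 - \<kappa>2 z) = 1" "A1 z * (1 - \<kappa>2 z) + \<kappa>1 z * (0 - A2 z) = 0" "B1 z * (1 - \<kappa>2 z) + \<kappa>1 z * (0 - B2 z) = 0"
   using 1(3-5)[OF zb(1)] k2 by simp_all
 qed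
qed

text \<open>\<open>a\<close> is the point where the homeomorphism is infinite, or an arbitrary point if that is \<open>\<infinity>\<close>.\<close>

locale beltrami_solution =
 fixes a :: complex and f p \<mu> :: "complex => complex" and k :: real
 assumes f_cont: "continuous_on (- {a}) f" and f_inj: "inj_on f (- {a})"
  and p_meas: "p \<in> bmeas"
  and p_loc: "!!K. compact K ==> a \<notin> K ==> integrbl (%z. indicator K z * (cmod (p z))\<^sup>2)"
  and \<mu>_meas: "\<mu> \<in> bmeas" and \<mu>_le: "!!z. cmod (\<mu> z) <= k" and \<mu>_disc: "!!z. cmod z <= 1 ==> \<mu> z = 0"
  and weak: "!!\<theta> A B K. C1 \<theta> A B ==> compact K ==> a \<notin> K ==> (!!z. z \<notin> K ==> \<theta> z = 0) ==>
    (LBINT z. f z * A z) = - (LBINT z. p z * \<theta> z) \<and>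
    (LBINT z. f z * B z) = - (LBINT z. \<mu> z * p z * \<theta> z)"
  and proper: "!!z0 \<tau>. z0 ~= a ==> 0 < \<tau> ==> \<exists>\<delta>>0. \<forall>z. z ~= a --> \<tau> <= cmod (z - z0) --> \<delta> <= cmod (f z - f z0)"
  and k0: "0 <= k" and k_half: "k <= 1 / 2"
begin

lemma cutoff_continuous:
 assumes "continuous_on UNIV g" "closed K" "a \<notin> K" "!!z. z \<notin> K ==> g z = 0"
  and h: "continuous_on (- {a}) h"
 shows "continuous_on UNIV (%z. g z * h z :: complex)"
proof -
 have "continuous_on (- {a} \<union> - K) (%z. g z * h z)"
 proof (rule continuous_on_open_Un)
  show "continuous_on (- {a}) (%z. g z * h z)"
   by (intro continuous_intros h continuous_on_subset[OF assms(1)]) auto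
  show "continuous_on (- K) (%z. g z * h z)"
   by (rule continuous_on_eq[OF continuous_on_const[of _ 0]]) (use assms in auto)
 qed (use assms in auto)
 moreover have "- {a} \<union> - K = UNIV" using assms(3) by auto
 ultimately show ?thesis by simp
qed

text \<open>The product of \<kappa> with an arbitrary test function is admissible in
  \<open>weak\<close>; the terms containing derivatives of \<kappa> become the extra terms of the
  product rule.\<close>

lemma weak_C1_cutoff:
 assumes \<kappa>: "C1 \<kappa> A B" and K: "compact K" "a \<notin> K" "!!z. z \<notin> K ==> \<kappa> z = 0"
 obtains R where "weak_C1 R (%z. \<kappa> z * f z) (%z. \<kappa> z * p z + A z * f z) (%z. \<kappa> z * (\<mu> z * p z) + B z * f z)"
proof -
 have Kc: "closed K" using K compact_imp_closed by blast
 obtain R where R: "0 < R" "K \<subseteq> ball 0 R"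
  using bounded_subset_ballD[OF compact_imp_bounded[OF K(1)]] by blast
 have AB: "A z = 0" "B z = 0" if "z \<notin> K" for z
  using C1_derivs_zero[OF \<kappa>, of "- K" 0 z] K Kc that by auto
 have off: "z \<notin> K" if "R < norm z" for z using that R by auto
 note c = C1_continuous[OF \<kappa>] C1_continuous_derivs[OF \<kappa>]
 note cf = cutoff_continuous[OF c(1) Kc K(2,3) f_cont] cutoff_continuous[OF c(2) Kc K(2) AB(1) f_cont]
  cutoff_continuous[OF c(3) Kc K(2) AB(2) f_cont]
 have s2: "sq_int (%z. A z * f z)" "sq_int (%z. B z * f z)"
  by (rule continuous_support_sq_int[OF cf(2), of R], use AB off in auto)
    (rule continuous_support_sq_int[OF cf(3), of R], use AB off in auto)
 have [measurable]: "K \<in> sets borel" using Kc by simp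
 have [measurable]: "p \<in> bmeas" "\<mu> \<in> bmeas" by (rule p_meas \<mu>_meas)+
 have pK: "sq_int (%z. indicator K z * p z)"
 proof -
  have "(%z. (cmod (indicator K z * p z))\<^sup>2) = (%z. indicator K z * (cmod (p z))\<^sup>2)"
   by (auto simp: indicator_def fun_eq_iff)
  then show ?thesis using p_loc[OF K(1,2)] by (simp add: sq_int_def)
 qed
 have \<kappa>R: "\<kappa> z = 0" if "R < norm z" for z using K(3) off[OF that] by blast
 obtain C where C: "!!z. cmod (\<kappa> z) <= C"
  using bounded_if_compact_support[OF c(1) \<kappa>R] by blast
 have \<kappa>m: "\<kappa> \<in> bmeas" using c(1) by (rule borel_measurable_continuous_onI)
 have eq: "(%z. \<kappa> z * (indicator K z * p z)) = (%z. \<kappa> z * p z)" "(%z. \<mu> z * (\<kappa> z * p z)) = (%z. \<kappa> z * (\<mu> z * p z))"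
  using K(3) by (auto simp: indicator_def fun_eq_iff)
 have s1: "sq_int (%z. \<kappa> z * p z)" using l2_mult_bounded(1)[OF pK \<kappa>m C] by (simp only: eq)
 have s1': "sq_int (%z. \<kappa> z * (\<mu> z * p z))" using l2_mult_bounded(1)[OF s1 \<mu>_meas \<mu>_le] by (simp only: eq)
 have "weak_C1 R (%z. \<kappa> z * f z) (%z. \<kappa> z * p z + A z * f z) (%z. \<kappa> z * (\<mu> z * p z) + B z * f z)"
  unfolding weak_C1_def
 proof (intro conjI allI impI)
  show "continuous_on UNIV (%z. \<kappa> z * f z)" by (rule cf(1))
  show "sq_int (%z. \<kappa> z * p z + A z * f z)" "sq_int (%z. \<kappa> z * (\<mu> z * p z) + B z * f z)"
   by (rule sq_int_add[OF s1 s2(1)] sq_int_add[OF s1' s2(2)])+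
  show "\<kappa> z * f z = 0" "\<kappa> z * p z + A z * f z = 0" "\<kappa> z * (\<mu> z * p z) + B z * f z = 0" if "R < norm z" for z
   using off[OF that] K(3) AB by auto
  fix \<theta> A' B' assume \<theta>: "C1 \<theta> A' B'"
  note c\<theta> = C1_continuous[OF \<theta>] C1_continuous_derivs[OF \<theta>]
  have int: "integrbl (%z. h z * g z)" if "sq_int h" "!!z. z \<notin> K ==> h z = 0" "continuous_on UNIV g" for h g
  proof -
   have "(%z. h z * (indicator (cball 0 R) z * g z)) = (%z. h z * g z)"
   proof
    fix z show "h z * (indicator (cball 0 R) z * g z) = h z * g z"
     using that(2)[of z] off[of z] by (cases "R < norm z") (auto simp: indicator_def)
   qed
   with l2_Cauchy_Schwarz(1)[OF that(1) sq_int_on_ball[OF that(3), of R]] show ?thesis by simp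
  qed
  have s0: "sq_int (%z. \<kappa> z * f z)"
   by (rule continuous_support_sq_int[OF cf(1), of R]) (use K(3) off in auto)
  have w: "(LBINT z. f z * (A z * \<theta> z + \<kappa> z * A' z)) = - (LBINT z. p z * (\<kappa> z * \<theta> z))"
   "(LBINT z. f z * (B z * \<theta> z + \<kappa> z * B' z)) = - (LBINT z. \<mu> z * p z * (\<kappa> z * \<theta> z))"
   using weak[OF C1_mult[OF \<kappa> \<theta>] K(1,2)] K(3) by auto
  have i: "integrbl (%z. A z * f z * \<theta> z)" "integrbl (%z. B z * f z * \<theta> z)"
   "integrbl (%z. \<kappa> z * f z * A' z)" "integrbl (%z. \<kappa> z * f z * B' z)"
   "integrbl (%z. \<kappa> z * p z * \<theta> z)" "integrbl (%z. \<kappa> z * (\<mu> z * p z) * \<theta> z)"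
   by (rule int[OF s2(1) _ c\<theta>(1)], use AB in auto) (rule int[OF s2(2) _ c\<theta>(1)], use AB in auto,
     rule int[OF s0 _ c\<theta>(2)], use K(3) in auto, rule int[OF s0 _ c\<theta>(3)], use K(3) in auto,
     rule int[OF s1 _ c\<theta>(1)], use K(3) in auto, rule int[OF s1' _ c\<theta>(1)], use K(3) in auto)
  have "(LBINT z. A z * f z * \<theta> z) + (LBINT z. \<kappa> z * f z * A' z) = - (LBINT z. \<kappa> z * p z * \<theta> z)"
   using w(1) i(1,3) by (subst Bochner_Integration.integral_add[symmetric]) (simp_all add: algebra_simps)
  moreover have "(LBINT z. (\<kappa> z * p z + A z * f z) * \<theta> z) = (LBINT z. \<kappa> z * p z * \<theta> z) + (LBINT z. A z * f z * \<theta> z)"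
   using i(1,5) by (simp add: distrib_right)
  ultimately show "(LBINT z. \<kappa> z * f z * A' z) = - (LBINT z. (\<kappa> z * p z + A z * f z) * \<theta> z)"
   by (rule eq_neg_of_sums)
  have "(LBINT z. B z * f z * \<theta> z) + (LBINT z. \<kappa> z * f z * B' z) = - (LBINT z. \<kappa> z * (\<mu> z * p z) * \<theta> z)"
   using w(2) i(2,4) by (subst Bochner_Integration.integral_add[symmetric]) (simp_all add: algebra_simps)
  moreover have "(LBINT z. (\<kappa> z * (\<mu> z * p z) + B z * f z) * \<theta> z) = (LBINT z. \<kappa> z * (\<mu> z * p z) * \<theta> z) + (LBINT z. B z * f z * \<theta> z)"
   using i(2,6) by (simp add: distrib_right)
  ultimately show "(LBINT z. \<kappa> z * f z * B' z) = - (LBINT z. (\<kappa> z * (\<mu> z * p z) + B z * f z) * \<theta> z)"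
   by (rule eq_neg_of_sums)
 qed
 with that show ?thesis by blast
qed

text \<open>Weyl's lemma: \<mu> vanishes in the disc, so the mollifications of f have zero
  zbar-derivative near each point, and they converge uniformly.\<close>

lemma f_holomorphic: "f holomorphic_on ball 0 1 - {a}"
proof -
 have o: "open (ball 0 1 - {a})" by (simp add: open_Diff)
 have "\<exists>d>0. f holomorphic_on ball z1 d" if z1: "z1 \<in> ball 0 1 - {a}" for z1
 proof -
  obtain d0 where d0: "0 < d0" "cball z1 d0 \<subseteq> ball 0 1 - {a}"
   using o z1 open_contains_cball by blast
  define d where "d = d0 / 3"
  have d: "0 < d" "2 * d < 3 * d" "0 < 2 * d" "cball z1 (3 * d) \<subseteq> ball 0 1 - {a}" using d0 by (auto simp: d_def)
  obtain \<kappa> A B where \<kappa>: "C1 \<kappa> A B" "!!z. z \<notin> cball z1 (3 * d) ==> \<kappa> z = 0" "!!z. z \<in> ball z1 (2 * d) ==> \<kappa> z = 1"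
   "!!z. z \<in> ball z1 (2 * d) ==> A z = 0" "!!z. z \<in> ball z1 (2 * d) ==> B z = 0"
   by (rule radial_bump[OF d(3,2)]) blast
  have aK: "a \<notin> cball z1 (3 * d)" using d by auto
  obtain R where w: "weak_C1 R (%z. \<kappa> z * f z) (%z. \<kappa> z * p z + A z * f z) (%z. \<kappa> z * (\<mu> z * p z) + B z * f z)"
   by (rule weak_C1_cutoff[OF \<kappa>(1) compact_cball aK \<kappa>(2)]) auto
  \<comment> \<open>Mollifying on a scale of at most d/2 at a point of \<open>ball z1 d\<close> only
    sees \<open>ball z1 (2 * d)\<close>, where the cutoff is 1 and its derivatives vanish.\<close>
  define e where "e n = min (d / 2) (1 / real (Suc n))" for n
  have e: "0 < e n" for n using d by (simp add: e_def)
  define G where "G n \<phi> q \<longleftrightarrow> (\<exists>p'. C1 \<phi> p' q) \<and> (\<forall>z. cmod (\<phi> z - \<kappa> z * f z) <= e n) \<and> (\<forall>z\<in>ball z1 d. q z = 0)" for n \<phi> q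
  have "\<forall>n. \<exists>\<phi> q. G n \<phi> q"
  proof
   fix n
   show "\<exists>\<phi> q. G n \<phi> q"
   proof (rule weak_C1_approx[OF w e[of n]])
    fix \<phi> p' q
    assume *: "C1 \<phi> p' q" "!!z. cmod (\<phi> z - \<kappa> z * f z) <= e n"
     "!!z. (!!t. dist z t <= e n ==> \<kappa> t * (\<mu> t * p t) + B t * f t = 0) ==> q z = 0"
    have "q z = 0" if z: "z \<in> ball z1 d" for z
    proof (rule *(3))
     fix t assume t: "dist z t <= e n"
     have "e n <= d / 2" by (simp add: e_def)
     then have t1: "t \<in> ball z1 (2 * d)" using z t dist_triangle[of z1 t z] d(1) by auto
     then have "t \<in> cball z1 (3 * d)" using d(1) by auto
     then have "cmod t <= 1" using d(4) by fastforce
     then show "\<kappa> t * (\<mu> t * p t) + B t * f t = 0" using \<kappa>(5)[OF t1] \<mu>_disc by simp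
    qed
    with * show "\<exists>\<phi> q. G n \<phi> q" unfolding G_def by blast
   qed
  qed
  from choice[OF this] obtain \<phi> where "\<forall>n. \<exists>q. G n (\<phi> n) q" ..
  from choice[OF this] obtain q where G: "\<forall>n. G n (\<phi> n) (q n)" ..
  have \<phi>h: "\<phi> n holomorphic_on ball z1 d" for n
  proof (rule holomorphic_onI)
   fix z assume z: "z \<in> ball z1 d"
   have "\<exists>p'. C1 (\<phi> n) p' (q n)" using G unfolding G_def by blast
   then obtain p' where "C1 (\<phi> n) p' (q n)" ..
   from C1_has_derivative[OF this, of z] G z have "(\<phi> n has_field_derivative p' z) (at z)"
    by (simp add: has_field_derivative_def G_def)
   then show "\<phi> n field_differentiable at z within ball z1 d"
    using field_differentiable_at_within field_differentiable_def by blast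
  qed
  have "f holomorphic_on ball z1 d"
  proof (rule holomorphic_uniform_sequence[of _ \<phi>])
   fix x assume x: "x \<in> ball z1 d"
   obtain r where r: "0 < r" "cball x r \<subseteq> ball z1 d" using x open_contains_cball[of "ball z1 d"] open_ball[of z1 d] by blast
   have "uniform_limit (cball x r) \<phi> f sequentially"
   proof (rule uniform_limitI)
    fix \<epsilon> :: real assume \<epsilon>: "0 < \<epsilon>"
    obtain N where N: "1 / real (Suc N) < \<epsilon>" using nat_approx_posE[OF \<epsilon>] by blast
    show "\<forall>\<^sub>F n in sequentially. \<forall>x\<in>cball x r. dist (\<phi> n x) (f x) < \<epsilon>"
    proof (rule eventually_sequentiallyI[of N], rule ballI)
     fix n y assume n: "N <= n" and y: "y \<in> cball x r"
     have "y \<in> ball z1 (2 * d)" using r y d(1) by fastforce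
     then have "\<kappa> y = 1" by (rule \<kappa>(3))
     then have "cmod (\<phi> n y - f y) <= e n" using G unfolding G_def by (metis mult_1)
     also have "e n <= 1 / real (Suc n)" by (simp add: e_def)
     also have "\<dots> <= 1 / real (Suc N)" using n by (simp add: frac_le)
     finally show "dist (\<phi> n y) (f y) < \<epsilon>" using N by (simp add: dist_norm)
    qed
   qed
   with r show "\<exists>d'>0. cball x d' \<subseteq> ball z1 d \<and> uniform_limit (cball x d') \<phi> f sequentially" by blast
  qed (use \<phi>h in auto)
  with d(1) show ?thesis by blast
 qed
 then show ?thesis
  by (meson centre_in_ball holomorphic_on_imp_differentiable_at field_differentiable_at_within holomorphic_onI open_ball)
qed

lemma f_deriv_nonzero: "z \<in> ball 0 1 - {a} ==> deriv f z ~= 0"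
 by (rule holomorphic_injective_imp_regular[OF f_holomorphic])
   (auto intro: inj_on_subset[OF f_inj] simp: open_Diff)

end

section \<open>The regular part of the reciprocal and its energy\<close>

context beltrami_solution
begin

definition pole_quotient :: "complex => complex => complex" where
 "pole_quotient z0 z = (if z = z0 then deriv f z0 else (f z - f z0) / (z - z0))"

text \<open>The regular part at \<open>z0\<close> of the reciprocal of \<open>f - f z0\<close>, normalized by the residue and the
 distance of \<open>z0\<close> to the circle.\<close>

definition reg :: "complex => complex => complex" where
 "reg z0 z = of_real (1 - cmod z0) * deriv f z0 / (f z - f z0) - of_real (1 - cmod z0) / (z - z0)"

text \<open>The divided difference at z0 of 1 / \<open>pole_quotient z0\<close>, a form from which
  the removable singularity lemma gives holomorphy at z0.\<close>

definition reg_ext :: "complex => complex => complex" where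
 "reg_ext z0 z = of_real (1 - cmod z0) * deriv f z0 *
   (if z = z0 then deriv (%z. 1 / pole_quotient z0 z) z0
   else (1 / pole_quotient z0 z - 1 / pole_quotient z0 z0) / (z - z0))"

text \<open>This and \<open>reg_q\<close> are the derivatives of \<open>reg\<close> by the quotient
  rule. The subtracted 1 / (z - z0) is holomorphic off z0 and contributes to the first only.\<close>

definition reg_p :: "complex => complex => complex" where
 "reg_p z0 z = - (of_real (1 - cmod z0) * deriv f z0 * p z / (f z - f z0)\<^sup>2) + of_real (1 - cmod z0) / (z - z0)\<^sup>2"

definition reg_q :: "complex => complex => complex" where
 "reg_q z0 z = - (of_real (1 - cmod z0) * deriv f z0 * (\<mu> z * p z) / (f z - f z0)\<^sup>2)"

lemma open_domain: "open (ball 0 1 - {a})"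
 by (simp add: open_Diff)

lemma f_neq: "z ~= a ==> z0 ~= a ==> z ~= z0 ==> f z ~= f z0"
 using f_inj by (auto simp: inj_on_def)

context
 fixes z0 assumes z0: "z0 \<in> ball 0 1 - {a}"
begin

lemma r_pos: "0 < 1 - cmod z0"
 using z0 by simp

lemma pole_quotient_holomorphic: "pole_quotient z0 holomorphic_on ball 0 1 - {a}"
 unfolding pole_quotient_def[abs_def] by (rule pole_lemma_open[OF f_holomorphic open_domain])

lemma pole_quotient_nonzero: "z \<in> ball 0 1 - {a} ==> pole_quotient z0 z ~= 0"
 using f_deriv_nonzero[OF z0] f_neq[of z z0] z0 by (auto simp: pole_quotient_def)

lemma reg_ext_holomorphic: "reg_ext z0 holomorphic_on ball 0 1 - {a}"
proof -
 have "(%z. 1 / pole_quotient z0 z) holomorphic_on ball 0 1 - {a}"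
  by (intro holomorphic_intros pole_quotient_holomorphic pole_quotient_nonzero)
 from pole_lemma_open[OF this open_domain, of z0] show ?thesis
  unfolding reg_ext_def[abs_def] by (intro holomorphic_intros)
qed

lemma reg_ext_eq: "z \<in> ball 0 1 - {a} ==> z ~= z0 ==> reg_ext z0 z = reg z0 z"
proof -
 assume z: "z \<in> ball 0 1 - {a}" "z ~= z0"
 have n: "f z - f z0 ~= 0" "z - z0 ~= 0" "deriv f z0 ~= 0"
  using f_neq[of z z0] z z0 f_deriv_nonzero[OF z0] by auto
 define r d e D where "r = cx (1 - cmod z0)" and "d = f z - f z0" and "e = z - z0" and "D = deriv f z0"
 have "r * D * ((1 / (d / e) - 1 / D) / e) = r * D / d - r / e"
  using n unfolding d_def[symmetric] e_def[symmetric] D_def[symmetric] by (simp add: field_simps)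
 then show ?thesis using z(2) by (simp add: reg_ext_def reg_def pole_quotient_def r_def d_def e_def D_def)
qed

text \<open>Near z0 the holomorphic extension is bounded. Elsewhere, also near \<open>a\<close> and
  near infinity, \<open>proper\<close> keeps f - f z0 away from zero. The bound depends on z0, which
  is harmless: it only multiplies cutoff errors that tend to zero.\<close>

lemma reg_bounded: obtains M where "0 < M" "!!z. z ~= a ==> z ~= z0 ==> cmod (reg z0 z) <= M"
proof -
 obtain \<tau> where \<tau>: "0 < \<tau>" "cball z0 \<tau> \<subseteq> ball 0 1 - {a}"
  using open_domain z0 open_contains_cball by blast
 have "compact (reg_ext z0 ` cball z0 \<tau>)"
  by (intro compact_continuous_image continuous_on_subset[OF holomorphic_on_imp_continuous_on[OF reg_ext_holomorphic] \<tau>(2)]) auto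
 then obtain M1 where M1: "0 < M1" "!!z. z \<in> cball z0 \<tau> ==> cmod (reg_ext z0 z) <= M1"
  using compact_imp_bounded[of "reg_ext z0 ` cball z0 \<tau>"] by (auto simp: bounded_pos)
 obtain \<delta> where \<delta>: "0 < \<delta>" "\<forall>z. z ~= a --> \<tau> <= cmod (z - z0) --> \<delta> <= cmod (f z - f z0)"
  using proper[of z0 \<tau>] z0 \<tau>(1) by auto
 define M2 where "M2 = (1 - cmod z0) * cmod (deriv f z0) / \<delta> + (1 - cmod z0) / \<tau>"
 have M2: "0 <= M2" using r_pos \<delta>(1) \<tau>(1) by (simp add: M2_def)
 have "cmod (reg z0 z) <= M1 + M2" if z: "z ~= a" "z ~= z0" for z
 proof (cases "cmod (z - z0) <= \<tau>")
  case True
  then have "z \<in> cball z0 \<tau>" by (simp add: dist_norm norm_minus_commute)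
  then show ?thesis using M1(2)[of z] reg_ext_eq[of z] \<tau>(2) z M2 by fastforce
 next
  case False
  then have d: "\<delta> <= cmod (f z - f z0)" using \<delta>(2) z by auto
  have "cmod (reg z0 z) <= cmod (of_real (1 - cmod z0) * deriv f z0 / (f z - f z0)) + cmod (of_real (1 - cmod z0) / (z - z0))"
   unfolding reg_def by (rule norm_triangle_ineq4)
  also have "\<dots> = (1 - cmod z0) * cmod (deriv f z0) / cmod (f z - f z0) + (1 - cmod z0) / cmod (z - z0)"
   using r_pos by (simp only: norm_divide norm_mult norm_of_real abs_of_pos)
  also have "\<dots> <= M2" unfolding M2_def using r_pos d \<delta>(1) \<tau>(1) False by (intro add_mono frac_le) auto
  finally show ?thesis using M1(1) by simp
 qed
 moreover have "0 < M1 + M2" using M1 M2 by simp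
 ultimately show ?thesis using that by blast
qed

text \<open>\<open>weak_C1_reciprocal\<close> needs a compactly supported function, which f - f z0
  is not. A second cutoff, equal to 1 on the support of \<kappa>, makes it one and leaves the
  formulas on that support unchanged.\<close>

lemma weak_reg:
 assumes \<kappa>: "C1 \<kappa> A B" and S: "compact S" "a \<notin> S" "z0 \<notin> S" "!!z. z \<notin> S ==> \<kappa> z = 0"
 obtains R where "weak_C1 R (%z. \<kappa> z * reg z0 z) (%z. \<kappa> z * reg_p z0 z + A z * reg z0 z) (%z. \<kappa> z * reg_q z0 z + B z * reg z0 z)"
proof -
 have Sc: "closed S" using S(1) compact_imp_closed by blast
 have AB: "A z = 0" "B z = 0" if "z \<notin> S" for z
  using C1_derivs_zero[OF \<kappa>, of "- S" 0 z] S Sc that by auto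
 obtain \<kappa>1 A1 B1 K1 where 1: "C1 \<kappa>1 A1 B1" "compact K1" "a \<notin> K1" "!!z. z \<notin> K1 ==> \<kappa>1 z = 0"
  "!!z. z \<in> S ==> \<kappa>1 z = 1" "!!z. z \<in> S ==> A1 z = 0" "!!z. z \<in> S ==> B1 z = 0"
  by (rule compact_bump[OF S(1,2)]) blast
 obtain R1 where w1: "weak_C1 R1 (%z. \<kappa>1 z * f z) (%z. \<kappa>1 z * p z + A1 z * f z) (%z. \<kappa>1 z * (\<mu> z * p z) + B1 z * f z)"
  by (rule weak_C1_cutoff[OF 1(1,2,3,4)]) auto
 obtain R2 where R2: "0 < R2" "K1 \<union> S \<subseteq> ball 0 R2"
  using bounded_subset_ballD[OF compact_imp_bounded[OF compact_Un[OF 1(2) S(1)]]] by blast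
 have off: "z \<notin> K1" "z \<notin> S" if "R2 < norm z" for z using that R2 by auto
 define R where "R = max R1 R2"
 have "weak_C1 R2 \<kappa>1 A1 B1" by (rule C1_weak[OF 1(1)]) (use off 1(4) in auto)
 then have w2: "weak_C1 R \<kappa>1 A1 B1" by (rule weak_C1_mono) (simp add: R_def)
 have w1': "weak_C1 R (%z. \<kappa>1 z * f z) (%z. \<kappa>1 z * p z + A1 z * f z) (%z. \<kappa>1 z * (\<mu> z * p z) + B1 z * f z)"
  by (rule weak_C1_mono[OF w1]) (simp add: R_def)
 note \<psi> = weak_C1_add[OF w1' weak_C1_cmult[OF w2, where c = "- f z0"]]
 obtain \<tau> where \<tau>: "0 < \<tau>" "!!z. z \<in> S ==> \<tau> <= cmod (z - z0)"
 proof -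
  have "open (- S)" using Sc by auto
  then obtain \<tau> where "0 < \<tau>" "ball z0 \<tau> \<subseteq> - S" using S(3) open_contains_ball by blast
  then show ?thesis using that[of \<tau>] by (force simp: dist_norm norm_minus_commute not_le[symmetric])
 qed
 obtain \<delta> where \<delta>: "0 < \<delta>" "\<forall>z. z ~= a --> \<tau> <= cmod (z - z0) --> \<delta> <= cmod (f z - f z0)"
  using proper[of z0 \<tau>] z0 \<tau>(1) by auto
 have \<psi>S: "\<kappa>1 z * f z + - f z0 * \<kappa>1 z = f z - f z0" if "z \<in> S" for z using 1(5)[OF that] by simp
 have \<delta>': "\<delta> <= cmod (\<kappa>1 z * f z + - f z0 * \<kappa>1 z)" if "z \<in> S" for z
  unfolding \<psi>S[OF that] using \<delta>(2) \<tau>(2)[OF that] S(2) that by auto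
 have R: "\<kappa> z = 0" if "R < norm z" for z using off(2)[of z] S(4) that by (simp add: R_def)
 note rec = weak_C1_reciprocal[OF \<psi> \<kappa> Sc S(4) R \<delta>(1) \<delta>']
 define h where "h z = of_real (1 - cmod z0) / (z - z0)" for z
 have h: "h holomorphic_on - {z0}" unfolding h_def by (intro holomorphic_intros) auto
 have dh: "deriv h z = - (of_real (1 - cmod z0) / (z - z0)\<^sup>2)" if "z ~= z0" for z
 proof -
  have "((%z. r / (z - z0)) has_field_derivative - (r / (z - z0)\<^sup>2)) (at z)" for r
   using that by (auto intro!: derivative_eq_intros simp: power2_eq_square)
  then show ?thesis unfolding h_def by (rule DERIV_imp_deriv)
 qed
 have oz: "open (- {z0})" "S \<subseteq> - {z0}" using S(3) by auto
 have "weak_C1 R (%z. \<kappa> z * h z) (%z. A z * h z + \<kappa> z * deriv h z) (%z. B z * h z)"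
  by (rule C1_weak[OF C1_mult_holomorphic[OF \<kappa> Sc S(4) oz h]]) (use R in auto)
 from weak_C1_add[OF weak_C1_cmult[OF rec, where c = "of_real (1 - cmod z0) * deriv f z0"] weak_C1_cmult[OF this, where c = "- 1"]]
 have W: "weak_C1 R
  (%z. of_real (1 - cmod z0) * deriv f z0 * (\<kappa> z / (\<kappa>1 z * f z + - f z0 * \<kappa>1 z)) + - 1 * (\<kappa> z * h z))
  (%z. of_real (1 - cmod z0) * deriv f z0 * (A z / (\<kappa>1 z * f z + - f z0 * \<kappa>1 z) - \<kappa> z * (\<kappa>1 z * p z + A1 z * f z + - f z0 * A1 z) / (\<kappa>1 z * f z + - f z0 * \<kappa>1 z)\<^sup>2) + - 1 * (A z * h z + \<kappa> z * deriv h z))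
  (%z. of_real (1 - cmod z0) * deriv f z0 * (B z / (\<kappa>1 z * f z + - f z0 * \<kappa>1 z) - \<kappa> z * (\<kappa>1 z * (\<mu> z * p z) + B1 z * f z + - f z0 * B1 z) / (\<kappa>1 z * f z + - f z0 * \<kappa>1 z)\<^sup>2) + - 1 * (B z * h z))"
  (is "weak_C1 R ?u ?P ?Q") .
 define rr where "rr = cx (1 - cmod z0)"
 have "?u z = \<kappa> z * reg z0 z" for z
 proof (cases "z \<in> S")
  case True
  show ?thesis unfolding \<psi>S[OF True] reg_def h_def rr_def[symmetric] by (simp add: right_diff_distrib mult_ac)
 qed (simp add: S(4))
 moreover have "?P z = \<kappa> z * reg_p z0 z + A z * reg z0 z" for z
 proof (cases "z \<in> S")
  case True
  then have zz: "z ~= z0" using S(3) by auto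
  show ?thesis unfolding \<psi>S[OF True] reg_def reg_p_def h_def[of z] dh[OF zz] 1(5,6)[OF True] rr_def[symmetric]
   by (simp add: algebra_simps)
 qed (simp add: S(4) AB)
 moreover have "?Q z = \<kappa> z * reg_q z0 z + B z * reg z0 z" for z
 proof (cases "z \<in> S")
  case True
  show ?thesis unfolding \<psi>S[OF True] reg_def reg_q_def h_def 1(5,7)[OF True] rr_def[symmetric]
   by (simp add: algebra_simps)
 qed (simp add: S(4) AB)
 ultimately have "weak_C1 R (%z. \<kappa> z * reg z0 z) (%z. \<kappa> z * reg_p z0 z + A z * reg z0 z) (%z. \<kappa> z * reg_q z0 z + B z * reg z0 z)"
  using W by (simp only:)
 with that show ?thesis by blast
qed

lemma f_meas: "f \<in> bmeas"
proof -
 have "(%z. if z \<in> - {a} then f z else f a) \<in> bmeas"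
  by (rule borel_measurable_continuous_on_if[OF _ f_cont]) auto
 moreover have "(%z. if z \<in> - {a} then f z else f a) = f" by auto
 ultimately show ?thesis by simp
qed

lemma reg_meas: "reg z0 \<in> bmeas" "reg_p z0 \<in> bmeas" "reg_q z0 \<in> bmeas"
proof -
 note [measurable] = f_meas p_meas \<mu>_meas
 show "reg z0 \<in> bmeas" "reg_p z0 \<in> bmeas" "reg_q z0 \<in> bmeas"
  unfolding reg_def[abs_def] reg_p_def[abs_def] reg_q_def[abs_def] by measurable
qed

text \<open>The points of the support of \<mu> lie outside the disc, hence at distance at least 1 -
  |z0| from z0. There this is the full kernel; the truncation makes it square integrable.\<close>

definition kern :: "complex => complex" where
 "kern z = indicator {z. 1 - cmod z0 <= cmod (z - z0)} z / (z - z0)\<^sup>2"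

lemma kern_l2: "sq_int kern" "l2 kern <= sqrt pi / (1 - cmod z0)"
 using l2_inverse_square[OF r_pos, of z0] by (simp_all add: kern_def[abs_def])

lemma \<mu>_support: "\<mu> z ~= 0 ==> 1 - cmod z0 <= cmod (z - z0)"
proof -
 assume "\<mu> z ~= 0"
 then have "1 < cmod z" using \<mu>_disc[of z] by (cases "cmod z <= 1") auto
 then show ?thesis using norm_triangle_ineq2[of z z0] by linarith
qed

text \<open>The Beltrami equation after inversion. Its inhomogeneous term is the source of the first
  order part of every Taylor coefficient.\<close>

lemma reg_q_eq: "reg_q z0 z = \<mu> z * (reg_p z0 z - of_real (1 - cmod z0) * kern z)"
proof (cases "\<mu> z = 0")
 case False
 then have "kern z = 1 / (z - z0)\<^sup>2" using \<mu>_support by (simp add: kern_def)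
 then show ?thesis by (simp add: reg_q_def reg_p_def)
qed (simp add: reg_q_def)

lemma cutoff_mult_bounded:
 assumes "sq_int A" "M > 0" "!!z. z ~= a ==> z ~= z0 ==> cmod (reg z0 z) <= M" "A a = 0" "A z0 = 0"
 shows "sq_int (%z. A z * reg z0 z)" "l2 (%z. A z * reg z0 z) <= M * l2 A"
proof -
 define g where "g z = (if z = a \<or> z = z0 then 0 else reg z0 z)" for z
 note [measurable] = reg_meas
 have g: "g \<in> bmeas" unfolding g_def by measurable
 have gM: "cmod (g z) <= M" for z using assms(2,3) by (auto simp: g_def)
 have eq: "(%z. g z * A z) = (%z. A z * reg z0 z)" using assms(4,5) by (auto simp: g_def fun_eq_iff)
 show "sq_int (%z. A z * reg z0 z)" "l2 (%z. A z * reg z0 z) <= M * l2 A"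
  using l2_mult_bounded[OF assms(1) g gM] unfolding eq by auto
qed

text \<open>Let X be the norm of the cut-off \<open>reg_p\<close>. The isometry and the Beltrami
  equation give X <= k (X + sqrt pi) + 2 M \<epsilon>. Since k <= 1/2, the term k X is absorbed at
  the price of doubling the rest.\<close>

lemma energy_cutoff:
 assumes \<kappa>: "C1 \<kappa> A B" and S: "compact S" "a \<notin> S" "z0 \<notin> S" "!!z. z \<notin> S ==> \<kappa> z = 0"
  and b: "!!z. cmod (\<kappa> z) <= 1" and AB: "sq_int A" "sq_int B" "l2 A <= \<epsilon>" "l2 B <= \<epsilon>"
  and M: "M > 0" "!!z. z ~= a ==> z ~= z0 ==> cmod (reg z0 z) <= M"
 shows "sq_int (%z. \<kappa> z * reg_p z0 z)" "l2 (%z. \<kappa> z * reg_p z0 z) <= 2 * k * sqrt pi + 4 * M * \<epsilon>"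
proof -
 obtain R where w: "weak_C1 R (%z. \<kappa> z * reg z0 z) (%z. \<kappa> z * reg_p z0 z + A z * reg z0 z) (%z. \<kappa> z * reg_q z0 z + B z * reg z0 z)"
  by (rule weak_reg[OF \<kappa> S]) auto
 have o: "open (- S)" using S(1) compact_imp_closed by auto
 have z: "A a = 0" "A z0 = 0" "B a = 0" "B z0 = 0"
  using C1_derivs_zero[OF \<kappa> o, of 0] S by auto
 note mA = cutoff_mult_bounded[OF AB(1) M z(1,2)] and mB = cutoff_mult_bounded[OF AB(2) M z(3,4)]
 note D = weak_C1_D(2,3)[OF w]
 have eq: "(%z. \<kappa> z * reg_p z0 z + A z * reg z0 z - A z * reg z0 z) = (%z. \<kappa> z * reg_p z0 z)" by simp
 show s: "sq_int (%z. \<kappa> z * reg_p z0 z)" using sq_int_diff[OF D(1) mA(1)] unfolding eq .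
 have \<kappa>m: "\<kappa> \<in> bmeas" using C1_continuous[OF \<kappa>] by (rule borel_measurable_continuous_onI)
 note kk = l2_mult_bounded[OF sq_int_cmult[OF kern_l2(1), of "of_real (1 - cmod z0)"] \<kappa>m b]
 have kl: "l2 (%z. \<kappa> z * (of_real (1 - cmod z0) * kern z)) <= sqrt pi"
 proof -
  have "l2 (%z. \<kappa> z * (of_real (1 - cmod z0) * kern z)) <= l2 (%z. of_real (1 - cmod z0) * kern z)" using kk(2) by simp
  also have "\<dots> = (1 - cmod z0) * l2 kern" using r_pos by (simp only: l2_cmult norm_of_real abs_of_pos)
  also have "\<dots> <= (1 - cmod z0) * (sqrt pi / (1 - cmod z0))" using kern_l2(2) r_pos by (intro mult_left_mono) auto
  also have "\<dots> = sqrt pi" using r_pos by simp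
  finally show ?thesis .
 qed
 have eqq: "(%z. \<mu> z * (\<kappa> z * reg_p z0 z - \<kappa> z * (of_real (1 - cmod z0) * kern z))) = (%z. \<kappa> z * reg_q z0 z)"
  unfolding reg_q_eq by (simp add: fun_eq_iff algebra_simps)
 have q: "sq_int (%z. \<kappa> z * reg_q z0 z)" "l2 (%z. \<kappa> z * reg_q z0 z) <= k * l2 (%z. \<kappa> z * reg_p z0 z - \<kappa> z * (of_real (1 - cmod z0) * kern z))"
  using l2_mult_bounded[OF sq_int_diff[OF s kk(1)] \<mu>_meas \<mu>_le] unfolding eqq by auto
 define X where "X = l2 (%z. \<kappa> z * reg_p z0 z)"
 have "l2 (%z. \<kappa> z * reg_p z0 z - \<kappa> z * (of_real (1 - cmod z0) * kern z)) <= X + sqrt pi"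
  using l2_triangle_diff[OF s kk(1)] kl by (simp add: X_def)
 then have q2: "l2 (%z. \<kappa> z * reg_q z0 z) <= k * (X + sqrt pi)"
  using q(2) k0 by (meson mult_left_mono order_trans)
 have "X <= l2 (%z. \<kappa> z * reg_p z0 z + A z * reg z0 z) + l2 (%z. A z * reg z0 z)"
  using l2_triangle_diff[OF D(1) mA(1)] unfolding eq X_def .
 also have "l2 (%z. \<kappa> z * reg_p z0 z + A z * reg z0 z) = l2 (%z. \<kappa> z * reg_q z0 z + B z * reg z0 z)"
  by (rule weak_C1_isometry[OF w])
 also have "\<dots> <= l2 (%z. \<kappa> z * reg_q z0 z) + l2 (%z. B z * reg z0 z)"
  by (rule l2_triangle[OF q(1) mB(1)])
 finally have "X <= k * (X + sqrt pi) + M * l2 B + M * l2 A" using q2 mA(2) mB(2) by linarith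
 moreover have "M * l2 A <= M * \<epsilon>" "M * l2 B <= M * \<epsilon>" using AB(3,4) M(1) by auto
 moreover have "k * X <= 1 / 2 * X" using k_half by (intro mult_right_mono) (auto simp: X_def)
 ultimately have "X <= 1 / 2 * X + k * sqrt pi + 2 * (M * \<epsilon>)" by (simp add: distrib_left)
 then show "l2 (%z. \<kappa> z * reg_p z0 z) <= 2 * k * sqrt pi + 4 * M * \<epsilon>" unfolding X_def by linarith
qed

text \<open>With logarithmic width L = n + 1 the energies tend to zero while the cutoffs become 1 at
  each fixed regular point: the points a, z0 and infinity have capacity zero.\<close>

lemma cutoff_sequence:
 obtains \<kappa> A B S \<epsilon> where
  "!!n. C1 (\<kappa> n) (A n) (B n)" "!!n. compact (S n)" "!!n. a \<notin> S n" "!!n. z0 \<notin> S n" "!!n z. z \<notin> S n ==> \<kappa> n z = 0"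
  "!!n z. cmod (\<kappa> n z) <= 1" "!!n. sq_int (A n)" "!!n. sq_int (B n)" "!!n. l2 (A n) <= \<epsilon> n" "!!n. l2 (B n) <= \<epsilon> n"
  "\<epsilon> \<longlonglongrightarrow> 0" "!!z. z ~= a ==> z ~= z0 ==> \<forall>\<^sub>F n in sequentially. \<kappa> n z = 1"
proof -
 define L where "L n = real (Suc n)" for n
 define S where "S n = {z. exp (- 2 * L n) <= (cmod (z - a))\<^sup>2} \<inter> {z. exp (- 2 * L n) <= (cmod (z - z0))\<^sup>2} \<inter> {z. (cmod z)\<^sup>2 <= exp (2 * L n)}" for n
 define \<epsilon> where "\<epsilon> n = 3 * sqrt (4 * pi / L n)" for n
 define G where "G n \<kappa> A B \<longleftrightarrow> C1 \<kappa> A B \<and> sq_int A \<and> sq_int B \<and> l2 A <= \<epsilon> n \<and> l2 B <= \<epsilon> n \<and> (\<forall>z. cmod (\<kappa> z) <= 1) \<and>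
  (\<forall>z. z \<notin> S n --> \<kappa> z = 0) \<and> (\<forall>z. exp (- L n) <= (cmod (z - a))\<^sup>2 --> exp (- L n) <= (cmod (z - z0))\<^sup>2 --> (cmod z)\<^sup>2 <= exp (L n) --> \<kappa> z = 1)" for n \<kappa> A B
 have "\<forall>n. \<exists>\<kappa> A B. G n \<kappa> A B"
 proof
  fix n
  have L: "0 < L n" by (simp add: L_def)
  show "\<exists>\<kappa> A B. G n \<kappa> A B"
  proof (rule cutoff_exists[OF L, of a z0])
   fix \<kappa> A B
   assume *: "C1 \<kappa> A B" "sq_int A" "sq_int B" "l2 A <= 3 * sqrt (4 * pi / L n)" "l2 B <= 3 * sqrt (4 * pi / L n)" "!!z. cmod (\<kappa> z) <= 1"
    "!!z. (cmod (z - a))\<^sup>2 < exp (- 2 * L n) \<or> (cmod (z - z0))\<^sup>2 < exp (- 2 * L n) \<or> exp (2 * L n) < (cmod z)\<^sup>2 ==> \<kappa> z = 0"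
    "!!z. exp (- L n) <= (cmod (z - a))\<^sup>2 ==> exp (- L n) <= (cmod (z - z0))\<^sup>2 ==> (cmod z)\<^sup>2 <= exp (L n) ==> \<kappa> z = 1"
   have "\<kappa> z = 0" if "z \<notin> S n" for z by (rule *(7)) (use that in \<open>auto simp: S_def not_le\<close>)
   then have "G n \<kappa> A B" unfolding G_def \<epsilon>_def using * by blast
   then show ?thesis by blast
  qed
 qed
 from choice[OF this] obtain \<kappa> where "\<forall>n. \<exists>A B. G n (\<kappa> n) A B" ..
 from choice[OF this] obtain A where "\<forall>n. \<exists>B. G n (\<kappa> n) (A n) B" ..
 from choice[OF this] obtain B where G: "\<forall>n. G n (\<kappa> n) (A n) (B n)" ..
 have exp0: "\<forall>\<^sub>F n in sequentially. exp (- L n) <= c" if "0 < c" for c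
 proof -
  have "(%n. inverse (exp (real (Suc n)))) \<longlonglongrightarrow> 0"
   by (intro tendsto_inverse_0_at_top filterlim_compose[OF exp_at_top] filterlim_compose[OF filterlim_real_sequentially filterlim_Suc])
  then have "\<forall>\<^sub>F n in sequentially. inverse (exp (real (Suc n))) < c" using that by (rule order_tendstoD(2))
  then show ?thesis by (rule eventually_mono) (simp only: L_def exp_minus less_imp_le)
 qed
 have expi: "\<forall>\<^sub>F n in sequentially. c <= exp (L n)" for c
 proof -
  have "filterlim (%n. exp (real (Suc n))) at_top sequentially"
   by (intro filterlim_compose[OF exp_at_top] filterlim_compose[OF filterlim_real_sequentially filterlim_Suc])
  then show ?thesis unfolding L_def filterlim_at_top by blast
 qed
 show ?thesis
 proof (rule that[of \<kappa> A B S \<epsilon>])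
  fix n
  show "compact (S n)"
  proof -
   have "S n \<subseteq> cball 0 (sqrt (exp (2 * L n)))" by (auto simp: S_def real_le_rsqrt)
   then have "bounded (S n)" using bounded_subset bounded_cball by blast
   moreover have "closed (S n)" unfolding S_def
    by (intro closed_Int closed_Collect_le continuous_intros)
   ultimately show ?thesis by (simp add: compact_eq_bounded_closed)
  qed
  show "a \<notin> S n" "z0 \<notin> S n" by (auto simp: S_def not_le)
 next
  have "(%n. 3 * sqrt (4 * pi * (1 / real (Suc n)))) \<longlonglongrightarrow> 3 * sqrt (4 * pi * 0)"
   by (intro tendsto_intros LIMSEQ_Suc[OF lim_1_over_n])
  then show "\<epsilon> \<longlonglongrightarrow> 0" by (simp add: \<epsilon>_def[abs_def] L_def)
 next
  fix z assume z: "z ~= a" "z ~= z0"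
  then have "0 < (cmod (z - a))\<^sup>2" "0 < (cmod (z - z0))\<^sup>2" by auto
  from exp0[OF this(1)] exp0[OF this(2)] expi[of "(cmod z)\<^sup>2"]
  show "\<forall>\<^sub>F n in sequentially. \<kappa> n z = 1"
   by eventually_elim (use G in \<open>auto simp: G_def\<close>)
 qed (use G in \<open>auto simp: G_def\<close>)
qed

lemma AE_not_singular: "AE z in lborel. z ~= a \<and> z ~= z0"
 using AE_lborel_singleton[of a] AE_lborel_singleton[of z0] by eventually_elim auto

text \<open>The cutoff errors in the energy bound tend to zero, and Fatou's lemma transfers the
  bound to the limit.\<close>

lemma reg_p_l2: "sq_int (reg_p z0)" "l2 (reg_p z0) <= 2 * k * sqrt pi"
proof -
 obtain M where M: "0 < M" "!!z. z ~= a ==> z ~= z0 ==> cmod (reg z0 z) <= M" by (rule reg_bounded) blast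
 obtain \<kappa> A B S \<epsilon> where C: "!!n. C1 (\<kappa> n) (A n) (B n)" "!!n. compact (S n)" "!!n. a \<notin> S n" "!!n. z0 \<notin> S n" "!!n z. z \<notin> S n ==> \<kappa> n z = 0"
  "!!n z. cmod (\<kappa> n z) <= 1" "!!n. sq_int (A n)" "!!n. sq_int (B n)" "!!n. l2 (A n) <= \<epsilon> n" "!!n. l2 (B n) <= \<epsilon> n"
  "\<epsilon> \<longlonglongrightarrow> 0" "!!z. z ~= a ==> z ~= z0 ==> \<forall>\<^sub>F n in sequentially. \<kappa> n z = 1"
  by (rule cutoff_sequence) blast
 have e: "sq_int (%z. \<kappa> n z * reg_p z0 z) \<and> l2 (%z. \<kappa> n z * reg_p z0 z) <= 2 * k * sqrt pi + 4 * M * \<epsilon> n" for n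
  using energy_cutoff[OF C(1-4) C(5) C(6) C(7-10) M] by blast
 define b where "b n = (2 * k * sqrt pi + 4 * M * \<epsilon> n)\<^sup>2" for n
 have bl: "b \<longlonglongrightarrow> (2 * k * sqrt pi)\<^sup>2"
 proof -
  have "b \<longlonglongrightarrow> (2 * k * sqrt pi + 4 * M * 0)\<^sup>2" unfolding b_def[abs_def] by (intro tendsto_intros C(11))
  then show ?thesis by simp
 qed
 note [measurable] = reg_meas
 have \<kappa>m[measurable]: "\<kappa> n \<in> bmeas" for n using C1_continuous[OF C(1)] by (rule borel_measurable_continuous_onI)
 have "(\<integral>\<^sup>+z. ennreal ((cmod (reg_p z0 z))\<^sup>2) \<partial>lborel) = (\<integral>\<^sup>+z. liminf (%n. ennreal ((cmod (\<kappa> n z * reg_p z0 z))\<^sup>2)) \<partial>lborel)"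
 proof (rule nn_integral_cong_AE)
  show "AE z in lborel. ennreal ((cmod (reg_p z0 z))\<^sup>2) = liminf (%n. ennreal ((cmod (\<kappa> n z * reg_p z0 z))\<^sup>2))"
   using AE_not_singular
  proof eventually_elim
   case (elim z)
   then have "\<forall>\<^sub>F n in sequentially. \<kappa> n z = 1" using C(12) by auto
   then have "\<forall>\<^sub>F n in sequentially. ennreal ((cmod (\<kappa> n z * reg_p z0 z))\<^sup>2) = ennreal ((cmod (reg_p z0 z))\<^sup>2)"
    by eventually_elim simp
   then have "(%n. ennreal ((cmod (\<kappa> n z * reg_p z0 z))\<^sup>2)) \<longlonglongrightarrow> ennreal ((cmod (reg_p z0 z))\<^sup>2)"
    by (rule tendsto_eventually)
   then show ?case using lim_imp_Liminf[OF sequentially_bot] by metis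
  qed
 qed
 also have "\<dots> <= liminf (%n. \<integral>\<^sup>+z. ennreal ((cmod (\<kappa> n z * reg_p z0 z))\<^sup>2) \<partial>lborel)"
  by (rule nn_integral_liminf) measurable
 also have "\<dots> <= liminf (%n. ennreal (b n))"
 proof (rule Liminf_mono, rule always_eventually, rule allI)
  fix n
  have "(\<integral>\<^sup>+z. ennreal ((cmod (\<kappa> n z * reg_p z0 z))\<^sup>2) \<partial>lborel) = ennreal ((l2 (%z. \<kappa> n z * reg_p z0 z))\<^sup>2)"
   unfolding l2_power2 using e[of n] by (subst nn_integral_eq_integral) (auto simp: sq_int_def)
  also have "\<dots> <= ennreal (b n)" unfolding b_def using e[of n] by (intro ennreal_leI power_mono) auto
  finally show "(\<integral>\<^sup>+z. ennreal ((cmod (\<kappa> n z * reg_p z0 z))\<^sup>2) \<partial>lborel) <= ennreal (b n)" .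
 qed
 also have "\<dots> = ennreal ((2 * k * sqrt pi)\<^sup>2)"
  by (rule lim_imp_Liminf[OF sequentially_bot tendsto_ennrealI[OF bl]])
 finally have le: "(\<integral>\<^sup>+z. ennreal ((cmod (reg_p z0 z))\<^sup>2) \<partial>lborel) <= ennreal ((2 * k * sqrt pi)\<^sup>2)" .
 have "sqrt ((2 * k * sqrt pi)\<^sup>2) = 2 * k * sqrt pi" using k0 by (simp only: real_sqrt_abs) simp
 with l2_of_nn_integral[OF reg_meas(2) zero_le_power2 le]
 show "sq_int (reg_p z0)" "l2 (reg_p z0) <= 2 * k * sqrt pi" by auto
qed

end

end

lemma tendsto_l2_cutoff:
 assumes g: "integrbl (g :: complex => complex)" and \<kappa>: "!!n. \<kappa> n \<in> bmeas" "!!n z. cmod (\<kappa> n z) <= 1"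
  and lim: "AE z in lborel. \<forall>\<^sub>F n in sequentially. \<kappa> n z = 1"
 shows "(%n. (LBINT z. \<kappa> n z * g z)) \<longlonglongrightarrow> (LBINT z. g z)"
proof (rule integral_dominated_convergence[where w = "%z. cmod (g z)"])
 have [measurable]: "g \<in> bmeas" using borel_measurable_integrable[OF g] by simp
 note [measurable] = \<kappa>(1)
 show "g \<in> borel_measurable lborel" by measurable
 show "(%z. \<kappa> n z * g z) \<in> borel_measurable lborel" for n by measurable
 show "integrbl (%z. cmod (g z))" using g by simp
 show "AE z in lborel. (%n. \<kappa> n z * g z) \<longlonglongrightarrow> g z"
  using lim
 proof eventually_elim
  case (elim z)
  then have "\<forall>\<^sub>F n in sequentially. \<kappa> n z * g z = g z" by eventually_elim simp
  then show ?case by (rule tendsto_eventually)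
 qed
 show "AE z in lborel. cmod (\<kappa> n z * g z) <= cmod (g z)" for n
  using \<kappa>(2)[of n] by (auto simp: norm_mult mult_left_le_one_le)
qed

context beltrami_solution
begin

context
 fixes z0 assumes z0: "z0 \<in> ball 0 1 - {a}"
begin

lemma reg_q_l2: "sq_int (reg_q z0)" "l2 (reg_q z0) <= 2 * k * sqrt pi"
proof -
 have r: "0 < 1 - cmod z0" by (rule r_pos[OF z0])
 have s: "sq_int (%z. of_real (1 - cmod z0) * kern z0 z)" by (rule sq_int_cmult[OF kern_l2(1)[OF z0]])
 have "l2 (%z. of_real (1 - cmod z0) * kern z0 z) = (1 - cmod z0) * l2 (kern z0)" using r by (simp only: l2_cmult norm_of_real abs_of_pos)
 also have "\<dots> <= (1 - cmod z0) * (sqrt pi / (1 - cmod z0))" using kern_l2(2)[OF z0] r by (intro mult_left_mono) auto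
 finally have l: "l2 (%z. of_real (1 - cmod z0) * kern z0 z) <= sqrt pi" using r by simp
 note m = l2_mult_bounded[OF sq_int_diff[OF reg_p_l2(1)[OF z0] s] \<mu>_meas \<mu>_le]
 have eq: "(%z. \<mu> z * (reg_p z0 z - of_real (1 - cmod z0) * kern z0 z)) = reg_q z0"
  using reg_q_eq[OF z0] by (simp add: fun_eq_iff)
 show "sq_int (reg_q z0)" using m(1) unfolding eq .
 have "l2 (reg_q z0) <= k * l2 (%z. reg_p z0 z - of_real (1 - cmod z0) * kern z0 z)" using m(2) unfolding eq .
 also have "\<dots> <= k * (2 * k * sqrt pi + sqrt pi)"
  using l2_triangle_diff[OF reg_p_l2(1)[OF z0] s] reg_p_l2(2)[OF z0] l k0 by (intro mult_left_mono) auto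
 also have "\<dots> <= k * (2 * sqrt pi)"
 proof (intro mult_left_mono k0)
  have "2 * k * sqrt pi <= 1 * sqrt pi" using k_half by (intro mult_right_mono) auto
  then show "2 * k * sqrt pi + sqrt pi <= 2 * sqrt pi" by simp
 qed
 finally show "l2 (reg_q z0) <= 2 * k * sqrt pi" by (simp add: mult_ac)
qed

text \<open>Truncated like \<open>kern\<close>, to a region containing the support of \<mu>. Pairing
  with it produces the Taylor coefficient of order n.\<close>

definition pkern :: "nat => complex => complex" where
 "pkern n z = indicator {z. 1 - cmod z0 <= cmod (z - z0)} z / (z - z0) ^ (n + 1)"

lemma pkern_l2:
 assumes n: "1 <= n"
 shows "sq_int (pkern n)" "l2 (pkern n) <= sqrt pi / (1 - cmod z0) ^ n"
proof -
 have r: "0 < 1 - cmod z0" by (rule r_pos[OF z0])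
 have m: "pkern n \<in> bmeas" unfolding pkern_def[abs_def] by measurable
 define C where "C = 1 / (1 - cmod z0) ^ (n - 1)"
 have C0: "0 <= C" using r by (simp add: C_def)
 have le: "AE z in lborel. cmod (pkern n z) <= cmod (of_real C * kern z0 z)"
 proof (rule AE_I2)
  fix z
  show "cmod (pkern n z) <= cmod (of_real C * kern z0 z)"
  proof (cases "1 - cmod z0 <= cmod (z - z0)")
   case True
   have e: "n + 1 = (n - 1) + 2" using n by simp
   have "cmod (pkern n z) = 1 / cmod (z - z0) ^ (n - 1) * (1 / cmod (z - z0) ^ 2)"
    unfolding pkern_def e power_add using True by (simp add: norm_divide norm_mult norm_power)
   also have "\<dots> <= C * (1 / cmod (z - z0) ^ 2)"
    unfolding C_def using True r by (intro mult_right_mono frac_le power_mono) auto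
   also have "\<dots> = cmod (of_real C * kern z0 z)"
    using True C0 z0 by (simp add: kern_def norm_mult norm_divide norm_power)
   finally show ?thesis .
  qed (simp add: pkern_def)
 qed
 note s = l2_mono[OF m sq_int_cmult[OF kern_l2(1)[OF z0]] le]
 show "sq_int (pkern n)" by (rule s(1))
 have "l2 (pkern n) <= C * l2 (kern z0)" using s(2) C0 by (simp only: l2_cmult norm_of_real abs_of_nonneg)
 also have "\<dots> <= C * (sqrt pi / (1 - cmod z0))" using kern_l2(2)[OF z0] C0 by (intro mult_left_mono) auto
 also have "\<dots> = sqrt pi / (1 - cmod z0) ^ n"
 proof -
  have "(1 - cmod z0) ^ n = (1 - cmod z0) ^ (n - 1) * (1 - cmod z0)" using n by (cases n) auto
  then show ?thesis by (simp add: C_def)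
 qed
 finally show "l2 (pkern n) <= sqrt pi / (1 - cmod z0) ^ n" .
qed

text \<open>A Pompeiu formula. The test function \<theta> is the power (z - z0)^(-n-1) with its
  singularity cut out. Its zbar-derivative lives on a small annulus and extracts the coefficient of
  \<open>reg_ext\<close>; on the support of \<mu> it is the kernel itself.\<close>

lemma reg_coefficient:
 assumes F: "(%w. reg_ext z0 (z0 + w)) has_fps_expansion F" and n: "1 <= n"
 shows "of_real pi * fps_nth F n = - (LBINT z. reg_q z0 z * pkern n z)"
proof -
 have r: "0 < 1 - cmod z0" by (rule r_pos[OF z0])
 obtain \<rho>0 where \<rho>0: "0 < \<rho>0" "ball z0 \<rho>0 \<subseteq> ball 0 1 - {a}"
  using open_domain z0 open_contains_ball by blast
 \<comment> \<open>The bound by 1 - |z0| keeps the annulus of the cutoff away from the support of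
   \<mu>.\<close>
 define \<rho> where "\<rho> = min \<rho>0 (1 - cmod z0)"
 have \<rho>: "0 < \<rho>" "ball z0 \<rho> \<subseteq> ball 0 1 - {a}" "\<rho> <= 1 - cmod z0" using \<rho>0 r by (auto simp: \<rho>_def)
 define s t where "s = \<rho> / 3" and "t = \<rho> / 2"
 have st: "0 < s" "s < t" "t < \<rho>" "0 < t" using \<rho> by (auto simp: s_def t_def)
 define kk where "kk x = step ((x - s\<^sup>2) / (t\<^sup>2 - s\<^sup>2))" for x
 define kk' where "kk' x = step' ((x - s\<^sup>2) / (t\<^sup>2 - s\<^sup>2)) / (t\<^sup>2 - s\<^sup>2)" for x
 have kk: "!!x. (kk has_real_derivative kk' x) (at x)" "continuous_on UNIV kk'" "!!x. 0 <= kk' x"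
  "!!x. x <= s\<^sup>2 ==> kk x = 0" "!!x. t\<^sup>2 <= x ==> kk x = 1" "!!x. x <= s\<^sup>2 ==> kk' x = 0" "!!x. t\<^sup>2 <= x ==> kk' x = 0"
  "!!x. 0 <= kk x \<and> kk x <= 1"
  using radial_step[OF st(1,2)] by (auto simp: kk_def[abs_def] kk'_def[abs_def])
 define H where "H z = 1 / (z - z0) ^ (n + 1)" for z
 define \<theta> where "\<theta> z = cx (kk ((cmod (z - z0))\<^sup>2)) * H z" for z
 have C: "C1 \<theta> (%z. cx (kk' ((cmod (z - z0))\<^sup>2)) * cnj (z - z0) * H z + cx (kk ((cmod (z - z0))\<^sup>2)) * deriv H z)
   (%z. cx (kk' ((cmod (z - z0))\<^sup>2)) * (z - z0) * H z)"
  unfolding \<theta>_def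
 proof (rule C1_mult_holomorphic[OF C1_radial[OF kk(1,2)], where S = "- ball z0 s" and W = "- {z0}"])
  fix z assume "z \<notin> - ball z0 s"
  then have "(cmod (z - z0))\<^sup>2 <= s\<^sup>2" by (auto simp: dist_norm norm_minus_commute intro!: power_mono)
  then show "cx (kk ((cmod (z - z0))\<^sup>2)) = 0" using kk(4) by simp
 qed (use st in \<open>auto simp: H_def[abs_def] intro!: holomorphic_intros\<close>)
 define \<theta>B where "\<theta>B z = cx (kk' ((cmod (z - z0))\<^sup>2)) * (1 / (z - z0) ^ n)" for z
 have \<theta>B: "(%z. cx (kk' ((cmod (z - z0))\<^sup>2)) * (z - z0) * H z) = \<theta>B"
 proof
  fix z show "cx (kk' ((cmod (z - z0))\<^sup>2)) * (z - z0) * H z = \<theta>B z"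
   using kk(6)[of 0] n by (cases "z = z0") (auto simp: \<theta>B_def H_def)
 qed
 note C = C[unfolded \<theta>B]
 have \<theta>s: "sq_int \<theta>"
 proof -
  define Cn where "Cn = 1 / s ^ (n - 1)"
  have le: "AE z in lborel. cmod (\<theta> z) <= cmod (of_real Cn * (indicator {z. s <= cmod (z - z0)} z / (z - z0)\<^sup>2))"
  proof (rule AE_I2)
   fix z
   show "cmod (\<theta> z) <= cmod (of_real Cn * (indicator {z. s <= cmod (z - z0)} z / (z - z0)\<^sup>2))"
   proof (cases "s <= cmod (z - z0)")
    case True
    have e: "n + 1 = (n - 1) + 2" using n by simp
    have "cmod (\<theta> z) <= 1 * (1 / cmod (z - z0) ^ (n - 1) * (1 / cmod (z - z0) ^ 2))"
     unfolding \<theta>_def norm_mult H_def e power_add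
     using kk(8)[of "(cmod (z - z0))\<^sup>2"] by (intro mult_mono) (auto simp: norm_divide norm_mult norm_power)
    also have "\<dots> <= 1 * (Cn * (1 / cmod (z - z0) ^ 2))"
     unfolding Cn_def using True st by (intro mult_left_mono mult_right_mono frac_le power_mono) auto
    also have "\<dots> = cmod (of_real Cn * (indicator {z. s <= cmod (z - z0)} z / (z - z0)\<^sup>2))"
     using True st by (simp add: norm_mult norm_divide norm_power Cn_def)
    finally show ?thesis .
   next
    case False
    then have "(cmod (z - z0))\<^sup>2 <= s\<^sup>2" by (intro power_mono) auto
    then show ?thesis using kk(4) False by (simp add: \<theta>_def)
   qed
  qed
  show ?thesis
   by (rule l2_mono(1)[OF _ sq_int_cmult[OF l2_inverse_square(1)[OF st(1), of z0]] le])
     (use C1_continuous[OF C] in \<open>auto intro: borel_measurable_continuous_onI\<close>)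
 qed
 obtain M where M: "0 < M" "!!z. z ~= a ==> z ~= z0 ==> cmod (reg z0 z) <= M" by (rule reg_bounded[OF z0]) blast
 obtain \<kappa> A B S \<epsilon> where cs: "!!n. C1 (\<kappa> n) (A n) (B n)" "!!n. compact (S n)" "!!n. a \<notin> S n" "!!n. z0 \<notin> S n" "!!n z. z \<notin> S n ==> \<kappa> n z = 0"
  "!!n z. cmod (\<kappa> n z) <= 1" "!!n. sq_int (A n)" "!!n. sq_int (B n)" "!!n. l2 (A n) <= \<epsilon> n" "!!n. l2 (B n) <= \<epsilon> n"
  "\<epsilon> \<longlonglongrightarrow> 0" "!!z. z ~= a ==> z ~= z0 ==> \<forall>\<^sub>F n in sequentially. \<kappa> n z = 1"
  by (rule cutoff_sequence[OF z0]) blast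
 have lim1: "AE z in lborel. \<forall>\<^sub>F n in sequentially. \<kappa> n z = 1"
  using AE_not_singular[OF z0] by eventually_elim (use cs(12) in auto)
 have \<kappa>m: "\<kappa> n \<in> bmeas" for n using C1_continuous[OF cs(1)] by (rule borel_measurable_continuous_onI)
 have off: "kk' ((cmod (z - z0))\<^sup>2) = 0" if "z \<notin> ball z0 \<rho>" for z
 proof -
  have "t <= cmod (z - z0)" using that st by (auto simp: dist_norm norm_minus_commute)
  then have "t\<^sup>2 <= (cmod (z - z0))\<^sup>2" using st by (intro power_mono) auto
  then show ?thesis by (rule kk(7))
 qed
 have reg\<theta>: "reg z0 z * \<theta>B z = cx (kk' ((cmod (z - z0))\<^sup>2)) * (reg_ext z0 z * (1 / (z - z0) ^ n))" for z
 proof (cases "z \<in> ball z0 \<rho> - {z0}")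
  case True
  then have "reg_ext z0 z = reg z0 z" using \<rho>(2) by (intro reg_ext_eq[OF z0]) auto
  then show ?thesis by (simp add: \<theta>B_def)
 next
  case False
  then have "kk' ((cmod (z - z0))\<^sup>2) = 0" using off[of z] kk(6)[of 0] by (cases "z = z0") auto
  then show ?thesis by (simp add: \<theta>B_def)
 qed
 have hol: "reg_ext z0 holomorphic_on ball z0 \<rho>" by (rule holomorphic_on_subset[OF reg_ext_holomorphic[OF z0] \<rho>(2)])
 have ct: "continuous_on (ball z0 \<rho> - {z0}) (%z. reg_ext z0 z * (1 / (z - z0) ^ n))"
  by (intro continuous_intros continuous_on_subset[OF holomorphic_on_imp_continuous_on[OF hol]]) auto
 have i1: "integrbl (%z. reg z0 z * \<theta>B z)"
  unfolding reg\<theta> by (rule integrable_compact_support[OF continuous_on_radial_glue[OF kk(2,6,7) st(1,4,3) ct]])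
 have v1: "(LBINT z. reg z0 z * \<theta>B z) = of_real pi * fps_nth F n"
  unfolding reg\<theta> by (rule radial_step_coefficient[OF st(1-3) kk(1-7) hol F])
 note qs = reg_q_l2(1)
 have i2: "integrbl (%z. reg_q z0 z * \<theta> z)" by (rule l2_Cauchy_Schwarz(1)[OF qs \<theta>s])
 have v2: "(%z. reg_q z0 z * \<theta> z) = (%z. reg_q z0 z * pkern n z)"
 proof
  fix z show "reg_q z0 z * \<theta> z = reg_q z0 z * pkern n z"
  proof (cases "\<mu> z = 0")
   case False
   then have le: "1 - cmod z0 <= cmod (z - z0)" by (rule \<mu>_support[OF z0])
   then have "t <= cmod (z - z0)" using \<rho>(3) st by linarith
   then have "t\<^sup>2 <= (cmod (z - z0))\<^sup>2" using st by (intro power_mono) auto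
   then show ?thesis using le by (simp add: \<theta>_def pkern_def H_def kk(5))
  qed (simp add: reg_q_def)
 qed
 have step: "(LBINT m. \<kappa> n m * (reg z0 m * \<theta>B m)) = - (LBINT z. \<kappa> n z * (reg_q z0 z * \<theta> z)) - (LBINT z. B n z * reg z0 z * \<theta> z)
   \<and> cmod (LBINT z. B n z * reg z0 z * \<theta> z) <= M * \<epsilon> n * l2 \<theta>" for n
 proof -
  obtain R where w: "weak_C1 R (%z. \<kappa> n z * reg z0 z) (%z. \<kappa> n z * reg_p z0 z + A n z * reg z0 z) (%z. \<kappa> n z * reg_q z0 z + B n z * reg z0 z)"
   by (rule weak_reg[OF z0 cs(1,2,3,4)]) (use cs(5) in auto)
  have o: "open (- S n)" using cs(2) compact_imp_closed by auto
  have z: "B n a = 0" "B n z0 = 0"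
   by (rule C1_derivs_zero(2)[OF cs(1)[of n] o, of 0], use cs(3,4,5) in auto)+
  note mB = cutoff_mult_bounded[OF z0 cs(8) M z]
  have \<kappa>q: "sq_int (%z. \<kappa> n z * reg_q z0 z)" by (rule l2_mult_bounded(1)[OF qs \<kappa>m cs(6)])
  have "(LBINT z. \<kappa> n z * reg z0 z * \<theta>B z) = - (LBINT z. (\<kappa> n z * reg_q z0 z + B n z * reg z0 z) * \<theta> z)"
   by (rule weak_C1_D(8)[OF w C])
  also have "(LBINT z. (\<kappa> n z * reg_q z0 z + B n z * reg z0 z) * \<theta> z) = (LBINT z. \<kappa> n z * reg_q z0 z * \<theta> z) + (LBINT z. B n z * reg z0 z * \<theta> z)"
   using l2_Cauchy_Schwarz(1)[OF \<kappa>q \<theta>s] l2_Cauchy_Schwarz(1)[OF mB(1) \<theta>s] by (simp add: distrib_right)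
  finally have 1: "(LBINT m. \<kappa> n m * (reg z0 m * \<theta>B m)) = - (LBINT z. \<kappa> n z * (reg_q z0 z * \<theta> z)) - (LBINT z. B n z * reg z0 z * \<theta> z)"
   by (simp add: mult.assoc)
  have "cmod (LBINT z. B n z * reg z0 z * \<theta> z) <= l2 (%z. B n z * reg z0 z) * l2 \<theta>"
   by (rule l2_Cauchy_Schwarz(4)[OF mB(1) \<theta>s])
  also have "\<dots> <= M * l2 (B n) * l2 \<theta>" by (intro mult_right_mono mB) auto
  also have "\<dots> <= M * \<epsilon> n * l2 \<theta>" using cs(10) M(1) by (intro mult_right_mono mult_left_mono) auto
  finally show ?thesis using 1 by blast
 qed
 have L: "(%n. (LBINT m. \<kappa> n m * (reg z0 m * \<theta>B m))) \<longlonglongrightarrow> of_real pi * fps_nth F n"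
  using tendsto_l2_cutoff[OF i1 \<kappa>m cs(6) lim1] unfolding v1 .
 have R1: "(%n. (LBINT z. \<kappa> n z * (reg_q z0 z * \<theta> z))) \<longlonglongrightarrow> (LBINT z. reg_q z0 z * pkern n z)"
  using tendsto_l2_cutoff[OF i2 \<kappa>m cs(6) lim1] unfolding v2 .
 have R2: "(%n. (LBINT z. B n z * reg z0 z * \<theta> z)) \<longlonglongrightarrow> 0"
 proof (rule Lim_null_comparison)
  show "\<forall>\<^sub>F n in sequentially. norm (LBINT z. B n z * reg z0 z * \<theta> z) <= M * \<epsilon> n * l2 \<theta>" using step by simp
  have "(%n. M * \<epsilon> n * l2 \<theta>) \<longlonglongrightarrow> M * 0 * l2 \<theta>" by (intro tendsto_intros cs(11))
  then show "(%n. M * \<epsilon> n * l2 \<theta>) \<longlonglongrightarrow> 0" by simp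
 qed
 have "(%n. (LBINT m. \<kappa> n m * (reg z0 m * \<theta>B m))) \<longlonglongrightarrow> - (LBINT z. reg_q z0 z * pkern n z) - 0"
  using tendsto_diff[OF tendsto_minus[OF R1] R2] step by simp
 from LIMSEQ_unique[OF L this] show ?thesis by simp
qed

text \<open>Cauchy-Schwarz with the norms of \<open>reg_q\<close> and \<open>pkern\<close>. For the
  second bound \<open>reg_q_eq\<close> splits off the kernel, and what remains is \<mu> times
  \<open>reg_p\<close>, of norm at most k times 2 k sqrt pi.\<close>

lemma reg_coefficient_bounds:
 assumes F: "(%w. reg_ext z0 (z0 + w)) has_fps_expansion F" and n: "1 <= n"
 shows "cmod (fps_nth F n) * (1 - cmod z0) ^ n <= 2 * k"
  and "cmod (of_real ((1 - cmod z0) ^ n) * fps_nth F n -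
    of_real ((1 - cmod z0) ^ (n + 1) / pi) * (LBINT z. \<mu> z / (z - z0) ^ (n + 3))) <= 2 * k\<^sup>2"
proof -
 have r: "0 < 1 - cmod z0" by (rule r_pos[OF z0])
 define r where "r = 1 - cmod z0"
 have r0: "0 < r" using r by (simp add: r_def)
 have sp: "sqrt pi * sqrt pi = pi" by simp
 have bound: "c * (r ^ n) <= K" if "pi * c <= K * sqrt pi * (sqrt pi / r ^ n)" for c K
 proof -
  have "K * sqrt pi * (sqrt pi / r ^ n) = pi * (K / r ^ n)" using sp by (simp add: mult_ac)
  with that have "pi * c <= pi * (K / r ^ n)" by (simp only:)
  then have "c <= K / r ^ n" by (rule mult_left_le_imp_le) simp
  then show ?thesis using r0 by (simp add: field_simps)
 qed
 note coef = reg_coefficient[OF F n] and pk = pkern_l2[OF n, folded r_def]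
 have "pi * cmod (fps_nth F n) = cmod (of_real pi * fps_nth F n)" by (simp add: norm_mult)
 also have "\<dots> <= l2 (reg_q z0) * l2 (pkern n)"
  unfolding coef norm_minus_cancel by (rule l2_Cauchy_Schwarz(4)[OF reg_q_l2(1) pk(1)])
 also have "\<dots> <= 2 * k * sqrt pi * (sqrt pi / r ^ n)"
  using k0 by (intro mult_mono reg_q_l2 pk) auto
 finally show "cmod (fps_nth F n) * (1 - cmod z0) ^ n <= 2 * k" unfolding r_def[symmetric] by (rule bound)
 define I where "I = (LBINT z. \<mu> z / (z - z0) ^ (n + 3))"
 have s\<mu>p: "sq_int (%z. \<mu> z * reg_p z0 z)" "l2 (%z. \<mu> z * reg_p z0 z) <= 2 * k\<^sup>2 * sqrt pi"
 proof -
  note m = l2_mult_bounded[OF reg_p_l2(1)[OF z0] \<mu>_meas \<mu>_le]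
  show "sq_int (%z. \<mu> z * reg_p z0 z)" by (rule m(1))
  have "l2 (%z. \<mu> z * reg_p z0 z) <= k * (2 * k * sqrt pi)"
   by (rule order_trans[OF m(2) mult_left_mono[OF reg_p_l2(2)[OF z0] k0]])
  then show "l2 (%z. \<mu> z * reg_p z0 z) <= 2 * k\<^sup>2 * sqrt pi" by (simp add: power2_eq_square mult_ac)
 qed
 have s\<mu>k: "sq_int (%z. \<mu> z * (of_real r * kern z0 z))"
  by (rule l2_mult_bounded(1)[OF sq_int_cmult[OF kern_l2(1)[OF z0]] \<mu>_meas \<mu>_le])
 have e1: "\<mu> z * (of_real r * kern z0 z) * pkern n z = of_real r * (\<mu> z / (z - z0) ^ (n + 3))" for z
 proof (cases "\<mu> z = 0")
  case False
  then have "1 - cmod z0 <= cmod (z - z0)" by (rule \<mu>_support[OF z0])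
  then have kp: "kern z0 z = 1 / (z - z0)\<^sup>2" "pkern n z = 1 / (z - z0) ^ (n + 1)"
   unfolding kern_def[OF z0] pkern_def by simp_all
  have "(z - z0) ^ (n + 3) = (z - z0) ^ (2 + (n + 1))" by (rule arg_cong[where f = "%m. (z - z0) ^ m"]) simp
  also have "\<dots> = (z - z0)\<^sup>2 * (z - z0) ^ (n + 1)" by (rule power_add)
  finally have e: "(z - z0) ^ (n + 3) = (z - z0)\<^sup>2 * (z - z0) ^ (n + 1)" .
  show ?thesis unfolding kp e by (simp add: mult_ac)
 qed simp
 have e2: "reg_q z0 z * pkern n z = \<mu> z * reg_p z0 z * pkern n z - of_real r * (\<mu> z / (z - z0) ^ (n + 3))" for z
  unfolding e1[symmetric] reg_q_eq[OF z0, folded r_def] by (simp add: algebra_simps)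
 have i1: "integrbl (%z. \<mu> z * reg_p z0 z * pkern n z)" by (rule l2_Cauchy_Schwarz(1)[OF s\<mu>p(1) pk(1)])
 have i2: "integrbl (%z. of_real r * (\<mu> z / (z - z0) ^ (n + 3)))"
  using l2_Cauchy_Schwarz(1)[OF s\<mu>k pk(1)] unfolding e1 .
 have "of_real pi * fps_nth F n = - ((LBINT z. \<mu> z * reg_p z0 z * pkern n z) - of_real r * I)"
  unfolding coef e2 I_def using i1 i2 by (subst Bochner_Integration.integral_diff) (simp_all del: times_divide_eq_right)
 then have "of_real pi * (fps_nth F n - of_real (r / pi) * I) = - (LBINT z. \<mu> z * reg_p z0 z * pkern n z)"
  by (simp add: algebra_simps)
 then have "pi * cmod (fps_nth F n - of_real (r / pi) * I) = cmod (LBINT z. \<mu> z * reg_p z0 z * pkern n z)"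
  by (metis norm_minus_cancel norm_mult norm_of_real abs_of_pos pi_gt_zero)
 also have "\<dots> <= l2 (%z. \<mu> z * reg_p z0 z) * l2 (pkern n)"
  by (rule l2_Cauchy_Schwarz(4)[OF s\<mu>p(1) pk(1)])
 also have "\<dots> <= 2 * k\<^sup>2 * sqrt pi * (sqrt pi / r ^ n)"
  by (intro mult_mono s\<mu>p pk) auto
 finally have "cmod (fps_nth F n - of_real (r / pi) * I) * r ^ n <= 2 * k\<^sup>2" by (rule bound)
 moreover have "of_real (r ^ n) * fps_nth F n - of_real (r ^ (n + 1) / pi) * I = (fps_nth F n - of_real (r / pi) * I) * of_real (r ^ n)"
  by (simp add: algebra_simps)
 ultimately show "cmod (of_real ((1 - cmod z0) ^ n) * fps_nth F n -
    of_real ((1 - cmod z0) ^ (n + 1) / pi) * (LBINT z. \<mu> z / (z - z0) ^ (n + 3))) <= 2 * k\<^sup>2"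
  unfolding r_def[symmetric] I_def[symmetric] using r0 by (simp only: norm_mult norm_of_real abs_of_pos zero_less_power)
qed

end

end

section \<open>The pre-Schwarzian derivative and distortion in the disc\<close>

lemma inverse_distance_derivative:
 "t < 1 ==> ((%t. c / (1 - t)) has_vector_derivative c / (1 - t)\<^sup>2) (at (t::real))" for c :: real
 unfolding has_real_derivative_iff_has_vector_derivative[symmetric]
 by (auto intro!: derivative_eq_intros simp: power2_eq_square)

context beltrami_solution
begin

definition pre_schwarzian :: "complex => complex" where
 "pre_schwarzian z = deriv (deriv f) z / deriv f z"

lemma f_expansion:
 assumes z0: "z0 \<in> ball 0 1 - {a}"
 obtains E where "(%w. f (z0 + w)) has_fps_expansion E" "!!n. fps_nth E n = (deriv ^^ n) f z0 / fact n"
proof -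
 obtain \<rho> where \<rho>: "0 < \<rho>" "ball z0 \<rho> \<subseteq> ball 0 1 - {a}"
  using open_domain z0 open_contains_ball by blast
 have h: "(%w. f (z0 + w)) holomorphic_on ball 0 \<rho>"
  by (rule holomorphic_on_compose_gen[OF _ holomorphic_on_subset[OF f_holomorphic \<rho>(2)], of "%w. z0 + w", unfolded o_def])
    (auto intro!: holomorphic_intros simp: dist_norm)
 have e: "(%w. f (z0 + w)) has_fps_expansion fps_expansion (%w. f (z0 + w)) 0"
  by (rule has_fps_expansion_fps_expansion[OF _ _ h]) (use \<rho> in auto)
 moreover have "fps_nth (fps_expansion (%w. f (z0 + w)) 0) n = (deriv ^^ n) f z0 / fact n" for n
 proof -
  have "(deriv ^^ n) (%w. f (z0 + w)) 0 = (deriv ^^ n) f z0"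
   by (subst (2) higher_deriv_shift_0) (simp add: o_def)
  then show ?thesis by (simp add: fps_expansion_def)
 qed
 ultimately show ?thesis using that by blast
qed

text \<open>Clearing denominators in \<open>reg\<close> gives an identity of power series, whose
  coefficients of w^2 and w^3 determine the first two of \<open>F\<close>. The second of these is
  -r/6 times the Schwarzian derivative of f.\<close>

lemma reg_expansion:
 assumes z0: "z0 \<in> ball 0 1 - {a}"
 obtains F where "(%w. reg_ext z0 (z0 + w)) has_fps_expansion F"
  "fps_nth F 0 = - (of_real (1 - cmod z0) * pre_schwarzian z0 / 2)"
  "fps_nth F 1 = of_real (1 - cmod z0) * ((pre_schwarzian z0)\<^sup>2 / 4 - (deriv ^^ 3) f z0 / (6 * deriv f z0))"
proof -
 obtain \<rho> where \<rho>: "0 < \<rho>" "ball z0 \<rho> \<subseteq> ball 0 1 - {a}"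
  using open_domain z0 open_contains_ball by blast
 have h: "(%w. reg_ext z0 (z0 + w)) holomorphic_on ball 0 \<rho>"
  by (rule holomorphic_on_compose_gen[OF _ holomorphic_on_subset[OF reg_ext_holomorphic[OF z0] \<rho>(2)], of "%w. z0 + w", unfolded o_def])
    (auto intro!: holomorphic_intros simp: dist_norm)
 define F where "F = fps_expansion (%w. reg_ext z0 (z0 + w)) 0"
 have F: "(%w. reg_ext z0 (z0 + w)) has_fps_expansion F"
  unfolding F_def by (rule has_fps_expansion_fps_expansion[OF _ _ h]) (use \<rho> in auto)
 obtain E where E: "(%w. f (z0 + w)) has_fps_expansion E" "!!n. fps_nth E n = (deriv ^^ n) f z0 / fact n"
  by (rule f_expansion[OF z0]) blast
 define r where "r = cx (1 - cmod z0)"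
 define D where "D = deriv f z0"
 have D: "D ~= 0" unfolding D_def by (rule f_deriv_nonzero[OF z0])
 have l: "(%w. reg_ext z0 (z0 + w) * (f (z0 + w) - f z0) * w) has_fps_expansion (F * (E - fps_const (f z0)) * fps_X)"
  by (intro fps_expansion_intros F E(1))
 have rr: "(%w. r * D * w - r * (f (z0 + w) - f z0)) has_fps_expansion (fps_const (r * D) * fps_X - fps_const r * (E - fps_const (f z0)))"
  by (intro fps_expansion_intros E(1))
 have ev: "\<forall>\<^sub>F w in nhds 0. reg_ext z0 (z0 + w) * (f (z0 + w) - f z0) * w = r * D * w - r * (f (z0 + w) - f z0)"
 proof (rule eventually_mono[OF eventually_nhds_in_open[OF open_ball]])
  show "(0::complex) \<in> ball 0 \<rho>" using \<rho> by simp
  fix w :: complex assume w: "w \<in> ball 0 \<rho>"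
  show "reg_ext z0 (z0 + w) * (f (z0 + w) - f z0) * w = r * D * w - r * (f (z0 + w) - f z0)"
  proof (cases "w = 0")
   case False
   have "z0 + w \<in> ball z0 \<rho>" using w by (simp add: dist_norm)
   then have in_d: "z0 + w \<in> ball 0 1 - {a}" using \<rho>(2) by blast
   have n: "f (z0 + w) - f z0 ~= 0" using f_neq[of "z0 + w" z0] in_d z0 False by auto
   have "reg_ext z0 (z0 + w) = r * D / (f (z0 + w) - f z0) - r / w"
    using reg_ext_eq[OF z0 in_d] False by (simp add: reg_def r_def D_def)
   then show ?thesis using n False by (simp add: field_simps)
  qed simp
 qed
 have eq: "F * (E - fps_const (f z0)) * fps_X = fps_const (r * D) * fps_X - fps_const r * (E - fps_const (f z0))"
 proof (rule fps_ext)
  fix n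
  have "(deriv ^^ n) (%w. reg_ext z0 (z0 + w) * (f (z0 + w) - f z0) * w) 0 = (deriv ^^ n) (%w. r * D * w - r * (f (z0 + w) - f z0)) 0"
   by (rule higher_deriv_cong_ev[OF ev refl])
  then show "fps_nth (F * (E - fps_const (f z0)) * fps_X) n = fps_nth (fps_const (r * D) * fps_X - fps_const r * (E - fps_const (f z0))) n"
   using fps_nth_fps_expansion[OF l, of n] fps_nth_fps_expansion[OF rr, of n] by simp
 qed
 have E0: "fps_nth E 0 = f z0" "fps_nth E 1 = D" using E(2)[of 0] E(2)[of 1] by (simp_all add: D_def)
 define E2 E3 where "E2 = fps_nth E 2" and "E3 = fps_nth E 3"
 have "fps_nth (F * (E - fps_const (f z0)) * fps_X) 2 = fps_nth (fps_const (r * D) * fps_X - fps_const r * (E - fps_const (f z0))) 2"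
  using eq by simp
 then have c2: "fps_nth F 0 * D = - (r * E2)"
  using E0 by (simp add: numeral_2_eq_2 fps_mult_nth E2_def)
 have "fps_nth (F * (E - fps_const (f z0)) * fps_X) 3 = fps_nth (fps_const (r * D) * fps_X - fps_const r * (E - fps_const (f z0))) 3"
  using eq by simp
 then have c3: "fps_nth F 0 * E2 + fps_nth F 1 * D = - (r * E3)"
  using E0 by (simp add: numeral_3_eq_3 numeral_2_eq_2 fps_mult_nth E2_def E3_def)
 have E2: "E2 = pre_schwarzian z0 * D / 2"
  using E(2)[of 2] D by (simp add: E2_def pre_schwarzian_def D_def numeral_2_eq_2)
 have E3: "E3 = (deriv ^^ 3) f z0 / 6" using E(2)[of 3] by (simp add: E3_def fact_numeral)
 have F0: "fps_nth F 0 = - (r * pre_schwarzian z0 / 2)"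
 proof -
  have "fps_nth F 0 = - (r * E2) / D" unfolding c2[symmetric] using D by simp
  then show ?thesis unfolding E2 using D by simp
 qed
 have "fps_nth F 1 = r * ((pre_schwarzian z0)\<^sup>2 / 4 - (deriv ^^ 3) f z0 / (6 * D))"
 proof -
  have "fps_nth F 1 * D = - (r * E3) - fps_nth F 0 * E2" using c3 by (simp add: algebra_simps)
  then have "fps_nth F 1 = (- (r * E3) - fps_nth F 0 * E2) / D" using D by (simp add: field_simps)
  then show ?thesis unfolding F0 E2 E3 using D by (simp add: field_simps power2_eq_square)
 qed
 with F0 F show ?thesis using that by (simp add: r_def D_def)
qed

lemma f_deriv_holomorphic: "deriv f holomorphic_on ball 0 1 - {a}" "deriv (deriv f) holomorphic_on ball 0 1 - {a}"
 using holomorphic_deriv[OF f_holomorphic open_domain] holomorphic_deriv[OF holomorphic_deriv[OF f_holomorphic open_domain] open_domain] by auto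

text \<open>With T the pre-Schwarzian, T' - T^2/2 is the Schwarzian derivative, that is -6/r times
  the coefficient of order 1; this coefficient is at most 2 k / r.\<close>

lemma pre_schwarzian_deriv:
 assumes z0: "z0 \<in> ball 0 1 - {a}"
 obtains d where "(pre_schwarzian has_field_derivative d) (at z0)"
  "cmod (d - (pre_schwarzian z0)\<^sup>2 / 2) <= 12 * k / (1 - cmod z0)\<^sup>2"
proof -
 have r: "0 < 1 - cmod z0" by (rule r_pos[OF z0])
 obtain F where F: "(%w. reg_ext z0 (z0 + w)) has_fps_expansion F"
  "fps_nth F 1 = of_real (1 - cmod z0) * ((pre_schwarzian z0)\<^sup>2 / 4 - (deriv ^^ 3) f z0 / (6 * deriv f z0))"
  by (rule reg_expansion[OF z0]) blast
 note nz = f_deriv_nonzero[OF z0]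
 have d1: "(deriv f has_field_derivative deriv (deriv f) z0) (at z0)"
  by (rule holomorphic_derivI[OF f_deriv_holomorphic(1) open_domain z0])
 have d2: "(deriv (deriv f) has_field_derivative (deriv ^^ 3) f z0) (at z0)"
  using holomorphic_derivI[OF f_deriv_holomorphic(2) open_domain z0] by (simp add: numeral_3_eq_3)
 have "((%z. deriv (deriv f) z / deriv f z) has_field_derivative
   ((deriv ^^ 3) f z0 * deriv f z0 - deriv (deriv f) z0 * deriv (deriv f) z0) / (deriv f z0 * deriv f z0)) (at z0)"
  by (rule DERIV_divide[OF d2 d1 nz])
 then have d: "(pre_schwarzian has_field_derivative (deriv ^^ 3) f z0 / deriv f z0 - (pre_schwarzian z0)\<^sup>2) (at z0)"
  using nz by (simp add: pre_schwarzian_def[abs_def] diff_divide_distrib power2_eq_square)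
 define r where "r = cx (1 - cmod z0)"
 have r0: "r ~= 0" using r by (simp add: r_def del: of_real_diff)
 have eq: "(deriv ^^ 3) f z0 / deriv f z0 - (pre_schwarzian z0)\<^sup>2 - (pre_schwarzian z0)\<^sup>2 / 2 = - (6 / r * fps_nth F 1)"
  unfolding F(2) r_def[symmetric] using r0 nz by (simp add: field_simps)
 have "cmod (fps_nth F 1) * (1 - cmod z0) ^ 1 <= 2 * k" by (rule reg_coefficient_bounds(1)[OF z0 F(1)]) simp
 then have "cmod (fps_nth F 1) <= 2 * k / (1 - cmod z0)" using r by (simp add: field_simps)
 then have "6 / (1 - cmod z0) * cmod (fps_nth F 1) <= 6 / (1 - cmod z0) * (2 * k / (1 - cmod z0))"
  using r by (intro mult_left_mono) auto
 then have "cmod ((deriv ^^ 3) f z0 / deriv f z0 - (pre_schwarzian z0)\<^sup>2 - (pre_schwarzian z0)\<^sup>2 / 2) <= 12 * k / (1 - cmod z0)\<^sup>2"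
  unfolding eq norm_minus_cancel norm_mult norm_divide r_def norm_of_real using r by (simp add: power2_eq_square)
 with d show ?thesis using that by blast
qed

end

locale normalized_beltrami_solution = beltrami_solution +
 assumes a0: "a ~= 0" and norm1: "deriv f 0 = 1" and norm2: "(deriv ^^ 2) f 0 = 0"
  and pole: "a \<in> ball 0 1 ==> filterlim f at_infinity (at a)"
begin

lemma pre_schwarzian_0: "pre_schwarzian 0 = 0"
 using norm2 by (simp add: pre_schwarzian_def numeral_2_eq_2)

text \<open>The Schwarzian derivative is of size \<open>k / (1 - |z|)\<^sup>2\<close>, and along a radius \<open>2 \<beta> / (1 - |z|)\<close>
 is a supersolution of the Riccati equation for the pre-Schwarzian.\<close>

lemma pre_schwarzian_radial_bound:
 assumes u: "cmod u = 1" and x: "0 <= x" "x < 1" and av: "!!s. 0 <= s ==> s <= x ==> of_real s * u ~= a"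
  and \<beta>: "0 < \<beta>" "12 * k <= \<beta>" "\<beta> <= 1 / 4"
 shows "cmod (pre_schwarzian (of_real x * u)) * (1 - x) <= 2 * \<beta>"
proof (rule ccontr)
 assume neg: "\<not> ?thesis"
 define y where "y s = pre_schwarzian (of_real s * u)" for s
 have in_d: "of_real s * u \<in> ball 0 1 - {a}" if "0 <= s" "s <= x" for s
  using av[OF that] that x u by (simp add: norm_mult)
 have yd: "\<exists>d. (y has_vector_derivative d) (at s) \<and> cmod (d / u - (y s)\<^sup>2 / 2) <= 12 * k / (1 - s)\<^sup>2" if s: "0 <= s" "s <= x" for s
 proof -
  obtain d where d: "(pre_schwarzian has_field_derivative d) (at (of_real s * u))"
   "cmod (d - (pre_schwarzian (of_real s * u))\<^sup>2 / 2) <= 12 * k / (1 - cmod (of_real s * u))\<^sup>2"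
   by (rule pre_schwarzian_deriv[OF in_d[OF s]]) blast
  have "((%s. cx s * u) has_vector_derivative u) (at s)"
   unfolding has_vector_derivative_def by (auto intro!: derivative_eq_intros simp: scaleR_conv_of_real)
  from field_vector_diff_chain_at[OF this d(1)] have "(y has_vector_derivative u * d) (at s)"
   by (simp add: y_def[abs_def] o_def)
  moreover have "u ~= 0" using u by auto
  moreover have "cmod (of_real s * u) = s" using u s by (simp add: norm_mult)
  ultimately show ?thesis using d(2) by (intro exI[of _ "u * d"]) (auto simp: y_def)
 qed
 have yc: "continuous_on {0..x} y"
  using yd by (intro continuous_at_imp_continuous_on ballI) (metis atLeastAtMost_iff has_vector_derivative_continuous)
 \<comment> \<open>The set where the strict bound fails. On the interval before its least point s
   the strict bound holds.\<close>
 define B where "B = {s \<in> {0..x}. 2 * \<beta> <= cmod (y s) * (1 - s)}"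
 have Bc: "compact B"
 proof -
  have "closed B" unfolding B_def
   by (intro continuous_on_closed_Collect_le continuous_intros yc)
  moreover have "bounded B" by (rule bounded_subset[of "{0..x}"]) (auto simp: B_def)
  ultimately show ?thesis by (simp add: compact_eq_bounded_closed)
 qed
 have xB: "x \<in> B" using neg x by (auto simp: B_def y_def)
 then obtain s where s: "s \<in> B" "!!t. t \<in> B ==> s <= t" using compact_attains_inf[OF Bc] by blast
 have s01: "0 <= s" "s <= x" "s < 1" and ys: "2 * \<beta> <= cmod (y s) * (1 - s)" using s(1) x by (auto simp: B_def)
 have y0: "y 0 = 0" using pre_schwarzian_0 by (simp add: y_def)
 have s0: "0 < s" using ys y0 s01 \<beta>(1) by (cases "s = 0") auto
 have below: "cmod (y t) * (1 - t) < 2 * \<beta>" if "0 <= t" "t < s" for t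
  using s(2)[of t] that s01 by (auto simp: B_def not_le[symmetric])
 have "\<forall>t. \<exists>d. 0 <= t --> t <= x --> (y has_vector_derivative d) (at t) \<and> cmod (d / u - (y t)\<^sup>2 / 2) <= 12 * k / (1 - t)\<^sup>2"
  using yd by blast
 from choice[OF this] obtain y' where y': "!!t. 0 <= t ==> t <= x ==> (y has_vector_derivative y' t) (at t)"
  "!!t. 0 <= t ==> t <= x ==> cmod (y' t / u - (y t)\<^sup>2 / 2) <= 12 * k / (1 - t)\<^sup>2" by blast
 \<comment> \<open>Integrating the Riccati inequality from the value 0 at the origin up to s yields
   the constant 3/2 instead of 2, which contradicts the choice of s.\<close>
 have "norm (y s - y 0) <= 3 / 2 * \<beta> / (1 - s) - 3 / 2 * \<beta> / (1 - 0)"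
 proof (rule differentiable_bound_general[OF s0, where f' = y' and \<phi>' = "%t. 3 / 2 * \<beta> / (1 - t)\<^sup>2"])
  show "continuous_on {0..s} y" by (rule continuous_on_subset[OF yc]) (use s01 in auto)
  show "continuous_on {0..s} (%t. 3 / 2 * \<beta> / (1 - t))" using s01 by (intro continuous_intros) auto
  fix t assume t: "0 < t" "t < s"
  then have t1: "0 <= t" "t <= x" "0 < 1 - t" using s01 by auto
  show "(y has_vector_derivative y' t) (at t)" by (rule y'(1)[OF t1(1,2)])
  show "((%t. 3 / 2 * \<beta> / (1 - t)) has_vector_derivative 3 / 2 * \<beta> / (1 - t)\<^sup>2) (at t)"
   by (rule inverse_distance_derivative) (use t1 in simp)
  have yt: "cmod (y t) <= 2 * \<beta> / (1 - t)" using below[of t] t t1 by (simp add: field_simps)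
  have "cmod (y' t / u) <= cmod (y' t / u - (y t)\<^sup>2 / 2) + cmod ((y t)\<^sup>2 / 2)"
   using norm_triangle_ineq[of "y' t / u - (y t)\<^sup>2 / 2" "(y t)\<^sup>2 / 2"] by simp
  also have "\<dots> <= 12 * k / (1 - t)\<^sup>2 + (2 * \<beta> / (1 - t))\<^sup>2 / 2"
   using power_mono[OF yt norm_ge_zero, of 2] y'(2)[OF t1(1,2)] by (simp add: norm_divide norm_power)
  also have "\<dots> = (12 * k + 2 * \<beta> * \<beta>) / (1 - t)\<^sup>2"
   by (simp add: power_divide power_mult_distrib add_divide_distrib power2_eq_square[of \<beta>])
  also have "\<dots> <= (3 / 2 * \<beta>) / (1 - t)\<^sup>2"
  proof (rule divide_right_mono)
   \<comment> \<open>Half the square of 2 \<beta> is 2 \<beta>^2, at most \<beta>/2 because \<beta>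
     <= 1/4; the Schwarzian contributes at most \<beta>.\<close>
   have "2 * \<beta> * \<beta> <= 2 * \<beta> * (1 / 4)" using \<beta> by (intro mult_left_mono) auto
   then show "12 * k + 2 * \<beta> * \<beta> <= 3 / 2 * \<beta>" using \<beta> by linarith
  qed simp
  finally show "norm (y' t) <= 3 / 2 * \<beta> / (1 - t)\<^sup>2" using u by (simp add: norm_divide)
 qed
 also have "\<dots> < 3 / 2 * \<beta> / (1 - s)" using \<beta> by simp
 finally have "cmod (y s) * (1 - s) < 3 / 2 * \<beta>" using s01 by (simp add: y0 field_simps)
 then show False using ys \<beta> by linarith
qed

end

locale small_beltrami_solution = normalized_beltrami_solution +
 assumes k_small: "48 * k <= 1"
begin

text \<open>Along the radius |f'|^2 (1 - s) has derivative at most |f'|^2 (2 |T| (1 - s) - 1) with T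
  the pre-Schwarzian, so it never exceeds its initial value 1. This growth of order 1/2 is what
  makes (1 - |z|) f' tend to zero at the circle.\<close>

lemma deriv_radial_bound:
 assumes u: "cmod u = 1" and x: "0 <= x" "x < 1" and av: "!!s. 0 <= s ==> s <= x ==> of_real s * u ~= a"
 shows "(cmod (deriv f (of_real x * u)))\<^sup>2 * (1 - x) <= 1"
proof -
 define g where "g s = deriv f (of_real s * u)" for s
 define g' where "g' s = u * deriv (deriv f) (of_real s * u)" for s
 have in_d: "of_real s * u \<in> ball 0 1 - {a}" if "0 <= s" "s <= x" for s
  using av[OF that] that x u by (simp add: norm_mult)
 have gd: "(g has_vector_derivative g' s) (at s)" if s: "0 <= s" "s <= x" for s
 proof -
  have d: "(deriv f has_field_derivative deriv (deriv f) (of_real s * u)) (at (of_real s * u))"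
   by (rule holomorphic_derivI[OF f_deriv_holomorphic(1) open_domain in_d[OF s]])
  have "((%s. cx s * u) has_vector_derivative u) (at s)"
   unfolding has_vector_derivative_def by (auto intro!: derivative_eq_intros simp: scaleR_conv_of_real)
  from field_vector_diff_chain_at[OF this d] show ?thesis
   by (simp add: g_def[abs_def] g'_def o_def)
 qed
 define h where "h s = (cmod (g s))\<^sup>2 * (1 - s)" for s
 have hd: "(h has_real_derivative (2 * (g s \<bullet> g' s)) * (1 - s) - (cmod (g s))\<^sup>2) (at s)" if s: "0 <= s" "s <= x" for s
 proof -
  have "((%s. g s \<bullet> g s) has_derivative (%t. g s \<bullet> (t *\<^sub>R g' s) + (t *\<^sub>R g' s) \<bullet> g s)) (at s)"
   using gd[OF s] by (intro has_derivative_inner) (simp_all add: has_vector_derivative_def)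
  then have "((%s. (cmod (g s))\<^sup>2) has_real_derivative 2 * (g s \<bullet> g' s)) (at s)"
   unfolding has_field_derivative_def power2_norm_eq_inner
   by (rule has_derivative_eq_rhs) (auto simp: fun_eq_iff inner_commute)
  moreover have "((%s. 1 - s) has_real_derivative - 1) (at s)" by (auto intro!: derivative_eq_intros)
  ultimately have "((%s. (cmod (g s))\<^sup>2 * (1 - s)) has_real_derivative 2 * (g s \<bullet> g' s) * (1 - s) + - 1 * (cmod (g s))\<^sup>2) (at s)"
   by (rule DERIV_mult)
  then show ?thesis unfolding h_def[abs_def] by simp
 qed
 have "h x <= h 0"
 proof (rule DERIV_nonpos_imp_nonincreasing[OF x(1)])
  fix s assume s: "0 <= s" "s <= x"
  \<comment> \<open>The choice \<beta> = 1/4 gives the bound 1/2, just enough for the sign of the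
    derivative.\<close>
  have T: "cmod (pre_schwarzian (of_real s * u)) * (1 - s) <= 2 * (1 / 4)"
   by (rule pre_schwarzian_radial_bound[OF u]) (use s x k_small av in auto)
  have nz: "deriv f (of_real s * u) ~= 0" by (rule f_deriv_nonzero[OF in_d[OF s]])
  have g's: "cmod (g' s) = cmod (pre_schwarzian (of_real s * u)) * cmod (g s)"
   using nz u by (simp add: g'_def g_def pre_schwarzian_def norm_mult norm_divide)
  have "(2 * (g s \<bullet> g' s)) * (1 - s) <= 2 * (cmod (g s) * cmod (g' s)) * (1 - s)"
   using norm_cauchy_schwarz[of "g s" "g' s"] s x by (intro mult_right_mono) auto
  also have "\<dots> = 2 * (cmod (g s))\<^sup>2 * (cmod (pre_schwarzian (of_real s * u)) * (1 - s))"
   unfolding g's by (simp add: power2_eq_square)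
  also have "\<dots> <= 2 * (cmod (g s))\<^sup>2 * (2 * (1 / 4))" by (intro mult_left_mono T) auto
  finally have "(2 * (g s \<bullet> g' s)) * (1 - s) - (cmod (g s))\<^sup>2 <= 0" by simp
  with hd[OF s] show "\<exists>y. (h has_real_derivative y) (at s) \<and> y <= 0" by blast
 qed
 then show ?thesis using norm1 by (simp add: h_def g_def)
qed

text \<open>Along the radius towards \<open>a\<close> the bound on f' holds up to \<open>a\<close>,
  with 1 - s at least 1 - |a| > 0. So f stays bounded on that segment, against
  \<open>pole\<close>.\<close>

lemma no_pole: "a \<notin> ball 0 1"
proof
 assume a1: "a \<in> ball 0 1"
 define u where "u = a / of_real (cmod a)"
 have na: "0 < cmod a" "cmod a < 1" using a0 a1 by auto
 have u: "cmod u = 1" "a = of_real (cmod a) * u" using na by (auto simp: u_def norm_divide)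
 have u0: "u ~= 0" using u by auto
 have av: "of_real s * u ~= a" if "s < cmod a" "0 <= s" for s
 proof
  assume "of_real s * u = a"
  then have "cmod (of_real s * u) = cmod a" by simp
  then show False using that u(1) by (simp add: norm_mult)
 qed
 have db: "cmod (deriv f (of_real s * u)) <= 1 / (1 - cmod a) + 1" if s: "0 <= s" "s < cmod a" for s
 proof -
  have "(cmod (deriv f (of_real s * u)))\<^sup>2 * (1 - s) <= 1"
   by (rule deriv_radial_bound[OF u(1)]) (use s na av in auto)
  moreover have "1 - cmod a <= 1 - s" using s by simp
  ultimately have "(cmod (deriv f (of_real s * u)))\<^sup>2 * (1 - cmod a) <= 1"
   by (meson mult_left_mono order_trans zero_le_power2)
  then have "(cmod (deriv f (of_real s * u)))\<^sup>2 <= 1 / (1 - cmod a)" using na by (simp add: field_simps)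
  moreover have "cmod (deriv f (of_real s * u)) <= (cmod (deriv f (of_real s * u)))\<^sup>2 + 1"
  proof -
   define D where "D = cmod (deriv f (of_real s * u))"
   have "0 <= D" "2 * D * 1 <= D\<^sup>2 + 1\<^sup>2" by (simp add: D_def, rule sum_squares_bound)
   then show ?thesis unfolding D_def[symmetric] by simp
  qed
  ultimately show ?thesis by linarith
 qed
 define C where "C = 1 / (1 - cmod a) + 1"
 have fb: "cmod (f (of_real s * u)) <= cmod (f 0) + C" if s: "0 < s" "s < cmod a" for s
 proof -
  have in_d: "of_real t * u \<in> ball 0 1 - {a}" if "0 <= t" "t <= s" for t
   using av[of t] that s na u by (simp add: norm_mult)
  have "cmod (f (of_real s * u) - f (of_real 0 * u)) <= C * s - C * 0"
  proof (rule differentiable_bound_general[OF s(1), where f' = "%t. u * deriv f (of_real t * u)" and \<phi>' = "%t. C"])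
   show "continuous_on {0..s} (%t. f (of_real t * u))"
   proof (rule continuous_on_compose2[OF holomorphic_on_imp_continuous_on[OF f_holomorphic]])
    show "(%t. of_real t * u) ` {0..s} \<subseteq> ball 0 1 - {a}" by (rule image_subsetI, rule in_d) auto
   qed (intro continuous_intros)
   fix t assume t: "0 < t" "t < s"
   have d: "(f has_field_derivative deriv f (of_real t * u)) (at (of_real t * u))"
    by (rule holomorphic_derivI[OF f_holomorphic open_domain in_d]) (use t in auto)
   have "((%s. cx s * u) has_vector_derivative u) (at t)"
    unfolding has_vector_derivative_def by (auto intro!: derivative_eq_intros simp: scaleR_conv_of_real)
   from field_vector_diff_chain_at[OF this d]
   show "((%t. f (of_real t * u)) has_vector_derivative u * deriv f (of_real t * u)) (at t)" by (simp add: o_def)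
   show "((%t. C * t) has_vector_derivative C) (at t)"
    unfolding has_real_derivative_iff_has_vector_derivative[symmetric] by (auto intro!: derivative_eq_intros)
   show "norm (u * deriv f (of_real t * u)) <= C"
    using db[of t] t s u(1) by (simp add: norm_mult C_def)
  qed (auto intro!: continuous_intros)
  also have "\<dots> <= C"
  proof -
   have "0 <= C" using na by (simp add: C_def)
   then show ?thesis using s na mult_left_mono[of s 1 C] by simp
  qed
  finally show ?thesis using norm_triangle_ineq2[of "f (of_real s * u)" "f 0"] by simp
 qed
 have "filterlim (%n. of_real (cmod a * (1 - 1 / real (n + 2))) * u) (at a) sequentially"
  unfolding filterlim_at
 proof (intro conjI always_eventually allI)
  have "(%n. of_real (cmod a * (1 - 1 / real (n + 2))) * u) \<longlonglongrightarrow> of_real (cmod a * (1 - 0)) * u"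
   by (intro tendsto_intros LIMSEQ_ignore_initial_segment[OF lim_1_over_n])
  then show "(%n. of_real (cmod a * (1 - 1 / real (n + 2))) * u) \<longlonglongrightarrow> a" using u(2) by simp
  show "of_real (cmod a * (1 - 1 / real (n + 2))) * u ~= a" for n
   by (rule av) (use na in \<open>auto simp: field_simps\<close>)
 qed simp
 from filterlim_compose[OF pole[OF a1] this]
 have "filterlim (%n. f (of_real (cmod a * (1 - 1 / real (n + 2))) * u)) at_infinity sequentially" .
 then have "\<forall>\<^sub>F n in sequentially. cmod (f 0) + C + 1 <= cmod (f (of_real (cmod a * (1 - 1 / real (n + 2))) * u))"
  using filterlim_at_infinity[of 0] by (auto simp: filterlim_at_infinity_conv_norm_at_top filterlim_at_top)
 then obtain n where "cmod (f 0) + C + 1 <= cmod (f (of_real (cmod a * (1 - 1 / real (n + 2))) * u))"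
  by (auto simp: eventually_sequentially)
 moreover have "cmod (f (of_real (cmod a * (1 - 1 / real (n + 2))) * u)) <= cmod (f 0) + C"
 proof (rule fb)
  have "0 < 1 - 1 / real (n + 2)" "1 - 1 / real (n + 2) < 1" by auto
  then show "0 < cmod a * (1 - 1 / real (n + 2))" "cmod a * (1 - 1 / real (n + 2)) < cmod a"
   using na mult_strict_left_mono[of "1 - 1 / real (n + 2)" 1 "cmod a"] by simp_all
 qed
 ultimately show False by linarith
qed

lemma disc_domain: "ball 0 1 - {a} = ball 0 1"
 using no_pole by auto

lemma polar_point:
 assumes "z \<in> ball 0 1"
 obtains u where "cmod u = 1" "z = of_real (cmod z) * u" "!!s. 0 <= s ==> s <= cmod z ==> of_real s * u ~= a"
proof -
 define u where "u = (if z = 0 then 1 else z / of_real (cmod z))"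
 have u: "cmod u = 1" "z = of_real (cmod z) * u" by (auto simp: u_def norm_divide)
 have "of_real s * u ~= a" if "0 <= s" "s <= cmod z" for s
 proof
  assume "of_real s * u = a"
  then have "cmod a = s" using u(1) that by (metis abs_of_nonneg mult.right_neutral norm_mult norm_of_real)
  then show False using no_pole assms that by auto
 qed
 with u show ?thesis using that by blast
qed

lemma pre_schwarzian_bound:
 assumes z: "z \<in> ball 0 1"
 shows "cmod (pre_schwarzian z) * (1 - cmod z) <= 24 * k"
proof -
 obtain u where u: "cmod u = 1" "z = of_real (cmod z) * u" "!!s. 0 <= s ==> s <= cmod z ==> of_real s * u ~= a"
  by (rule polar_point[OF z]) blast
 have b: "cmod (pre_schwarzian z) * (1 - cmod z) <= 2 * \<beta>" if "0 < \<beta>" "12 * k <= \<beta>" "\<beta> <= 1 / 4" for \<beta>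
  using pre_schwarzian_radial_bound[OF u(1) _ _ u(3) that, of "cmod z"] z u(2) by auto
 show ?thesis
 \<comment> \<open>The natural choice is \<beta> = 12 k, but \<beta> has to be positive; for k = 0
   it is sent to zero instead.\<close>
 proof (cases "k = 0")
  case False
  then show ?thesis using b[of "12 * k"] k0 k_small by simp
 next
  case True
  have "cmod (pre_schwarzian z) * (1 - cmod z) <= 0"
  proof (rule field_le_epsilon)
   fix e :: real assume e: "0 < e"
   show "cmod (pre_schwarzian z) * (1 - cmod z) <= 0 + e"
   proof -
    have m: "min (e / 2) (1 / 4) <= e / 2" "min (e / 2) (1 / 4) <= 1 / 4" "0 < min (e / 2) (1 / 4)" using e by auto
    show ?thesis using b[OF m(3) _ m(2)] m True by linarith
   qed
  qed
  then show ?thesis using True by simp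
 qed
qed

lemma deriv_bound:
 assumes z: "z \<in> ball 0 1"
 shows "(cmod (deriv f z))\<^sup>2 * (1 - cmod z) <= 1"
proof -
 obtain u where u: "cmod u = 1" "z = of_real (cmod z) * u" "!!s. 0 <= s ==> s <= cmod z ==> of_real s * u ~= a"
  by (rule polar_point[OF z]) blast
 then show ?thesis using deriv_radial_bound[OF u(1) _ _ u(3), of "cmod z"] z by auto
qed

text \<open>|f''| is the product of the pre-Schwarzian, at most 24 k / (1 - t), and |f'|, at most 1
  / (1 - t). Integrating 24 k / (1 - t)^2 along the radius gives the bound.\<close>

lemma deriv_minus_one_bound:
 assumes z: "z \<in> ball 0 1"
 shows "cmod (deriv f z - 1) * (1 - cmod z) <= 24 * k"
proof (cases "z = 0")
 case True
 then show ?thesis using norm1 k0 by simp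
next
 case False
 obtain u where u: "cmod u = 1" "z = of_real (cmod z) * u" "!!s. 0 <= s ==> s <= cmod z ==> of_real s * u ~= a"
  by (rule polar_point[OF z]) blast
 define x where "x = cmod z"
 have x: "0 < x" "x < 1" using z False by (auto simp: x_def)
 have in_d: "of_real t * u \<in> ball 0 1 - {a}" if "0 <= t" "t <= x" for t
  using u(3)[of t] that x u(1) by (simp add: norm_mult x_def)
 have "norm (deriv f (of_real x * u) - deriv f (of_real 0 * u)) <= 24 * k / (1 - x) - 24 * k / (1 - 0)"
 proof (rule differentiable_bound_general[OF x(1), where f' = "%t. u * deriv (deriv f) (of_real t * u)" and \<phi>' = "%t. 24 * k / (1 - t)\<^sup>2"])
  show "continuous_on {0..x} (%t. deriv f (of_real t * u))"
  proof (rule continuous_on_compose2[OF holomorphic_on_imp_continuous_on[OF f_deriv_holomorphic(1)]])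
   show "(%t. of_real t * u) ` {0..x} \<subseteq> ball 0 1 - {a}" by (rule image_subsetI, rule in_d) auto
  qed (intro continuous_intros)
  show "continuous_on {0..x} (%t. 24 * k / (1 - t))" using x by (intro continuous_intros) auto
  fix t assume t: "0 < t" "t < x"
  have d: "(deriv f has_field_derivative deriv (deriv f) (of_real t * u)) (at (of_real t * u))"
   by (rule holomorphic_derivI[OF f_deriv_holomorphic(1) open_domain in_d]) (use t in auto)
  have "((%s. cx s * u) has_vector_derivative u) (at t)"
   unfolding has_vector_derivative_def by (auto intro!: derivative_eq_intros simp: scaleR_conv_of_real)
  from field_vector_diff_chain_at[OF this d]
  show "((%t. deriv f (of_real t * u)) has_vector_derivative u * deriv (deriv f) (of_real t * u)) (at t)" by (simp add: o_def)
  show "((%t. 24 * k / (1 - t)) has_vector_derivative 24 * k / (1 - t)\<^sup>2) (at t)"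
   by (rule inverse_distance_derivative) (use t x in simp)
  have tz: "of_real t * u \<in> ball 0 1" "cmod (of_real t * u) = t" using t x u(1) by (auto simp: norm_mult)
  define D where "D = cmod (deriv f (of_real t * u))"
  have "D\<^sup>2 * (1 - t) <= 1" using deriv_bound[OF tz(1)] tz(2) by (simp add: D_def)
  then have "D\<^sup>2 * (1 - t) * (1 - t) <= 1 * 1" using t x by (intro mult_mono) auto
  then have "(D * (1 - t))\<^sup>2 <= 1\<^sup>2" by (simp add: power2_eq_square mult_ac)
  then have D1: "D * (1 - t) <= 1" by (rule power2_le_imp_le) simp
  have nz: "deriv f (of_real t * u) ~= 0" by (rule f_deriv_nonzero[OF in_d]) (use t in auto)
  have "cmod (u * deriv (deriv f) (of_real t * u)) = cmod (pre_schwarzian (of_real t * u)) * D"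
   using nz u(1) by (simp add: pre_schwarzian_def norm_mult norm_divide D_def)
  also have "\<dots> = (cmod (pre_schwarzian (of_real t * u)) * (1 - t)) * (D * (1 - t)) / (1 - t)\<^sup>2"
   using t x by (simp add: power2_eq_square)
  also have "\<dots> <= (24 * k) * 1 / (1 - t)\<^sup>2"
   using pre_schwarzian_bound[OF tz(1)] tz(2) D1 k0 t x
   by (intro divide_right_mono mult_mono[where b = "24 * k" and d = 1]) (auto simp: D_def)
  finally show "norm (u * deriv (deriv f) (of_real t * u)) <= 24 * k / (1 - t)\<^sup>2" by simp
 qed
 then have "cmod (deriv f z - 1) <= 24 * k / (1 - x)" using u(2) norm1 k0 by (simp add: x_def)
 then show ?thesis using x by (simp add: x_def[symmetric] field_simps)
qed

end

section \<open>Covariant differential polynomials\<close>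

text \<open>Separates the polynomial from the function, so that it can be evaluated at jets that are
  prescribed at will.\<close>

definition jeval :: "diff_poly => (nat => complex) => complex" where
 "jeval P x = (\<Sum>e \<in> keys P. lookup P e *
    (\<Prod>k \<in> keys e. x k ^ lookup e k))"

lemma diff_op_jeval: "diff_op P f z = jeval P (jet f z)"
 by (simp add: diff_op_def jeval_def)

lemma jeval_cong:
 assumes "diff_poly_upto N P" "x 1 = y 1" "!!k. 2 <= k ==> k <= N ==> x k = y k"
 shows "jeval P x = jeval P y"
 unfolding jeval_def
proof (intro sum.cong refl arg_cong2[where f = "(*)"] prod.cong)
 fix e k assume e: "e \<in> keys P" "k \<in> keys e"
 then have "k = 1 \<or> (2 <= k \<and> k <= N)"
  using assms(1) unfolding diff_poly_upto_def by fastforce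
 then have "x k = y k" using assms(2,3) by auto
 then show "x k ^ lookup e k = y k ^ lookup e k" by simp
qed

text \<open>Induction on the variables: the monomials sharing one exponent of the new variable have
  a nonzero sum at some point by induction, which makes a one-variable polynomial nonzero.
  Coordinates are kept nonzero because one of them will be inverted to become f'.\<close>

lemma multivariate_nonvanishing:
 fixes c :: "'a => complex" and ex :: "'a => nat => nat"
 assumes "finite I" "finite K" "K ~= {}" "!!a. a \<in> K ==> c a ~= 0"
  "!!a b. a \<in> K ==> b \<in> K ==> (!!i. i \<in> I ==> ex a i = ex b i) ==> a = b"
 obtains y where "!!i. y i ~= 0" "(\<Sum>a\<in>K. c a * (\<Prod>i\<in>I. y i ^ ex a i)) ~= 0"
proof -
 have "\<exists>y. (\<forall>i. y i ~= 0) \<and> (\<Sum>a\<in>K. c a * (\<Prod>i\<in>I. y i ^ ex a i)) ~= 0"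
  using assms
 proof (induction I arbitrary: K rule: finite_induct)
  case empty
  then obtain a where "a \<in> K" by blast
  with empty.prems(4) have "K = {a}" by auto
  with empty.prems(3)[of a] \<open>a \<in> K\<close> show ?case by (intro exI[of _ "%_. 1"]) auto
 next
  case (insert j I)
  obtain a0 where a0: "a0 \<in> K" using insert.prems(2) by blast
  define K' where "K' = {a \<in> K. ex a j = ex a0 j}"
  have "\<exists>y. (\<forall>i. y i ~= 0) \<and> (\<Sum>a\<in>K'. c a * (\<Prod>i\<in>I. y i ^ ex a i)) ~= 0"
  proof (rule insert.IH)
   show "finite K'" using insert.prems(1) by (simp add: K'_def)
   show "K' ~= {}" using a0 by (auto simp: K'_def)
   show "c a ~= 0" if "a \<in> K'" for a using insert.prems(3) that by (auto simp: K'_def)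
   fix a b assume ab: "a \<in> K'" "b \<in> K'" "!!i. i \<in> I ==> ex a i = ex b i"
   show "a = b"
   proof (rule insert.prems(4))
    show "a \<in> K" "b \<in> K" using ab by (auto simp: K'_def)
    show "ex a i = ex b i" if "i \<in> insert j I" for i
     using that ab by (auto simp: K'_def)
   qed
  qed
  then obtain y where y: "!!i. y i ~= 0" "(\<Sum>a\<in>K'. c a * (\<Prod>i\<in>I. y i ^ ex a i)) ~= 0" by blast
  define p where "p = (\<Sum>a\<in>K. monom (c a * (\<Prod>i\<in>I. y i ^ ex a i)) (ex a j))"
  have "coeff p (ex a0 j) = (\<Sum>a\<in>K. if ex a j = ex a0 j then c a * (\<Prod>i\<in>I. y i ^ ex a i) else 0)"
   by (simp add: p_def coeff_sum coeff_monom)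
  also have "\<dots> = (\<Sum>a\<in>K'. c a * (\<Prod>i\<in>I. y i ^ ex a i))"
   unfolding K'_def using insert.prems(1) by (simp add: sum.inter_filter)
  finally have "p ~= 0" using y(2) by auto
  then have "finite ({t. poly p t = 0} \<union> {0})" using poly_roots_finite by blast
  then obtain t where t: "t \<notin> {t. poly p t = 0} \<union> {0}"
   using ex_new_if_finite infinite_UNIV_char_0 by blast
  have "(\<Sum>a\<in>K. c a * (\<Prod>i\<in>insert j I. (y(j := t)) i ^ ex a i)) = poly p t"
   unfolding p_def poly_sum
  proof (intro sum.cong refl)
   fix a
   have "(\<Prod>i\<in>I. (y(j := t)) i ^ ex a i) = (\<Prod>i\<in>I. y i ^ ex a i)"
    using insert.hyps(2) by (intro prod.cong) auto
   then show "c a * (\<Prod>i\<in>insert j I. (y(j := t)) i ^ ex a i) = poly (monom (c a * (\<Prod>i\<in>I. y i ^ ex a i)) (ex a j)) t"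
    using insert.hyps by (simp add: poly_monom)
  qed
  with t y(1) show ?case by (intro exI[of _ "y(j := t)"]) auto
 qed
 then show ?thesis using that by blast
qed

lemma prod_keys_extend:
 assumes "finite I" "keys e \<subseteq> I"
 shows "(\<Prod>k \<in> keys e. x k ^ lookup e k) = (\<Prod>k\<in>I. (x k :: complex) ^ lookup e k)"
 by (rule prod.mono_neutral_left) (use assms in \<open>auto simp: in_keys_iff\<close>)

lemma keys_upto:
 assumes "diff_poly_upto N P" "e \<in> keys P"
 shows "keys e \<subseteq> insert 1 {2..N}"
 using assms by (auto simp: diff_poly_upto_def)

lemma higher_deriv_polynomial: "(deriv ^^ k) (poly p) = poly ((pderiv ^^ k) p)" for p :: "complex poly"
proof (induction k)
 case (Suc k)
 have "deriv (poly q) = poly (pderiv q)" for q :: "complex poly"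
  by (rule ext, rule DERIV_imp_deriv, rule poly_DERIV)
 with Suc show ?case by simp
qed simp

lemma coeff_higher_pderiv_0: "coeff ((pderiv ^^ k) p) 0 = fact k * coeff (p :: complex poly) k"
proof -
 have "coeff ((pderiv ^^ k) p) n = (fact (n + k) / fact n) * coeff p (n + k)" for n
 proof (induction k arbitrary: n)
  case (Suc k)
  have "coeff ((pderiv ^^ Suc k) p) n = of_nat (Suc n) * coeff ((pderiv ^^ k) p) (Suc n)"
   by (simp add: coeff_pderiv)
  also have "\<dots> = of_nat (Suc n) * (fact (Suc n + k) / fact (Suc n) * coeff p (Suc n + k))"
   by (simp only: Suc)
  also have "\<dots> = fact (n + Suc k) / fact n * coeff p (n + Suc k)"
   by (simp add: fact_Suc[of n] del: of_nat_Suc fact_Suc)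
  finally show ?case .
 qed simp
 from this[of 0] show ?thesis by simp
qed

lemma higher_deriv_polynomial_0: "(deriv ^^ k) (poly p) 0 = fact k * coeff p k" for p :: "complex poly"
 by (simp add: higher_deriv_polynomial poly_0_coeff_0 coeff_higher_pderiv_0)

lemma covariant_at:
 assumes "moebius_covariant m P" "f holomorphic_on D" "inj_on f D" "open D" "connected D"
  "a * d - b * c = 1" "c * z + d ~= 0" "moebius a b c d z \<in> D"
 shows "diff_op P (f \<circ> moebius a b c d) z = diff_op P f (moebius a b c d z) * deriv (moebius a b c d) z powi m"
 using assms unfolding moebius_covariant_def schlicht_on_def by blast

text \<open>The exponent of c by which the monomial scales when f (z) is replaced by f (c z): each
  k-th derivative gains c^k and each 1 / f' loses one factor c.\<close>

definition jet_weight :: "(nat \<Rightarrow>\<^sub>0 nat) => int" where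
 "jet_weight e = int (\<Sum>k \<in> keys e - {1}. k * lookup e k) - int (lookup e 1)"

definition jet_degree :: "(nat \<Rightarrow>\<^sub>0 nat) => nat" where
 "jet_degree e = (\<Sum>k \<in> keys e - {1}. lookup e k)"

lemma jet_monomial_scale:
 assumes c: "c ~= (0 :: complex)"
 shows "(\<Prod>k \<in> keys e. (if k = 1 then x 1 / c else c ^ k * x k) ^ lookup e k)
  = c powi jet_weight e * (\<Prod>k \<in> keys e. x k ^ lookup e k)"
proof -
 have *: "(\<Prod>k \<in> keys e. y k ^ lookup e k) =
  y 1 ^ lookup e 1 * (\<Prod>k \<in> keys e - {1}. y k ^ lookup e k)" for y :: "nat => complex"
 proof (cases "1 \<in> keys e")
  case True
  then show ?thesis by (subst prod.remove[of _ 1]) auto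
 next
  case False
  then show ?thesis by (simp add: in_keys_iff)
 qed
 have "(\<Prod>k \<in> keys e - {1}. (if k = 1 then x 1 / c else c ^ k * x k) ^ lookup e k) =
  (\<Prod>k \<in> keys e - {1}. c ^ (k * lookup e k) * x k ^ lookup e k)"
  by (intro prod.cong refl) (simp add: power_mult_distrib power_mult)
 also have "\<dots> = c ^ (\<Sum>k \<in> keys e - {1}. k * lookup e k) *
   (\<Prod>k \<in> keys e - {1}. x k ^ lookup e k)"
  by (simp add: prod.distrib power_sum)
 finally have eq: "(\<Prod>k \<in> keys e - {1}. (if k = 1 then x 1 / c else c ^ k * x k) ^ lookup e k) =
   c ^ (\<Sum>k \<in> keys e - {1}. k * lookup e k) *
   (\<Prod>k \<in> keys e - {1}. x k ^ lookup e k)" .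
 have w: "c powi jet_weight e = c ^ (\<Sum>k \<in> keys e - {1}. k * lookup e k) / c ^ lookup e 1"
  unfolding jet_weight_def using c by (subst power_int_diff) (simp_all only: power_int_of_nat, simp)
 show ?thesis
  unfolding *[of "%k. if k = 1 then x 1 / c else c ^ k * x k"] *[of x] eq w
  by (simp add: power_divide)
qed

text \<open>Under z -> 2 z a monomial is multiplied by 2 to its weight, and by covariance the whole
  operator by 2^m. Jets at 0 can be prescribed freely by a polynomial injective near 0, so a
  monomial of another weight would leave a nonzero polynomial that vanishes at all these
  jets.\<close>

lemma covariant_weight:
 assumes P: "diff_poly_upto N P" and cov: "moebius_covariant m P" and e: "e \<in> keys P"
 shows "jet_weight e = m"
proof (rule ccontr)
 assume ne: "jet_weight e ~= m"
 define K where "K = {e \<in> keys P. jet_weight e ~= m}"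
 define cc where "cc e = lookup P e * (2 powi jet_weight e - 2 powi m)" for e
 have fK: "finite K" "K ~= {}" using e ne by (auto simp: K_def)
 have ccn: "cc e ~= 0" if "e \<in> K" for e
 proof -
  have "(2::real) powi jet_weight e ~= 2 powi m"
   using that power_int_strict_increasing[of "jet_weight e" m "2::real"] power_int_strict_increasing[of m "jet_weight e" "2::real"]
   by (cases "jet_weight e" m rule: linorder_cases) (auto simp: K_def)
  then have "cx (2 powi jet_weight e) ~= cx (2 powi m)" unfolding of_real_eq_iff .
  then have "(2::complex) powi jet_weight e - 2 powi m ~= 0" by simp
  then show ?thesis using that by (simp add: cc_def K_def in_keys_iff)
 qed
 obtain y where y: "!!i. y i ~= 0" "(\<Sum>e\<in>K. cc e * (\<Prod>i\<in>insert 1 {2..N}. y i ^ lookup e i)) ~= 0"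
 proof (rule multivariate_nonvanishing[of "insert 1 {2..N}" K cc "%e. lookup e"])
  fix a b assume ab: "a \<in> K" "b \<in> K" "!!i. i \<in> insert 1 {2..N} ==> lookup a i = lookup b i"
  have "lookup a i = lookup b i" for i
  proof (cases "i \<in> insert 1 {2..N}")
   case False
   then have "i \<notin> keys a" "i \<notin> keys b"
    using ab(1,2) keys_upto[OF P, of a] keys_upto[OF P, of b] unfolding K_def by blast+
   then show ?thesis by (simp add: in_keys_iff)
  qed (rule ab(3))
  then show "a = b" by (simp add: poly_mapping_eq_iff fun_eq_iff)
 qed (use fK ccn in auto)
 \<comment> \<open>The jet of \<open>p\<close> at 0 is y. Entry 1 of a jet is 1 / f', which explains
   the inverse.\<close>
 define p where "p = (\<Sum>k\<in>insert 1 {2..N}. monom (if k = 1 then inverse (y 1) else y k / fact k) k)"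
 have pc: "coeff p k = (if k = 1 then inverse (y 1) else if 2 <= k \<and> k <= N then y k / fact k else 0)" for k
 proof -
  have "coeff p k = (\<Sum>j\<in>insert 1 {2..N}. if j = k then (if j = 1 then inverse (y 1) else y j / fact j) else 0)"
   by (simp add: p_def coeff_sum coeff_monom)
  also have "\<dots> = (if k \<in> insert 1 {2..N} then (if k = 1 then inverse (y 1) else y k / fact k) else 0)"
   by (subst sum.delta) auto
  finally show ?thesis by auto
 qed
 have j0: "jet (poly p) 0 1 = y 1" using higher_deriv_polynomial_0[of 1 p] by (simp add: jet_def pc)
 have jk: "jet (poly p) 0 k = y k" if "2 <= k" "k <= N" for k
  using that by (simp add: jet_def higher_deriv_polynomial_0 pc)
 have d0: "deriv (poly p) 0 ~= 0" using higher_deriv_polynomial_0[of 1 p] y(1)[of 1] by (simp add: pc)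
 obtain r where r: "r > 0" "inj_on (poly p) (ball 0 r)"
 proof (rule has_complex_derivative_locally_injective[of "poly p" UNIV 0])
  show "poly p holomorphic_on UNIV"
   by (auto simp: holomorphic_on_def field_differentiable_def intro: poly_DERIV has_field_derivative_at_within)
 qed (use d0 in auto)
 \<comment> \<open>The matrix with diagonal s, 1/s has determinant 1 and represents z -> 2
   z.\<close>
 define s where "s = cx (sqrt 2)"
 have s2: "s * s = 2" unfolding s_def by (simp flip: of_real_mult)
 have s0: "s ~= 0" using s2 by auto
 define M where "M = moebius s 0 0 (inverse s)"
 have M: "M = (%z. 2 * z)" unfolding M_def moebius_def using s0 s2 by (auto simp: fun_eq_iff field_simps)
 have dM: "deriv M 0 = 2" unfolding M by simp
 define q where "q = pcompose p [:0, 2:]"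
 have pq: "poly p \<circ> M = poly q" unfolding M q_def by (auto simp: fun_eq_iff poly_pcompose mult.commute)
 have qc: "coeff q k = 2 ^ k * coeff p k" for k unfolding q_def by (rule coeff_pcompose_linear)
 have cov': "diff_op P (poly p \<circ> M) 0 = diff_op P (poly p) (M 0) * deriv M 0 powi m"
  unfolding M_def
  by (rule covariant_at[OF cov _ r(2)]) (use r s0 in \<open>auto simp: moebius_def intro!: holomorphic_intros\<close>)
 have l: "diff_op P (poly p \<circ> M) 0 = jeval P (%k. if k = 1 then y 1 / 2 else 2 ^ k * y k)"
  unfolding pq diff_op_jeval
 proof (rule jeval_cong[OF P])
  show "jet (poly q) 0 1 = (if (1::nat) = 1 then y 1 / 2 else 2 ^ 1 * y 1)"
   using higher_deriv_polynomial_0[of 1 q] by (simp add: jet_def qc pc)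
  show "jet (poly q) 0 k = (if k = 1 then y 1 / 2 else 2 ^ k * y k)" if "2 <= k" "k <= N" for k
   using that by (simp add: jet_def higher_deriv_polynomial_0 qc pc)
 qed
 have r': "diff_op P (poly p) (M 0) = jeval P y"
  unfolding diff_op_jeval M by (rule jeval_cong[OF P]) (use j0 jk in auto)
 have "jeval P (%k. if k = 1 then y 1 / 2 else 2 ^ k * y k) = (\<Sum>e \<in> keys P. lookup P e *
   (2 powi jet_weight e * (\<Prod>k \<in> keys e. y k ^ lookup e k)))"
  unfolding jeval_def using jet_monomial_scale[where c = 2 and x = y] by simp
 moreover have "jeval P y * 2 powi m = (\<Sum>e \<in> keys P. lookup P e *
   (2 powi m * (\<Prod>k \<in> keys e. y k ^ lookup e k)))"
  unfolding jeval_def sum_distrib_right by (intro sum.cong refl) (simp add: mult_ac)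
 ultimately have "0 = (\<Sum>e \<in> keys P. lookup P e *
   (2 powi jet_weight e * (\<Prod>k \<in> keys e. y k ^ lookup e k))) -
   (\<Sum>e \<in> keys P. lookup P e *
   (2 powi m * (\<Prod>k \<in> keys e. y k ^ lookup e k)))"
  using cov' unfolding l r' dM by simp
 also have "\<dots> = (\<Sum>e \<in> keys P. cc e * (\<Prod>k \<in> keys e. y k ^ lookup e k))"
  unfolding sum_subtractf[symmetric] cc_def by (intro sum.cong refl) (simp add: algebra_simps)
 also have "\<dots> = (\<Sum>e \<in> K. cc e * (\<Prod>k \<in> keys e. y k ^ lookup e k))"
  by (rule sum.mono_neutral_right) (auto simp: K_def cc_def)
 also have "\<dots> = (\<Sum>e \<in> K. cc e * (\<Prod>i\<in>insert 1 {2..N}. y i ^ lookup e i))"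
 proof (intro sum.cong refl arg_cong2[where f = "(*)"])
  fix e assume "e \<in> K"
  then show "(\<Prod>k \<in> keys e. y k ^ lookup e k) = (\<Prod>i\<in>insert 1 {2..N}. y i ^ lookup e i)"
   by (intro prod_keys_extend keys_upto[OF P]) (auto simp: K_def)
 qed
 finally show False using y(2) by simp
qed

lemma higher_deriv_moebius_shear:
 assumes "1 - t * z ~= (0::complex)"
 shows "(deriv ^^ Suc k) (%z. z / (1 - t * z)) z = fact (Suc k) * t ^ k / (1 - t * z) ^ (k + 2)"
 using assms
proof (induction k arbitrary: z)
 case 0
 have "((%z. z / (1 - t * z)) has_field_derivative 1 / (1 - t * z) ^ 2) (at z)"
  using 0 by (auto intro!: derivative_eq_intros simp: field_simps power2_eq_square)
 then show ?case by (simp add: DERIV_imp_deriv power2_eq_square)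
next
 case (Suc k)
 have o: "open {z. 1 - t * z ~= 0}" by (intro open_Collect_neq continuous_intros)
 have "(deriv ^^ Suc (Suc k)) (%z. z / (1 - t * z)) z = deriv (%z. fact (Suc k) * t ^ k / (1 - t * z) ^ (k + 2)) z"
  unfolding funpow.simps(2)[of "Suc k"] o_apply
 proof (rule deriv_cong_ev)
  show "\<forall>\<^sub>F x in nhds z. (deriv ^^ Suc k) (%z. z / (1 - t * z)) x = fact (Suc k) * t ^ k / (1 - t * x) ^ (k + 2)"
  proof (rule eventually_mono[OF eventually_nhds_in_open[OF o]])
   show "z \<in> {z. 1 - t * z ~= 0}" using Suc.prems by simp
   show "(deriv ^^ Suc k) (%z. z / (1 - t * z)) x = fact (Suc k) * t ^ k / (1 - t * x) ^ (k + 2)"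
    if "x \<in> {z. 1 - t * z ~= 0}" for x using Suc.IH[of x] that by blast
  qed
 qed simp
 also have "\<dots> = fact (Suc (Suc k)) * t ^ Suc k / (1 - t * z) ^ (Suc k + 2)"
 proof (rule DERIV_imp_deriv)
  have "((%z. fact (Suc k) * t ^ k * inverse ((1 - t * z) ^ (k + 2))) has_field_derivative
    fact (Suc k) * t ^ k * (- (inverse ((1 - t * z) ^ (k + 2)) * (of_nat (k + 2) * (- t) * (1 - t * z) ^ (k + 1)) * inverse ((1 - t * z) ^ (k + 2))))) (at z)"
  proof -
   have "((%z. 1 - t * z) has_field_derivative - t) (at z)" by (auto intro!: derivative_eq_intros)
   from DERIV_power[OF this, of "k + 2"]
   have "((%z. (1 - t * z) ^ (k + 2)) has_field_derivative of_nat (k + 2) * (- t) * (1 - t * z) ^ (k + 1)) (at z)"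
    by (simp add: mult.assoc)
   from DERIV_cmult[OF DERIV_inverse'[OF this]] Suc.prems show ?thesis by simp
  qed
  moreover have "fact (Suc k) * t ^ k * (- (inverse ((1 - t * z) ^ (k + 2)) * (of_nat (k + 2) * (- t) * (1 - t * z) ^ (k + 1)) * inverse ((1 - t * z) ^ (k + 2))))
   = fact (Suc (Suc k)) * t ^ Suc k / (1 - t * z) ^ (Suc k + 2)"
  proof -
   define w where "w = 1 - t * z"
   have w: "w ~= 0" using Suc.prems by (simp add: w_def)
   have "inverse (w ^ (k + 2)) * w ^ (k + 1) * inverse (w ^ (k + 2)) = inverse (w ^ (k + 3))"
    using w by (simp add: field_simps power_add eval_nat_numeral)
   then have "fact (Suc k) * t ^ k * (of_nat (k + 2) * t * (inverse (w ^ (k + 2)) * w ^ (k + 1) * inverse (w ^ (k + 2))))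
    = fact (Suc (Suc k)) * t ^ Suc k / w ^ (Suc k + 2)"
    by (simp add: fact_Suc[of "Suc k"] field_simps eval_nat_numeral del: fact_Suc)
   then show ?thesis unfolding w_def[symmetric] by (simp add: mult_ac)
  qed
  ultimately show "((%z. fact (Suc k) * t ^ k / (1 - t * z) ^ (k + 2)) has_field_derivative
    fact (Suc (Suc k)) * t ^ Suc k / (1 - t * z) ^ (Suc k + 2)) (at z)"
   by (simp only: divide_inverse)
 qed
 finally show ?case .
qed

lemma lin_exponent_lookup:
 fixes k l i :: nat
 assumes "2 <= k"
 shows "lookup (single k 1 + single 1 l) i = (if i = k then 1 else if i = 1 then l else 0)"
 using assms by (auto simp: lookup_add lookup_single when_def)

lemma lin_exponent_keys:
 fixes k l :: nat
 assumes "2 <= k"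
 shows "keys (single k 1 + single 1 l) - {1} = {k}"
 using assms by (auto simp: in_keys_iff lin_exponent_lookup[OF assms, simplified] split: if_splits)

lemma lin_exponent_weight:
 fixes k l :: nat
 assumes "2 <= k"
 shows "jet_weight (single k 1 + single 1 l) = int k - int l"
  "jet_degree (single k 1 + single 1 l) = 1"
 using assms unfolding jet_weight_def jet_degree_def lin_exponent_keys[OF assms]
 by (auto simp: lin_exponent_lookup[OF assms, simplified])

lemma jet_degree_zero_cases:
 assumes "jet_degree e = 0"
 shows "e = single 1 (lookup e 1)"
proof (rule poly_mapping_eqI)
 fix i
 have "keys e - {1} = {}"
  using assms unfolding jet_degree_def by (auto simp: in_keys_iff)
 then have "i ~= 1 ==> lookup e i = 0"
  by (metis Diff_iff empty_iff in_keys_iff singletonD)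
 then show "lookup e i = lookup (single 1 (lookup e 1)) i"
  by (auto simp: lookup_single when_def)
qed

lemma jet_degree_one_cases:
 assumes "jet_degree e = 1" "keys e \<subseteq> insert 1 {2..N}"
 obtains k where "2 <= k" "k <= N" "e = single k 1 + single 1 (lookup e 1)"
proof -
 have "\<exists>k\<in>keys e - {1}. lookup e k = 1 \<and> (\<forall>j\<in>keys e - {1}. k ~= j --> lookup e j = 0)"
  using assms(1) unfolding jet_degree_def by (subst (asm) sum_eq_1_iff) auto
 then obtain k where k: "k \<in> keys e - {1}" "lookup e k = 1"
  "!!j. j \<in> keys e - {1} ==> k ~= j ==> lookup e j = 0" by blast
 have k2: "2 <= k" "k <= N" using k(1) assms(2) by auto
 moreover have "e = single k 1 + single 1 (lookup e 1)"
 proof (rule poly_mapping_eqI)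
  fix i
  show "lookup e i = lookup (single k 1 + single 1 (lookup e 1)) i"
   unfolding lin_exponent_lookup[OF k2(1)]
  proof (cases "i = k \<or> i = 1")
   case False
   then show "lookup e i = (if i = k then 1 else if i = 1 then lookup e 1 else 0)"
    using k(3)[of i] by (cases "i \<in> keys e") (auto simp: in_keys_iff)
  qed (use k in auto)
 qed
 ultimately show ?thesis using that by blast
qed

text \<open>The identity composed with z / (1 - t z) has the jet k! t^(k-1) at 0, and the covariance
  factor there is 1; so a certain polynomial in t is constant. Its coefficient of t comes only from
  monomials f'' / (f')^l, and the weight fixes l.\<close>

lemma covariant_lin_coeff_2:
 assumes P: "diff_poly_upto N P" and cov: "moebius_covariant m P"
 shows "lin_coeff P 2 l = 0"
proof (rule ccontr)
 assume ne: "lin_coeff P 2 l ~= 0"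
 define e2 :: "nat \<Rightarrow>\<^sub>0 nat" where "e2 = single 2 1 + single 1 l"
 have e2: "e2 \<in> keys P" using ne by (simp add: lin_coeff_def in_keys_iff e2_def)
 define d where "d e = (\<Sum>k \<in> keys e - {1}. (k - 1) * lookup e k)" for e :: "nat \<Rightarrow>\<^sub>0 nat"
 define b where "b e = lookup P e * (\<Prod>k \<in> keys e - {1}. fact k ^ lookup e k)" for e
 have ev: "jeval P (%k. if k = 1 then 1 else fact k * t ^ (k - 1)) = (\<Sum>e \<in> keys P. b e * t ^ d e)" for t
  unfolding jeval_def
 proof (intro sum.cong refl)
  fix e
  have "(\<Prod>k \<in> keys e. (if k = 1 then 1 else fact k * t ^ (k - 1)) ^ lookup e k) =
   (\<Prod>k \<in> keys e - {1}. (fact k * t ^ (k - 1)) ^ lookup e k)"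
   by (rule prod.mono_neutral_cong_right) auto
  also have "\<dots> = (\<Prod>k \<in> keys e - {1}. fact k ^ lookup e k) * t ^ d e"
   unfolding d_def power_sum prod.distrib[symmetric] by (intro prod.cong refl) (simp add: power_mult_distrib power_mult)
  finally show "lookup P e * (\<Prod>k \<in> keys e. (if k = 1 then 1 else fact k * t ^ (k - 1)) ^ lookup e k) = b e * t ^ d e"
   by (simp add: b_def)
 qed
 have const: "(\<Sum>e \<in> keys P. b e * t ^ d e) = (\<Sum>e \<in> keys P. b e * 0 ^ d e)" for t
 proof -
  define M where "M = moebius 1 0 (- t) 1"
  have M: "M = (%z. z / (1 - t * z))" by (auto simp: M_def moebius_def)
  have "diff_op P ((%z. z) \<circ> M) 0 = diff_op P (%z. z) (M 0) * deriv M 0 powi m"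
   unfolding M_def by (rule covariant_at[OF cov, of _ UNIV]) (auto intro: holomorphic_intros)
  moreover have "deriv M 0 = 1" unfolding M using higher_deriv_moebius_shear[of t 0 0] by simp
  moreover have "diff_op P ((%z. z) \<circ> M) 0 = jeval P (%k. if k = 1 then 1 else fact k * t ^ (k - 1))"
   unfolding diff_op_jeval
  proof (rule jeval_cong[OF P])
   show "jet ((%z. z) \<circ> M) 0 1 = (if (1::nat) = 1 then 1 else fact 1 * t ^ (1 - 1))"
    using higher_deriv_moebius_shear[of t 0 0] by (simp add: jet_def M o_def)
   show "jet ((%z. z) \<circ> M) 0 k = (if k = 1 then 1 else fact k * t ^ (k - 1))" if "2 <= k" "k <= N" for k
    using higher_deriv_moebius_shear[of t 0 "k - 1"] that by (simp add: jet_def M o_def Suc_diff_le)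
  qed
  moreover have "diff_op P (%z. z) (M 0) = jeval P (%k. if k = 1 then 1 else fact k * 0 ^ (k - 1))"
   unfolding diff_op_jeval
  proof (rule jeval_cong[OF P])
   show "jet (%z. z) (M 0) 1 = (if (1::nat) = 1 then 1 else fact 1 * 0 ^ (1 - 1))" by (simp add: jet_def)
   show "jet (%z. z) (M 0) k = (if k = 1 then 1 else fact k * 0 ^ (k - 1))" if "2 <= k" "k <= N" for k
    using that by (simp add: jet_def power_0_left)
  qed
  ultimately show ?thesis unfolding ev by simp
 qed
 define p where "p = (\<Sum>e \<in> keys P. monom (b e) (d e)) - [:(\<Sum>e \<in> keys P. b e * 0 ^ d e):]"
 have "poly p t = 0" for t
  using const[of t] by (simp add: p_def poly_sum poly_monom)
 then have "p = 0" by (metis poly_0 poly_eq_poly_eq_iff ext)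
 then have "0 = coeff p 1" by simp
 also have "\<dots> = (\<Sum>e \<in> keys P. if d e = 1 then b e else 0)"
  by (simp add: p_def coeff_sum coeff_monom)
 also have "\<dots> = (\<Sum>e \<in> {e2}. if d e = 1 then b e else 0)"
 proof (rule sum.mono_neutral_right)
  show "\<forall>e\<in>keys P - {e2}. (if d e = 1 then b e else 0) = 0"
  proof
   fix e assume e: "e \<in> keys P - {e2}"
   have "d e ~= 1"
   proof
    assume d1: "d e = 1"
    have k1: "keys e \<subseteq> insert 1 {2..N}" using keys_upto[OF P] e by auto
    have "jet_degree e <= d e" unfolding jet_degree_def d_def
    proof (rule sum_mono)
     fix k assume "k \<in> keys e - {1}"
     with k1 have "k \<in> {2..N}" by blast
     then have "2 <= k" by simp
     then have "1 <= k - 1" by arith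
     then show "lookup e k <= (k - 1) * lookup e k" by simp
    qed
    moreover have "jet_degree e ~= 0"
    proof
     assume "jet_degree e = 0"
     then have "keys e - {1} = {}" unfolding jet_degree_def by (auto simp: in_keys_iff)
     then have "d e = 0" unfolding d_def by (simp only: sum.empty)
     then show False using d1 by simp
    qed
    ultimately have "jet_degree e = 1" using d1 by simp
    then obtain k where k: "2 <= k" "k <= N" "e = single k 1 + single 1 (lookup e 1)"
     using jet_degree_one_cases[OF _ k1] by blast
    define l' where "l' = lookup e 1"
    have e': "e = single k 1 + single 1 l'" using k(3) by (simp add: l'_def)
    have "d e = k - 1" unfolding d_def e' lin_exponent_keys[OF k(1)] using k(1) by (simp add: lin_exponent_lookup[OF k(1), simplified])
    with d1 k(1) have k2: "k = 2" by simp
    have "jet_weight e = jet_weight e2" using covariant_weight[OF P cov] e e2 by auto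
    then have "l' = l" unfolding e' e2_def lin_exponent_weight(1)[OF k(1)] lin_exponent_weight(1)[OF order_refl] k2 by simp
    with e' k2 have "e = e2" by (simp add: e2_def)
    with e show False by simp
   qed
   then show "(if d e = 1 then b e else 0) = 0" by simp
  qed
 qed (use e2 in auto)
 also have "\<dots> = lin_coeff P 2 l * 2"
  unfolding d_def b_def by (simp add: e2_def lin_coeff_def lin_exponent_keys[OF order_refl, simplified] lin_exponent_lookup[OF order_refl, simplified])
 finally show False using ne by simp
qed

lemma lin_support_facts:
 assumes P: "diff_poly_upto N P" and cov: "moebius_covariant m P" and kl: "(k, l) \<in> lin_support P"
 shows "3 <= k" "k <= N" "int k - int l = m" "single k 1 + single 1 l \<in> keys P"
proof -
 from kl have k2: "2 <= k" and c: "lin_coeff P k l ~= 0" by (auto simp: lin_support_def)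
 from c show key: "single k 1 + single 1 l \<in> keys P"
  by (simp add: lin_coeff_def in_keys_iff)
 have "k ~= 2" using c covariant_lin_coeff_2[OF P cov] by auto
 with k2 show "3 <= k" by simp
 show "int k - int l = m" using covariant_weight[OF P cov key] lin_exponent_weight(1)[OF k2] by simp
 have "k \<in> keys (single k 1 + single 1 l) - {1}" unfolding lin_exponent_keys[OF k2] by simp
 then show "k <= N" using keys_upto[OF P key] k2 by auto
qed

section \<open>Normal form of the jets at a point of the disc\<close>

context small_beltrami_solution
begin

lemma reg_ext_centre_bound:
 assumes z0: "z0 \<in> ball 0 1"
 shows "cmod (reg_ext z0 z0) <= 12 * k"
proof -
 have z0': "z0 \<in> ball 0 1 - {a}" using z0 by (simp only: disc_domain)
 obtain F where F: "(%w. reg_ext z0 (z0 + w)) has_fps_expansion F"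
  "fps_nth F 0 = - (of_real (1 - cmod z0) * pre_schwarzian z0 / 2)"
  by (rule reg_expansion[OF z0']) blast
 have "reg_ext z0 z0 = - (of_real (1 - cmod z0) * pre_schwarzian z0 / 2)"
  using fps_nth_fps_expansion[OF F(1), of 0] F(2) by simp
 then have "cmod (reg_ext z0 z0) = cmod (pre_schwarzian z0) * (1 - cmod z0) / 2"
  using z0 by (simp add: norm_mult norm_divide del: of_real_diff)
 then show ?thesis using pre_schwarzian_bound[OF z0] by simp
qed

text \<open>Precomposition with the Moebius map \<open>\<zeta> \<mapsto> z\<^sub>0 + r \<zeta> / (1 + A \<zeta>)\<close> removes the second
 order term of \<open>f\<close> at \<open>z\<^sub>0\<close>.\<close>

lemma centred_expansion:
 assumes z0: "z0 \<in> ball 0 1"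
 defines "r \<equiv> 1 - cmod z0" and "A \<equiv> - reg_ext z0 z0"
 obtains W where "W holomorphic_on ball 0 (1 / 2)" "W 0 = 0"
  "!!n. 1 <= n ==> cmod (of_real (r ^ (n + 1) / pi) * (LBINT z. \<mu> z / (z - z0) ^ (n + 3))) <= 3 * k"
  "!!n. 1 <= n ==> cmod ((deriv ^^ n) W 0 / fact n - of_real (r ^ (n + 1) / pi) * (LBINT z. \<mu> z / (z - z0) ^ (n + 3))) <= (165 * 4 ^ n + 2) * k\<^sup>2"
  "!!\<zeta>. \<zeta> \<in> ball 0 (1 / 2) ==> 1 + A * \<zeta> ~= 0 \<and> z0 + of_real r * \<zeta> / (1 + A * \<zeta>) \<in> ball 0 1 \<and>
    f (z0 + of_real r * \<zeta> / (1 + A * \<zeta>)) = f z0 + of_real r * deriv f z0 * (\<zeta> - \<zeta>\<^sup>2 * W \<zeta>)"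
proof -
 have z0': "z0 \<in> ball 0 1 - {a}" using z0 by (simp only: disc_domain)
 have r: "0 < r" "r <= 1" using z0 by (auto simp: r_def)
 define R where "R = cx r"
 have R0: "R ~= 0" "cmod R = r" using r by (auto simp: R_def)
 have kk: "k <= 1 / 48" using k_small by simp
 have A: "cmod A <= 12 * k" using reg_ext_centre_bound[OF z0] by (simp add: A_def)
 obtain F where F: "(%w. reg_ext z0 (z0 + w)) has_fps_expansion F" by (rule reg_expansion[OF z0']) blast
 note cb = reg_coefficient_bounds[OF z0' F, folded r_def]
 \<comment> \<open>The regular part in the coordinate \<xi> = (z - z0) / r, with its constant term
   removed.\<close>
 define V where "V \<xi> = reg_ext z0 (z0 + R * \<xi>) + A" for \<xi>
 have map: "z0 + R * \<xi> \<in> ball 0 1" if "\<xi> \<in> ball 0 1" for \<xi>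
 proof -
  have "cmod (z0 + R * \<xi>) <= cmod z0 + r * cmod \<xi>" using norm_triangle_ineq[of z0 "R * \<xi>"] R0 by (simp add: norm_mult)
  also have "\<dots> < cmod z0 + r * 1" using that r by simp
  finally show ?thesis by (simp add: r_def)
 qed
 have Vh: "V holomorphic_on ball 0 1"
  unfolding V_def[abs_def]
  by (intro holomorphic_intros holomorphic_on_compose_gen[OF _ reg_ext_holomorphic[OF z0', unfolded disc_domain], of "%\<xi>. z0 + R * \<xi>", unfolded o_def])
    (use map in auto)
 have Ve: "V has_fps_expansion (F oo (fps_const R * fps_X)) + fps_const A"
  unfolding V_def[abs_def]
  by (intro has_fps_expansion_add has_fps_expansion_const
    has_fps_expansion_compose[OF F, of "%\<xi>. R * \<xi>" "fps_const R * fps_X", unfolded o_def]) (auto intro!: fps_expansion_intros)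
 have V0: "V 0 = 0" by (simp add: V_def A_def)
 have Vn: "(deriv ^^ n) V 0 / fact n = R ^ n * fps_nth F n" if "1 <= n" for n
  using fps_nth_fps_expansion[OF Ve, of n] that by (simp add: fps_compose_linear)
 have Vn2k: "cmod ((deriv ^^ n) V 0 / fact n) <= 2 * k" if "1 <= n" for n
  using cb(1)[OF that] unfolding Vn[OF that] by (simp add: norm_mult norm_power R0 mult.commute)
 \<comment> \<open>Coefficients of size 2 k sum to 2 k (5/7) / (2/7) = 5 k. The radii 5/7 and 4/7
   leave a margin of 1/7 for the Cauchy estimate of V'.\<close>
 have V5: "cmod (V \<xi>) <= 5 * k" if "cmod \<xi> <= 5 / 7" for \<xi>
 proof -
  have s: "(%n. (deriv ^^ n) V 0 / fact n * \<xi> ^ n) sums V \<xi>"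
   using holomorphic_power_series[OF Vh, of \<xi>] that by simp
  have s': "(%n. (deriv ^^ Suc n) V 0 / fact (Suc n) * \<xi> ^ Suc n) sums V \<xi>"
   using s V0 by (subst sums_Suc_iff) simp
  have g: "(%n. 2 * k * (5 / 7) * (5 / 7) ^ n) sums (2 * k * (5 / 7) * (1 / (1 - 5 / 7)))"
   by (intro sums_mult geometric_sums) simp
  have "norm (suminf (%n. (deriv ^^ Suc n) V 0 / fact (Suc n) * \<xi> ^ Suc n)) <= suminf (%n. 2 * k * (5 / 7) * (5 / 7) ^ n)"
  proof (rule norm_suminf_le[OF _ sums_summable[OF g]])
   fix n
   have "norm ((deriv ^^ Suc n) V 0 / fact (Suc n) * \<xi> ^ Suc n) <= 2 * k * (5 / 7) ^ Suc n"
    unfolding norm_mult norm_power by (intro mult_mono power_mono Vn2k that) (use k0 in auto)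
   then show "norm ((deriv ^^ Suc n) V 0 / fact (Suc n) * \<xi> ^ Suc n) <= 2 * k * (5 / 7) * (5 / 7) ^ n" by simp
  qed
  then show ?thesis using sums_unique[OF s'] sums_unique[OF g] by simp
 qed
 have V': "cmod (deriv V \<xi>) <= 35 * k" if "cmod \<xi> <= 4 / 7" for \<xi>
 proof -
  have sub: "cball \<xi> (1 / 7) \<subseteq> ball 0 1"
  proof
   fix y assume "y \<in> cball \<xi> (1 / 7)"
   then show "y \<in> ball 0 1" using norm_triangle_sub[of y \<xi>] that by (simp add: dist_norm norm_minus_commute)
  qed
  have "cmod ((deriv ^^ 1) V \<xi>) <= fact 1 * (5 * k) / (1 / 7) ^ 1"
  proof (rule Cauchy_inequality)
   show "V holomorphic_on ball \<xi> (1 / 7)" using sub by (intro holomorphic_on_subset[OF Vh]) auto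
   show "continuous_on (cball \<xi> (1 / 7)) V"
    by (rule continuous_on_subset[OF holomorphic_on_imp_continuous_on[OF Vh] sub])
   fix y assume "cmod (\<xi> - y) = 1 / 7"
   then show "cmod (V y) <= 5 * k" using norm_triangle_sub[of y \<xi>] that by (intro V5) (simp add: norm_minus_commute)
  qed simp
  then show ?thesis by simp
 qed
 define t where "t \<zeta> = \<zeta> / (1 + A * \<zeta>)" for \<zeta>
 have den: "7 / 8 <= cmod (1 + A * \<zeta>)" if "cmod \<zeta> <= 1 / 2" for \<zeta>
 proof -
  have "cmod (A * \<zeta>) <= (1 / 4) * (1 / 2)" unfolding norm_mult using A kk that by (intro mult_mono) auto
  then show ?thesis using norm_diff_ineq[of 1 "A * \<zeta>"] by simp
 qed
 have den0: "1 + A * \<zeta> ~= 0" if "cmod \<zeta> <= 1 / 2" for \<zeta>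
  using den[OF that] by auto
 have t4: "cmod (t \<zeta>) <= 4 / 7" if "cmod \<zeta> <= 1 / 2" for \<zeta>
 proof -
  have "cmod (t \<zeta>) <= (1 / 2) / (7 / 8)"
   unfolding t_def norm_divide using den[OF that] that by (intro frac_le) auto
  then show ?thesis by simp
 qed
 define U where "U \<zeta> = V (t \<zeta>)" for \<zeta>
 have U5: "cmod (U \<zeta>) <= 5 * k" if "cmod \<zeta> <= 1 / 2" for \<zeta>
  unfolding U_def using t4[OF that] by (intro V5) simp
 have den2: "1 / 2 <= cmod (1 + \<zeta> * U \<zeta>)" if "cmod \<zeta> <= 1 / 2" for \<zeta>
 proof -
  have "cmod (\<zeta> * U \<zeta>) <= (1 / 2) * (5 * k)" unfolding norm_mult using U5[OF that] that by (intro mult_mono) auto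
  then show ?thesis using norm_diff_ineq[of 1 "\<zeta> * U \<zeta>"] kk by simp
 qed
 have den20: "1 + \<zeta> * U \<zeta> ~= 0" if "cmod \<zeta> <= 1 / 2" for \<zeta>
  using den2[OF that] by auto
 define W where "W \<zeta> = U \<zeta> / (1 + \<zeta> * U \<zeta>)" for \<zeta>
 have th: "t holomorphic_on ball 0 (1 / 2)"
  unfolding t_def[abs_def] using den0 by (intro holomorphic_intros) auto
 have Uh: "U holomorphic_on ball 0 (1 / 2)"
  unfolding U_def[abs_def]
 proof (rule holomorphic_on_compose_gen[OF th Vh, unfolded o_def])
  show "t ` ball 0 (1 / 2) \<subseteq> ball 0 1"
  proof (rule image_subsetI)
   fix \<zeta> :: complex assume "\<zeta> \<in> ball 0 (1 / 2)"
   then show "t \<zeta> \<in> ball 0 1" using t4[of \<zeta>] by simp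
  qed
 qed
 have Wh: "W holomorphic_on ball 0 (1 / 2)"
  unfolding W_def[abs_def] using den20 by (intro holomorphic_intros Uh) auto
 have W0: "W 0 = 0" by (simp add: W_def U_def t_def V0)
 \<comment> \<open>The change of variable t costs 35 k times 4 k, the passage from U to W costs 25
   k^2, in total 165 k^2.\<close>
 have WV: "cmod (W \<zeta> - V \<zeta>) <= 165 * k\<^sup>2" if z: "cmod \<zeta> <= 1 / 2" for \<zeta>
 proof -
  have "cmod (V (t \<zeta>) - V \<zeta>) <= 35 * k * cmod (t \<zeta> - \<zeta>)"
  proof (rule field_differentiable_bound[of "cball 0 (4 / 7)" V "deriv V"])
   fix y assume "y \<in> cball (0::complex) (4 / 7)"
   then show "(V has_field_derivative deriv V y) (at y within cball 0 (4 / 7))" "cmod (deriv V y) <= 35 * k"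
    by (auto intro!: V' has_field_derivative_at_within[OF holomorphic_derivI[OF Vh open_ball]])
  qed (use z t4[OF z] in auto)
  moreover have "cmod (t \<zeta> - \<zeta>) <= 4 * k"
  proof -
   have "t \<zeta> - \<zeta> = - (A * \<zeta> * \<zeta>) / (1 + A * \<zeta>)" unfolding t_def using den0[OF z] by (simp add: field_simps)
   also have "cmod \<dots> <= (12 * k * (1 / 2) * (1 / 2)) / (7 / 8)"
    unfolding norm_divide norm_minus_cancel norm_mult
    using den[OF z] A z k0 by (intro frac_le mult_mono) auto
   finally show ?thesis using k0 by simp
  qed
  ultimately have "cmod (U \<zeta> - V \<zeta>) <= 35 * k * (4 * k)"
   unfolding U_def using k0 by (meson mult_left_mono order_trans mult_nonneg_nonneg zero_le_numeral)
  moreover have "cmod (W \<zeta> - U \<zeta>) <= 25 * k\<^sup>2"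
  proof -
   have "W \<zeta> - U \<zeta> = - (\<zeta> * U \<zeta> * U \<zeta>) / (1 + \<zeta> * U \<zeta>)" unfolding W_def using den20[OF z] by (simp add: field_simps)
   also have "cmod \<dots> <= ((1 / 2) * (5 * k) * (5 * k)) / (1 / 2)"
    unfolding norm_divide norm_minus_cancel norm_mult
    using den2[OF z] U5[OF z] z k0 by (intro frac_le mult_mono) auto
   finally show ?thesis by (simp add: power2_eq_square)
  qed
  moreover have "cmod (W \<zeta> - V \<zeta>) <= cmod (W \<zeta> - U \<zeta>) + cmod (U \<zeta> - V \<zeta>)"
   using norm_triangle_ineq[of "W \<zeta> - U \<zeta>" "U \<zeta> - V \<zeta>"] by simp
  ultimately show ?thesis by (simp add: power2_eq_square)
 qed
 \<comment> \<open>A Cauchy estimate on the circle of radius 1/4, whence the factor 4^n.\<close>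
 have WVn: "cmod ((deriv ^^ n) W 0 / fact n - (deriv ^^ n) V 0 / fact n) <= 165 * 4 ^ n * k\<^sup>2" for n
 proof -
  have hs: "V holomorphic_on ball 0 (1 / 2)" by (rule holomorphic_on_subset[OF Vh]) auto
  have hd: "(%\<zeta>. W \<zeta> - V \<zeta>) holomorphic_on ball 0 (1 / 2)" by (intro holomorphic_intros Wh hs)
  have "cmod ((deriv ^^ n) (%\<zeta>. W \<zeta> - V \<zeta>) 0) <= fact n * (165 * k\<^sup>2) / (1 / 4) ^ n"
  proof (rule Cauchy_inequality)
   show "(%\<zeta>. W \<zeta> - V \<zeta>) holomorphic_on ball 0 (1 / 4)" by (rule holomorphic_on_subset[OF hd]) auto
   show "continuous_on (cball 0 (1 / 4)) (%\<zeta>. W \<zeta> - V \<zeta>)"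
    by (rule continuous_on_subset[OF holomorphic_on_imp_continuous_on[OF hd]]) auto
  qed (auto intro!: WV)
  moreover have "(deriv ^^ n) (%\<zeta>. W \<zeta> - V \<zeta>) 0 = (deriv ^^ n) W 0 - (deriv ^^ n) V 0"
   by (rule higher_deriv_diff[OF Wh hs]) auto
  ultimately show ?thesis
   by (simp add: diff_divide_distrib[symmetric] norm_divide field_simps power_divide)
 qed
 show ?thesis
 proof (rule that[OF Wh W0])
  fix n :: nat assume n: "1 <= n"
  define J where "J = of_real (r ^ (n + 1) / pi) * (LBINT z. \<mu> z / (z - z0) ^ (n + 3))"
  have VJ: "cmod ((deriv ^^ n) V 0 / fact n - J) <= 2 * k\<^sup>2"
   using cb(2)[OF n] unfolding Vn[OF n] J_def R_def by simp
  have k2: "2 * k\<^sup>2 <= k" using kk k0 mult_right_mono[of "2 * k" 1 k] by (simp add: power2_eq_square)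
  have "cmod J <= 3 * k"
   using VJ Vn2k[OF n] k2 norm_triangle_ineq2[of J "(deriv ^^ n) V 0 / fact n"] by (simp add: norm_minus_commute)
  then show "cmod (of_real (r ^ (n + 1) / pi) * (LBINT z. \<mu> z / (z - z0) ^ (n + 3))) <= 3 * k" by (simp add: J_def)
  have "cmod ((deriv ^^ n) W 0 / fact n - J) <= 165 * 4 ^ n * k\<^sup>2 + 2 * k\<^sup>2"
   using norm_triangle_mono[OF WVn[of n] VJ] by simp
  then show "cmod ((deriv ^^ n) W 0 / fact n - of_real (r ^ (n + 1) / pi) * (LBINT z. \<mu> z / (z - z0) ^ (n + 3))) <= (165 * 4 ^ n + 2) * k\<^sup>2"
   by (simp add: J_def algebra_simps)
 next
  fix \<zeta> :: complex assume "\<zeta> \<in> ball 0 (1 / 2)"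
  then have z: "cmod \<zeta> <= 1 / 2" by simp
  have eq: "z0 + of_real r * \<zeta> / (1 + A * \<zeta>) = z0 + R * t \<zeta>" by (simp add: t_def R_def)
  have in_b: "z0 + R * t \<zeta> \<in> ball 0 1" using t4[OF z] by (intro map) auto
  have "f (z0 + R * t \<zeta>) = f z0 + R * deriv f z0 * (\<zeta> - \<zeta>\<^sup>2 * W \<zeta>)"
  proof (cases "\<zeta> = 0")
   case False
   define d where "d = f (z0 + R * t \<zeta>) - f z0"
   define D where "D = deriv f z0"
   have D0: "D ~= 0" unfolding D_def by (rule f_deriv_nonzero[OF z0'])
   have t0: "t \<zeta> ~= 0" using False den0[OF z] by (simp add: t_def)
   have ne: "z0 + R * t \<zeta> ~= z0" using t0 R0(1) by simp
   have in_b': "z0 + R * t \<zeta> \<in> ball 0 1 - {a}" using in_b by (simp only: disc_domain)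
   have "f (z0 + R * t \<zeta>) ~= f z0" by (rule f_neq) (use in_b' z0' ne in \<open>simp_all only: Diff_iff insert_iff empty_iff, simp_all\<close>)
   then have d0: "d ~= 0" by (simp add: d_def)
   have "reg_ext z0 (z0 + R * t \<zeta>) = reg z0 (z0 + R * t \<zeta>)"
    by (rule reg_ext_eq[OF z0' in_b' ne])
   then have "U \<zeta> - A = R * D / d - R / (R * t \<zeta>)"
    unfolding U_def V_def reg_def by (simp add: R_def r_def d_def D_def)
   also have "R / (R * t \<zeta>) = 1 / \<zeta> + A" using R0 False den0[OF z] by (simp add: t_def field_simps)
   finally have "R * D / d = (1 + \<zeta> * U \<zeta>) / \<zeta>" using False by (simp add: field_simps)
   then have "d = R * D * (\<zeta> / (1 + \<zeta> * U \<zeta>))" using d0 False den20[OF z] by (simp add: field_simps)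
   also have "\<zeta> / (1 + \<zeta> * U \<zeta>) = \<zeta> - \<zeta>\<^sup>2 * W \<zeta>"
    unfolding W_def using den20[OF z] by (simp add: field_simps power2_eq_square)
   finally show ?thesis unfolding d_def D_def diff_eq_eq by (simp only: add.commute)
  qed (simp add: t_def)
  then show "1 + A * \<zeta> ~= 0 \<and> z0 + of_real r * \<zeta> / (1 + A * \<zeta>) \<in> ball 0 1 \<and>
    f (z0 + of_real r * \<zeta> / (1 + A * \<zeta>)) = f z0 + of_real r * deriv f z0 * (\<zeta> - \<zeta>\<^sup>2 * W \<zeta>)"
   using den0[OF z] in_b unfolding eq by (simp add: R_def)
 qed
qed

text \<open>The integral belonging to order j in the claimed derivative, scaled by the power of 1 -
  |z0| that makes it bounded by a multiple of k uniformly in z0.\<close>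

definition jet_coeff :: "complex => nat => complex" where
 "jet_coeff z0 j = (-1) ^ j * fact j * of_real ((1 - cmod z0) ^ (j - 1) / pi) * (LBINT \<eta>. \<mu> \<eta> / (z0 - \<eta>) ^ (j + 1))"

text \<open>Covariance at 0 under the map of \<open>centred_expansion\<close>, whose derivative
  there is r, turns r^m Q[f](z0) into Q of f z0 + \<rho> (\<zeta> - \<zeta>^2 W) at 0. The j-th jet
  is therefore -\<rho> j! times the coefficient of order j - 2 of W.\<close>

lemma jet_normal_form:
 assumes P: "diff_poly_upto N P" and cov: "moebius_covariant m P" and z0: "z0 \<in> ball 0 1"
 defines "\<rho> \<equiv> of_real (1 - cmod z0) * deriv f z0"
 obtains x where "x 2 = 0"
  "!!j. 3 <= j ==> cmod (x j - jet_coeff z0 j) <= fact j * (165 * 4 ^ j + 2) * k\<^sup>2"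
  "!!j. 3 <= j ==> cmod (jet_coeff z0 j) <= fact j * 3 * k"
  "diff_op P f z0 * of_real (1 - cmod z0) powi m = jeval P (%j. if j = 1 then inverse \<rho> else \<rho> * x j)"
proof -
 have z0': "z0 \<in> ball 0 1 - {a}" using z0 by (simp only: disc_domain)
 define r where "r = 1 - cmod z0"
 define A where "A = - reg_ext z0 z0"
 obtain W where W: "W holomorphic_on ball 0 (1 / 2)" "W 0 = 0"
  and J: "!!n. 1 <= n ==> cmod (of_real (r ^ (n + 1) / pi) * (LBINT z. \<mu> z / (z - z0) ^ (n + 3))) <= 3 * k"
  and WJ: "!!n. 1 <= n ==> cmod ((deriv ^^ n) W 0 / fact n - of_real (r ^ (n + 1) / pi) * (LBINT z. \<mu> z / (z - z0) ^ (n + 3))) <= (165 * 4 ^ n + 2) * k\<^sup>2"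
  and Wf: "!!\<zeta>. \<zeta> \<in> ball 0 (1 / 2) ==> 1 + A * \<zeta> ~= 0 \<and> z0 + of_real r * \<zeta> / (1 + A * \<zeta>) \<in> ball 0 1 \<and>
    f (z0 + of_real r * \<zeta> / (1 + A * \<zeta>)) = f z0 + of_real r * deriv f z0 * (\<zeta> - \<zeta>\<^sup>2 * W \<zeta>)"
  unfolding r_def A_def by (rule centred_expansion[OF z0]) blast
 have r: "0 < r" using z0 by (simp add: r_def)
 \<comment> \<open>Dividing all matrix entries by a square root of r makes the determinant
   1.\<close>
 define q where "q = csqrt (of_real r)"
 have q: "q * q = of_real r" "q ~= 0" using r power2_csqrt[of "of_real r"] by (auto simp: q_def power2_eq_square)
 define M where "M = moebius ((of_real r + z0 * A) / q) (z0 / q) (A / q) (1 / q)"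
 have M: "M \<zeta> = z0 + of_real r * \<zeta> / (1 + A * \<zeta>)" if "1 + A * \<zeta> ~= 0" for \<zeta>
 proof -
  define X where "X = of_real r + z0 * A"
  have "X / q * \<zeta> + z0 / q = (X * \<zeta> + z0) / q" "A / q * \<zeta> + 1 / q = (1 + A * \<zeta>) / q"
   by (simp_all add: add_divide_distrib)
  then have "M \<zeta> = (((of_real r + z0 * A) * \<zeta> + z0) / q) / ((1 + A * \<zeta>) / q)"
   by (simp only: M_def moebius_def X_def)
  also have "\<dots> = ((of_real r + z0 * A) * \<zeta> + z0) / (1 + A * \<zeta>)" using q by simp
  also have "\<dots> = z0 + of_real r * \<zeta> / (1 + A * \<zeta>)" using that by (simp add: field_simps)
  finally show ?thesis .
 qed
 define x where "x j = (if j = 2 then 0 else - (fact j * ((deriv ^^ (j - 2)) W 0 / fact (j - 2))))" for j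
 have det: "(of_real r + z0 * A) / q * (1 / q) - z0 / q * (A / q) = 1"
  using q by (simp add: q(1)[symmetric] field_simps)
 have ev: "\<forall>\<^sub>F \<zeta> in nhds 0. M \<zeta> = z0 + of_real r * \<zeta> / (1 + A * \<zeta>)"
  by (rule eventually_mono[OF eventually_nhds_in_open[of "ball 0 (1 / 2)"]]) (use M Wf in auto)
 have dM: "deriv M 0 = of_real r"
 proof (rule DERIV_imp_deriv)
  have "((%\<zeta>. z0 + of_real r * \<zeta> / (1 + A * \<zeta>)) has_field_derivative of_real r) (at 0)"
   by (auto intro!: derivative_eq_intros)
  then show "(M has_field_derivative of_real r) (at 0)" by (subst DERIV_cong_ev[OF refl ev refl])
 qed
 have "diff_op P (f \<circ> M) 0 = diff_op P f (M 0) * deriv M 0 powi m"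
  unfolding M_def
 proof (rule covariant_at[OF cov _ _ open_ball connected_ball det])
  show "f holomorphic_on ball 0 1" using f_holomorphic by (simp only: disc_domain)
  show "inj_on f (ball 0 1)" unfolding inj_on_def using f_neq disc_domain by blast
  show "A / q * 0 + 1 / q ~= 0" using q by simp
  show "moebius ((of_real r + z0 * A) / q) (z0 / q) (A / q) (1 / q) 0 \<in> ball 0 1"
   using M[of 0] z0 by (simp add: M_def)
 qed
 then have cv: "diff_op P f z0 * of_real r powi m = diff_op P (f \<circ> M) 0" using M[of 0] dM by simp
 have We: "W has_fps_expansion fps_expansion W 0"
  by (rule has_fps_expansion_fps_expansion[OF _ _ W(1)]) auto
 have ge: "(%\<zeta>. f z0 + \<rho> * (\<zeta> - \<zeta>\<^sup>2 * W \<zeta>)) has_fps_expansion fps_const (f z0) + fps_const \<rho> * (fps_X - fps_X\<^sup>2 * fps_expansion W 0)"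
  by (intro fps_expansion_intros We)
 have evf: "\<forall>\<^sub>F \<zeta> in nhds 0. (f \<circ> M) \<zeta> = f z0 + \<rho> * (\<zeta> - \<zeta>\<^sup>2 * W \<zeta>)"
  by (rule eventually_mono[OF eventually_nhds_in_open[of "ball 0 (1 / 2)"]])
    (use M Wf in \<open>auto simp: \<rho>_def r_def simp del: mem_ball mem_ball_0 of_real_diff\<close>)
 have jets: "(deriv ^^ n) (f \<circ> M) 0 = fact n * fps_nth (fps_const (f z0) + fps_const \<rho> * (fps_X - fps_X\<^sup>2 * fps_expansion W 0)) n" for n
 proof -
  have "(deriv ^^ n) (f \<circ> M) 0 = (deriv ^^ n) (%\<zeta>. f z0 + \<rho> * (\<zeta> - \<zeta>\<^sup>2 * W \<zeta>)) 0" by (rule higher_deriv_cong_ev[OF evf refl])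
  then show ?thesis using fps_nth_fps_expansion[OF ge, of n] by simp
 qed
 have jet1: "deriv (f \<circ> M) 0 = \<rho>" using jets[of 1] by (simp add: fps_X_power_mult_nth)
 have jetj: "(deriv ^^ j) (f \<circ> M) 0 = \<rho> * x j" if j: "2 <= j" for j
 proof -
  have "fps_nth fps_X j = (0 :: complex)" using j by simp
  then show ?thesis
   using jets[of j] j W(2) by (simp add: fps_X_power_mult_nth x_def fps_expansion_def)
 qed
 have "jeval P (jet (f \<circ> M) 0) = jeval P (%j. if j = 1 then inverse \<rho> else \<rho> * x j)"
  by (rule jeval_cong[OF P]) (auto simp: jet_def jet1 jetj)
 then have main: "diff_op P f z0 * of_real (1 - cmod z0) powi m = jeval P (%j. if j = 1 then inverse \<rho> else \<rho> * x j)"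
  using cv by (simp add: diff_op_jeval r_def)
 have jc: "jet_coeff z0 j = - (fact j * (of_real (r ^ (j - 2 + 1) / pi) * (LBINT z. \<mu> z / (z - z0) ^ (j - 2 + 3))))" if "3 <= j" for j
 proof -
  have s: "\<mu> z / (z - z0) ^ n = (-1) ^ n * (\<mu> z / (z0 - z) ^ n)" for z n
  proof -
   have "(z0 - z) ^ n = (-1) ^ n * (z - z0) ^ n" using power_minus[of "z - z0" n] by simp
   then show ?thesis by simp
  qed
  have e: "j - 2 + 1 = j - 1" "j - 2 + 3 = j + 1" using that by auto
  have i: "(LBINT z. \<mu> z / (z - z0) ^ (j + 1)) = (-1) ^ (j + 1) * (LBINT z. \<mu> z / (z0 - z) ^ (j + 1))"
   unfolding s[of _ "j + 1"] by (rule integral_mult_right_zero)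
  show ?thesis unfolding jet_coeff_def e i r_def by (simp del: integral_mult_right_zero)
 qed
 show ?thesis
 proof (rule that[of x, OF _ _ _ main])
  show "x 2 = 0" by (simp add: x_def)
  fix j :: nat assume j: "3 <= j"
  then have j1: "1 <= j - 2" by simp
  show "cmod (jet_coeff z0 j) <= fact j * 3 * k"
   unfolding jc[OF j] norm_minus_cancel norm_mult[of "fact j"] using J[OF j1] by (simp add: mult.assoc)
  have "x j - jet_coeff z0 j = - (fact j * ((deriv ^^ (j - 2)) W 0 / fact (j - 2) - of_real (r ^ (j - 2 + 1) / pi) * (LBINT z. \<mu> z / (z - z0) ^ (j - 2 + 3))))"
   unfolding jc[OF j] using j by (simp add: x_def algebra_simps)
  then have "cmod (x j - jet_coeff z0 j) <= fact j * ((165 * 4 ^ (j - 2) + 2) * k\<^sup>2)"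
   using WJ[OF j1] by (simp add: norm_mult del: of_real_divide of_real_power)
  also have "\<dots> <= fact j * ((165 * 4 ^ j + 2) * k\<^sup>2)"
   by (intro mult_left_mono mult_right_mono add_mono power_increasing) auto
  finally show "cmod (x j - jet_coeff z0 j) <= fact j * (165 * 4 ^ j + 2) * k\<^sup>2" by (simp add: mult.assoc)
 qed
qed

end

section \<open>Powers of \<rho> in the normal form, and its remainder\<close>

definition jet_exponents :: "diff_poly => (nat \<Rightarrow>\<^sub>0 nat) set" where
 "jet_exponents P = {e \<in> keys P. lookup e 2 = 0}"

lemma jet_exponents_degree:
 fixes x :: "nat => complex"
 assumes P: "diff_poly_upto N P" and e: "e \<in> jet_exponents P"
 shows "jet_degree e = (\<Sum>k\<in>{3..N}. lookup e k)"
  and "(\<Prod>k \<in> keys e - {1}. x k ^ lookup e k) = (\<Prod>k\<in>{3..N}. x k ^ lookup e k)"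
proof -
 have sub: "keys e - {1} \<subseteq> {3..N}"
 proof
  fix k assume k: "k \<in> keys e - {1}"
  then have "k \<in> {2..N}" using keys_upto[OF P, of e] e by (auto simp: jet_exponents_def)
  moreover have "k ~= 2" using k e by (auto simp: jet_exponents_def in_keys_iff)
  ultimately show "k \<in> {3..N}" by auto
 qed
 show "jet_degree e = (\<Sum>k\<in>{3..N}. lookup e k)"
  unfolding jet_degree_def by (rule sum.mono_neutral_left) (use sub in \<open>auto simp: in_keys_iff\<close>)
 show "(\<Prod>k \<in> keys e - {1}. x k ^ lookup e k) = (\<Prod>k\<in>{3..N}. x k ^ lookup e k)"
  by (rule prod.mono_neutral_left) (use sub in \<open>auto simp: in_keys_iff\<close>)
qed

text \<open>A monomial gains one factor \<rho> for each derivative of order at least 2 and loses one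
  for each 1 / f'. Monomials containing f'' vanish together with \<open>x 2\<close>.\<close>

lemma jeval_jets:
 assumes P: "diff_poly_upto N P" and \<rho>: "\<rho> ~= 0" and x2: "x 2 = 0"
 shows "jeval P (%j. if j = 1 then inverse \<rho> else \<rho> * x j) =
  (\<Sum>e\<in>jet_exponents P. lookup P e * \<rho> powi (int (jet_degree e) - int (lookup e 1)) *
    (\<Prod>k\<in>{3..N}. x k ^ lookup e k))"
proof -
 let ?y = "%j. if j = 1 then inverse \<rho> else \<rho> * x j"
 have t: "(\<Prod>k \<in> keys e. ?y k ^ lookup e k) =
  \<rho> powi (int (jet_degree e) - int (lookup e 1)) * (\<Prod>k \<in> keys e - {1}. x k ^ lookup e k)" for e
 proof -
  have "(\<Prod>k \<in> keys e. ?y k ^ lookup e k) =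
   ?y 1 ^ lookup e 1 * (\<Prod>k \<in> keys e - {1}. ?y k ^ lookup e k)"
  proof (cases "1 \<in> keys e")
   case True
   then show ?thesis by (subst prod.remove[of _ 1]) auto
  qed (simp add: in_keys_iff)
  also have "(\<Prod>k \<in> keys e - {1}. ?y k ^ lookup e k) =
   (\<Prod>k \<in> keys e - {1}. \<rho> ^ lookup e k * x k ^ lookup e k)"
   by (intro prod.cong refl) (simp add: power_mult_distrib)
  also have "\<dots> = \<rho> ^ jet_degree e * (\<Prod>k \<in> keys e - {1}. x k ^ lookup e k)"
   by (simp add: prod.distrib power_sum jet_degree_def)
  finally show ?thesis using \<rho> by (simp add: power_int_diff power_inverse field_simps)
 qed
 have "jeval P ?y = (\<Sum>e\<in>jet_exponents P. lookup P e * (\<Prod>k \<in> keys e. ?y k ^ lookup e k))"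
  unfolding jeval_def
 proof (rule sum.mono_neutral_right)
  show "\<forall>e\<in>keys P - jet_exponents P. lookup P e * (\<Prod>k \<in> keys e. ?y k ^ lookup e k) = 0"
  proof
   fix e assume "e \<in> keys P - jet_exponents P"
   then have "2 \<in> keys e" by (auto simp: jet_exponents_def in_keys_iff)
   then have "(\<Prod>k \<in> keys e. ?y k ^ lookup e k) = 0"
    using x2 by (intro prod_zero bexI[of _ 2]) (auto simp: in_keys_iff)
   then show "lookup P e * (\<Prod>k \<in> keys e. ?y k ^ lookup e k) = 0" by simp
  qed
 qed (auto simp: jet_exponents_def)
 also have "\<dots> = (\<Sum>e\<in>jet_exponents P. lookup P e * \<rho> powi (int (jet_degree e) - int (lookup e 1)) *
    (\<Prod>k\<in>{3..N}. x k ^ lookup e k))"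
 proof (rule sum.cong[OF refl])
  fix e assume e: "e \<in> jet_exponents P"
  show "lookup P e * (\<Prod>k \<in> keys e. ?y k ^ lookup e k) = lookup P e * \<rho> powi (int (jet_degree e) - int (lookup e 1)) *
    (\<Prod>k\<in>{3..N}. x k ^ lookup e k)"
   unfolding t jet_exponents_degree(2)[OF P e] by (simp only: mult.assoc)
 qed
 finally show ?thesis .
qed

lemma finite_jet_exponents: "finite (jet_exponents P)"
 by (simp add: jet_exponents_def)

lemma norm_monomial_le:
 fixes x :: "nat => complex"
 assumes "!!k. k \<in> I ==> cmod (x k) <= M"
 shows "cmod (\<Prod>k\<in>I. x k ^ e k) <= M ^ (\<Sum>k\<in>I. e k)"
proof -
 have "cmod (\<Prod>k\<in>I. x k ^ e k) <= (\<Prod>k\<in>I. M ^ e k)"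
  unfolding prod_norm[symmetric] by (intro prod_mono) (auto simp: norm_power intro!: power_mono assms)
 then show ?thesis by (simp add: power_sum)
qed

text \<open>If the jets could be steered to \<open>\<tau> y + O(\<tau>\<^sup>2)\<close> while \<open>\<rho> \<rightarrow> 0\<close>, a negative power of \<open>\<rho>\<close> in the
 normal form would make the value of the operator unbounded.\<close>

lemma jet_exponents_nonneg:
 assumes P: "diff_poly_upto N P"
  and steer: "!!y. \<exists>C. \<exists>\<tau>0>0. \<forall>\<tau>. 0 < \<tau> --> \<tau> < \<tau>0 --> (\<exists>Bd. \<forall>\<delta>>0. \<exists>\<rho> x. \<rho> ~= 0 \<and> cmod \<rho> < \<delta> \<and> x 2 = 0 \<and>
    (\<forall>k\<in>{3..N}. cmod (x k - of_real \<tau> * y k) <= C * \<tau>\<^sup>2) \<and>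
    cmod (jeval P (%j. if j = 1 then inverse \<rho> else \<rho> * x j)) <= Bd)"
  and e: "e \<in> jet_exponents P"
 shows "lookup e 1 <= jet_degree e"
proof (rule ccontr)
 assume neg: "\<not> ?thesis"
 define s where "s e = int (lookup e 1) - int (jet_degree e)" for e
 \<comment> \<open>The most negative power of \<rho> is -J. After multiplication by \<rho>^J only
   the monomials in \<open>K\<close> survive as \<rho> tends to 0.\<close>
 define J where "J = Max (s ` jet_exponents P)"
 have sJ: "s e <= J" if "e \<in> jet_exponents P" for e
  unfolding J_def using that finite_jet_exponents by (intro Max_ge) auto
 have J0: "0 < J" using sJ[OF e] neg by (simp add: s_def)
 define K where "K = {e \<in> jet_exponents P. s e = J}"
 have "J \<in> s ` jet_exponents P" unfolding J_def using e finite_jet_exponents by (intro Max_in) auto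
 then have Kne: "K ~= {}" by (auto simp: K_def)
 have Kfin: "finite K" using finite_jet_exponents by (simp add: K_def)
 \<comment> \<open>For jets \<tau> y + O(\<tau>^2) the lowest degree in \<open>K\<close> dominates
   as \<tau> tends to 0; y is chosen so that the part \<open>Kd\<close> of that degree does not
   vanish.\<close>
 define d where "d = Min (jet_degree ` K)"
 have dle: "d <= jet_degree e" if "e \<in> K" for e unfolding d_def using that Kfin by (intro Min_le) auto
 define Kd where "Kd = {e \<in> K. jet_degree e = d}"
 have "d \<in> jet_degree ` K" unfolding d_def using Kne Kfin by (intro Min_in) auto
 then have Kdne: "Kd ~= {}" by (auto simp: Kd_def)
 obtain y where y: "(\<Sum>e\<in>Kd. lookup P e * (\<Prod>i\<in>{3..N}. y i ^ lookup e i)) ~= 0"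
 proof (rule multivariate_nonvanishing[of "{3..N}" Kd "lookup P" lookup])
  show "finite Kd" using Kfin by (simp add: Kd_def)
  show "lookup P e ~= 0" if "e \<in> Kd" for e
   using that by (auto simp: Kd_def K_def jet_exponents_def in_keys_iff)
  fix a b assume ab: "a \<in> Kd" "b \<in> Kd" and eq: "!!i. i \<in> {3..N} ==> lookup a i = lookup b i"
  show "a = b"
  proof (rule poly_mapping_eqI)
   fix i
   have ks: "keys a \<subseteq> insert 1 {2..N}" "keys b \<subseteq> insert 1 {2..N}"
    by (rule keys_upto[OF P], use ab in \<open>simp add: Kd_def K_def jet_exponents_def\<close>)+
   consider "i = 1" | "i = 2" | "i \<in> {3..N}" | "i \<notin> insert 1 {2..N}" by fastforce
   then show "lookup a i = lookup b i"
   proof cases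
    case 1
    then show ?thesis using ab by (simp add: Kd_def K_def s_def)
   next
    case 2
    then show ?thesis using ab by (simp add: Kd_def K_def jet_exponents_def)
   next
    case 3
    then show ?thesis by (rule eq)
   next
    case 4
    then have "i \<notin> keys a" "i \<notin> keys b" using ks by auto
    then show ?thesis by (simp add: in_keys_iff)
   qed
  qed
 qed (use Kdne in auto)
 define R where "R x = (\<Sum>e\<in>K. lookup P e * (\<Prod>k\<in>{3..N}. x k ^ lookup e k))" for x :: "nat => complex"
 obtain C \<tau>0 where \<tau>0: "0 < \<tau>0" and st: "!!\<tau>. 0 < \<tau> ==> \<tau> < \<tau>0 ==> \<exists>Bd. \<forall>\<delta>>0. \<exists>\<rho> x. \<rho> ~= 0 \<and> cmod \<rho> < \<delta> \<and> x 2 = 0 \<and>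
    (\<forall>k\<in>{3..N}. cmod (x k - of_real \<tau> * y k) <= C * \<tau>\<^sup>2) \<and>
    cmod (jeval P (%j. if j = 1 then inverse \<rho> else \<rho> * x j)) <= Bd" using steer[of y] by blast
 have small: "\<exists>x. (\<forall>k\<in>{3..N}. cmod (x k - of_real \<tau> * y k) <= C * \<tau>\<^sup>2) \<and> cmod (R x) <= \<tau> ^ (d + 1)"
  if \<tau>: "0 < \<tau>" "\<tau> < \<tau>0" for \<tau>
 proof -
  obtain Bd where Bd: "!!\<delta>. 0 < \<delta> ==> \<exists>\<rho> x. \<rho> ~= 0 \<and> cmod \<rho> < \<delta> \<and> x 2 = 0 \<and>
    (\<forall>k\<in>{3..N}. cmod (x k - of_real \<tau> * y k) <= C * \<tau>\<^sup>2) \<and>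
    cmod (jeval P (%j. if j = 1 then inverse \<rho> else \<rho> * x j)) <= Bd" using st[OF \<tau>] by blast
  define M where "M = 1 + \<bar>C\<bar> * \<tau>\<^sup>2 + (\<Sum>k\<in>{3..N}. \<tau> * cmod (y k))"
  have M1: "1 <= M" unfolding M_def using \<tau> by (simp add: sum_nonneg)
  define S where "S = \<bar>Bd\<bar> + (\<Sum>e\<in>jet_exponents P. cmod (lookup P e) * M ^ jet_degree e)"
  have S0: "0 <= S" unfolding S_def using M1 by (intro add_nonneg_nonneg sum_nonneg) auto
  \<comment> \<open>All terms other than \<open>R x\<close> are together at most |\<rho>| S, so this
    \<rho> makes |R x| at most \<tau>^(d+1), one order smaller than its leading part.\<close>
  obtain \<rho> x where x: "\<rho> ~= 0" "cmod \<rho> < min 1 (\<tau> ^ (d + 1) / (S + 1))" "x 2 = 0"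
    "!!k. k \<in> {3..N} ==> cmod (x k - of_real \<tau> * y k) <= C * \<tau>\<^sup>2"
    "cmod (jeval P (%j. if j = 1 then inverse \<rho> else \<rho> * x j)) <= Bd"
   using Bd[of "min 1 (\<tau> ^ (d + 1) / (S + 1))"] \<tau> S0 by auto
  have xM: "cmod (x k) <= M" if k: "k \<in> {3..N}" for k
  proof -
   have "cmod (x k) <= cmod (x k - of_real \<tau> * y k) + cmod (of_real \<tau> * y k)"
    using norm_triangle_ineq[of "x k - of_real \<tau> * y k" "of_real \<tau> * y k"] by simp
   moreover have "cmod (of_real \<tau> * y k) <= (\<Sum>k\<in>{3..N}. \<tau> * cmod (y k))"
    using \<tau> k by (simp add: norm_mult) (intro member_le_sum[of k "{3..N}" "%k. \<tau> * cmod (y k)"], auto)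
   moreover have "C * \<tau>\<^sup>2 <= \<bar>C\<bar> * \<tau>\<^sup>2" by (intro mult_right_mono) auto
   ultimately show ?thesis using x(4)[OF k] by (simp add: M_def)
  qed
  have powi: "\<rho> powi J * \<rho> powi (int (jet_degree e) - int (lookup e 1)) = \<rho> ^ nat (J - s e)" if "e \<in> jet_exponents P" for e
  proof -
   have "\<rho> powi J * \<rho> powi (int (jet_degree e) - int (lookup e 1)) = \<rho> powi (J - s e)"
    unfolding power_int_add[symmetric, of \<rho>, OF disjI1[OF x(1)]] s_def
    by (rule arg_cong[where f = "%i. \<rho> powi i"]) simp
   also have "\<dots> = \<rho> ^ nat (J - s e)" using sJ[OF that] by (simp add: power_int_def)
   finally show ?thesis .
  qed
  define X where "X e = lookup P e * \<rho> ^ nat (J - s e) * (\<Prod>k\<in>{3..N}. x k ^ lookup e k)" for e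
  have XR: "(\<Sum>e\<in>K. X e) = R x" unfolding R_def by (intro sum.cong refl) (simp add: X_def K_def)
  have "\<rho> powi J * jeval P (%j. if j = 1 then inverse \<rho> else \<rho> * x j) = (\<Sum>e\<in>jet_exponents P. X e)"
   unfolding jeval_jets[of N P \<rho> x, OF P x(1,3)] sum_distrib_left
   by (intro sum.cong refl) (simp add: X_def powi[symmetric] mult_ac)
  also have "\<dots> = R x + (\<Sum>e\<in>jet_exponents P - K. X e)"
   unfolding XR[symmetric] using finite_jet_exponents by (subst sum.subset_diff[of K]) (auto simp: K_def add.commute)
  finally have eq: "R x = \<rho> powi J * jeval P (%j. if j = 1 then inverse \<rho> else \<rho> * x j) - (\<Sum>e\<in>jet_exponents P - K. X e)" by simp
  have p1: "cmod \<rho> ^ n <= cmod \<rho>" if "0 < n" for n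
   using power_decreasing[of 1 n "cmod \<rho>"] x(2) that by simp
  have "cmod (\<rho> powi J * jeval P (%j. if j = 1 then inverse \<rho> else \<rho> * x j)) <= cmod \<rho> * \<bar>Bd\<bar>"
   unfolding norm_mult using x(5) J0 p1[of "nat J"] by (intro mult_mono) (auto simp: norm_power power_int_def)
  moreover have "cmod (\<Sum>e\<in>jet_exponents P - K. X e) <= (\<Sum>e\<in>jet_exponents P. cmod \<rho> * (cmod (lookup P e) * M ^ jet_degree e))"
  proof -
   have "cmod (\<Sum>e\<in>jet_exponents P - K. X e) <= (\<Sum>e\<in>jet_exponents P - K. cmod \<rho> * (cmod (lookup P e) * M ^ jet_degree e))"
   proof (rule sum_norm_le)
    fix e assume e: "e \<in> jet_exponents P - K"
    then have "s e < J" using sJ[of e] by (auto simp: K_def order_less_le)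
    then have "cmod (\<rho> ^ nat (J - s e)) <= cmod \<rho>" unfolding norm_power by (intro p1) simp
    moreover have "cmod (\<Prod>k\<in>{3..N}. x k ^ lookup e k) <= M ^ jet_degree e"
     using norm_monomial_le[of "{3..N}" x M "lookup e", OF xM] jet_exponents_degree(1)[OF P, of e] e by simp
    ultimately have "cmod (lookup P e) * (cmod (\<rho> ^ nat (J - s e)) * cmod (\<Prod>k\<in>{3..N}. x k ^ lookup e k))
      <= cmod (lookup P e) * (cmod \<rho> * M ^ jet_degree e)"
     by (intro mult_left_mono mult_mono) auto
    then show "cmod (X e) <= cmod \<rho> * (cmod (lookup P e) * M ^ jet_degree e)"
     by (simp add: X_def norm_mult mult_ac)
   qed
   also have "\<dots> <= (\<Sum>e\<in>jet_exponents P. cmod \<rho> * (cmod (lookup P e) * M ^ jet_degree e))"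
    using finite_jet_exponents M1 by (intro sum_mono2) auto
   finally show ?thesis .
  qed
  ultimately have "cmod (R x) <= cmod \<rho> * S"
   unfolding eq S_def distrib_left sum_distrib_left by (rule norm_triangle_le_diff[OF add_mono])
  also have "\<dots> <= \<tau> ^ (d + 1) / (S + 1) * S" using x(2) S0 by (intro mult_right_mono) auto
  also have "\<dots> <= \<tau> ^ (d + 1)" using S0 \<tau> by (simp add: field_simps)
  finally show ?thesis using x(4) by blast
 qed
 define \<tau> where "\<tau> n = \<tau>0 / real (n + 2)" for n :: nat
 have \<tau>: "0 < \<tau> n" "\<tau> n < \<tau>0" for n using \<tau>0 by (auto simp: \<tau>_def field_simps add_pos_nonneg)
 have \<tau>lim: "\<tau> \<longlonglongrightarrow> 0" unfolding \<tau>_def[abs_def]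
  using LIMSEQ_ignore_initial_segment[OF lim_const_over_n[of \<tau>0], of 2] by simp
 have "\<forall>n. \<exists>x. (\<forall>k\<in>{3..N}. cmod (x k - of_real (\<tau> n) * y k) <= C * (\<tau> n)\<^sup>2) \<and> cmod (R x) <= \<tau> n ^ (d + 1)"
  using small \<tau> by blast
 from choice[OF this] obtain X where X: "!!n k. k \<in> {3..N} ==> cmod (X n k - of_real (\<tau> n) * y k) <= C * (\<tau> n)\<^sup>2"
  "!!n. cmod (R (X n)) <= \<tau> n ^ (d + 1)" by blast
 have Xy: "(%n. X n k / of_real (\<tau> n)) \<longlonglongrightarrow> y k" if k: "k \<in> {3..N}" for k
 proof (rule Lim_transform2[OF tendsto_const])
  show "(%n. y k - X n k / of_real (\<tau> n)) \<longlonglongrightarrow> 0"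
  proof (rule Lim_null_comparison)
   show "\<forall>\<^sub>F n in sequentially. norm (y k - X n k / of_real (\<tau> n)) <= C * \<tau> n"
   proof (rule always_eventually, rule allI)
    fix n
    have "y k - X n k / of_real (\<tau> n) = - (X n k - of_real (\<tau> n) * y k) / of_real (\<tau> n)"
     using \<tau>(1)[of n] by (simp add: field_simps)
    then have "norm (y k - X n k / of_real (\<tau> n)) = cmod (X n k - of_real (\<tau> n) * y k) / \<tau> n"
     using \<tau>(1)[of n] by (simp add: norm_divide norm_minus_commute)
    also have "\<dots> <= C * (\<tau> n)\<^sup>2 / \<tau> n" using \<tau>(1)[of n] X(1)[OF k, of n] by (intro divide_right_mono) auto
    also have "\<dots> = C * \<tau> n" using \<tau>(1)[of n] by (simp add: power2_eq_square)
    finally show "norm (y k - X n k / of_real (\<tau> n)) <= C * \<tau> n" .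
   qed
   show "(%n. C * \<tau> n) \<longlonglongrightarrow> 0" using tendsto_mult_left[OF \<tau>lim, of C] by simp
  qed
 qed
 have scaled: "R (X n) / of_real (\<tau> n) ^ d = (\<Sum>e\<in>K. lookup P e * of_real (\<tau> n) ^ (jet_degree e - d) * (\<Prod>k\<in>{3..N}. (X n k / of_real (\<tau> n)) ^ lookup e k))" for n
  unfolding R_def sum_divide_distrib
 proof (rule sum.cong[OF refl])
  fix e assume e: "e \<in> K"
  define t where "t = cx (\<tau> n)"
  have t0: "t ~= 0" using \<tau>(1)[of n] by (simp add: t_def)
  have "(\<Prod>k\<in>{3..N}. (X n k / t) ^ lookup e k) = (\<Prod>k\<in>{3..N}. X n k ^ lookup e k) / t ^ jet_degree e"
   using e unfolding power_divide prod_dividef by (subst jet_exponents_degree(1)[OF P, of e]) (auto simp: K_def power_sum)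
  moreover have "t ^ jet_degree e = t ^ (jet_degree e - d) * t ^ d" using dle[OF e] by (simp add: power_add[symmetric])
  ultimately show "lookup P e * (\<Prod>k\<in>{3..N}. X n k ^ lookup e k) / cx (\<tau> n) ^ d
   = lookup P e * of_real (\<tau> n) ^ (jet_degree e - d) * (\<Prod>k\<in>{3..N}. (X n k / of_real (\<tau> n)) ^ lookup e k)"
   using t0 by (simp add: t_def)
 qed
 have "(%n. R (X n) / of_real (\<tau> n) ^ d) \<longlonglongrightarrow> (\<Sum>e\<in>K. lookup P e * of_real 0 ^ (jet_degree e - d) * (\<Prod>k\<in>{3..N}. y k ^ lookup e k))"
  unfolding scaled by (intro tendsto_intros Xy \<tau>lim)
 also have "(\<Sum>e\<in>K. lookup P e * of_real 0 ^ (jet_degree e - d) * (\<Prod>k\<in>{3..N}. y k ^ lookup e k)) =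
   (\<Sum>e\<in>Kd. lookup P e * (\<Prod>k\<in>{3..N}. y k ^ lookup e k))"
 proof (rule sum.mono_neutral_cong_right[OF Kfin])
  show "\<forall>e\<in>K - Kd. lookup P e * of_real 0 ^ (jet_degree e - d) * (\<Prod>k\<in>{3..N}. y k ^ lookup e k) = 0"
  proof
   fix e assume "e \<in> K - Kd"
   then have "0 < jet_degree e - d" using dle[of e] by (auto simp: Kd_def)
   then show "lookup P e * of_real 0 ^ (jet_degree e - d) * (\<Prod>k\<in>{3..N}. y k ^ lookup e k) = 0" by simp
  qed
 qed (auto simp: Kd_def)
 finally have l1: "(%n. R (X n) / of_real (\<tau> n) ^ d) \<longlonglongrightarrow> (\<Sum>e\<in>Kd. lookup P e * (\<Prod>k\<in>{3..N}. y k ^ lookup e k))" .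
 have "(%n. R (X n) / of_real (\<tau> n) ^ d) \<longlonglongrightarrow> 0"
 proof (rule Lim_null_comparison[OF _ \<tau>lim], rule always_eventually, rule allI)
  fix n
  have "norm (R (X n) / of_real (\<tau> n) ^ d) <= \<tau> n ^ (d + 1) / \<tau> n ^ d"
   unfolding norm_divide norm_power norm_of_real using X(2)[of n] \<tau>(1)[of n] by (intro frac_le) auto
  then show "norm (R (X n) / of_real (\<tau> n) ^ d) <= \<tau> n" using \<tau>(1)[of n] by simp
 qed
 from LIMSEQ_unique[OF this l1] y show False by simp
qed

text \<open>The weight forces k = m + l, so an exponent of degree one is determined by l. This
  rewrites the linear part as a sum over exponents, to be compared with the normal form term by
  term.\<close>

lemma sum_lin_support:
 assumes P: "diff_poly_upto N P" and cov: "moebius_covariant m P"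
 shows "(\<Sum>(k, l)\<in>lin_support P. lin_coeff P k l * g k l) =
  (\<Sum>e\<in>{e\<in>jet_exponents P. jet_degree e = 1}. lookup P e * g (nat (m + int (lookup e 1))) (lookup e 1))"
proof (rule sum.reindex_bij_witness[where i = "%e. (nat (m + int (lookup e 1)), lookup e 1)"
   and j = "%(k, l). single k 1 + single 1 l"])
 fix p assume "p \<in> lin_support P"
 moreover obtain k l where p: "p = (k, l)" by fastforce
 ultimately have kl: "(k, l) \<in> lin_support P" by simp
 note F = lin_support_facts[OF P cov kl]
 have k2: "2 <= k" using F(1) by simp
 note lk = lin_exponent_lookup[OF k2, of l]
 have m: "nat (m + int l) = k" using F(3) by linarith
 have l1: "lookup (single k 1 + single 1 l) 1 = l" unfolding lk using k2 by simp
 have l2: "lookup (single k 1 + single 1 l) 2 = 0" unfolding lk using F(1) by simp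
 show "(%e. (nat (m + int (lookup e 1)), lookup e 1)) (case p of (k, l) => single k 1 + single 1 l) = p"
  unfolding p prod.case l1 m ..
 show "(case p of (k, l) => single k 1 + single 1 l) \<in> {e\<in>jet_exponents P. jet_degree e = 1}"
  unfolding p prod.case jet_exponents_def using F(4) l2 lin_exponent_weight(2)[OF k2, of l] by blast
 show "lookup P (case p of (k, l) => single k 1 + single 1 l) *
   g (nat (m + int (lookup (case p of (k, l) => single k 1 + single 1 l) 1)))
    (lookup (case p of (k, l) => single k 1 + single 1 l) 1)
   = (case p of (k, l) => lin_coeff P k l * g k l)"
  unfolding p prod.case l1 m lin_coeff_def ..
next
 fix e assume e: "e \<in> {e\<in>jet_exponents P. jet_degree e = 1}"
 then have key: "e \<in> keys P" and d: "jet_degree e = 1" by (auto simp: jet_exponents_def)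
 obtain k where k: "2 <= k" "e = single k 1 + single 1 (lookup e 1)"
  by (rule jet_degree_one_cases[OF d keys_upto[OF P key]]) blast
 define l where "l = lookup e 1"
 have e': "e = single k 1 + single 1 l" using k(2) by (simp only: l_def)
 have "int k - int l = m" using covariant_weight[OF P cov key] lin_exponent_weight(1)[OF k(1), of l] unfolding e' by simp
 then have m: "nat (m + int l) = k" by linarith
 show "(%(k, l). single k 1 + single 1 l) (nat (m + int (lookup e 1)), lookup e 1) = e"
  unfolding l_def[symmetric] m prod.case by (rule e'[symmetric])
 have "lin_coeff P k l ~= 0" using key unfolding lin_coeff_def e'[symmetric] by (simp add: in_keys_iff)
 then show "(nat (m + int (lookup e 1)), lookup e 1) \<in> lin_support P"
  unfolding l_def[symmetric] m lin_support_def using k(1) by simp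
qed

text \<open>The monomials are sorted by degree. Nonnegativity leaves only the constant in degree 0
  and l <= 1 in degree 1, where replacing \<rho> by r and x by A costs at most B k^2 + 24 k B k. In
  degree at least 2 the bound |x| <= 2 B k gives k^2 at once.\<close>

lemma jet_remainder:
 assumes P: "diff_poly_upto N P" and cov: "moebius_covariant m P"
  and nonneg: "!!e. e \<in> jet_exponents P ==> lookup e 1 <= jet_degree e" and B: "1 <= B"
 obtains C where "0 <= C" "!!(k::real) (r::real) \<rho> x A. 0 <= k ==> k <= 1 ==> \<rho> ~= 0 ==> cmod \<rho> <= 1 ==> cmod (\<rho> - of_real r) <= 24 * k ==> x 2 = 0 ==>
   (\<forall>j\<in>{3..N}. cmod (x j - A j) <= B * k\<^sup>2 \<and> cmod (A j) <= B * k) ==>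
   cmod (jeval P (%j. if j = 1 then inverse \<rho> else \<rho> * x j) - lookup P 0 -
    (\<Sum>(k, l)\<in>lin_support P. lin_coeff P k l * (of_real r ^ (1 - l) * A k))) <= C * k\<^sup>2"
proof (rule that[of "\<Sum>e\<in>jet_exponents P. cmod (lookup P e) * ((2 * B) ^ jet_degree e + 25 * B)"])
 show "0 <= (\<Sum>e\<in>jet_exponents P. cmod (lookup P e) * ((2 * B) ^ jet_degree e + 25 * B))"
  using B by (intro sum_nonneg mult_nonneg_nonneg add_nonneg_nonneg) auto
 fix k r :: real and \<rho> :: complex and x A :: "nat => complex"
 assume k: "0 <= k" "k <= 1" and \<rho>: "\<rho> ~= 0" "cmod \<rho> <= 1" "cmod (\<rho> - of_real r) <= 24 * k" and x2: "x 2 = 0"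
  and xA': "\<forall>j\<in>{3..N}. cmod (x j - A j) <= B * k\<^sup>2 \<and> cmod (A j) <= B * k"
 have xA: "cmod (x j - A j) <= B * k\<^sup>2" and A: "cmod (A j) <= B * k" if "j \<in> {3..N}" for j
  using xA' that by auto
 define G where "G e = of_real r ^ (1 - lookup e 1) * A (nat (m + int (lookup e 1)))" for e :: "nat \<Rightarrow>\<^sub>0 nat"
 define T where "T e = (if e = 0 then 1 else if jet_degree e = 1 then G e else 0)" for e :: "nat \<Rightarrow>\<^sub>0 nat"
 define X where "X e = \<rho> powi (int (jet_degree e) - int (lookup e 1)) * (\<Prod>k\<in>{3..N}. x k ^ lookup e k)" for e
 have d0: "jet_degree (0 :: nat \<Rightarrow>\<^sub>0 nat) = 0" by (simp add: jet_degree_def)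
 have "(\<Sum>e\<in>jet_exponents P. lookup P e * T e) =
   (\<Sum>e\<in>jet_exponents P. (if e = 0 then lookup P 0 else 0) + (if jet_degree e = 1 then lookup P e * G e else 0))"
  by (intro sum.cong refl) (auto simp: T_def d0)
 also have "\<dots> = lookup P 0 + (\<Sum>e\<in>{e\<in>jet_exponents P. jet_degree e = 1}. lookup P e * G e)"
  unfolding sum.distrib sum.inter_filter[OF finite_jet_exponents]
  by (auto simp: finite_jet_exponents jet_exponents_def in_keys_iff)
 also have "(\<Sum>e\<in>{e\<in>jet_exponents P. jet_degree e = 1}. lookup P e * G e) = (\<Sum>(k, l)\<in>lin_support P. lin_coeff P k l * (of_real r ^ (1 - l) * A k))"
  unfolding sum_lin_support[OF P cov] G_def ..
 finally have "jeval P (%j. if j = 1 then inverse \<rho> else \<rho> * x j) - lookup P 0 -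
    (\<Sum>(k, l)\<in>lin_support P. lin_coeff P k l * (of_real r ^ (1 - l) * A k)) = (\<Sum>e\<in>jet_exponents P. lookup P e * (X e - T e))"
  unfolding jeval_jets[of N P \<rho> x, OF P \<rho>(1) x2] X_def by (simp add: right_diff_distrib sum_subtractf mult.assoc)
 also have "cmod \<dots> <= (\<Sum>e\<in>jet_exponents P. cmod (lookup P e) * ((2 * B) ^ jet_degree e + 25 * B) * k\<^sup>2)"
 proof (rule sum_norm_le)
  fix e assume e: "e \<in> jet_exponents P"
  then have key: "e \<in> keys P" by (simp add: jet_exponents_def)
  note nn = nonneg[OF e]
  have Xp: "X e = \<rho> ^ (jet_degree e - lookup e 1) * (\<Prod>k\<in>{3..N}. x k ^ lookup e k)"
   unfolding X_def of_nat_diff[OF nn, symmetric] power_int_of_nat ..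
  have x2B: "cmod (x j) <= 2 * B * k" if j: "j \<in> {3..N}" for j
  proof -
   have "cmod (x j) <= B * k\<^sup>2 + B * k" using norm_triangle_mono[OF xA[OF j] A[OF j]] by simp
   moreover have "B * k\<^sup>2 <= B * k" using k B mult_left_mono[of k 1 k] by (intro mult_left_mono) (auto simp: power2_eq_square)
   ultimately show ?thesis by simp
  qed
  have mx: "cmod (\<Prod>k\<in>{3..N}. x k ^ lookup e k) <= (2 * B * k) ^ jet_degree e"
   using norm_monomial_le[of "{3..N}" x "2 * B * k" "lookup e", OF x2B] jet_exponents_degree(1)[OF P e] by simp
  have p0: "0 <= (2 * B) ^ jet_degree e" "0 <= k\<^sup>2" using B by auto
  have "cmod (X e - T e) <= ((2 * B) ^ jet_degree e + 25 * B) * k\<^sup>2"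
  proof -
   consider "jet_degree e = 0" | "jet_degree e = 1" | "2 <= jet_degree e" by linarith
   then show ?thesis
   proof cases
    case 1
    then have e0: "e = 0" using jet_degree_zero_cases[OF 1] nn by simp
    have "X e = 1" unfolding Xp by (simp add: e0 d0)
    then show ?thesis using p0 B by (simp add: T_def e0)
   next
    case 2
    obtain j where j: "2 <= j" "j <= N" "e = single j 1 + single 1 (lookup e 1)"
     by (rule jet_degree_one_cases[OF 2 keys_upto[OF P key]]) blast
    define l where "l = lookup e 1"
    have e': "e = single j 1 + single 1 l" using j(3) by (simp only: l_def)
    note lk = lin_exponent_lookup[OF j(1), of l, folded e']
    have "j ~= 2" using e lk[of 2] by (auto simp: jet_exponents_def)
    then have j3: "j \<in> {3..N}" using j by auto
    have "int j - int l = m" using covariant_weight[OF P cov key] lin_exponent_weight(1)[OF j(1), of l, folded e'] by simp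
    then have m: "nat (m + int l) = j" by linarith
    have l1: "l = 0 \<or> l = 1" using nn 2 by (auto simp: l_def)
    have pr: "(\<Prod>k\<in>{3..N}. x k ^ lookup e k) = x j"
    proof -
     have "(\<Prod>k\<in>{3..N}. x k ^ lookup e k) = (\<Prod>k\<in>{3..N}. if k = j then x k else 1)"
      by (intro prod.cong refl) (simp add: lk)
     then show ?thesis using j3 by simp
    qed
    have ne: "e ~= 0" using 2 d0 by auto
    have XT: "X e - T e = \<rho> ^ (1 - l) * x j - of_real r ^ (1 - l) * A j"
     unfolding Xp T_def G_def pr l_def[symmetric] m 2 using ne by simp
    have "cmod (X e - T e) <= 25 * B * k\<^sup>2"
    proof (cases "l = 0")
     case True
     have "X e - T e = \<rho> * (x j - A j) + (\<rho> - of_real r) * A j" unfolding XT using True by (simp add: algebra_simps)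
     also have "cmod \<dots> <= 1 * (B * k\<^sup>2) + 24 * k * (B * k)"
      by (rule norm_triangle_mono) (unfold norm_mult, intro mult_mono xA A j3 \<rho>; use k B in simp)+
     finally show ?thesis by (simp add: power2_eq_square)
    next
     case False
     then have "X e - T e = x j - A j" unfolding XT using l1 by auto
     moreover have "B * k\<^sup>2 <= 25 * B * k\<^sup>2" using B by (intro mult_right_mono) auto
     ultimately show ?thesis using xA[OF j3] by simp
    qed
    then show ?thesis using mult_nonneg_nonneg[OF p0] unfolding distrib_right by linarith
   next
    case 3
    then have "T e = 0" using d0 by (auto simp: T_def)
    then have "cmod (X e - T e) <= 1 * (2 * B * k) ^ jet_degree e"
     unfolding Xp using mx \<rho>(2) by (simp only: norm_mult diff_0_right norm_power) (intro mult_mono power_le_one; simp)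
    also have "\<dots> = (2 * B) ^ jet_degree e * k ^ jet_degree e" by (simp only: power_mult_distrib mult_1)
    also have "\<dots> <= (2 * B) ^ jet_degree e * k\<^sup>2" using k 3 p0 by (intro mult_left_mono power_decreasing) auto
    also have "\<dots> <= ((2 * B) ^ jet_degree e + 25 * B) * k\<^sup>2" using B by (intro mult_right_mono) auto
    finally show ?thesis .
   qed
  qed
  then show "cmod (lookup P e * (X e - T e)) <= cmod (lookup P e) * ((2 * B) ^ jet_degree e + 25 * B) * k\<^sup>2"
   unfolding norm_mult mult.assoc by (intro mult_left_mono) auto
 qed
 finally show "cmod (jeval P (%j. if j = 1 then inverse \<rho> else \<rho> * x j) - lookup P 0 -
    (\<Sum>(k, l)\<in>lin_support P. lin_coeff P k l * (of_real r ^ (1 - l) * A k))) <=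
   (\<Sum>e\<in>jet_exponents P. cmod (lookup P e) * ((2 * B) ^ jet_degree e + 25 * B)) * k\<^sup>2"
  by (simp add: sum_distrib_right)
qed

section \<open>Solutions on the sphere\<close>

lemma open_Dc: "open Dc"
 unfolding Dc_def by (intro open_Collect_less continuous_intros)

lemma not_negligible_Dc: "\<not> negligible Dc"
proof (rule open_not_negligible[OF open_Dc])
 have "2 \<in> Dc" by (simp add: Dc_def)
 then show "Dc ~= {}" by blast
qed

text \<open>On a null set the essential supremum would be minus infinity, so the sign rests on
  \<open>Dc\<close> having positive measure. For a nonmeasurable function the essential supremum is
  infinite and its real value is 0.\<close>

lemma Linf_norm_nonneg: "0 <= Linf_norm \<nu>"
proof (cases "(%z. ereal (norm (\<nu> z))) \<in> borel_measurable (lebesgue_on Dc)")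
 case True
 then have "emeasure (lebesgue_on Dc) (space (lebesgue_on Dc)) ~= 0"
  using open_Dc by (subst emeasure_restrict_space) (use not_negligible_Dc in \<open>auto simp: negligible_iff_null_sets null_sets_def\<close>)
 from esssup_const[OF this, of "0 :: ereal"]
 have "0 <= esssup (lebesgue_on Dc) (%z. ereal (norm (\<nu> z)))"
  using esssup_mono[of "%_. 0 :: ereal" "lebesgue_on Dc" "%z. ereal (norm (\<nu> z))"] by simp
 then show ?thesis by (simp add: Linf_norm_def real_of_ereal_pos)
qed (simp add: Linf_norm_def esssup_non_measurable top_ereal_def)

lemma AE_lebesgue_on_open: "open U ==> (AE z in lebesgue_on U. Q z) \<longleftrightarrow> (AE z in lborel. z \<in> U --> Q z)" for U :: "complex set"
 by (subst AE_restrict_space_iff) (auto simp: AE_completion_iff)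

lemma Linf_norm_AE:
 assumes "\<nu> \<in> Linf"
 shows "AE z in lborel. z \<in> Dc --> cmod (\<nu> z) <= Linf_norm \<nu>"
proof -
 define S where "S = esssup (lebesgue_on Dc) (%z. ereal (norm (\<nu> z)))"
 have "S < \<infinity>" using assms by (simp add: Linf_def S_def)
 have "AE z in lebesgue_on Dc. ereal (norm (\<nu> z)) <= S" unfolding S_def by (rule esssup_AE)
 then have "AE z in lebesgue_on Dc. cmod (\<nu> z) <= real_of_ereal S"
  by (rule AE_mp) (use \<open>S < \<infinity>\<close> in \<open>cases S; auto intro!: AE_I2\<close>)
 then show ?thesis unfolding AE_lebesgue_on_open[OF open_Dc] by (simp add: Linf_norm_def S_def)
qed

lemma Linf_normI:
 assumes "\<nu> \<in> borel_measurable (lebesgue_on Dc)" "AE z in lborel. z \<in> Dc --> cmod (\<nu> z) <= B"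
 shows "\<nu> \<in> Linf" "Linf_norm \<nu> <= B"
proof -
 have m: "(%z. ereal (norm (\<nu> z))) \<in> borel_measurable (lebesgue_on Dc)" using assms(1) by measurable
 have "AE z in lebesgue_on Dc. ereal (norm (\<nu> z)) <= ereal B"
  unfolding AE_lebesgue_on_open[OF open_Dc] using assms(2) by simp
 from esssup_I[OF m this] have le: "esssup (lebesgue_on Dc) (%z. ereal (norm (\<nu> z))) <= ereal B" .
 then have "esssup (lebesgue_on Dc) (%z. ereal (norm (\<nu> z))) < \<infinity>" by (rule le_less_trans) simp
 with assms(1) show "\<nu> \<in> Linf" by (simp add: Linf_def)
 have "B \<ge> 0 \<or> esssup (lebesgue_on Dc) (%z. ereal (norm (\<nu> z))) ~= - \<infinity>"
 proof (rule ccontr)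
  assume "\<not> ?thesis"
  then have "esssup (lebesgue_on Dc) (%z. ereal (norm (\<nu> z))) = - \<infinity>" by simp
  with esssup_AE[of "%z. ereal (norm (\<nu> z))" "lebesgue_on Dc"] have "AE z in lebesgue_on Dc. False" by simp
  then have "AE z in lebesgue. z \<notin> Dc" unfolding AE_lebesgue_on_open[OF open_Dc] by (simp add: AE_completion_iff)
  then have "negligible Dc" using AE_iff_null_sets[of Dc lebesgue] open_Dc by (simp add: negligible_iff_null_sets)
  with not_negligible_Dc show False by simp
 qed
 with le show "Linf_norm \<nu> <= B" unfolding Linf_norm_def
  by (cases "esssup (lebesgue_on Dc) (%z. ereal (norm (\<nu> z)))") auto
qed

lemma Linf_measurable: "\<nu> \<in> Linf ==> \<nu> \<in> borel_measurable (lebesgue_on Dc)"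
 by (simp add: Linf_def)

lemma Linf_cmult:
 assumes "\<nu> \<in> Linf"
 shows "(%\<eta>. c * \<nu> \<eta>) \<in> Linf" "Linf_norm (%\<eta>. c * \<nu> \<eta>) <= cmod c * Linf_norm \<nu>"
proof -
 note m = Linf_measurable[OF assms]
 have "AE z in lborel. z \<in> Dc --> cmod (c * \<nu> z) <= cmod c * Linf_norm \<nu>"
  using Linf_norm_AE[OF assms] by eventually_elim (auto simp: norm_mult intro!: mult_left_mono)
 from Linf_normI[OF _ this] m show "(%\<eta>. c * \<nu> \<eta>) \<in> Linf" "Linf_norm (%\<eta>. c * \<nu> \<eta>) <= cmod c * Linf_norm \<nu>"
  by measurable
qed

text \<open>The hypotheses speak of Lebesgue measurable functions on an open set, the calculus of
  Borel functions on the plane; extension by zero and a change on a null set connect the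
  two.\<close>

lemma borel_representative:
 assumes U: "open U" and g: "g \<in> borel_measurable (lebesgue_on U)"
 obtains g' :: "complex => complex" where "g' \<in> bmeas" "!!z. z \<notin> U ==> g' z = 0"
  "AE z in lborel. z \<in> U --> g z = g' z"
proof -
 define G where "G z = (if z \<in> U then g z else 0)" for z
 have "G \<in> borel_measurable lebesgue"
  unfolding G_def[abs_def] using g U by (subst borel_measurable_if) auto
 then have "(%z. Re (G z)) \<in> borel_measurable lebesgue" "(%z. Im (G z)) \<in> borel_measurable lebesgue" by measurable
 from this[THEN completion_ex_borel_measurable_real] obtain u v where
  u: "u \<in> borel_measurable lborel" "AE z in lborel. Re (G z) = u z" and
  v: "v \<in> borel_measurable lborel" "AE z in lborel. Im (G z) = v z" by blast
 define g' where "g' z = indicator U z * Complex (u z) (v z)" for z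
 have [measurable]: "U \<in> sets borel" "u \<in> bmeas" "v \<in> bmeas" using u(1) v(1) U by auto
 have "g' \<in> bmeas"
  unfolding g'_def[abs_def] Complex_eq by measurable
 moreover have "AE z in lborel. z \<in> U --> g z = g' z"
  using u(2) v(2) by eventually_elim (auto simp: g'_def G_def complex_eq_iff)
 ultimately show ?thesis using that[of g'] by (auto simp: g'_def)
qed

lemma integral_lebesgue_on_open:
 fixes G :: "complex => complex"
 assumes U: "open U" and G: "G \<in> borel_measurable (lebesgue_on U)" and G': "G' \<in> bmeas"
  and z: "!!z. z \<notin> U ==> G' z = 0" and ae: "AE z in lborel. z \<in> U --> G z = G' z"
 shows "(LINT z|lebesgue_on U. G z) = (LBINT z. G' z)"
proof -
 have "(LINT z|lebesgue_on U. G z) = (LINT z|lebesgue. indicator U z *\<^sub>R G z)"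
  using U by (intro integral_restrict_space) auto
 also have "\<dots> = (LINT z|lebesgue. G' z)"
 proof (rule integral_cong_AE)
  have "(%z. if z \<in> U then G z else 0) \<in> borel_measurable lebesgue" using G U by (subst borel_measurable_if) auto
  also have "(%z. if z \<in> U then G z else 0) = (%z. indicator U z *\<^sub>R G z)" by (auto simp: indicator_def)
  finally show "(%z. indicator U z *\<^sub>R G z) \<in> borel_measurable lebesgue" .
  show "G' \<in> borel_measurable lebesgue" using G' by (intro measurable_completion) simp
  show "AE z in lebesgue. indicator U z *\<^sub>R G z = G' z"
   unfolding AE_completion_iff using ae by eventually_elim (auto simp: z indicator_def)
 qed
 also have "\<dots> = (LBINT z. G' z)" using G' by (intro integral_completion) simp
 finally show ?thesis .
qed

lemma borel_measurable_lebesgue_on: "h \<in> bmeas ==> h \<in> borel_measurable (lebesgue_on U)" for h :: "complex => complex"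
 by (intro measurable_restrict_space1 measurable_completion) simp

lemma open_sphere_Some: "openin sphere_top W ==> open {z. Some z \<in> W}"
proof -
 assume "openin sphere_top W"
 then consider U where "open U" "W = Some ` U" | C where "closed C" "W = insert None (Some ` (- C))"
  unfolding sphere_top_def openin_Alexandroff_compactification by (auto simp: Compl_eq_Diff_UNIV)
 then show ?thesis
 proof cases
  case 1
  then have "{z. Some z \<in> W} = U" by auto
  with 1 show ?thesis by simp
 next
  case 2
  then have "{z. Some z \<in> W} = - C" by auto
  with 2(1) show ?thesis by (simp only: open_Compl)
 qed
qed

lemma sphere_homeomorphism:
 assumes "homeomorphic_map sphere_top sphere_top w"
 shows "inj w" and "open {z. w (Some z) ~= None}"
  and "open V ==> open {z. w (Some z) \<in> Some ` V}"
  and "open V ==> open {y. Some y \<in> w ` Some ` V}"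
  and "compact C ==> open {z. w (Some z) \<notin> Some ` C}"
proof -
 have ts: "topspace sphere_top = UNIV" by (auto simp: sphere_top_def) (metis UNIV_I image_iff not_Some_eq)
 have cm: "continuous_map sphere_top sphere_top w" and om: "open_map sphere_top sphere_top w"
  using assms by (auto simp: homeomorphic_eq_everything_map)
 show "inj w" using assms ts by (auto simp: homeomorphic_eq_everything_map)
 have os: "openin sphere_top (Some ` V)" if "open V" for V using that by (simp add: sphere_top_def)
 have pre: "open {z. w (Some z) \<in> W}" if "openin sphere_top W" for W
  using open_sphere_Some[OF openin_continuous_map_preimage[OF cm that]] by (simp add: ts)
 show "open {z. w (Some z) \<in> Some ` V}" if "open V" for V by (rule pre[OF os[OF that]])
 have "{z. w (Some z) \<in> range Some} = {z. w (Some z) ~= None}" by (auto simp: image_iff)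
 with pre[OF os[OF open_UNIV]] show "open {z. w (Some z) ~= None}" by simp
 show "open V ==> open {y. Some y \<in> w ` Some ` V}"
  using open_sphere_Some om os by (auto simp: open_map_def)
 show "open {z. w (Some z) \<notin> Some ` C}" if C: "compact C"
 proof -
  have "openin sphere_top (insert None (Some ` (- C)))"
   unfolding sphere_top_def openin_Alexandroff_compactification
   using C by (intro disjI2 exI[of _ C]) (auto simp: Compl_eq_Diff_UNIV compact_imp_closed)
  moreover have "w (Some z) \<in> insert None (Some ` (- C)) \<longleftrightarrow> w (Some z) \<notin> Some ` C" for z
   by (cases "w (Some z)") auto
  ultimately show ?thesis using pre[of "insert None (Some ` (- C))"] by simp
 qed
qed

text \<open>The topological assumptions of the locale come from the homeomorphism:
  \<open>proper\<close> from the openness of images of balls together with injectivity,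
  \<open>pole\<close> from continuity at the preimage of infinity.\<close>

lemma qc_solution_beltrami:
 assumes \<mu>: "\<mu> \<in> Linf" and small: "48 * Linf_norm \<mu> <= 1" and w: "normalized_qc_solution \<mu> w"
 obtains a p \<mu>0 where "small_beltrami_solution a (planar w) p \<mu>0 (Linf_norm \<mu>)" "ball 0 1 \<subseteq> finite_points w"
  "!!z n. z \<in> ball 0 1 ==> (LBINT \<eta>. \<mu>0 \<eta> / (z - \<eta>) ^ n) = (LINT \<eta>|lebesgue_on Dc. \<mu> \<eta> / (z - \<eta>) ^ n)"
proof -
 define U where "U = finite_points w"
 define f where "f = planar w"
 define k where "k = Linf_norm \<mu>"
 from w obtain p q where hom: "homeomorphic_map sphere_top sphere_top w"
  and p: "locally_L2 U p" and q: "locally_L2 U q" and wd: "weak_derivatives U f p q"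
  and bel: "AE z in lebesgue_on U. q z = (if z \<in> Dc then \<mu> z else 0) * p z"
  and w0: "w (Some 0) = Some 0" and d1: "deriv f 0 = 1" and d2: "(deriv ^^ 2) f 0 = 0"
  unfolding normalized_qc_solution_def qc_solution_def U_def f_def by blast
 note H = sphere_homeomorphism[OF hom]
 have oU: "open U" using H(2) by (simp add: U_def finite_points_def)
 have wf: "w (Some z) = Some (f z)" if "z \<in> U" for z
  using that by (auto simp: U_def finite_points_def f_def planar_def)
 have "\<exists>a. a ~= 0 \<and> - {a} \<subseteq> U \<and> (a \<in> ball 0 1 --> a \<notin> U)"
 proof (cases "U = UNIV")
  case True
  \<comment> \<open>If all finite points have finite images, \<open>a\<close> may be any nonzero
    point off the disc, such as 2.\<close>
  then show ?thesis by (intro exI[of _ 2]) auto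
 next
  case False
  then obtain a where a: "a \<notin> U" by blast
  have "z \<in> U" if "z ~= a" for z
   using a that injD[OF H(1), of "Some z" "Some a"] by (auto simp: U_def finite_points_def)
  moreover have "a ~= 0" using a w0 by (auto simp: U_def finite_points_def)
  ultimately show ?thesis using a by (intro exI[of _ a]) auto
 qed
 then obtain a where a: "a ~= 0" "- {a} \<subseteq> U" "a \<in> ball 0 1 ==> a \<notin> U" by blast
 have fcU: "continuous_on U f"
  unfolding continuous_on_open_vimage[OF oU]
 proof (intro allI impI)
  fix V :: "complex set" assume "open V"
  have "f -` V \<inter> U = {z. w (Some z) \<in> Some ` V}"
  proof (rule set_eqI)
   fix z
   show "z \<in> f -` V \<inter> U \<longleftrightarrow> z \<in> {z. w (Some z) \<in> Some ` V}"
    using wf[of z] by (cases "z \<in> U") (auto simp: U_def finite_points_def)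
  qed
  then show "open (f -` V \<inter> U)" using H(3)[OF \<open>open V\<close>] by simp
 qed
 obtain p0 where p0: "p0 \<in> bmeas" "!!z. z \<notin> U ==> p0 z = 0" "AE z in lborel. z \<in> U --> p z = p0 z"
 proof -
  have "p \<in> borel_measurable (lebesgue_on U)" using p by (simp add: locally_L2_def)
  then show ?thesis by (rule borel_representative[OF oU]) (rule that)
 qed
 obtain \<mu>1 where \<mu>1: "\<mu>1 \<in> bmeas" "!!z. z \<notin> Dc ==> \<mu>1 z = 0" "AE z in lborel. z \<in> Dc --> \<mu> z = \<mu>1 z"
  by (rule borel_representative[OF open_Dc Linf_measurable[OF \<mu>]]) (rule that)
 \<comment> \<open>Truncation at k changes the coefficient on a null set only and makes the bound
   valid everywhere.\<close>
 define \<mu>0 where "\<mu>0 z = (if cmod (\<mu>1 z) <= k then \<mu>1 z else 0)" for z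
 have \<mu>0m: "\<mu>0 \<in> bmeas" unfolding \<mu>0_def[abs_def] using \<mu>1(1) by measurable
 have \<mu>0D: "\<mu>0 z = 0" if "z \<notin> Dc" for z using \<mu>1(2)[OF that] by (simp add: \<mu>0_def)
 have \<mu>0ae: "AE z in lborel. z \<in> Dc --> \<mu> z = \<mu>0 z"
  using \<mu>1(3) Linf_norm_AE[OF \<mu>] by eventually_elim (auto simp: \<mu>0_def k_def)
 have ints: "(LBINT \<eta>. \<mu>0 \<eta> / (z - \<eta>) ^ n) = (LINT \<eta>|lebesgue_on Dc. \<mu> \<eta> / (z - \<eta>) ^ n)" for z n
 proof (rule integral_lebesgue_on_open[OF open_Dc, symmetric])
  have h: "(%\<eta>. (z - \<eta>) ^ n) \<in> bmeas" by measurable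
  show "(%\<eta>. \<mu> \<eta> / (z - \<eta>) ^ n) \<in> borel_measurable (lebesgue_on Dc)"
   by (intro borel_measurable_divide Linf_measurable[OF \<mu>] borel_measurable_lebesgue_on[OF h])
  show "(%\<eta>. \<mu>0 \<eta> / (z - \<eta>) ^ n) \<in> bmeas" using \<mu>0m h by measurable
  show "AE \<eta> in lborel. \<eta> \<in> Dc --> \<mu> \<eta> / (z - \<eta>) ^ n = \<mu>0 \<eta> / (z - \<eta>) ^ n"
   using \<mu>0ae by eventually_elim auto
 qed (simp add: \<mu>0D)
 have "small_beltrami_solution a f p0 \<mu>0 k"
 proof
  show "continuous_on (- {a}) f" by (rule continuous_on_subset[OF fcU a(2)])
  show "inj_on f (- {a})"
  proof (rule inj_onI)
   fix x y assume "x \<in> - {a}" "y \<in> - {a}" "f x = f y"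
   then have "w (Some x) = w (Some y)" using wf a(2) by (metis subsetD)
   then show "x = y" using injD[OF H(1)] by blast
  qed
  show "p0 \<in> bmeas" "\<mu>0 \<in> bmeas" by (fact p0 \<mu>0m)+
  show "cmod (\<mu>0 z) <= k" for z using Linf_norm_nonneg[of \<mu>] by (simp add: \<mu>0_def k_def)
  show "\<mu>0 z = 0" if "cmod z <= 1" for z using that by (intro \<mu>0D) (simp add: Dc_def)
  show "0 <= k" "k <= 1 / 2" "48 * k <= 1" using Linf_norm_nonneg[of \<mu>] small by (auto simp: k_def)
  show "a ~= 0" "deriv f 0 = 1" "(deriv ^^ 2) f 0 = 0" by (fact a d1 d2)+
  show "integrbl (%z. indicator K z * (cmod (p0 z))\<^sup>2)" if K: "compact K" "a \<notin> K" for K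
  proof -
   have KU: "K \<subseteq> U" using a(2) K by auto
   have "integrable (lebesgue_on K) (%z. (norm (p z))\<^sup>2)" using p K(1) KU by (simp add: locally_L2_def)
   then have i: "integrable lebesgue (%z. indicator K z *\<^sub>R (norm (p z))\<^sup>2)"
    using K(1) by (subst (asm) integrable_restrict_space) (auto intro: lmeasurable_compact fmeasurableD)
   have [measurable]: "p0 \<in> bmeas" "K \<in> sets borel" by (rule p0(1), rule borel_compact[OF K(1)])
   have mK: "(%z. indicator K z * (cmod (p0 z))\<^sup>2) \<in> borel_measurable lborel" by measurable
   have "integrable lebesgue (%z. indicator K z * (cmod (p0 z))\<^sup>2)"
   proof (rule integrable_cong_AE_imp[OF i])
    show "AE z in lebesgue. indicator K z *\<^sub>R (norm (p z))\<^sup>2 = indicator K z * (cmod (p0 z))\<^sup>2"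
     unfolding AE_completion_iff using p0(3) by eventually_elim (use KU in \<open>auto simp: indicator_def\<close>)
    show "(%z. indicator K z * (cmod (p0 z))\<^sup>2) \<in> borel_measurable lebesgue"
     by (rule measurable_completion[OF mK])
   qed
   with mK show ?thesis by (simp add: integrable_completion)
  qed
  show "\<exists>\<delta>>0. \<forall>z. z ~= a --> \<tau> <= cmod (z - z0) --> \<delta> <= cmod (f z - f z0)" if z0: "z0 ~= a" "0 < \<tau>" for z0 \<tau>
  proof -
   define V where "V = {y. Some y \<in> w ` Some ` ball z0 \<tau>}"
   have "open V" unfolding V_def by (rule H(4)) simp
   moreover have "f z0 \<in> V" unfolding V_def using wf[of z0] z0 a(2) by (auto intro!: image_eqI[of _ _ "Some z0"])
   ultimately obtain \<delta> where \<delta>: "0 < \<delta>" "ball (f z0) \<delta> \<subseteq> V" using open_contains_ball by blast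
   have "\<delta> <= cmod (f z - f z0)" if z: "z ~= a" "\<tau> <= cmod (z - z0)" for z
   proof (rule ccontr)
    assume "\<not> ?thesis"
    then have "f z \<in> V" using \<delta>(2) by (auto simp: dist_norm norm_minus_commute)
    then obtain y where y: "y \<in> ball z0 \<tau>" "Some (f z) = w (Some y)" by (auto simp: V_def)
    have "z \<in> U" using z(1) a(2) by auto
    with y(2) have "w (Some y) = w (Some z)" by (simp only: wf)
    then have "y = z" using injD[OF H(1)] by blast
    with y(1) z(2) show False by (simp add: dist_norm norm_minus_commute)
   qed
   with \<delta>(1) show ?thesis by blast
  qed
  show "filterlim f at_infinity (at a)" if a1: "a \<in> ball 0 1"
   unfolding filterlim_at_infinity_conv_norm_at_top filterlim_at_top
  proof
   fix B :: real
   have aN: "w (Some a) = None" using a(3)[OF a1] by (simp add: U_def finite_points_def)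
   have "\<forall>\<^sub>F z in nhds a. w (Some z) \<notin> Some ` cball 0 B"
    using eventually_nhds_in_open[OF H(5)[of "cball 0 B"], of a] aN by auto
   then show "\<forall>\<^sub>F z in at a. B <= norm (f z)"
    unfolding eventually_at_filter
   proof eventually_elim
    case (elim z)
    show ?case
    proof (intro impI)
     assume "z ~= a"
     then have "z \<in> U" using a(2) by auto
     then have "f z \<notin> cball 0 B" using elim wf[of z] by auto
     then show "B <= norm (f z)" by simp
    qed
   qed
  qed
  fix \<theta> A B K assume \<theta>: "C1 \<theta> A B" "compact K" "a \<notin> K" "!!z. z \<notin> K ==> \<theta> z = 0"
  have KU: "K \<subseteq> U" using a(2) \<theta>(3) by auto
  have AB0: "A z = 0" "B z = 0" if "z \<notin> K" for z
  proof -
   have K: "open (- K)" "z \<in> - K" using that compact_imp_closed[OF \<theta>(2)] by auto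
   show "A z = 0" "B z = 0"
    by (rule C1_derivs_zero[OF \<theta>(1) K(1) _ K(2), of 0], simp add: \<theta>(4))+
  qed
  have mAB: "A \<in> bmeas" "B \<in> bmeas" "\<theta> \<in> bmeas"
  proof -
   have "continuous_on UNIV \<theta>"
    by (intro continuous_at_imp_continuous_on ballI has_derivative_continuous[OF C1_has_derivative[OF \<theta>(1)]])
   then show "A \<in> bmeas" "B \<in> bmeas" "\<theta> \<in> bmeas"
    using \<theta>(1) by (auto simp: C1_def intro: borel_measurable_continuous_onI)
  qed
  have fU: "f \<in> borel_measurable (lebesgue_on U)"
   by (rule continuous_imp_measurable_on_sets_lebesgue[OF fcU]) (use oU in auto)
  have mf: "(%z. f z * E z) \<in> bmeas" if "E \<in> bmeas" "!!z. z \<notin> K ==> E z = 0" for E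
  proof -
   have "(%z. indicator U z *\<^sub>R f z) \<in> bmeas"
    by (rule borel_measurable_continuous_on_indicator[OF _ fcU]) (use oU in simp)
   then have "(%z. (indicator U z *\<^sub>R f z) * E z) \<in> bmeas" using that(1) by measurable
   also have "(%z. (indicator U z *\<^sub>R f z) * E z) = (%z. f z * E z)"
    using that(2) KU by (auto simp: indicator_def fun_eq_iff)
   finally show ?thesis .
  qed
  have lf: "(LINT z|lebesgue_on U. f z * E z) = (LBINT z. f z * E z)" if "E \<in> bmeas" "!!z. z \<notin> K ==> E z = 0" for E
  proof (rule integral_lebesgue_on_open[OF oU borel_measurable_times[OF fU borel_measurable_lebesgue_on[OF that(1)]] mf[OF that]])
   show "f z * E z = 0" if "z \<notin> U" for z using that \<open>!!z. z \<notin> K ==> E z = 0\<close>[of z] KU by auto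
  qed simp_all
  note td = wd[unfolded weak_derivatives_def, rule_format, OF C1_test_function[OF \<theta>(1,2) KU \<theta>(4)], unfolded C1_frechet[OF \<theta>(1)]]
  have "(LINT z|lebesgue_on U. p z * \<theta> z) = (LBINT z. p0 z * \<theta> z)"
  proof (rule integral_lebesgue_on_open[OF oU])
   show "(%z. p z * \<theta> z) \<in> borel_measurable (lebesgue_on U)"
    by (rule borel_measurable_times[OF conjunct1[OF p[unfolded locally_L2_def]] borel_measurable_lebesgue_on[OF mAB(3)]])
   show "(%z. p0 z * \<theta> z) \<in> bmeas" using p0(1) mAB by measurable
   show "AE z in lborel. z \<in> U --> p z * \<theta> z = p0 z * \<theta> z" using p0(3) by eventually_elim auto
  qed (use p0 in simp)
  moreover have "(LINT z|lebesgue_on U. q z * \<theta> z) = (LBINT z. \<mu>0 z * p0 z * \<theta> z)"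
  proof (rule integral_lebesgue_on_open[OF oU])
   show "(%z. q z * \<theta> z) \<in> borel_measurable (lebesgue_on U)"
    by (rule borel_measurable_times[OF conjunct1[OF q[unfolded locally_L2_def]] borel_measurable_lebesgue_on[OF mAB(3)]])
   show "(%z. \<mu>0 z * p0 z * \<theta> z) \<in> bmeas" using p0(1) \<mu>0m mAB by measurable
   show "AE z in lborel. z \<in> U --> q z * \<theta> z = \<mu>0 z * p0 z * \<theta> z"
    using p0(3) \<mu>0ae bel[unfolded AE_lebesgue_on_open[OF oU]] by eventually_elim (auto simp: \<mu>0D)
  qed (use p0 in simp)
  ultimately show "(LBINT z. f z * A z) = - (LBINT z. p0 z * \<theta> z) \<and>
    (LBINT z. f z * B z) = - (LBINT z. \<mu>0 z * p0 z * \<theta> z)"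
   using td lf[OF mAB(1) AB0(1)] lf[OF mAB(2) AB0(2)] by simp
 qed
 then interpret S: small_beltrami_solution a f p0 \<mu>0 k .
 have "ball 0 1 \<subseteq> finite_points w" using S.no_pole a(2) by (auto simp: U_def)
 with S.small_beltrami_solution_axioms ints show ?thesis using that by (simp add: f_def k_def)
qed

text \<open>\<open>jet_coeff\<close> expressed through the given coefficient on \<open>Dc\<close>
  and not its Borel representative, so that it is independent of any solution.\<close>

definition lin_jet :: "(complex => complex) => complex => nat => complex" where
 "lin_jet \<nu> z j = (-1) ^ j * fact j * of_real ((1 - cmod z) ^ (j - 1) / pi) * (LINT \<eta>|lebesgue_on Dc. \<nu> \<eta> / (z - \<eta>) ^ (j + 1))"

text \<open>All that later arguments need from a solution. The bound on \<rho> is r^2 |f'|^2 <= r, a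
  consequence of \<open>deriv_bound\<close>.\<close>

lemma belt_jets:
 assumes P: "diff_poly_upto N P" and cov: "moebius_covariant m P"
  and \<mu>: "\<mu> \<in> Linf" "48 * Linf_norm \<mu> <= 1" and w: "normalized_qc_solution \<mu> w" and z0: "z0 \<in> ball 0 1"
 defines "\<rho> \<equiv> of_real (1 - cmod z0) * deriv (planar w) z0"
 obtains x where "x 2 = 0"
  "!!j. 3 <= j ==> cmod (x j - lin_jet \<mu> z0 j) <= fact j * (165 * 4 ^ j + 2) * (Linf_norm \<mu>)\<^sup>2"
  "!!j. 3 <= j ==> cmod (lin_jet \<mu> z0 j) <= fact j * 3 * Linf_norm \<mu>"
  "diff_op P (planar w) z0 * of_real (1 - cmod z0) powi m = jeval P (%j. if j = 1 then inverse \<rho> else \<rho> * x j)"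
  "\<rho> ~= 0" "(cmod \<rho>)\<^sup>2 <= 1 - cmod z0" "cmod (\<rho> - of_real (1 - cmod z0)) <= 24 * Linf_norm \<mu>"
proof -
 obtain a p \<mu>0 where S: "small_beltrami_solution a (planar w) p \<mu>0 (Linf_norm \<mu>)"
  and ints: "!!z n. z \<in> ball 0 1 ==> (LBINT \<eta>. \<mu>0 \<eta> / (z - \<eta>) ^ n) = (LINT \<eta>|lebesgue_on Dc. \<mu> \<eta> / (z - \<eta>) ^ n)"
  by (rule qc_solution_beltrami[OF \<mu> w]) (rule that)
 interpret S: small_beltrami_solution a "planar w" p \<mu>0 "Linf_norm \<mu>" by (rule S)
 have z0': "z0 \<in> ball 0 1 - {a}" using z0 by (simp only: S.disc_domain)
 have jc: "S.jet_coeff z0 j = lin_jet \<mu> z0 j" for j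
  unfolding S.jet_coeff_def lin_jet_def ints[OF z0] ..
 obtain x where x: "x 2 = 0"
  "!!j. 3 <= j ==> cmod (x j - lin_jet \<mu> z0 j) <= fact j * (165 * 4 ^ j + 2) * (Linf_norm \<mu>)\<^sup>2"
  "!!j. 3 <= j ==> cmod (lin_jet \<mu> z0 j) <= fact j * 3 * Linf_norm \<mu>"
  "diff_op P (planar w) z0 * of_real (1 - cmod z0) powi m = jeval P (%j. if j = 1 then inverse \<rho> else \<rho> * x j)"
  by (rule S.jet_normal_form[OF P cov z0, unfolded jc, folded \<rho>_def]) (rule that)
 define r where "r = 1 - cmod z0"
 have r: "0 < r" "r <= 1" using z0 by (auto simp: r_def)
 define D where "D = deriv (planar w) z0"
 have "(cmod D)\<^sup>2 * r <= 1" "cmod (D - 1) * r <= 24 * Linf_norm \<mu>" "D ~= 0"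
  unfolding D_def r_def using S.deriv_bound[OF z0] S.deriv_minus_one_bound[OF z0] S.f_deriv_nonzero[OF z0'] by auto
 moreover have \<rho>: "\<rho> = of_real r * D" by (simp add: \<rho>_def r_def D_def)
 moreover have "\<rho> - of_real r = of_real r * (D - 1)" by (simp add: \<rho> algebra_simps)
 ultimately have "\<rho> ~= 0" "cmod (\<rho> - of_real r) <= 24 * Linf_norm \<mu>" "(cmod \<rho>)\<^sup>2 <= r"
  using r mult_left_mono[of "(cmod D)\<^sup>2 * r" 1 r]
  by (auto simp: norm_mult power_mult_distrib mult_ac power2_eq_square)
 then show ?thesis using that[OF x] by (simp add: r_def)
qed

section \<open>Coefficients that prescribe the jets near a boundary point\<close>

lemma lborel_complex_affine:
 fixes f :: "complex => complex"
 assumes f: "f \<in> bmeas" and c: "(c :: real) ~= 0"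
 shows "(LBINT z. f z) = of_real (c\<^sup>2) * (LBINT z. f (t + of_real c * z))"
proof -
 have [measurable]: "f \<in> bmeas" by (rule f)
 have "(LBINT z. f z) = (\<integral>z. f z \<partial>density (distr lborel borel (%x. t + c *\<^sub>R x)) (%_. ennreal (\<bar>c\<bar> ^ DIM(complex))))"
  using lborel_affine[OF c, of t] by (simp add: ennreal_power)
 also have "\<dots> = (\<integral>z. (\<bar>c\<bar> ^ DIM(complex)) *\<^sub>R f z \<partial>distr lborel borel (%x. t + c *\<^sub>R x))"
  by (rule integral_density) auto
 also have "\<dots> = (LBINT z. (\<bar>c\<bar> ^ DIM(complex)) *\<^sub>R f (t + c *\<^sub>R z))"
  by (rule integral_distr) auto
 also have "\<dots> = of_real (c\<^sup>2) * (LBINT z. f (t + of_real c * z))"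
  by (simp add: scaleR_conv_of_real)
 finally show ?thesis .
qed

text \<open>Elimination: a vector u with L j u = 1 is used to subtract multiples of
  \<open>L j\<close> from the other functionals, which stay independent. After they are solved for,
  adding a multiple of u adjusts the value of \<open>L j\<close>.\<close>

lemma independent_functionals_surjective:
 fixes L :: "'i => ('a => complex) => complex"
 assumes "finite I" "V ~= {}" "!!u v c. u \<in> V ==> v \<in> V ==> (%z. v z + c * u z) \<in> V"
  "!!i u v c. i \<in> I ==> u \<in> V ==> v \<in> V ==> L i (%z. v z + c * u z) = L i v + c * L i u"
  "!!c. \<exists>i\<in>I. c i ~= 0 ==> \<exists>v\<in>V. (\<Sum>i\<in>I. c i * L i v) ~= 0"
 shows "\<exists>v\<in>V. \<forall>i\<in>I. L i v = b i"
 using assms(1,4,5)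
proof (induction I arbitrary: L b rule: finite_induct)
 case empty
 then show ?case using assms(2) by blast
next
 case (insert j I)
 have "\<exists>v\<in>V. (\<Sum>i\<in>insert j I. (if i = j then 1 else 0) * L i v) ~= 0"
  by (rule insert.prems(2)) auto
 then obtain u0 where u0: "u0 \<in> V" "L j u0 ~= 0"
  using insert.hyps by (auto simp: sum.neutral[of I] split: if_splits)
 define u where "u = (%z. u0 z + (1 / L j u0 - 1) * u0 z)"
 have "L j u = L j u0 + (1 / L j u0 - 1) * L j u0"
  unfolding u_def by (rule insert.prems(1)) (use u0 in auto)
 moreover have "u \<in> V" unfolding u_def by (rule assms(3)[OF u0(1) u0(1)])
 ultimately have u: "u \<in> V" "L j u = 1" using u0 by (auto simp: field_simps)
 define L' where "L' i v = L i v - L i u * L j v" for i v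
 have "\<exists>v\<in>V. \<forall>i\<in>I. L' i v = b i - L i u * b j"
 proof (rule insert.IH)
  show "L' i (%z. v z + c * u z) = L' i v + c * L' i u" if "i \<in> I" "u \<in> V" "v \<in> V" for i u v c
   using that insert.prems(1) by (simp add: L'_def algebra_simps)
  fix c :: "'i => complex" assume c: "\<exists>i\<in>I. c i ~= 0"
  define c' where "c' i = (if i = j then - (\<Sum>i\<in>I. c i * L i u) else c i)" for i
  have "\<exists>v\<in>V. (\<Sum>i\<in>insert j I. c' i * L i v) ~= 0"
   by (rule insert.prems(2)) (use c insert.hyps in \<open>auto simp: c'_def\<close>)
  moreover have "(\<Sum>i\<in>insert j I. c' i * L i v) = (\<Sum>i\<in>I. c i * L' i v)" for v
  proof -
   have "(\<Sum>i\<in>I. c' i * L i v) = (\<Sum>i\<in>I. c i * L i v)"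
    using insert.hyps by (intro sum.cong) (auto simp: c'_def)
   then show ?thesis using insert.hyps
    by (simp add: c'_def L'_def right_diff_distrib sum_subtractf sum_distrib_right mult.assoc)
  qed
  ultimately show "\<exists>v\<in>V. (\<Sum>i\<in>I. c i * L' i v) ~= 0" by simp
 qed
 then obtain v where v: "v \<in> V" "!!i. i \<in> I ==> L' i v = b i - L i u * b j" by blast
 define v' where "v' = (%z. v z + (b j - L j v) * u z)"
 have "v' \<in> V" unfolding v'_def by (rule assms(3)[OF u(1) v(1)])
 moreover have lv: "L i v' = L i v + (b j - L j v) * L i u" if "i \<in> insert j I" for i
  unfolding v'_def by (rule insert.prems(1)[OF that u(1) v(1)])
 have "L i v' = b i" if i: "i \<in> insert j I" for i
 proof (cases "i = j")
  case True
  then show ?thesis using lv[OF i] u by simp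
 next
  case False
  then have "L i v = b i - L i u * b j + L i u * L j v" using i v(2)[of i] by (simp add: L'_def algebra_simps)
  then show ?thesis using lv[OF i] by (simp add: algebra_simps)
 qed
 ultimately show ?case by blast
qed

text \<open>The right half plane puts 1 + c \<xi> outside the closed disc for every c > 0, and the
  radii 1 and 2 make copies disjoint on scales of ratio at least 2.\<close>

definition half_annulus :: "complex set" where
 "half_annulus = {\<xi>. 0 < Re \<xi> \<and> 1 <= cmod \<xi> \<and> cmod \<xi> < 2}"

lemma half_annulus_borel [measurable]: "half_annulus \<in> sets borel"
 unfolding half_annulus_def by measurable

lemma one_le_cmod_add_one: "0 < Re \<xi> ==> 1 <= cmod (1 + \<xi>)"
 using complex_Re_le_cmod[of "1 + \<xi>"] by simp

text \<open>A linear combination K of the kernels is tested on its own conjugate. If the result were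
  zero, K would vanish almost everywhere on the half annulus; but (1 + \<xi>)^(N+1) K is a nonzero
  polynomial in 1 + \<xi>.\<close>

lemma moments_surjective:
 obtains v :: "complex => complex" and M where "v \<in> bmeas" "0 <= M" "!!\<xi>. cmod (v \<xi>) <= M" "!!\<xi>. \<xi> \<notin> half_annulus ==> v \<xi> = 0"
  "!!k. k \<in> {3..N} ==> (LBINT \<xi>. v \<xi> / (1 + \<xi>) ^ (k + 1)) = b k"
proof -
 define V where "V = {v :: complex => complex. v \<in> bmeas \<and> (\<exists>M. \<forall>\<xi>. cmod (v \<xi>) <= M) \<and> (\<forall>\<xi>. \<xi> \<notin> half_annulus --> v \<xi> = 0)}"
 define L where "L k v = (LBINT \<xi>. v \<xi> / (1 + \<xi>) ^ (k + 1))" for k :: nat and v :: "complex => complex"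
 have int: "integrbl (%\<xi>. v \<xi> / (1 + \<xi>) ^ n)" if v: "v \<in> V" for v n
 proof -
  obtain M where M: "!!\<xi>. cmod (v \<xi>) <= M" using v by (auto simp: V_def)
  have [measurable]: "v \<in> bmeas" using v by (simp add: V_def)
  show ?thesis
  proof (rule Bochner_Integration.integrable_bound[OF integrable_indicator_cball[of 0 2 M]])
   show "AE \<xi> in lborel. norm (v \<xi> / (1 + \<xi>) ^ n) <= norm (indicator (cball 0 2) \<xi> * M)"
   proof (rule AE_I2)
    fix \<xi>
    show "norm (v \<xi> / (1 + \<xi>) ^ n) <= norm (indicator (cball 0 2) \<xi> * M)"
    proof (cases "\<xi> \<in> half_annulus")
     case True
     then have "1 <= cmod (1 + \<xi>) ^ n" "\<xi> \<in> cball 0 2" using one_le_cmod_add_one[of \<xi>] by (auto simp: half_annulus_def one_le_power)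
     moreover have "cmod (v \<xi>) / cmod (1 + \<xi>) ^ n <= M / 1"
      using M[of \<xi>] calculation(1) by (intro frac_le) (auto intro: order_trans[OF norm_ge_zero])
     ultimately show ?thesis using order_trans[OF norm_ge_zero M[of \<xi>]] by (simp add: norm_divide norm_power)
    qed (use v in \<open>auto simp: V_def\<close>)
   qed
  qed measurable
 qed
 have "\<exists>v\<in>V. \<forall>k\<in>{3..N}. L k v = b k"
 proof (rule independent_functionals_surjective)
  have "(%_. 0) \<in> V" by (auto simp: V_def)
  then show "V ~= {}" by blast
  show "(%z. v z + c * u z) \<in> V" if uv: "u \<in> V" "v \<in> V" for u v c
  proof -
   obtain M M' where M: "!!\<xi>. cmod (v \<xi>) <= M" "!!\<xi>. cmod (u \<xi>) <= M'" using uv by (auto simp: V_def)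
   have "cmod (v \<xi> + c * u \<xi>) <= M + cmod c * M'" for \<xi>
    by (rule norm_triangle_mono) (auto simp: norm_mult intro!: M mult_left_mono)
   then show ?thesis using uv by (auto simp: V_def)
  qed
  show "L i (%z. v z + c * u z) = L i v + c * L i u" if "u \<in> V" "v \<in> V" for i u v c
   unfolding L_def add_divide_distrib times_divide_eq_right[symmetric]
    Bochner_Integration.integral_add[OF int[OF that(2)] integrable_mult_right[OF int[OF that(1)]]]
   by (simp only: integral_mult_right_zero)
  fix c :: "nat => complex" assume c: "\<exists>i\<in>{3..N}. c i ~= 0"
  define K where "K \<xi> = (\<Sum>i\<in>{3..N}. c i / (1 + \<xi>) ^ (i + 1))" for \<xi>
  define v where "v \<xi> = indicator half_annulus \<xi> * cnj (K \<xi>)" for \<xi>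
  have Kb: "cmod (K \<xi>) <= (\<Sum>i\<in>{3..N}. cmod (c i))" if "\<xi> \<in> half_annulus" for \<xi>
   unfolding K_def
  proof (rule sum_norm_le)
   fix i
   have "1 <= cmod (1 + \<xi>) ^ (i + 1)" using that one_le_cmod_add_one[of \<xi>] by (intro one_le_power) (simp add: half_annulus_def)
   then have "cmod (c i) / cmod (1 + \<xi>) ^ (i + 1) <= cmod (c i) / 1" by (intro frac_le) auto
   then show "norm (c i / (1 + \<xi>) ^ (i + 1)) <= cmod (c i)" by (simp only: norm_divide norm_power div_by_1)
  qed
  have [measurable]: "cnj \<in> bmeas" by (intro borel_measurable_continuous_onI continuous_intros)
  have [measurable]: "K \<in> bmeas" unfolding K_def[abs_def] by measurable
  have vV: "v \<in> V"
   unfolding V_def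
  proof (intro CollectI conjI exI allI impI)
   show "v \<in> bmeas" unfolding v_def[abs_def] by measurable
   show "cmod (v \<xi>) <= (\<Sum>i\<in>{3..N}. cmod (c i))" for \<xi>
    using Kb[of \<xi>] by (cases "\<xi> \<in> half_annulus") (auto simp: v_def sum_nonneg)
   show "v \<xi> = 0" if "\<xi> \<notin> half_annulus" for \<xi> using that by (simp add: v_def)
  qed
  have sumL: "(\<Sum>i\<in>{3..N}. c i * L i v) = (LBINT \<xi>. of_real (indicator half_annulus \<xi> * (cmod (K \<xi>))\<^sup>2))"
  proof -
   have "(\<Sum>i\<in>{3..N}. c i * L i v) = (\<Sum>i\<in>{3..N}. (LBINT \<xi>. c i * (v \<xi> / (1 + \<xi>) ^ (i + 1))))"
    by (simp only: L_def integral_mult_right_zero)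
   also have "\<dots> = (LBINT \<xi>. (\<Sum>i\<in>{3..N}. c i * (v \<xi> / (1 + \<xi>) ^ (i + 1))))"
    by (rule Bochner_Integration.integral_sum[symmetric]) (intro integrable_mult_right int[OF vV])
   also have "\<dots> = (LBINT \<xi>. of_real (indicator half_annulus \<xi> * (cmod (K \<xi>))\<^sup>2))"
   proof (rule Bochner_Integration.integral_cong[OF refl])
    fix \<xi>
    have "(\<Sum>i\<in>{3..N}. c i * (v \<xi> / (1 + \<xi>) ^ (i + 1))) = v \<xi> * K \<xi>"
     by (simp add: K_def sum_distrib_left mult_ac)
    then show "(\<Sum>i\<in>{3..N}. c i * (v \<xi> / (1 + \<xi>) ^ (i + 1))) = of_real (indicator half_annulus \<xi> * (cmod (K \<xi>))\<^sup>2)"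
     unfolding \<open>_ = v \<xi> * K \<xi>\<close> v_def
     by (cases "\<xi> \<in> half_annulus") (simp_all add: mult.commute complex_norm_square[symmetric] del: of_real_power)
   qed
   finally show ?thesis .
  qed
  have "(\<Sum>i\<in>{3..N}. c i * L i v) ~= 0"
  proof
   assume "(\<Sum>i\<in>{3..N}. c i * L i v) = 0"
   then have i0: "(LBINT \<xi>. indicator half_annulus \<xi> * (cmod (K \<xi>))\<^sup>2) = (0::real)"
    unfolding sumL integral_complex_of_real by (simp only: of_real_eq_0_iff)
   have ii: "integrbl (%\<xi>. indicator half_annulus \<xi> * (cmod (K \<xi>))\<^sup>2)"
   proof (rule Bochner_Integration.integrable_bound[OF integrable_indicator_cball[of 0 2 "(\<Sum>i\<in>{3..N}. cmod (c i))\<^sup>2"]])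
    show "AE \<xi> in lborel. norm (indicator half_annulus \<xi> * (cmod (K \<xi>))\<^sup>2) <= norm (indicator (cball 0 2) \<xi> * (\<Sum>i\<in>{3..N}. cmod (c i))\<^sup>2)"
     using Kb by (intro AE_I2) (auto simp: indicator_def half_annulus_def intro!: power_mono)
   qed measurable
   have ae: "AE \<xi> in lborel. indicator half_annulus \<xi> * (cmod (K \<xi>))\<^sup>2 = (0::real)"
    using i0 by (subst (asm) integral_nonneg_eq_0_iff_AE[OF ii]) auto
   define q where "q = (\<Sum>i\<in>{3..N}. monom (c i) (N - i))"
   have qK: "poly q (1 + \<xi>) = (1 + \<xi>) ^ (N + 1) * K \<xi>" if "1 + \<xi> ~= 0" for \<xi>
    unfolding q_def K_def poly_sum sum_distrib_left
   proof (intro sum.cong refl)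
    fix i assume "i \<in> {3..N}"
    then have "N + 1 = (N - i) + (i + 1)" by simp
    then have "(1 + \<xi>) ^ (N + 1) = (1 + \<xi>) ^ (N - i) * (1 + \<xi>) ^ (i + 1)" by (metis power_add)
    then show "poly (monom (c i) (N - i)) (1 + \<xi>) = (1 + \<xi>) ^ (N + 1) * (c i / (1 + \<xi>) ^ (i + 1))"
     using that by (simp add: poly_monom)
   qed
   obtain i0 where i0: "i0 \<in> {3..N}" "c i0 ~= 0" using c by blast
   have "coeff q (N - i0) = (\<Sum>i\<in>{3..N}. if i = i0 then c i else 0)"
    unfolding q_def coeff_sum coeff_monom using i0 by (intro sum.cong refl if_cong) auto
   also have "\<dots> = c i0" using i0 by simp
   finally have "q ~= 0" using i0 by auto
   then have fin: "finite {z. poly q z = 0}" by (rule poly_roots_finite)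
   have sub: "ball (3 / 2) (1 / 4) \<subseteq> half_annulus"
   proof
    fix \<xi> :: complex assume "\<xi> \<in> ball (3 / 2) (1 / 4)"
    then have d: "cmod (\<xi> - 3 / 2) < 1 / 4" by (simp add: dist_norm norm_minus_commute)
    have "cmod \<xi> <= cmod (\<xi> - 3 / 2) + 3 / 2" using norm_triangle_ineq[of "\<xi> - 3 / 2" "3 / 2"] by simp
    moreover have "- (1 / 4) < Re (\<xi> - 3 / 2)" using abs_Re_le_cmod[of "\<xi> - 3 / 2"] d by linarith
    ultimately show "\<xi> \<in> half_annulus" using d complex_Re_le_cmod[of \<xi>] by (simp add: half_annulus_def)
   qed
   have "{\<xi> \<in> half_annulus. K \<xi> = 0} \<subseteq> (%z. z - 1) ` {z. poly q z = 0}"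
   proof
    fix \<xi> assume x: "\<xi> \<in> {\<xi> \<in> half_annulus. K \<xi> = 0}"
    then have "1 + \<xi> ~= 0" using one_le_cmod_add_one[of \<xi>] by (auto simp: half_annulus_def)
    from qK[OF this] x show "\<xi> \<in> (%z. z - 1) ` {z. poly q z = 0}" by (intro image_eqI[of _ _ "1 + \<xi>"]) auto
   qed
   then have "finite {\<xi> \<in> half_annulus. K \<xi> = 0}" using fin by (meson finite_imageI finite_subset)
   then have "AE \<xi> in lborel. \<xi> \<notin> {\<xi> \<in> half_annulus. K \<xi> = 0}"
    by (intro AE_not_in finite_imp_null_set_lborel)
   with ae have "AE \<xi> in lborel. \<xi> \<notin> half_annulus" by eventually_elim (auto simp: indicator_def split: if_splits)
   then have "AE \<xi> in lborel. \<xi> \<notin> ball (3 / 2 :: complex) (1 / 4)" by eventually_elim (use sub in blast)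
   then have "negligible (ball (3 / 2 :: complex) (1 / 4))"
    using AE_iff_null_sets[of "ball (3 / 2 :: complex) (1 / 4)" lebesgue] by (simp add: negligible_iff_null_sets AE_completion_iff)
   then show False using open_not_negligible[of "ball (3 / 2 :: complex) (1 / 4)"] by simp
  qed
  with vV show "\<exists>v\<in>V. (\<Sum>i\<in>{3..N}. c i * L i v) ~= 0" by blast
 qed simp
 then obtain v where v: "v \<in> V" "!!k. k \<in> {3..N} ==> L k v = b k" by blast
 then obtain M where "!!\<xi>. cmod (v \<xi>) <= M" by (auto simp: V_def)
 with v show ?thesis using that[of v M] order_trans[OF norm_ge_zero, of "v 0" M] by (auto simp: V_def L_def)
qed

lemma integral_Dc:
 fixes g :: "complex => complex"
 assumes "g \<in> bmeas" "!!z. z \<notin> Dc ==> g z = 0"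
 shows "(LINT z|lebesgue_on Dc. g z) = (LBINT z. g z)"
 by (rule integral_lebesgue_on_open[OF open_Dc borel_measurable_lebesgue_on[OF assms(1)] assms(1)]) (use assms(2) in auto)

definition scale :: "nat => real" where
 "scale n = 2 ^ (n * n)"

text \<open>The coefficient repeats a fixed profile \<open>v\<close> at the point \<open>1\<close> on the widely separated
 scales \<open>2 ^ - n\<^sup>2\<close>, so that on each of these scales only one copy is visible in the limit.\<close>

lemma steering:
 fixes y :: "nat => complex"
 defines "s \<equiv> scale"
 obtains \<nu> M where "\<nu> \<in> Linf" "0 <= M" "Linf_norm \<nu> <= M"
  "!!k. k \<in> {3..N} ==> (%n. lin_jet \<nu> (of_real (1 - 1 / s n)) k) \<longlonglongrightarrow> y k"
proof -
 obtain v :: "complex => complex" and M where v: "v \<in> bmeas" "0 <= M" "!!\<xi>. cmod (v \<xi>) <= M"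
  "!!\<xi>. \<xi> \<notin> half_annulus ==> v \<xi> = 0"
  "!!k. k \<in> {3..N} ==> (LBINT \<xi>. v \<xi> / (1 + \<xi>) ^ (k + 1)) = - (pi * y k / fact k)"
  by (rule moments_surjective[of N "%k. - (pi * y k / fact k)"]) (rule that)
 have [measurable]: "v \<in> bmeas" by (rule v(1))
 have s0: "0 < s n" "1 <= s n" for n by (auto simp: s_def scale_def)
 \<comment> \<open>The exponents are squares, so the ratio of two scales is at least 2 to the larger
   index. With a fixed ratio the neighbouring copies would remain visible in the limit.\<close>
 have gap: "s i * 2 ^ j <= s j" if "i < j" for i j
 proof -
  have "i * j + j <= j * j" using mult_le_mono1[of "i + 1" j j] that by simp
  moreover have "i * i <= i * j" using that by (intro mult_le_mono2) simp
  ultimately have "i * i + j <= j * j" by linarith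
  then show ?thesis unfolding s_def scale_def power_add[symmetric] by (intro power_increasing) auto
 qed
 have v0: "v \<xi> = 0" if "cmod \<xi> < 1 \<or> 2 <= cmod \<xi> \<or> Re \<xi> <= 0" for \<xi>
  using that by (intro v(4)) (auto simp: half_annulus_def)
 have ns: "cmod (of_real (s i) * \<xi>) = s i * cmod \<xi>" for i \<xi> using s0[of i] by (simp add: norm_mult)
 have single: "\<exists>j. \<forall>i. i ~= j --> v (of_real (s i) * \<xi>) = 0" for \<xi>
 proof (cases "\<exists>j. v (of_real (s j) * \<xi>) ~= 0")
  case True
  then obtain j where "v (of_real (s j) * \<xi>) ~= 0" by blast
  then have j: "1 <= s j * cmod \<xi>" "s j * cmod \<xi> < 2" using v0[of "of_real (s j) * \<xi>"] unfolding ns by fastforce+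
  have "v (of_real (s i) * \<xi>) = 0" if "i ~= j" for i
  proof (cases "i < j")
   case True
   have "s i * 2 ^ 1 <= s i * 2 ^ j" using True s0[of i] by (intro mult_left_mono power_increasing) auto
   then have "s i * 2 <= s j" using gap[OF True] by simp
   then have "s i * 2 * cmod \<xi> <= s j * cmod \<xi>" by (rule mult_right_mono) simp
   then show ?thesis using j by (intro v0) (simp add: ns)
  next
   case False
   then have ij: "j < i" using that by simp
   have "s j * 2 ^ 1 <= s j * 2 ^ i" using ij s0[of j] by (intro mult_left_mono power_increasing) auto
   then have "s j * 2 <= s i" using gap[OF ij] by simp
   then have "s j * 2 * cmod \<xi> <= s i * cmod \<xi>" by (rule mult_right_mono) simp
   then show ?thesis using j by (intro v0) (simp add: ns)
  qed
  then show ?thesis by blast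
 qed blast
 define h where "h \<xi> = suminf (%i. v (of_real (s i) * \<xi>))" for \<xi>
 have h_eq: "h \<xi> = v (of_real (s j) * \<xi>)" if "!!i. i ~= j ==> v (of_real (s i) * \<xi>) = 0" for j \<xi>
  unfolding h_def using that by (subst suminf_finite[of "{j}"]) auto
 have hM: "cmod (h \<xi>) <= M" for \<xi>
 proof -
  obtain j where "!!i. i ~= j ==> v (of_real (s i) * \<xi>) = 0" using single by blast
  from h_eq[OF this] show ?thesis using v(3) by simp
 qed
 have h0: "h \<xi> = 0" if "Re \<xi> <= 0" for \<xi>
 proof -
  have "v (of_real (s i) * \<xi>) = 0" for i using that s0[of i] by (intro v0) (simp add: mult_nonneg_nonpos)
  then show ?thesis by (simp add: h_def)
 qed
 have [measurable]: "h \<in> bmeas" unfolding h_def[abs_def] by measurable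
 define \<nu> where "\<nu> \<eta> = h (\<eta> - 1)" for \<eta>
 have \<nu>m [measurable]: "\<nu> \<in> bmeas" unfolding \<nu>_def[abs_def] by measurable
 have \<nu>0: "\<nu> \<eta> = 0" if "\<eta> \<notin> Dc" for \<eta>
  using that complex_Re_le_cmod[of \<eta>] by (auto simp: \<nu>_def Dc_def intro!: h0)
 have \<nu>: "\<nu> \<in> Linf" "Linf_norm \<nu> <= M"
  by (rule Linf_normI[OF borel_measurable_lebesgue_on[OF \<nu>m], of M], intro AE_I2 impI, simp add: \<nu>_def hM)+
 define I where "I k n = (LBINT \<xi>. h (of_real (1 / s n) * \<xi>) / (1 + \<xi>) ^ (k + 1))" for k n
 \<comment> \<open>The substitution \<eta> = 1 + \<xi> / s n turns 1 - 1 / s n - \<eta> into -(1 +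
   \<xi>) / s n, and all powers of the scale cancel against the weight in
   \<open>lin_jet\<close>.\<close>
 have lj: "lin_jet \<nu> (of_real (1 - 1 / s n)) k = - (fact k / of_real pi) * I k n" if k: "k \<in> {3..N}" for k n
 proof -
  define c where "c = 1 / s n"
  have c: "0 < c" "c <= 1" using s0[of n] by (auto simp: c_def)
  define C where "C = cx c"
  have C: "C ~= 0" using c by (simp add: C_def)
  have "(LINT \<eta>|lebesgue_on Dc. \<nu> \<eta> / (of_real (1 - c) - \<eta>) ^ (k + 1)) = (LBINT \<eta>. \<nu> \<eta> / (of_real (1 - c) - \<eta>) ^ (k + 1))"
   by (rule integral_Dc) (measurable, simp add: \<nu>0)
  also have "\<dots> = of_real (c\<^sup>2) * (LBINT \<xi>. \<nu> (1 + of_real c * \<xi>) / (of_real (1 - c) - (1 + of_real c * \<xi>)) ^ (k + 1))"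
   using c by (intro lborel_complex_affine) auto
  also have "(%\<xi>. \<nu> (1 + of_real c * \<xi>) / (of_real (1 - c) - (1 + of_real c * \<xi>)) ^ (k + 1)) =
    (%\<xi>. 1 / (- C) ^ (k + 1) * (h (of_real c * \<xi>) / (1 + \<xi>) ^ (k + 1)))"
  proof
   fix \<xi>
   have "of_real (1 - c) - (1 + of_real c * \<xi>) = (- C) * (1 + \<xi>)" by (simp add: C_def algebra_simps)
   then show "\<nu> (1 + of_real c * \<xi>) / (of_real (1 - c) - (1 + of_real c * \<xi>)) ^ (k + 1) =
    1 / (- C) ^ (k + 1) * (h (of_real c * \<xi>) / (1 + \<xi>) ^ (k + 1))"
    by (simp only: power_mult_distrib) (simp add: \<nu>_def)
  qed
  also have "(LBINT \<xi>. 1 / (- C) ^ (k + 1) * (h (of_real c * \<xi>) / (1 + \<xi>) ^ (k + 1))) = 1 / (- C) ^ (k + 1) * I k n"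
   unfolding I_def c_def[symmetric] by (rule integral_mult_right_zero)
  finally have int: "(LINT \<eta>|lebesgue_on Dc. \<nu> \<eta> / (of_real (1 - c) - \<eta>) ^ (k + 1)) = C\<^sup>2 * (1 / (- C) ^ (k + 1) * I k n)"
   by (simp add: C_def)
  have nc: "1 - cmod (of_real (1 - c)) = c" using c by (simp del: of_real_diff)
  have pw: "C ^ (k - 1) * C\<^sup>2 = C ^ (k + 1)" unfolding power_add[symmetric] using k by (intro arg_cong[where f = "%i. C ^ i"]) auto
  have "(- C) ^ (k + 1) = (- 1) ^ (k + 1) * C ^ (k + 1)" by (rule power_minus)
  moreover have "((- 1) ^ k :: complex) * (- 1) ^ k = 1" by (simp add: power_mult_distrib[symmetric])
  ultimately have "(- 1) ^ k * (C ^ (k - 1) * C\<^sup>2) * (1 / (- C) ^ (k + 1)) = - 1"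
   using C unfolding pw by (simp add: field_simps)
  moreover have "lin_jet \<nu> (of_real (1 - c)) k = (fact k / of_real pi) * I k n * ((- 1) ^ k * (C ^ (k - 1) * C\<^sup>2) * (1 / (- C) ^ (k + 1)))"
   unfolding lin_jet_def nc int by (simp only: of_real_divide of_real_power C_def[symmetric] mult_ac times_divide_eq_left times_divide_eq_right)
  ultimately show ?thesis by (simp add: c_def)
 qed
 have lim: "(%n. I k n) \<longlonglongrightarrow> (LBINT \<xi>. v \<xi> / (1 + \<xi>) ^ (k + 1))" if k: "k \<in> {3..N}" for k
  unfolding I_def
 proof (rule integral_dominated_convergence)
  \<comment> \<open>The dominating function is M / |1 + \<xi>|^4, which suffices because k + 1 >= 4
    and |1 + \<xi>| >= 1 where the profile lives.\<close>
  define g where "g = (%z. indicator {z. 1 <= cmod (z - (- 1))} z / (z - (- 1))\<^sup>2)"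
  have "sq_int g" unfolding g_def by (rule l2_inverse_square) simp
  then show "integrbl (%\<xi>. M * (cmod (g \<xi>))\<^sup>2)" by (intro integrable_mult_right) (simp add: sq_int_def)
  show "AE \<xi> in lborel. norm (h (of_real (1 / s n) * \<xi>) / (1 + \<xi>) ^ (k + 1)) <= M * (cmod (g \<xi>))\<^sup>2" for n
  proof (rule AE_I2)
   fix \<xi>
   show "norm (h (of_real (1 / s n) * \<xi>) / (1 + \<xi>) ^ (k + 1)) <= M * (cmod (g \<xi>))\<^sup>2"
   proof (cases "Re \<xi> <= 0")
    case True
    then have "h (of_real (1 / s n) * \<xi>) = 0" using s0[of n] by (intro h0) (simp add: divide_nonpos_pos)
    then show ?thesis using v(2) by simp
   next
    case False
    then have a1: "1 <= cmod (1 + \<xi>)" by (intro one_le_cmod_add_one) simp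
    have "norm (h (of_real (1 / s n) * \<xi>) / (1 + \<xi>) ^ (k + 1)) <= M / cmod (1 + \<xi>) ^ 4"
     unfolding norm_divide norm_power using a1 k v(2) by (intro frac_le hM power_increasing) (auto intro: less_le_trans[of 0 1] zero_less_power)
    also have "\<dots> = M * (cmod (g \<xi>))\<^sup>2"
     using a1 by (simp add: g_def add.commute norm_divide norm_power power_divide)
    finally show ?thesis .
   qed
  qed
  show "AE \<xi> in lborel. (%n. h (of_real (1 / s n) * \<xi>) / (1 + \<xi>) ^ (k + 1)) \<longlonglongrightarrow> v \<xi> / (1 + \<xi>) ^ (k + 1)"
  proof (rule AE_I2, rule tendsto_eventually)
   fix \<xi>
   \<comment> \<open>For n >= n0 and \<xi> nonzero, \<xi> multiplied by s i / s n has modulus below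
     1 if i < n and above 2 if i > n; only the copy with i = n contributes.\<close>
   obtain n0 where n0: "max (cmod \<xi>) (2 / cmod \<xi>) < 2 ^ n0" using real_arch_pow[of 2 "max (cmod \<xi>) (2 / cmod \<xi>)"] by auto
   show "\<forall>\<^sub>F n in sequentially. h (of_real (1 / s n) * \<xi>) / (1 + \<xi>) ^ (k + 1) = v \<xi> / (1 + \<xi>) ^ (k + 1)"
   proof (rule eventually_sequentiallyI[of n0])
    fix n assume "n0 <= n"
    then have "(2::real) ^ n0 <= 2 ^ n" by (intro power_increasing) auto
    then have n: "cmod \<xi> < 2 ^ n" "2 / cmod \<xi> < 2 ^ n" using n0 unfolding max_less_iff_conj by linarith+
    have nn: "cmod (of_real (s i) * (of_real (1 / s n) * \<xi>)) = s i / s n * cmod \<xi>" for i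
     using s0[of i] s0[of n] by (simp add: norm_mult norm_divide)
    have "h (of_real (1 / s n) * \<xi>) = v (of_real (s n) * (of_real (1 / s n) * \<xi>))"
    proof (rule h_eq)
     fix i assume "i ~= n"
     show "v (of_real (s i) * (of_real (1 / s n) * \<xi>)) = 0"
     proof (cases "\<xi> = 0")
      case False
      show ?thesis
      proof (cases "i < n")
       case True
       have "s i / s n * cmod \<xi> <= 1 / 2 ^ n * cmod \<xi>"
        using gap[OF True] s0[of n] by (intro mult_right_mono) (auto simp: field_simps)
       also have "\<dots> < 1" using n by (simp add: field_simps)
       finally have lt: "s i / s n * cmod \<xi> < 1" .
       show ?thesis by (rule v0, rule disjI1, subst nn, rule lt)
      next
       case F: False
       then have ni: "n < i" using \<open>i ~= n\<close> by simp
       have "(2::real) ^ n <= 2 ^ i" using ni by (intro power_increasing) auto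
       also have "\<dots> <= s i / s n" using gap[OF ni] s0[of n] by (simp add: field_simps)
       finally have "2 ^ n * cmod \<xi> <= s i / s n * cmod \<xi>" by (rule mult_right_mono) simp
       moreover have "2 < 2 ^ n * cmod \<xi>" using n(2) False by (simp add: field_simps)
       ultimately have gt: "2 <= s i / s n * cmod \<xi>" by linarith
       show ?thesis by (rule v0, rule disjI2, rule disjI1, subst nn, rule gt)
      qed
     qed (simp add: v0)
    qed
    then show "h (of_real (1 / s n) * \<xi>) / (1 + \<xi>) ^ (k + 1) = v \<xi> / (1 + \<xi>) ^ (k + 1)"
     using s0[of n] by simp
   qed
  qed
 qed measurable
 have "(%n. lin_jet \<nu> (of_real (1 - 1 / s n)) k) \<longlonglongrightarrow> y k" if k: "k \<in> {3..N}" for k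
  unfolding lj[OF k] using tendsto_mult_left[OF lim[OF k], of "- (fact k / of_real pi)"] v(5)[OF k] by simp
 with \<nu> v(2) show ?thesis using that by blast
qed

lemma powi_le_two_power:
 assumes "1 <= t" "t <= (2::real)"
 shows "t powi j <= 2 ^ nat \<bar>j\<bar>"
proof (cases "0 <= j")
 case True
 then show ?thesis using assms by (simp add: power_int_def power_mono)
next
 case False
 have "inverse t ^ nat (- j) <= 1" using assms by (intro power_le_one) (auto simp: inverse_le_1_iff)
 also have "(1::real) <= 2 ^ nat \<bar>j\<bar>" by simp
 finally show ?thesis using False by (simp add: power_int_def)
qed

text \<open>The weights differ by the factor (1 + |z|)^m, and 1 + |z| lies between 1 and 2; this
  works for either sign of m.\<close>

lemma disc_weights:
 assumes z: "z \<in> ball 0 1"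
 shows "(1 - cmod z) powi m <= (1 - (cmod z)\<^sup>2) powi m * 2 ^ nat \<bar>m\<bar>"
  and "(1 - (cmod z)\<^sup>2) powi m <= (1 - cmod z) powi m * 2 ^ nat \<bar>m\<bar>"
proof -
 define r t where "r = 1 - cmod z" and "t = 1 + cmod z"
 have r: "0 < r" "1 <= t" "t <= 2" using z by (auto simp: r_def t_def)
 have eq: "1 - (cmod z)\<^sup>2 = r * t" by (simp add: r_def t_def power2_eq_square algebra_simps)
 have "(r * t) powi m = r powi m * t powi m" by (rule power_int_mult_distrib)
 moreover have "t powi m * t powi (- m) = 1" using r by (simp add: power_int_minus)
 ultimately have "r powi m = (r * t) powi m * t powi (- m)" by simp
 also have "\<dots> <= (r * t) powi m * 2 ^ nat \<bar>m\<bar>"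
  using powi_le_two_power[OF r(2,3), of "- m"] r by (intro mult_left_mono) auto
 finally show "(1 - cmod z) powi m <= (1 - (cmod z)\<^sup>2) powi m * 2 ^ nat \<bar>m\<bar>" by (simp add: eq r_def)
 show "(1 - (cmod z)\<^sup>2) powi m <= (1 - cmod z) powi m * 2 ^ nat \<bar>m\<bar>"
  unfolding eq power_int_mult_distrib r_def[symmetric]
  using powi_le_two_power[OF r(2,3), of m] r by (intro mult_left_mono) auto
qed

lemma lin_jet_cmult: "lin_jet (%\<eta>. c * \<nu> \<eta>) z j = c * lin_jet \<nu> z j"
 unfolding lin_jet_def times_divide_eq_right[symmetric] integral_mult_right_zero by simp

section \<open>Excluding negative powers of \<rho> by the boundedness of Q[f]\<close>

locale normalized_solutions =
 fixes P :: diff_poly and N :: nat and m :: int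
  and w :: "(complex => complex) => complex option => complex option"
 assumes Q_poly: "diff_poly_upto N P"
  and Q_covariant: "moebius_covariant m P"
  and w_solution: "!!\<mu>. \<mu> \<in> Belt ==> normalized_qc_solution \<mu> (w \<mu>)"
  and beta_into_B: "!!\<mu>. \<mu> \<in> schlicht_Belt w ==> diff_op P (planar (w \<mu>)) \<in> B_space m"
begin

lemma small_in_schlicht_Belt:
 assumes "\<mu> \<in> Linf" "48 * Linf_norm \<mu> <= 1"
 shows "normalized_qc_solution \<mu> (w \<mu>)" "\<mu> \<in> schlicht_Belt w"
proof -
 have b: "\<mu> \<in> Belt" using assms by (simp add: Belt_def)
 show n: "normalized_qc_solution \<mu> (w \<mu>)" by (rule w_solution[OF b])
 have "ball 0 1 \<subseteq> finite_points (w \<mu>)" by (rule qc_solution_beltrami[OF assms n])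
 with b show "\<mu> \<in> schlicht_Belt w" by (simp add: schlicht_Belt_def)
qed

text \<open>For the fixed coefficient \<tau> \<nu>, \<open>beta_into_B\<close> bounds the normal
  form at all points of the disc. Along the points 1 - 1 / \<open>scale n\<close> its jets come
  within O(\<tau>^2) of \<tau> y, while |\<rho>|^2 <= 1 - |z| forces \<rho> to zero.\<close>

lemma exponents_nonneg:
 assumes e: "e \<in> jet_exponents P"
 shows "lookup e 1 <= jet_degree e"
proof (rule jet_exponents_nonneg[OF Q_poly _ e])
 fix y :: "nat => complex"
 obtain \<nu> M where \<nu>: "\<nu> \<in> Linf" "0 <= M" "Linf_norm \<nu> <= M"
  and lim: "!!k. k \<in> {3..N} ==> (%n. lin_jet \<nu> (of_real (1 - 1 / scale n)) k) \<longlonglongrightarrow> y k"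
  by (rule steering[of N y]) (rule that)
 define Mx where "Mx = (\<Sum>k\<in>{3..N}. fact k * (165 * 4 ^ k + 2) :: real)"
 define C where "C = Mx * M\<^sup>2 + 1"
 show "\<exists>C. \<exists>\<tau>0>0. \<forall>\<tau>. 0 < \<tau> --> \<tau> < \<tau>0 --> (\<exists>Bd. \<forall>\<delta>>0. \<exists>\<rho> x. \<rho> ~= 0 \<and> cmod \<rho> < \<delta> \<and> x 2 = 0 \<and>
    (\<forall>k\<in>{3..N}. cmod (x k - of_real \<tau> * y k) <= C * \<tau>\<^sup>2) \<and>
    cmod (jeval P (%j. if j = 1 then inverse \<rho> else \<rho> * x j)) <= Bd)"
 proof (rule exI[of _ C], rule exI[of _ "1 / (48 * (M + 1))"], intro conjI allI impI)
  show "0 < 1 / (48 * (M + 1))" using \<nu>(2) by simp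
  fix \<tau> :: real assume \<tau>: "0 < \<tau>" "\<tau> < 1 / (48 * (M + 1))"
  define \<mu> where "\<mu> = (%\<eta>. of_real \<tau> * \<nu> \<eta>)"
  have \<mu>: "\<mu> \<in> Linf" unfolding \<mu>_def by (rule Linf_cmult(1)[OF \<nu>(1)])
  have "Linf_norm \<mu> <= \<tau> * Linf_norm \<nu>" unfolding \<mu>_def using Linf_cmult(2)[OF \<nu>(1), of "of_real \<tau>"] \<tau> by simp
  also have "\<dots> <= \<tau> * M" using \<tau> \<nu>(3) by (intro mult_left_mono) auto
  finally have \<mu>n: "Linf_norm \<mu> <= \<tau> * M" .
  have "\<tau> * (48 * (M + 1)) < 1" using \<tau> \<nu>(2) by (simp add: field_simps)
  then have \<mu>s: "48 * Linf_norm \<mu> <= 1" using \<mu>n \<tau>(1) by (simp add: algebra_simps)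
  note S = small_in_schlicht_Belt[OF \<mu> \<mu>s]
  obtain B0 where B0': "\<forall>z\<in>ball 0 1. norm (diff_op P (planar (w \<mu>)) z) * (1 - (norm z)\<^sup>2) powi m <= B0"
   using beta_into_B[OF S(2)] unfolding B_space_def bdd_above_def by auto
  note B0 = bspec[OF B0']
  show "\<exists>Bd. \<forall>\<delta>>0. \<exists>\<rho> x. \<rho> ~= 0 \<and> cmod \<rho> < \<delta> \<and> x 2 = 0 \<and>
    (\<forall>k\<in>{3..N}. cmod (x k - of_real \<tau> * y k) <= C * \<tau>\<^sup>2) \<and>
    cmod (jeval P (%j. if j = 1 then inverse \<rho> else \<rho> * x j)) <= Bd"
  proof (rule exI[of _ "B0 * 2 ^ nat \<bar>m\<bar>"], intro allI impI)
   fix \<delta> :: real assume \<delta>: "0 < \<delta>"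
   have "(%n. 1 / scale n) \<longlonglongrightarrow> 0"
   proof (rule Lim_null_comparison[OF _ LIMSEQ_realpow_zero[of "1 / 2"]], rule always_eventually, rule allI)
    fix n :: nat
    have "(2::real) ^ n <= 2 ^ (n * n)" by (intro power_increasing) (auto simp: le_square)
    then show "norm (1 / scale n) <= (1 / 2) ^ n" by (simp add: scale_def power_divide frac_le)
   qed auto
   then have "\<forall>\<^sub>F n in sequentially. 1 / scale n < \<delta>\<^sup>2" using \<delta> by (intro order_tendstoD(2)) auto
   moreover have "\<forall>\<^sub>F n in sequentially. \<forall>k\<in>{3..N}. dist (lin_jet \<nu> (of_real (1 - 1 / scale n)) k) (y k) < \<tau>"
    using lim \<tau>(1) by (intro eventually_ball_finite ballI tendstoD) auto
   ultimately have "\<forall>\<^sub>F n in sequentially. 1 / scale n < \<delta>\<^sup>2 \<and> (\<forall>k\<in>{3..N}. dist (lin_jet \<nu> (of_real (1 - 1 / scale n)) k) (y k) < \<tau>)"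
    by (rule eventually_conj)
   then obtain n where n: "1 / scale n < \<delta>\<^sup>2" "!!k. k \<in> {3..N} ==> cmod (lin_jet \<nu> (of_real (1 - 1 / scale n)) k - y k) < \<tau>"
    unfolding dist_norm by (auto simp: eventually_sequentially)
   define z where "z = cx (1 - 1 / scale n)"
   have s1: "1 <= scale n" by (simp add: scale_def)
   have cz: "1 - cmod z = 1 / scale n" unfolding z_def norm_of_real using s1 by simp
   have z: "z \<in> ball 0 1" using cz s1 by (simp add: dist_norm) (smt (verit) divide_pos_pos)
   obtain x where x: "x 2 = 0"
    "!!j. 3 <= j ==> cmod (x j - lin_jet \<mu> z j) <= fact j * (165 * 4 ^ j + 2) * (Linf_norm \<mu>)\<^sup>2"
    and ev: "diff_op P (planar (w \<mu>)) z * of_real (1 - cmod z) powi m = jeval P (%j. if j = 1 then inverse (of_real (1 - cmod z) * deriv (planar (w \<mu>)) z) else of_real (1 - cmod z) * deriv (planar (w \<mu>)) z * x j)"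
    and \<rho>: "of_real (1 - cmod z) * deriv (planar (w \<mu>)) z ~= 0" "(cmod (of_real (1 - cmod z) * deriv (planar (w \<mu>)) z))\<^sup>2 <= 1 - cmod z"
    by (rule belt_jets[OF Q_poly Q_covariant \<mu> \<mu>s S(1) z]) (rule that)
   define \<rho>' where "\<rho>' = of_real (1 - cmod z) * deriv (planar (w \<mu>)) z"
   have "(cmod \<rho>')\<^sup>2 < \<delta>\<^sup>2" using \<rho>(2)[folded \<rho>'_def] n(1) unfolding cz by linarith
   then have r1: "cmod \<rho>' < \<delta>" by (rule power2_less_imp_less) (rule less_imp_le[OF \<delta>])
   have "cmod (x k - of_real \<tau> * y k) <= C * \<tau>\<^sup>2" if k: "k \<in> {3..N}" for k
   proof -
    have "cmod (x k - lin_jet \<mu> z k) <= fact k * (165 * 4 ^ k + 2) * (Linf_norm \<mu>)\<^sup>2" using k by (intro x(2)) auto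
    also have "\<dots> <= Mx * (\<tau> * M)\<^sup>2"
     using \<mu>n Linf_norm_nonneg[of \<mu>] k unfolding Mx_def
     by (intro mult_mono power_mono member_le_sum sum_nonneg) auto
    finally have a: "cmod (x k - lin_jet \<mu> z k) <= Mx * (\<tau> * M)\<^sup>2" .
    have "lin_jet \<mu> z k - of_real \<tau> * y k = of_real \<tau> * (lin_jet \<nu> z k - y k)"
     by (simp add: \<mu>_def lin_jet_cmult right_diff_distrib)
    then have b: "cmod (lin_jet \<mu> z k - of_real \<tau> * y k) <= \<tau> * \<tau>"
     using n(2)[OF k] \<tau>(1) by (simp add: norm_mult z_def del: of_real_diff)
    have "cmod (x k - of_real \<tau> * y k) <= Mx * (\<tau> * M)\<^sup>2 + \<tau> * \<tau>"
     using norm_triangle_mono[OF a b] by simp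
    also have "\<dots> = C * \<tau>\<^sup>2" by (simp add: C_def power2_eq_square algebra_simps)
    finally show ?thesis .
   qed
   moreover have "cmod (jeval P (%j. if j = 1 then inverse \<rho>' else \<rho>' * x j)) <= B0 * 2 ^ nat \<bar>m\<bar>"
   proof -
    have "cmod (jeval P (%j. if j = 1 then inverse \<rho>' else \<rho>' * x j)) = cmod (diff_op P (planar (w \<mu>)) z) * (1 - cmod z) powi m"
     unfolding \<rho>'_def ev[symmetric] norm_mult norm_power_int using z by (simp del: of_real_diff)
    also have "\<dots> <= cmod (diff_op P (planar (w \<mu>)) z) * ((1 - (cmod z)\<^sup>2) powi m * 2 ^ nat \<bar>m\<bar>)"
     by (intro mult_left_mono disc_weights(1)[OF z]) simp
    also have "\<dots> = (cmod (diff_op P (planar (w \<mu>)) z) * (1 - (cmod z)\<^sup>2) powi m) * 2 ^ nat \<bar>m\<bar>" by simp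
    also have "\<dots> <= B0 * 2 ^ nat \<bar>m\<bar>" by (intro mult_right_mono B0 z) simp
    finally show ?thesis .
   qed
   ultimately show "\<exists>\<rho> x. \<rho> ~= 0 \<and> cmod \<rho> < \<delta> \<and> x 2 = 0 \<and>
    (\<forall>k\<in>{3..N}. cmod (x k - of_real \<tau> * y k) <= C * \<tau>\<^sup>2) \<and>
    cmod (jeval P (%j. if j = 1 then inverse \<rho> else \<rho> * x j)) <= B0 * 2 ^ nat \<bar>m\<bar>"
    using x(1) r1 \<rho>(1)[folded \<rho>'_def] by (intro exI[of _ \<rho>'] exI[of _ x]) simp
  qed
 qed
qed

end

section \<open>The derivative at the origin\<close>

text \<open>For k >= 3 the kernel is dominated by a multiple of |\<eta> - z|^(-4), the square of the
  function in \<open>l2_inverse_square\<close>.\<close>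

lemma lin_integrable:
 assumes \<nu>: "\<nu> \<in> Linf" and z: "z \<in> ball 0 1" and k: "3 <= k"
 shows "integrable (lebesgue_on Dc) (%\<eta>. \<nu> \<eta> / (z - \<eta>) ^ (k + 1))"
proof -
 define r where "r = 1 - cmod z"
 have r: "0 < r" using z by (simp add: r_def)
 define g where "g = (%\<eta>. indicator {\<eta>. r <= cmod (\<eta> - z)} \<eta> / (\<eta> - z)\<^sup>2)"
 define c where "c = Linf_norm \<nu> / r ^ (k - 3)"
 have "sq_int g" unfolding g_def by (rule l2_inverse_square[OF r])
 then have i: "integrbl (%\<eta>. c * (cmod (g \<eta>))\<^sup>2)" by (intro integrable_mult_right) (simp add: sq_int_def)
 have "integrable lebesgue (%\<eta>. c * (cmod (g \<eta>))\<^sup>2)"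
  by (rule integrable_completion[THEN iffD2, OF borel_measurable_integrable[OF i] i])
 then have "integrable lebesgue (%\<eta>. indicator Dc \<eta> *\<^sub>R (c * (cmod (g \<eta>))\<^sup>2))"
  by (rule integrable_mult_indicator[rotated]) (use open_Dc in simp)
 then have G: "integrable (lebesgue_on Dc) (%\<eta>. c * (cmod (g \<eta>))\<^sup>2)"
  by (rule integrable_restrict_space[THEN iffD2, rotated]) (use open_Dc in simp)
 show ?thesis
 proof (rule Bochner_Integration.integrable_bound[OF G])
  show "(%\<eta>. \<nu> \<eta> / (z - \<eta>) ^ (k + 1)) \<in> borel_measurable (lebesgue_on Dc)"
   by (rule borel_measurable_divide[OF Linf_measurable[OF \<nu>] borel_measurable_lebesgue_on]) measurable
  show "AE \<eta> in lebesgue_on Dc. norm (\<nu> \<eta> / (z - \<eta>) ^ (k + 1)) <= norm (c * (cmod (g \<eta>))\<^sup>2)"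
   unfolding AE_lebesgue_on_open[OF open_Dc] using Linf_norm_AE[OF \<nu>]
  proof eventually_elim
   case (elim \<eta>)
   show ?case
   proof
    assume D: "\<eta> \<in> Dc"
    define d where "d = cmod (\<eta> - z)"
    have d: "r <= d" using D norm_triangle_ineq2[of \<eta> z] by (simp add: r_def d_def Dc_def)
    have "r ^ (k - 3) * d ^ 4 <= d ^ (k - 3) * d ^ 4" using d r by (intro mult_right_mono power_mono) auto
    also have "\<dots> = d ^ (k + 1)" unfolding power_add[symmetric] using k by (intro arg_cong[where f = "%i. d ^ i"]) auto
    finally have "Linf_norm \<nu> / d ^ (k + 1) <= Linf_norm \<nu> / (r ^ (k - 3) * d ^ 4)"
     using Linf_norm_nonneg[of \<nu>] r d by (intro divide_left_mono mult_pos_pos zero_less_power) auto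
    moreover have "norm (\<nu> \<eta> / (z - \<eta>) ^ (k + 1)) <= Linf_norm \<nu> / d ^ (k + 1)"
     unfolding norm_divide norm_power using elim D r d by (simp add: d_def norm_minus_commute divide_right_mono del: power_Suc)
    moreover have "norm (c * (cmod (g \<eta>))\<^sup>2) = Linf_norm \<nu> / (r ^ (k - 3) * d ^ 4)"
     using Linf_norm_nonneg[of \<nu>] r d by (simp add: c_def g_def d_def norm_divide norm_power power_divide abs_mult)
    ultimately show "norm (\<nu> \<eta> / (z - \<eta>) ^ (k + 1)) <= norm (c * (cmod (g \<eta>))\<^sup>2)" by linarith
   qed
  qed
 qed
qed

definition linearization :: "diff_poly => (complex => complex) => complex => complex" where
 "linearization P \<nu> z = (\<Sum>(k, l) \<in> lin_support P.
   lin_coeff P k l * ((-1) ^ k * fact k / of_real pi) * (LINT \<eta>|lebesgue_on Dc. \<nu> \<eta> / (z - \<eta>) ^ (k + 1)))"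

lemma linearization_cmult: "linearization P (%\<eta>. c * \<nu> \<eta>) z = c * linearization P \<nu> z"
 unfolding linearization_def sum_distrib_left times_divide_eq_right[symmetric] integral_mult_right_zero
 by (intro sum.cong refl) (auto simp: mult_ac)

context normalized_solutions
begin

lemma linearization_add:
 assumes "\<nu> \<in> Linf" "\<nu>' \<in> Linf" "z \<in> ball 0 1"
 shows "linearization P (%\<eta>. \<nu> \<eta> + \<nu>' \<eta>) z = linearization P \<nu> z + linearization P \<nu>' z"
 unfolding linearization_def sum.distrib[symmetric]
proof (rule sum.cong[OF refl])
 fix p assume p: "p \<in> lin_support P"
 obtain k l where kl: "p = (k, l)" by fastforce
 have k: "3 <= k" by (rule lin_support_facts(1)[OF Q_poly Q_covariant]) (use p kl in blast)
 have "(LINT \<eta>|lebesgue_on Dc. (\<nu> \<eta> + \<nu>' \<eta>) / (z - \<eta>) ^ (k + 1)) =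
   (LINT \<eta>|lebesgue_on Dc. \<nu> \<eta> / (z - \<eta>) ^ (k + 1)) + (LINT \<eta>|lebesgue_on Dc. \<nu>' \<eta> / (z - \<eta>) ^ (k + 1))"
  unfolding add_divide_distrib
  by (rule Bochner_Integration.integral_add) (rule lin_integrable[OF _ assms(3) k], fact)+
 then show "(case p of (k, l) => lin_coeff P k l * ((- 1) ^ k * fact k / of_real pi) * (LINT \<eta>|lebesgue_on Dc. (\<nu> \<eta> + \<nu>' \<eta>) / (z - \<eta>) ^ (k + 1))) =
   (case p of (k, l) => lin_coeff P k l * ((- 1) ^ k * fact k / of_real pi) * (LINT \<eta>|lebesgue_on Dc. \<nu> \<eta> / (z - \<eta>) ^ (k + 1))) +
   (case p of (k, l) => lin_coeff P k l * ((- 1) ^ k * fact k / of_real pi) * (LINT \<eta>|lebesgue_on Dc. \<nu>' \<eta> / (z - \<eta>) ^ (k + 1)))"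
  unfolding kl prod.case by (simp only: distrib_left)
qed

text \<open>The weight gives m = (1 - l) + (k - 1), with a true difference 1 - l because
  \<open>exponents_nonneg\<close> yields l <= 1. The second power is the one contained in
  \<open>lin_jet\<close>.\<close>

lemma weighted_linearization:
 assumes z: "z \<in> ball 0 1"
 shows "linearization P \<nu> z * of_real (1 - cmod z) powi m =
  (\<Sum>(k, l)\<in>lin_support P. lin_coeff P k l * (of_real (1 - cmod z) ^ (1 - l) * lin_jet \<nu> z k))"
 unfolding linearization_def sum_distrib_right
proof (rule sum.cong[OF refl])
 fix p assume p: "p \<in> lin_support P"
 obtain k l where kl: "p = (k, l)" by fastforce
 note F = lin_support_facts[OF Q_poly Q_covariant, of k l, folded kl, OF p]
 have "2 <= k" using F(1) by simp
 note lk = lin_exponent_lookup[OF this, of l] lin_exponent_weight(2)[OF this, of l]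
 have "single k 1 + single 1 l \<in> jet_exponents P"
  unfolding jet_exponents_def using F(1,4) lk(1)[of 2] by simp
 from exponents_nonneg[OF this] have l: "l <= 1" unfolding lk(2) unfolding lk(1) using F(1) by (auto split: if_splits)
 define C where "C = cx (1 - cmod z)"
 have "m = int ((1 - l) + (k - 1))" using F(1,3) l by linarith
 then have "C powi m = C ^ (1 - l) * C ^ (k - 1)" by (simp only: power_int_of_nat power_add)
 then show "(case p of (k, l) => lin_coeff P k l * ((- 1) ^ k * fact k / of_real pi) * (LINT \<eta>|lebesgue_on Dc. \<nu> \<eta> / (z - \<eta>) ^ (k + 1))) * of_real (1 - cmod z) powi m
   = (case p of (k, l) => lin_coeff P k l * (of_real (1 - cmod z) ^ (1 - l) * lin_jet \<nu> z k))"
  unfolding kl prod.case lin_jet_def C_def[symmetric] of_real_divide of_real_power by simp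
qed

lemma weighted_linearization_small:
 obtains C where "0 <= C" "!!\<nu> z. \<nu> \<in> Linf ==> 48 * Linf_norm \<nu> <= 1 ==> z \<in> ball 0 1 ==>
   cmod (linearization P \<nu> z) * (1 - (cmod z)\<^sup>2) powi m <= C * Linf_norm \<nu>"
  "!!\<nu> z. \<nu> \<in> Linf ==> 48 * Linf_norm \<nu> <= 1 ==> z \<in> ball 0 1 ==>
   cmod (diff_op P (planar (w \<nu>)) z - lookup P 0 - linearization P \<nu> z) * (1 - (cmod z)\<^sup>2) powi m <= C * (Linf_norm \<nu>)\<^sup>2"
proof -
 define B where "B = 1 + (\<Sum>k\<in>{3..N}. fact k * (165 * 4 ^ k + 2) :: real)"
 have Bk: "fact k * (165 * 4 ^ k + 2) <= B" "fact k * 3 <= B" if k: "k \<in> {3..N}" for k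
 proof -
  have "fact k * (165 * 4 ^ k + 2) <= (\<Sum>k\<in>{3..N}. fact k * (165 * 4 ^ k + 2) :: real)"
   by (rule member_le_sum[of k "{3..N}" "%k. fact k * (165 * 4 ^ k + 2)"]) (use k in auto)
  then show 1: "fact k * (165 * 4 ^ k + 2) <= B" by (simp add: B_def)
  have "1 <= (4::real) ^ k" by (rule one_le_power) simp
  then have "(3::real) <= 165 * 4 ^ k + 2" by linarith
  then have "fact k * 3 <= fact k * (165 * 4 ^ k + 2 :: real)" by (rule mult_left_mono) simp
  with 1 show "fact k * 3 <= B" by linarith
 qed
 have B1: "1 <= B" unfolding B_def by (simp add: sum_nonneg)
 obtain C where C: "0 <= C" "!!(k::real) (r::real) \<rho> x A. 0 <= k ==> k <= 1 ==> \<rho> ~= 0 ==> cmod \<rho> <= 1 ==> cmod (\<rho> - of_real r) <= 24 * k ==> x 2 = 0 ==>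
   (\<forall>j\<in>{3..N}. cmod (x j - A j) <= B * k\<^sup>2 \<and> cmod (A j) <= B * k) ==>
   cmod (jeval P (%j. if j = 1 then inverse \<rho> else \<rho> * x j) - lookup P 0 -
    (\<Sum>(k, l)\<in>lin_support P. lin_coeff P k l * (of_real r ^ (1 - l) * A k))) <= C * k\<^sup>2"
  by (rule jet_remainder[OF Q_poly Q_covariant _ B1]) (rule exponents_nonneg, assumption, rule that)
 define S where "S = (\<Sum>(k, l)\<in>lin_support P. cmod (lin_coeff P k l) * B)"
 have S0: "0 <= S" unfolding S_def using B1 by (intro sum_nonneg) auto
 define D where "D = (C + S) * 2 ^ nat \<bar>m\<bar>"
 \<comment> \<open>The constant monomial has weight 0; if it occurs then m = 0 and the factor is
   1.\<close>
 have P0: "lookup P 0 * of_real r powi m = lookup P 0" for r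
 proof (cases "lookup P 0 = 0")
  case False
  then have "jet_weight 0 = m" by (intro covariant_weight[OF Q_poly Q_covariant]) (simp add: in_keys_iff)
  then have "m = 0" by (simp add: jet_weight_def)
  then show ?thesis by simp
 qed simp
 have main: "cmod (linearization P \<nu> z * of_real (1 - cmod z) powi m) <= S * Linf_norm \<nu> \<and>
   cmod ((diff_op P (planar (w \<nu>)) z - lookup P 0 - linearization P \<nu> z) * of_real (1 - cmod z) powi m) <= C * (Linf_norm \<nu>)\<^sup>2"
  if \<nu>: "\<nu> \<in> Linf" "48 * Linf_norm \<nu> <= 1" and z: "z \<in> ball 0 1" for \<nu> z
 proof -
  define K where "K = Linf_norm \<nu>"
  have K: "0 <= K" "K <= 1" using Linf_norm_nonneg[of \<nu>] \<nu>(2) by (auto simp: K_def)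
  define \<rho> where "\<rho> = of_real (1 - cmod z) * deriv (planar (w \<nu>)) z"
  obtain x where x: "x 2 = 0"
    "!!j. 3 <= j ==> cmod (x j - lin_jet \<nu> z j) <= fact j * (165 * 4 ^ j + 2) * K\<^sup>2"
    "!!j. 3 <= j ==> cmod (lin_jet \<nu> z j) <= fact j * 3 * K"
    and ev: "diff_op P (planar (w \<nu>)) z * of_real (1 - cmod z) powi m = jeval P (%j. if j = 1 then inverse \<rho> else \<rho> * x j)"
    and \<rho>: "\<rho> ~= 0" "(cmod \<rho>)\<^sup>2 <= 1 - cmod z" "cmod (\<rho> - of_real (1 - cmod z)) <= 24 * K"
   by (rule belt_jets[OF Q_poly Q_covariant \<nu> small_in_schlicht_Belt(1)[OF \<nu>] z, folded \<rho>_def K_def]) (rule that)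
  have "(cmod \<rho>)\<^sup>2 <= 1\<^sup>2" using \<rho>(2) norm_ge_zero[of z] unfolding one_power2 by linarith
  then have \<rho>1: "cmod \<rho> <= 1" by (rule power2_le_imp_le) simp
  have xA: "cmod (x j - lin_jet \<nu> z j) <= B * K\<^sup>2" and AK: "cmod (lin_jet \<nu> z j) <= B * K" if j: "j \<in> {3..N}" for j
  proof -
   have j3: "3 <= j" using j by simp
   show "cmod (x j - lin_jet \<nu> z j) <= B * K\<^sup>2"
    by (rule order_trans[OF x(2)[OF j3]], rule mult_right_mono[OF Bk(1)[OF j]]) simp
   show "cmod (lin_jet \<nu> z j) <= B * K"
    by (rule order_trans[OF x(3)[OF j3]], rule mult_right_mono[OF Bk(2)[OF j]]) (rule K)
  qed
  have R: "cmod (jeval P (%j. if j = 1 then inverse \<rho> else \<rho> * x j) - lookup P 0 -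
    (\<Sum>(k, l)\<in>lin_support P. lin_coeff P k l * (of_real (1 - cmod z) ^ (1 - l) * lin_jet \<nu> z k))) <= C * K\<^sup>2"
   by (rule C(2)[where k = K and r = "1 - cmod z" and \<rho> = \<rho> and x = x and A = "lin_jet \<nu> z", OF K \<rho>(1) \<rho>1 \<rho>(3) x(1)]) (intro ballI conjI xA AK)
  have "(diff_op P (planar (w \<nu>)) z - lookup P 0 - linearization P \<nu> z) * of_real (1 - cmod z) powi m =
    jeval P (%j. if j = 1 then inverse \<rho> else \<rho> * x j) - lookup P 0 -
    (\<Sum>(k, l)\<in>lin_support P. lin_coeff P k l * (of_real (1 - cmod z) ^ (1 - l) * lin_jet \<nu> z k))"
   unfolding ev[symmetric] weighted_linearization[OF z, symmetric] left_diff_distrib P0 ..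
  with R have 2: "cmod ((diff_op P (planar (w \<nu>)) z - lookup P 0 - linearization P \<nu> z) * of_real (1 - cmod z) powi m) <= C * K\<^sup>2" by (simp only:)
  have "cmod (\<Sum>(k, l)\<in>lin_support P. lin_coeff P k l * (of_real (1 - cmod z) ^ (1 - l) * lin_jet \<nu> z k)) <=
    (\<Sum>(k, l)\<in>lin_support P. cmod (lin_coeff P k l) * B * K)"
  proof (rule sum_norm_le)
   fix p assume p: "p \<in> lin_support P"
   obtain k l where kl: "p = (k, l)" by fastforce
   have k: "k \<in> {3..N}" using lin_support_facts(1,2)[OF Q_poly Q_covariant p[unfolded kl]] by simp
   have "cmod (of_real (1 - cmod z) ^ (1 - l) * lin_jet \<nu> z k) <= 1 * (B * K)"
    unfolding norm_mult norm_power norm_of_real using z by (intro mult_mono AK[OF k] power_le_one) auto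
   then have "cmod (lin_coeff P k l * (of_real (1 - cmod z) ^ (1 - l) * lin_jet \<nu> z k)) <= cmod (lin_coeff P k l) * B * K"
    unfolding norm_mult[of "lin_coeff P k l"] mult.assoc[of "cmod (lin_coeff P k l)"] mult_1 by (rule mult_left_mono) simp
   then show "cmod (case p of (k, l) => lin_coeff P k l * (of_real (1 - cmod z) ^ (1 - l) * lin_jet \<nu> z k)) <=
     (case p of (k, l) => cmod (lin_coeff P k l) * B * K)" unfolding kl prod.case .
  qed
  also have "\<dots> = S * K" by (simp add: S_def sum_distrib_right case_prod_beta)
  finally show ?thesis using 2 unfolding weighted_linearization[OF z] K_def by blast
 qed
 have weight: "cmod G * (1 - (cmod z)\<^sup>2) powi m <= D * X" if "z \<in> ball 0 1" "cmod (G * of_real (1 - cmod z) powi m) <= Y * X" "0 <= X" "Y <= C + S" for G z X Y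
 proof -
  have "cmod G * (1 - (cmod z)\<^sup>2) powi m <= cmod G * ((1 - cmod z) powi m * 2 ^ nat \<bar>m\<bar>)"
   by (rule mult_left_mono[OF disc_weights(2)[OF that(1)]]) simp
  also have "\<dots> = cmod (G * of_real (1 - cmod z) powi m) * 2 ^ nat \<bar>m\<bar>"
   using that(1) by (simp add: norm_mult norm_power_int del: of_real_diff)
  also have "\<dots> <= Y * X * 2 ^ nat \<bar>m\<bar>" by (rule mult_right_mono[OF that(2)]) simp
  also have "\<dots> <= (C + S) * X * 2 ^ nat \<bar>m\<bar>" using that(3,4) by (intro mult_right_mono) auto
  finally show ?thesis by (simp add: D_def mult_ac)
 qed
 show ?thesis
 proof (rule that[of D])
  show "0 <= D" using C(1) S0 by (simp add: D_def)
  fix \<nu> and z :: complex assume a: "\<nu> \<in> Linf" "48 * Linf_norm \<nu> <= 1" "z \<in> ball 0 1"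
  show "cmod (linearization P \<nu> z) * (1 - (cmod z)\<^sup>2) powi m <= D * Linf_norm \<nu>"
   by (rule weight[OF a(3) conjunct1[OF main[OF a]] Linf_norm_nonneg]) (simp add: C(1))
  show "cmod (diff_op P (planar (w \<nu>)) z - lookup P 0 - linearization P \<nu> z) * (1 - (cmod z)\<^sup>2) powi m <= D * (Linf_norm \<nu>)\<^sup>2"
   by (rule weight[OF a(3) conjunct2[OF main[OF a]]]) (simp_all add: S0)
 qed
qed

text \<open>Homogeneity removes the smallness condition: the coefficient is first scaled so that its
  norm is at most 1/48.\<close>

lemma linearization_bound:
 obtains C where "0 <= C" "!!\<nu> z. \<nu> \<in> Linf ==> z \<in> ball 0 1 ==> cmod (linearization P \<nu> z) * (1 - (cmod z)\<^sup>2) powi m <= C * Linf_norm \<nu>"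
proof -
 obtain C where C: "0 <= C" "!!\<nu> z. \<nu> \<in> Linf ==> 48 * Linf_norm \<nu> <= 1 ==> z \<in> ball 0 1 ==>
   cmod (linearization P \<nu> z) * (1 - (cmod z)\<^sup>2) powi m <= C * Linf_norm \<nu>"
  by (rule weighted_linearization_small) (rule that)
 have "cmod (linearization P \<nu> z) * (1 - (cmod z)\<^sup>2) powi m <= C * Linf_norm \<nu>" if \<nu>: "\<nu> \<in> Linf" and z: "z \<in> ball 0 1" for \<nu> z
 proof -
  define t where "t = 1 / (48 * (Linf_norm \<nu> + 1))"
  have t: "0 < t" "48 * (t * Linf_norm \<nu>) <= 1" using Linf_norm_nonneg[of \<nu>] by (auto simp: t_def)
  have n: "Linf_norm (%\<eta>. of_real t * \<nu> \<eta>) <= t * Linf_norm \<nu>" using Linf_cmult(2)[OF \<nu>, of "of_real t"] t by simp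
  have "cmod (linearization P (%\<eta>. of_real t * \<nu> \<eta>) z) * (1 - (cmod z)\<^sup>2) powi m <= C * Linf_norm (%\<eta>. of_real t * \<nu> \<eta>)"
   by (rule C(2)[OF Linf_cmult(1)[OF \<nu>] _ z]) (use n t(2) in linarith)
  also have "\<dots> <= C * (t * Linf_norm \<nu>)" by (rule mult_left_mono[OF n C(1)])
  finally have "t * (cmod (linearization P \<nu> z) * (1 - (cmod z)\<^sup>2) powi m) <= t * (C * Linf_norm \<nu>)"
   using t(1) by (simp add: linearization_cmult norm_mult mult_ac)
  then show ?thesis using t(1) by simp
 qed
 with C(1) show ?thesis using that by blast
qed

text \<open>The difference quotients of Q[f] along t \<nu>, with the constant term of the polynomial
  subtracted, are holomorphic by \<open>beta_into_B\<close>. The quadratic remainder divided by t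
  tends to zero locally uniformly, so the limit is holomorphic.\<close>

lemma linearization_holomorphic:
 assumes \<nu>: "\<nu> \<in> Linf"
 shows "linearization P \<nu> holomorphic_on ball 0 1"
proof -
 obtain C where C: "0 <= C" "!!\<nu> z. \<nu> \<in> Linf ==> 48 * Linf_norm \<nu> <= 1 ==> z \<in> ball 0 1 ==>
   cmod (diff_op P (planar (w \<nu>)) z - lookup P 0 - linearization P \<nu> z) * (1 - (cmod z)\<^sup>2) powi m <= C * (Linf_norm \<nu>)\<^sup>2"
  by (rule weighted_linearization_small) (rule that)
 define K where "K = Linf_norm \<nu>"
 have K0: "0 <= K" unfolding K_def by (rule Linf_norm_nonneg)
 define t where "t n = 1 / (48 * (K + 1) * (real n + 1))" for n
 have t: "0 < t n" "48 * (t n * K) <= 1" for n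
 proof -
  show "0 < t n" using K0 by (simp add: t_def)
  have "48 * K <= 48 * (K + 1) * (real n + 1)" using K0 by (simp add: algebra_simps)
  then show "48 * (t n * K) <= 1" using K0 by (simp add: t_def divide_le_eq)
 qed
 define \<mu> where "\<mu> n = (%\<eta>. of_real (t n) * \<nu> \<eta>)" for n
 have \<mu>: "\<mu> n \<in> Linf" "Linf_norm (\<mu> n) <= t n * K" for n
  unfolding \<mu>_def using Linf_cmult[OF \<nu>, of "of_real (t n)"] t(1)[of n] by (auto simp: K_def)
 have \<mu>s: "48 * Linf_norm (\<mu> n) <= 1" for n using \<mu>(2)[of n] t(2)[of n] by linarith
 define G where "G n z = (diff_op P (planar (w (\<mu> n))) z - lookup P 0) / of_real (t n)" for n z
 have tlim: "t \<longlonglongrightarrow> 0"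
 proof -
  have "(%n. 1 / (48 * (K + 1)) * (1 / real (n + 1))) \<longlonglongrightarrow> 1 / (48 * (K + 1)) * 0"
   by (intro tendsto_mult_left LIMSEQ_ignore_initial_segment[OF lim_1_over_n])
  then show ?thesis by (simp add: t_def[abs_def] add.commute)
 qed
 show ?thesis
 proof (rule holomorphic_uniform_sequence[OF open_ball, of G])
  show "G n holomorphic_on ball 0 1" for n
   unfolding G_def[abs_def] using beta_into_B[OF small_in_schlicht_Belt(2)[OF \<mu>(1) \<mu>s]] t(1)[of n]
   by (intro holomorphic_intros) (auto simp: B_space_def)
  fix x :: complex assume x: "x \<in> ball 0 1"
  then obtain d where d: "0 < d" "cball x d \<subseteq> ball 0 1" using open_contains_cball[of "ball (0::complex) 1"] open_ball by blast
  have "continuous_on (cball x d) (%z. (1 - (cmod z)\<^sup>2) powi (- m))"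
  proof (rule continuous_on_power_int[OF _ disjI2])
   show "\<forall>z\<in>cball x d. 1 - (cmod z)\<^sup>2 ~= 0"
   proof
    fix z assume "z \<in> cball x d"
    then have "cmod z < 1" using d(2) by auto
    then show "1 - (cmod z)\<^sup>2 ~= 0" using power_strict_mono[of "cmod z" 1 2] by auto
   qed
  qed (intro continuous_intros)
  then have "bounded ((%z. (1 - (cmod z)\<^sup>2) powi (- m)) ` cball x d)"
   by (intro compact_imp_bounded compact_continuous_image compact_cball)
  then obtain B where B': "\<forall>z\<in>cball x d. \<bar>(1 - (cmod z)\<^sup>2) powi (- m)\<bar> <= B" by (auto simp: bounded_iff)
  note B = bspec[OF B']
  have B0: "0 <= B" using B[of x] d(1) by (auto intro: order_trans[OF abs_ge_zero])
  have est: "cmod (G n z - linearization P \<nu> z) <= (C * K\<^sup>2 * B) * t n" if z: "z \<in> cball x d" for n z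
  proof -
   have zb: "z \<in> ball 0 1" using z d(2) by blast
   define q where "q = (1 - (cmod z)\<^sup>2) powi m"
   have "0 < 1 - (cmod z)\<^sup>2" using zb power_strict_mono[of "cmod z" 1 2] by simp
   then have q: "0 < q" "inverse q <= B"
    using B[OF z] by (auto simp: q_def power_int_minus zero_less_power_int)
   define E where "E = diff_op P (planar (w (\<mu> n))) z - lookup P 0 - linearization P (\<mu> n) z"
   have "cmod E * q <= C * (Linf_norm (\<mu> n))\<^sup>2" unfolding E_def q_def by (rule C(2)[OF \<mu>(1) \<mu>s zb])
   also have "\<dots> <= C * (t n * K)\<^sup>2" by (intro mult_left_mono power_mono \<mu>(2) Linf_norm_nonneg C(1))
   finally have Eq: "cmod E * q <= C * (t n * K)\<^sup>2" .
   have "cmod E * q * inverse q <= C * (t n * K)\<^sup>2 * B"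
    by (rule mult_mono[OF Eq q(2)]) (use q C(1) in auto)
   moreover have "cmod E * q * inverse q = cmod E" using q(1) by simp
   ultimately have E: "cmod E <= C * (t n * K)\<^sup>2 * B" by (simp only:)
   have "G n z - linearization P \<nu> z = E / of_real (t n)"
    unfolding G_def E_def \<mu>_def linearization_cmult using t(1)[of n] by (simp add: diff_divide_distrib)
   then have "cmod (G n z - linearization P \<nu> z) = cmod E / t n" using t(1)[of n] by (simp add: norm_divide)
   also have "\<dots> <= C * (t n * K)\<^sup>2 * B / t n" using E t(1)[of n] by (intro divide_right_mono) auto
   also have "\<dots> = (C * K\<^sup>2 * B) * t n" using t(1)[of n] by (simp add: power2_eq_square)
   finally show ?thesis .
  qed
  have "uniform_limit (cball x d) G (linearization P \<nu>) sequentially"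
  proof (rule uniform_limitI)
   fix e :: real assume e: "0 < e"
   have "(%n. (C * K\<^sup>2 * B) * t n) \<longlonglongrightarrow> 0" using tendsto_mult_left[OF tlim, of "C * K\<^sup>2 * B"] by simp
   then have "\<forall>\<^sub>F n in sequentially. (C * K\<^sup>2 * B) * t n < e" using e by (rule order_tendstoD(2))
   then show "\<forall>\<^sub>F n in sequentially. \<forall>z\<in>cball x d. dist (G n z) (linearization P \<nu> z) < e"
   proof eventually_elim
    case (elim n)
    show ?case unfolding dist_norm by (intro ballI le_less_trans[OF est elim])
   qed
  qed
  with d show "\<exists>d>0. cball x d \<subseteq> ball 0 1 \<and> uniform_limit (cball x d) G (linearization P \<nu>) sequentially" by blast
 qed
qed

lemma frechet_derivative:
 "frechet_derivative_at_0 m (schlicht_Belt w) (%\<mu>. diff_op P (planar (w \<mu>))) (linearization P)"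
 unfolding frechet_derivative_at_0_def bounded_linear_Linf_B_def
proof (intro conjI allI ballI impI)
 obtain C where C: "0 <= C" "!!\<nu> z. \<nu> \<in> Linf ==> z \<in> ball 0 1 ==> cmod (linearization P \<nu> z) * (1 - (cmod z)\<^sup>2) powi m <= C * Linf_norm \<nu>"
  by (rule linearization_bound) (rule that)
 have norm_le: "B_norm m g <= c" if "!!z. z \<in> ball 0 1 ==> cmod (g z) * (1 - (cmod z)\<^sup>2) powi m <= c" for g c
  unfolding B_norm_def by (rule cSUP_least) (use that in auto)
 show "linearization P \<nu> \<in> B_space m" if "\<nu> \<in> Linf" for \<nu>
  unfolding B_space_def using linearization_holomorphic[OF that] C(2)[OF that] by (auto intro!: bdd_aboveI2)
 show "\<exists>C. \<forall>\<nu>\<in>Linf. B_norm m (linearization P \<nu>) <= C * Linf_norm \<nu>"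
  by (intro exI[of _ C] ballI norm_le C(2))
 show "linearization P (%\<eta>. \<nu> \<eta> + \<nu>' \<eta>) z = linearization P \<nu> z + linearization P \<nu>' z"
  if "\<nu> \<in> Linf" "\<nu>' \<in> Linf" "z \<in> ball 0 1" for \<nu> \<nu>' z by (rule linearization_add[OF that])
 show "linearization P (%\<eta>. c * \<nu> \<eta>) z = c * linearization P \<nu> z" for c \<nu> z by (rule linearization_cmult)
 show "\<exists>r>0. \<forall>\<nu>\<in>Linf. Linf_norm \<nu> < r --> \<nu> \<in> schlicht_Belt w"
  by (rule exI[of _ "1 / 48"]) (auto intro: small_in_schlicht_Belt)
 show "diff_op P (planar (w \<nu>)) \<in> B_space m" if "\<nu> \<in> schlicht_Belt w" for \<nu> by (rule beta_into_B[OF that])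
 obtain D where D: "0 <= D" "!!\<nu> z. \<nu> \<in> Linf ==> 48 * Linf_norm \<nu> <= 1 ==> z \<in> ball 0 1 ==>
   cmod (diff_op P (planar (w \<nu>)) z - lookup P 0 - linearization P \<nu> z) * (1 - (cmod z)\<^sup>2) powi m <= D * (Linf_norm \<nu>)\<^sup>2"
  by (rule weighted_linearization_small) (rule that)
 have Z: "(%_. 0) \<in> Linf" "Linf_norm (%_. 0) <= 0" by (rule Linf_normI[of _ 0]; simp)+
 then have Z0: "Linf_norm (%_. 0) = 0" using Linf_norm_nonneg[of "%_. 0"] by linarith
 \<comment> \<open>For the zero coefficient the quadratic remainder bound is zero, which evaluates Q
   there without identifying the solution as the identity.\<close>
 have origin: "diff_op P (planar (w (%_. 0))) z = lookup P 0" if z: "z \<in> ball 0 1" for z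
 proof -
  have l0: "linearization P (%_. 0) z = 0" by (simp add: linearization_def)
  have "0 < 1 - (cmod z)\<^sup>2" using z power_strict_mono[of "cmod z" 1 2] by simp
  then have "0 < (1 - (cmod z)\<^sup>2) powi m" by (rule zero_less_power_int)
  moreover have "cmod (diff_op P (planar (w (%_. 0))) z - lookup P 0) * (1 - (cmod z)\<^sup>2) powi m <= 0"
   using D(2)[OF Z(1) _ z] by (simp add: Z0 l0)
  ultimately have "cmod (diff_op P (planar (w (%_. 0))) z - lookup P 0) <= 0" by (simp add: mult_le_0_iff)
  then show ?thesis by simp
 qed
 fix \<epsilon> :: real assume \<epsilon>: "0 < \<epsilon>"
 show "\<exists>\<delta>>0. \<forall>\<nu>\<in>schlicht_Belt w. Linf_norm \<nu> < \<delta> -->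
   B_norm m (%z. diff_op P (planar (w \<nu>)) z - diff_op P (planar (w (%_. 0))) z - linearization P \<nu> z) <= \<epsilon> * Linf_norm \<nu>"
 \<comment> \<open>The second entry makes D k^2 <= \<epsilon> k for norms k below it; D + 1 replaces
   D in case D = 0.\<close>
 proof (rule exI[of _ "min (1 / 48) (\<epsilon> / (D + 1))"], intro conjI ballI impI)
  show "0 < min (1 / 48) (\<epsilon> / (D + 1))" using \<epsilon> D(1) by simp
  fix \<nu> assume \<nu>: "\<nu> \<in> schlicht_Belt w" "Linf_norm \<nu> < min (1 / 48) (\<epsilon> / (D + 1))"
  then have l: "\<nu> \<in> Linf" "48 * Linf_norm \<nu> <= 1" "Linf_norm \<nu> * (D + 1) < \<epsilon>"
   using D(1) by (auto simp: schlicht_Belt_def Belt_def field_simps)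
  show "B_norm m (%z. diff_op P (planar (w \<nu>)) z - diff_op P (planar (w (%_. 0))) z - linearization P \<nu> z) <= \<epsilon> * Linf_norm \<nu>"
  proof (rule norm_le)
   fix z :: complex assume z: "z \<in> ball 0 1"
   have "D * Linf_norm \<nu> <= \<epsilon>" using l(3) Linf_norm_nonneg[of \<nu>] by (simp add: algebra_simps)
   then have "D * (Linf_norm \<nu>)\<^sup>2 <= \<epsilon> * Linf_norm \<nu>"
    using mult_right_mono[of "D * Linf_norm \<nu>" \<epsilon> "Linf_norm \<nu>"] Linf_norm_nonneg[of \<nu>] by (simp add: power2_eq_square mult.assoc)
   then show "cmod (diff_op P (planar (w \<nu>)) z - diff_op P (planar (w (%_. 0))) z - linearization P \<nu> z) * (1 - (cmod z)\<^sup>2) powi m <= \<epsilon> * Linf_norm \<nu>"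
    using D(2)[OF l(1,2) z] unfolding origin[OF z] by linarith
  qed
 qed
qed

end

theorem theorem3p4:
  fixes P :: diff_poly and N :: nat and m :: int
    and w :: "(complex \<Rightarrow> complex) \<Rightarrow> complex option \<Rightarrow> complex option"
  assumes Q_poly: "diff_poly_upto N P"
    and Q_covariant: "moebius_covariant m P"
    and w_solution: "\<And>\<mu>. \<mu> \<in> Belt \<Longrightarrow> normalized_qc_solution \<mu> (w \<mu>)"
    and beta_into_B: "\<And>\<mu>. \<mu> \<in> schlicht_Belt w \<Longrightarrow> diff_op P (planar (w \<mu>)) \<in> B_space m"
  shows "frechet_derivative_at_0 m (schlicht_Belt w)
           (\<lambda>\<mu>. diff_op P (planar (w \<mu>)))
           (\<lambda>\<nu> z. \<Sum>(k, l) \<in> lin_support P.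
              lin_coeff P k l * ((-1) ^ k * fact k / of_real pi) *
              (LINT \<eta>|lebesgue_on Dc. \<nu> \<eta> / (z - \<eta>) ^ (k + 1)))"
proof -
  interpret normalized_solutions P N m w
    by (rule normalized_solutions.intro) (fact assms)+
  show ?thesis using frechet_derivative unfolding linearization_def[abs_def] .
qed

end
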